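(* Let $G=g_{\alpha\beta}\,d\tilde z^\alpha\otimes d\tilde z^\beta+g_{ab}\,\delta\tilde y^a\otimes\delta\tilde y^b$ be a (pseudo)metrical structure on $(\rho,\eta)TE$. Then the local real functions $$\overset{c}{H}{}^\alpha_{\beta\gamma}=\tfrac12\tilde g^{\alpha\varepsilon}\Big(\tilde\rho(\tilde\delta_\gamma)g_{\varepsilon\beta}+\tilde\rho(\tilde\delta_\beta)g_{\varepsilon\gamma}-\tilde\rho(\tilde\delta_\varepsilon)g_{\beta\gamma}+g_{\theta\varepsilon}\,L^\theta_{\gamma\beta}\circ h\circ\pi-g_{\beta\theta}\,L^\theta_{\gamma\varepsilon}\circ h\circ\pi-g_{\theta\gamma}\,L^\theta_{\beta\varepsilon}\circ h\circ\pi\Big),$$ $$\overset{c}{H}{}^a_{b\gamma}=\frac{\partial\Gamma^a_\gamma}{\partial y^b}+\tfrac12\tilde g^{ac}g_{bc\overset{0}{|}\gamma},\qquad \overset{c}{V}{}^\alpha_{\beta c}=\tfrac12\tilde g^{\alpha\varepsilon}\frac{\partial g_{\beta\varepsilon}}{\partial y^c},\qquad \overset{c}{V}{}^a_{bc}=\tfrac12\tilde g^{ae}\Big(\frac{\partial g_{eb}}{\partial y^c}+\frac{\partial g_{ec}}{\partial y^b}-\frac{\partial g_{bc}}{\partial y^e}\Big),$$ where $g_{bc\overset{0}{|}\gamma}$ is the horizontal covariant derivative of $g_{bc}$ with respect to the Berwald linear $(\rho,\eta)$-connection, are the components of a distinguished linear $(\rho,\eta)$-connection $D$ such that $(\rho,\eta)TE$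 becomes $(\rho,\eta)$-(pseudo)metrizable, i.e. $D_XG=0$ for every section $X$ of $(\rho,\eta)TE$. Moreover, if $G$ is both $\mathcal H$- and $\mathcal V$-Riemannian, then the local real functions $$\overset{c}{H}{}^\alpha_{\beta\gamma}=\tfrac12\tilde g^{\alpha\varepsilon}\Big(\rho^k_\gamma\circ h\circ\pi\,\frac{\partial g_{\varepsilon\beta}}{\partial x^k}+\rho^j_\beta\circ h\circ\pi\,\frac{\partial g_{\varepsilon\gamma}}{\partial x^j}-\rho^k_\varepsilon\circ h\circ\pi\,\frac{\partial g_{\beta\gamma}}{\partial x^k}+g_{\theta\varepsilon}\,L^\theta_{\gamma\beta}\circ h\circ\pi-g_{\beta\theta}\,L^\theta_{\gamma\varepsilon}\circ h\circ\pi-g_{\theta\gamma}\,L^\theta_{\beta\varepsilon}\circ h\circ\pi\Big),$$ $$\overset{c}{H}{}^a_{b\gamma}=\frac{\partial\Gamma^a_\gamma}{\partial y^b}+\tfrac12\tilde g^{ac}\Big(\rho^i_\gamma\circ h\circ\pi\,\frac{\partial g_{bc}}{\partial x^i}-\frac{\partial\Gamma^e_\gamma}{\partial y^b}g_{ec}-\frac{\partial\Gamma^e_\gamma}{\partial y^c}g_{eb}\Big),\qquad \overset{c}{V}{}^\alpha_{\beta c}=0,\qquad \overset{c}{V}{}^a_{bc}=0$$ are the components of a distinguished linear $(\rho,\eta)$-connection $D$ such that $(\rho,\eta)TE$ becomes $(\rho,\eta)$-(pseudo)metrizable, i.e. $D_XG=0$ for every section $X$.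
   Context: Everything is smooth; repeated indices are summed. Setting. $M,N$ are manifolds of dimension $m$, $h:M\to N$ and $\eta:N\to M$ are diffeomorphisms, $\nu:F\to N$ is a vector bundle of rank $p$, $\pi:E\to M$ a vector bundle of rank $r$. A generalized Lie algebroid structure $([\,,]_{F,h},(\rho,\eta))$ on $F$ consists of a vector bundle morphism $\rho:F\to TM$ covering $\eta$ and a Lie bracket $[\,,]_{F,h}$ on $\Gamma(F)$ with $[u,fv]_{F,h}=f[u,v]_{F,h}+(\mathcal A(u)f)\,v$ for $f\in C^\infty(N)$, where the map $\mathcal A=\Gamma(Th\circ\rho,h\circ\eta):\Gamma(F)\to\Gamma(TN)$ is a morphism of Lie algebras. Such a structure is fixed. In local coordinates $x^i$ on $M$ and a local frame $t_\alpha$ of $F$, $\mathcal A$ is described by local functions $\rho^i_\alpha$ on $N$ via $(\mathcal A(z^\alpha t_\alpha)f)\circ h=(\rho^i_\alpha\circ h)(z^\alpha\circ h)\,\partial(f\circ h)/\partial x^i$; thus $\mathcal A$ is $C^\infty(N)$-linear and the functions $\rho^i_\alpha\circ h$ are the components of a bundle map $h^*F\to TM$ over $\mathrm{Id}_M$. The structure functions are $[t_\alpha,t_\beta]_{F,h}=L^\gamma_{\alpha\beta}t_\gamma$. Generalized tangent bundle. Let $(x^i,y^a)$ be vector bundle coordinates on $E$ and $T_\alpha$ the frame of $\pi^*(h^*F)$ induced by $t_\alpha$. $(\rho,\eta)TE$ is the vector subbundle of $\pi^*(h^*F)\oplus TE\to E$ with local frame (natural base) $\tilde\partial_\alpha=T_\alpha\oplus(\rho^i_\alpha\circ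 h\circ\pi)\frac{\partial}{\partial x^i}$, $\dot{\tilde\partial}_a=0\oplus\frac{\partial}{\partial y^a}$. The anchor $\tilde\rho:(\rho,\eta)TE\to TE$ is $\tilde\rho(Z^\alpha\tilde\partial_\alpha+Y^a\dot{\tilde\partial}_a)=Z^\alpha(\rho^i_\alpha\circ h\circ\pi)\frac{\partial}{\partial x^i}+Y^a\frac{\partial}{\partial y^a}$; $\tilde\rho(X)f$ is the derivative of $f\in C^\infty(E)$ along the vector field $\tilde\rho(X)$. The vertical subbundle $V(\rho,\eta)TE$ is spanned by the $\dot{\tilde\partial}_a$. A $(\rho,\eta)$-connection $(\rho,\eta)\Gamma$ for $E$, fixed throughout, is a map $(\rho,\eta)TE\to V(\rho,\eta)TE$, a vector bundle map over $\mathrm{Id}_E$, which is the identity on $V(\rho,\eta)TE$; locally it maps $Z^\gamma\tilde\partial_\gamma+Y^a\dot{\tilde\partial}_a$ to $(Y^a+\Gamma^a_\gamma Z^\gamma)\dot{\tilde\partial}_a$, where $\Gamma^a_\gamma$ abbreviates $(\rho,\eta)\Gamma^a_\gamma$. Its kernel is the horizontal subbundle $H(\rho,\eta)TE$, with frame $\tilde\delta_\alpha=\tilde\partial_\alpha-\Gamma^a_\alpha\dot{\tilde\partial}_a$. The dual frame of $(\tilde\delta_\alpha,\dot{\tilde\partial}_a)$ is $(d\tilde z^\alpha,\delta\tilde y^a)$. Distinguished linear $(\rho,\eta)$-connection: a covariant derivative $D$ on the tensor algebra of $(\rho,\eta)TE$ ($C^\infty(E)$-linear in $X$, $D_Xf=\tilde\rho(X)f$,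 a derivation of tensor products commuting with contractions) preserving $H(\rho,\eta)TE$ and $V(\rho,\eta)TE$. Its components are given by $D_{\tilde\delta_\gamma}\tilde\delta_\beta=H^\alpha_{\beta\gamma}\tilde\delta_\alpha$, $D_{\tilde\delta_\gamma}\dot{\tilde\partial}_b=H^a_{b\gamma}\dot{\tilde\partial}_a$, $D_{\dot{\tilde\partial}_c}\tilde\delta_\beta=V^\alpha_{\beta c}\tilde\delta_\alpha$, $D_{\dot{\tilde\partial}_c}\dot{\tilde\partial}_b=V^a_{bc}\dot{\tilde\partial}_a$ (the prefix $(\rho,\eta)$ on components is dropped). Berwald linear $(\rho,\eta)$-connection: the one whose vertical-frame coefficients are $\mathring H^a_{b\gamma}=\partial\Gamma^a_\gamma/\partial y^b$ and whose $V$-components vanish, $\mathring V^\alpha_{\beta c}=0$, $\mathring V^a_{bc}=0$. Only these enter here, and $g_{bc\overset{0}{|}\gamma}=\tilde\rho(\tilde\delta_\gamma)g_{bc}-\frac{\partial\Gamma^e_\gamma}{\partial y^b}g_{ec}-\frac{\partial\Gamma^e_\gamma}{\partial y^c}g_{be}$. A (pseudo)metrical structure is a tensor field $G=g_{\alpha\beta}d\tilde z^\alpha\otimes d\tilde z^\beta+g_{ab}\delta\tilde y^a\otimes\delta\tilde y^b$ with symmetric components such that the matrices $(g_{\alpha\beta})$, $(g_{ab})$ are nondegenerate at every point of $E$ (metrical if moreover both have constant signature); $\tilde g^{\alpha\beta}$, $\tilde g^{ab}$ are the inverse matrices. $G$ is $\mathcal H$-Riemannian (resp. $\mathcal V$-Riemannian)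 if around each point of $M$ there is a vector bundle chart of $E$ in which the functions $g_{\alpha\beta}$ (resp. $g_{ab}$) depend only on $x$, not on $y$; the formulas of the second part are written in such charts. *)

theory Defs
  imports "HOL-Analysis.Analysis"
begin

section \<open>Smooth manifolds\<close>

text \<open>Meaningful on open sets only: the derivatives are not taken within \<open>S\<close>.\<close>

primrec Ck_on :: "nat \<Rightarrow> 'v::real_normed_vector set \<Rightarrow> ('v \<Rightarrow> 'w::real_normed_vector) \<Rightarrow> bool" where
  "Ck_on 0 S f \<longleftrightarrow> continuous_on S f"
| "Ck_on (Suc k) S f \<longleftrightarrow>
     (\<forall>x\<in>S. f differentiable (at x)) \<and> (\<forall>\<xi>. Ck_on k S (\<lambda>x. frechet_derivative f (at x) \<xi>))"

definition smooth_on :: "'v::real_normed_vector set \<Rightarrow> ('v \<Rightarrow> 'w::real_normed_vector) \<Rightarrow> bool" where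
  "smooth_on S f \<longleftrightarrow> (\<forall>k. Ck_on k S f)"

text \<open>A chart is a pair (domain, coordinate map). The points of a manifold are all elements of a
  type. Atlases need not be maximal, so that statements about every chart of the atlas contain
  the case of the maximal atlas.\<close>

type_synonym ('a, 'v) chart = "'a set \<times> ('a \<Rightarrow> 'v)"

type_synonym ('a, 'v) atlas = "('a, 'v) chart set"

definition chart_inv :: "('a, 'v) chart \<Rightarrow> 'v \<Rightarrow> 'a" where
  "chart_inv c = inv_into (fst c) (snd c)"

definition manifold ::
  "('a::{t2_space, second_countable_topology}, 'v::euclidean_space) atlas \<Rightarrow> bool" where
  "manifold A \<longleftrightarrow>
     (\<Union>c\<in>A. fst c) = UNIV \<and>
     (\<forall>c\<in>A. open (fst c) \<and> open (snd c ` fst c) \<and>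
        homeomorphism (fst c) (snd c ` fst c) (snd c) (chart_inv c)) \<and>
     (\<forall>c\<in>A. \<forall>c'\<in>A. smooth_on (snd c ` (fst c \<inter> fst c')) (snd c' \<circ> chart_inv c))"

definition msmooth_on ::
  "('a::topological_space, 'v::euclidean_space) atlas \<Rightarrow> 'a set \<Rightarrow> ('a \<Rightarrow> 'w::real_normed_vector) \<Rightarrow> bool" where
  "msmooth_on A U f \<longleftrightarrow> (\<forall>c\<in>A. smooth_on (snd c ` (fst c \<inter> U)) (f \<circ> chart_inv c))"

definition smooth_near ::
  "('a::topological_space, 'v::euclidean_space) atlas \<Rightarrow> 'a \<Rightarrow> ('a \<Rightarrow> 'w::real_normed_vector) \<Rightarrow> bool" where
  "smooth_near A x f \<longleftrightarrow> (\<exists>U. open U \<and> x \<in> U \<and> msmooth_on A U f)"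

definition smooth_functions ::
  "('a::topological_space, 'v::euclidean_space) atlas \<Rightarrow> ('a \<Rightarrow> real) set" where
  "smooth_functions A = {f. msmooth_on A UNIV f}"

definition smooth_map ::
  "('a::topological_space, 'v::euclidean_space) atlas \<Rightarrow>
   ('b::topological_space, 'w::euclidean_space) atlas \<Rightarrow> ('a \<Rightarrow> 'b) \<Rightarrow> bool" where
  "smooth_map A B h \<longleftrightarrow> continuous_on UNIV h \<and>
     (\<forall>c\<in>A. \<forall>d\<in>B. smooth_on (snd c ` (fst c \<inter> h -` fst d)) (snd d \<circ> h \<circ> chart_inv c))"

definition diffeomorphism ::
  "('a::topological_space, 'v::euclidean_space) atlas \<Rightarrow>
   ('b::topological_space, 'w::euclidean_space) atlas \<Rightarrow> ('a \<Rightarrow> 'b) \<Rightarrow> bool" where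
  "diffeomorphism A B h \<longleftrightarrow> bij h \<and> smooth_map A B h \<and> smooth_map B A (inv h)"

text \<open>A tangent vector at \<open>x\<close> is the derivative \<open>\<xi>\<^sup>i \<partial>/\<partial>x\<^sup>i\<close>
  acting on the functions that are smooth near \<open>x\<close>; by convention it vanishes on all
  other functions, so that it does not depend on the chart used to write it.\<close>

type_synonym 'a tangent = "('a \<Rightarrow> real) \<Rightarrow> real"

definition coord_vec ::
  "('a::topological_space, 'v::euclidean_space) atlas \<Rightarrow> ('a, 'v) chart \<Rightarrow> 'a \<Rightarrow> 'v \<Rightarrow> 'a tangent" where
  "coord_vec A c x \<xi> =
     (\<lambda>f. if smooth_near A x f then frechet_derivative (f \<circ> chart_inv c) (at (snd c x)) \<xi> else 0)"

definition tangent_space ::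
  "('a::topological_space, 'v::euclidean_space) atlas \<Rightarrow> 'a \<Rightarrow> 'a tangent set" where
  "tangent_space A x = {coord_vec A c x \<xi> | c \<xi>. c \<in> A \<and> x \<in> fst c}"

text \<open>The tangent map of a diffeomorphism \<open>h\<close>. (For a map that is not a diffeomorphism one would
  have to treat separately the functions \<open>g\<close> that are not smooth although \<open>g \<circ> h\<close> is.)\<close>

definition tangent_map :: "('a \<Rightarrow> 'b) \<Rightarrow> 'a tangent \<Rightarrow> 'b tangent" where
  "tangent_map h w = (\<lambda>g. w (g \<circ> h))"


section \<open>Vector bundles\<close>

text \<open>A vector bundle is given by its projection and a set of trivializations; a trivialization is a
  pair of its domain in the base and the fibre coordinate map on the total space. The linear
  structure of the fibres is the one transported by the trivializations.\<close>

type_synonym ('a, 'e, 'r) triv = "'a set \<times> ('e \<Rightarrow> real ^ 'r)"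

record ('a, 'e, 'r) vbundle =
  proj :: "'e \<Rightarrow> 'a"
  trivs :: "('a, 'e, 'r::finite) triv set"

definition vector_bundle ::
  "('a::topological_space, 'v::euclidean_space) atlas \<Rightarrow>
   ('a, 'e::topological_space, 'r::finite) vbundle \<Rightarrow> bool" where
  "vector_bundle A B \<longleftrightarrow>
     continuous_on UNIV (proj B) \<and>
     (\<Union>t\<in>trivs B. fst t) = UNIV \<and>
     (\<forall>t\<in>trivs B. open (fst t) \<and>
        (\<exists>g. homeomorphism (proj B -` fst t) (fst t \<times> UNIV) (\<lambda>e. (proj B e, snd t e)) g)) \<and>
     (\<forall>t\<in>trivs B. \<forall>t'\<in>trivs B. \<exists>\<Lambda> :: 'a \<Rightarrow> real ^ 'r ^ 'r.
        msmooth_on A (fst t \<inter> fst t') \<Lambda> \<and>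
        (\<forall>e. proj B e \<in> fst t \<inter> fst t' \<longrightarrow> snd t' e = \<Lambda> (proj B e) *v snd t e))"

definition fib_elt ::
  "('a, 'e, 'r::finite) vbundle \<Rightarrow> ('a, 'e, 'r) triv \<Rightarrow> 'a \<Rightarrow> real ^ 'r \<Rightarrow> 'e" where
  "fib_elt B t x \<xi> = (THE e. proj B e = x \<and> snd t e = \<xi>)"

definition fib_add :: "('a, 'e, 'r::finite) vbundle \<Rightarrow> 'e \<Rightarrow> 'e \<Rightarrow> 'e" where
  "fib_add B e e' = (THE e''. proj B e'' = proj B e \<and>
     (\<forall>t\<in>trivs B. proj B e \<in> fst t \<longrightarrow> snd t e'' = snd t e + snd t e'))"

definition fib_scale :: "('a, 'e, 'r::finite) vbundle \<Rightarrow> real \<Rightarrow> 'e \<Rightarrow> 'e" where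
  "fib_scale B k e = (THE e'. proj B e' = proj B e \<and>
     (\<forall>t\<in>trivs B. proj B e \<in> fst t \<longrightarrow> snd t e' = k *\<^sub>R snd t e))"

definition vb_sections ::
  "('a::topological_space, 'v::euclidean_space) atlas \<Rightarrow> ('a, 'e, 'r::finite) vbundle \<Rightarrow> ('a \<Rightarrow> 'e) set" where
  "vb_sections A B =
     {u. (\<forall>x. proj B (u x) = x) \<and> (\<forall>t\<in>trivs B. msmooth_on A (fst t) (snd t \<circ> u))}"

definition sec_add ::
  "('a, 'e, 'r::finite) vbundle \<Rightarrow> ('a \<Rightarrow> 'e) \<Rightarrow> ('a \<Rightarrow> 'e) \<Rightarrow> 'a \<Rightarrow> 'e" where
  "sec_add B u v = (\<lambda>x. fib_add B (u x) (v x))"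

definition sec_scale ::
  "('a, 'e, 'r::finite) vbundle \<Rightarrow> ('a \<Rightarrow> real) \<Rightarrow> ('a \<Rightarrow> 'e) \<Rightarrow> 'a \<Rightarrow> 'e" where
  "sec_scale B f u = (\<lambda>x. fib_scale B (f x) (u x))"

definition frame_sec ::
  "('a, 'e, 'r::finite) vbundle \<Rightarrow> ('a, 'e, 'r) triv \<Rightarrow> 'r \<Rightarrow> 'a \<Rightarrow> 'e" where
  "frame_sec B t \<alpha> x = fib_elt B t x (axis \<alpha> 1)"

definition near :: "'a::topological_space \<Rightarrow> ('a \<Rightarrow> 'b) \<Rightarrow> ('a \<Rightarrow> 'b) \<Rightarrow> bool" where
  "near x u v \<longleftrightarrow> (\<forall>\<^sub>F x' in nhds x. u x' = v x')"


section \<open>Generalized Lie algebroids\<close>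

text \<open>The data: \<open>h: M \<rightarrow> N\<close>, \<open>\<eta>: N \<rightarrow> M\<close>, the bundle \<open>F\<close> over \<open>N\<close> with \<open>\<rho>: F \<rightarrow> TM\<close> and the
  bracket on \<open>\<Gamma>(F)\<close>, and the bundle \<open>E\<close> over \<open>M\<close>. An element of the fibre of \<open>(\<rho>,\<eta>)TE\<close> over
  \<open>v\<close> is a pair consisting of an element of \<open>F\<close> over \<open>h(\<pi>(v))\<close> and a tangent vector to \<open>E\<close> at
  \<open>v\<close>. \<open>conn v\<close> is the restriction of the \<open>(\<rho>,\<eta>)\<close>-connection to the fibre over \<open>v\<close>.\<close>

type_synonym ('f, 'e) gte = "'f \<times> 'e tangent"

record ('a, 'b, 'm, 'f, 'p, 'e, 'r) gte_data =
  atlasM :: "('a, real ^ ('m::finite)) atlas"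
  atlasN :: "('b, real ^ ('m::finite)) atlas"
  hmap :: "'a \<Rightarrow> 'b"
  etamap :: "'b \<Rightarrow> 'a"
  bundleF :: "('b, 'f, 'p::finite) vbundle"
  rhomap :: "'f \<Rightarrow> 'a tangent"
  bracket :: "('b \<Rightarrow> 'f) \<Rightarrow> ('b \<Rightarrow> 'f) \<Rightarrow> ('b \<Rightarrow> 'f)"
  bundleE :: "('a, 'e, 'r::finite) vbundle"
  conn :: "'e \<Rightarrow> ('f, 'e) gte \<Rightarrow> ('f, 'e) gte"

text \<open>\<open>\<A> = \<Gamma>(Th \<circ> \<rho>, h \<circ> \<eta>)\<close>, where \<open>\<Gamma>(\<phi>, \<phi>\<^sub>0) u = \<phi> \<circ> u \<circ> \<phi>\<^sub>0\<^sup>-\<^sup>1\<close> for a bundle morphism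
  \<open>\<phi>\<close> covering a diffeomorphism \<open>\<phi>\<^sub>0\<close>.\<close>

definition anchor ::
  "('a, 'b, 'm::finite, 'f, 'p::finite, 'e, 'r::finite) gte_data \<Rightarrow> ('b \<Rightarrow> 'f) \<Rightarrow> 'b \<Rightarrow> 'b tangent" where
  "anchor S u y = tangent_map (hmap S) (rhomap S (u (inv (hmap S \<circ> etamap S) y)))"

definition rho_morphism ::
  "('a::topological_space, 'b::topological_space, 'm::finite, 'f, 'p::finite, 'e, 'r::finite) gte_data \<Rightarrow> bool" where
  "rho_morphism S \<longleftrightarrow>
     (\<forall>z. rhomap S z \<in> tangent_space (atlasM S) (etamap S (proj (bundleF S) z))) \<and>
     (\<forall>z z'. proj (bundleF S) z = proj (bundleF S) z' \<longrightarrow>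
        rhomap S (fib_add (bundleF S) z z') = (\<lambda>f. rhomap S z f + rhomap S z' f)) \<and>
     (\<forall>k z. rhomap S (fib_scale (bundleF S) k z) = (\<lambda>f. k * rhomap S z f)) \<and>
     (\<forall>t\<in>trivs (bundleF S). \<forall>c\<in>atlasM S. \<forall>\<alpha> i.
        msmooth_on (atlasN S) (fst t \<inter> etamap S -` fst c)
          (\<lambda>y. rhomap S (frame_sec (bundleF S) t \<alpha> y) (\<lambda>x. snd c x $ i)))"

text \<open>The \<open>C\<^sup>\<infinity>(N)\<close>-linearity of \<open>\<A>\<close> follows from the other axioms; it is listed because it is part
  of the local description of \<open>\<A>\<close>.\<close>

definition generalized_lie_algebroid ::
  "('a::{t2_space, second_countable_topology}, 'b::{t2_space, second_countable_topology}, 'm::finite,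
    'f::topological_space, 'p::finite, 'e, 'r::finite) gte_data \<Rightarrow> bool" where
  "generalized_lie_algebroid S \<longleftrightarrow>
     (let F = bundleF S; \<Gamma>F = vb_sections (atlasN S) F; CN = smooth_functions (atlasN S);
          br = bracket S; \<A> = anchor S
      in manifold (atlasM S) \<and> manifold (atlasN S) \<and>
         diffeomorphism (atlasM S) (atlasN S) (hmap S) \<and>
         diffeomorphism (atlasN S) (atlasM S) (etamap S) \<and>
         vector_bundle (atlasN S) F \<and>
         rho_morphism S \<and>
         (\<forall>u\<in>\<Gamma>F. \<forall>v\<in>\<Gamma>F. br u v \<in> \<Gamma>F) \<and>
         (\<forall>u\<in>\<Gamma>F. \<forall>v\<in>\<Gamma>F. \<forall>w\<in>\<Gamma>F. br u (sec_add F v w) = sec_add F (br u v) (br u w)) \<and>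
         (\<forall>u\<in>\<Gamma>F. \<forall>v\<in>\<Gamma>F. \<forall>k. br u (sec_scale F (\<lambda>_. k) v) = sec_scale F (\<lambda>_. k) (br u v)) \<and>
         (\<forall>u\<in>\<Gamma>F. \<forall>v\<in>\<Gamma>F. br u v = sec_scale F (\<lambda>_. -1) (br v u)) \<and>
         (\<forall>u\<in>\<Gamma>F. \<forall>v\<in>\<Gamma>F. \<forall>w\<in>\<Gamma>F.
            sec_add F (br u (br v w)) (sec_add F (br v (br w u)) (br w (br u v)))
              = sec_scale F (\<lambda>_. 0) u) \<and>
         (\<forall>u\<in>\<Gamma>F. \<forall>v\<in>\<Gamma>F. \<forall>f\<in>CN.
            br u (sec_scale F f v) = sec_add F (sec_scale F f (br u v)) (sec_scale F (\<lambda>y. \<A> u y f) v)) \<and>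
         (\<forall>u\<in>\<Gamma>F. \<forall>f\<in>CN. \<forall>y g. \<A> (sec_scale F f u) y g = f y * \<A> u y g) \<and>
         (\<forall>u\<in>\<Gamma>F. \<forall>v\<in>\<Gamma>F. \<forall>y f. smooth_near (atlasN S) y f \<longrightarrow>
            \<A> (br u v) y f = \<A> u y (\<lambda>y'. \<A> v y' f) - \<A> v y (\<lambda>y'. \<A> u y' f)))"


section \<open>The generalized tangent bundle\<close>

text \<open>A local chart consists of coordinates \<open>x\<^sup>i\<close> on \<open>M\<close>, fibre coordinates \<open>y\<^sup>a\<close> on \<open>E\<close> and a
  trivialization of \<open>F\<close>, that is a frame \<open>t\<^sub>\<alpha>\<close>.\<close>

type_synonym ('a, 'b, 'm, 'f, 'p, 'e, 'r) local_chart =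
  "('a, real ^ 'm) chart \<times> ('a, 'e, 'r) triv \<times> ('b, 'f, 'p) triv"

definition xpart :: "('a, 'b, 'm::finite, 'f, 'p::finite, 'e, 'r::finite) local_chart \<Rightarrow> ('a, real ^ 'm) chart" where
  "xpart c = fst c"

definition ypart :: "('a, 'b, 'm::finite, 'f, 'p::finite, 'e, 'r::finite) local_chart \<Rightarrow> ('a, 'e, 'r) triv" where
  "ypart c = fst (snd c)"

definition tpart :: "('a, 'b, 'm::finite, 'f, 'p::finite, 'e, 'r::finite) local_chart \<Rightarrow> ('b, 'f, 'p) triv" where
  "tpart c = snd (snd c)"

definition local_charts ::
  "('a, 'b, 'm::finite, 'f, 'p::finite, 'e, 'r::finite) gte_data \<Rightarrow>
   ('a, 'b, 'm, 'f, 'p, 'e, 'r) local_chart set" where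
  "local_charts S = atlasM S \<times> trivs (bundleE S) \<times> trivs (bundleF S)"

definition base_dom ::
  "('a, 'b, 'm::finite, 'f, 'p::finite, 'e, 'r::finite) gte_data \<Rightarrow>
   ('a, 'b, 'm, 'f, 'p, 'e, 'r) local_chart \<Rightarrow> 'a set" where
  "base_dom S c = fst (xpart c) \<inter> fst (ypart c) \<inter> hmap S -` fst (tpart c)"

definition dom_E ::
  "('a, 'b, 'm::finite, 'f, 'p::finite, 'e, 'r::finite) gte_data \<Rightarrow>
   ('a, 'b, 'm, 'f, 'p, 'e, 'r) local_chart \<Rightarrow> 'e set" where
  "dom_E S c = proj (bundleE S) -` base_dom S c"

definition total_chart ::
  "('a, 'e, 'r::finite) vbundle \<Rightarrow> ('a, real ^ 'm::finite) chart \<Rightarrow> ('a, 'e, 'r) triv \<Rightarrow>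
   ('e, (real ^ 'm) \<times> (real ^ 'r)) chart" where
  "total_chart B c t = (proj B -` (fst c \<inter> fst t), \<lambda>e. (snd c (proj B e), snd t e))"

definition atlasE ::
  "('a, 'b, 'm::finite, 'f, 'p::finite, 'e, 'r::finite) gte_data \<Rightarrow>
   ('e, (real ^ 'm) \<times> (real ^ 'r)) atlas" where
  "atlasE S = {total_chart (bundleE S) c t | c t. c \<in> atlasM S \<and> t \<in> trivs (bundleE S)}"

abbreviation chartE ::
  "('a, 'b, 'm::finite, 'f, 'p::finite, 'e, 'r::finite) gte_data \<Rightarrow>
   ('a, 'b, 'm, 'f, 'p, 'e, 'r) local_chart \<Rightarrow> ('e, (real ^ 'm) \<times> (real ^ 'r)) chart" where
  "chartE S c \<equiv> total_chart (bundleE S) (xpart c) (ypart c)"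

definition dx ::
  "('a, 'b, 'm::finite, 'f, 'p::finite, 'e::topological_space, 'r::finite) gte_data \<Rightarrow>
   ('a, 'b, 'm, 'f, 'p, 'e, 'r) local_chart \<Rightarrow> 'm \<Rightarrow> ('e \<Rightarrow> real) \<Rightarrow> 'e \<Rightarrow> real" where
  "dx S c i f v = coord_vec (atlasE S) (chartE S c) v (axis i 1, 0) f"

definition dy ::
  "('a, 'b, 'm::finite, 'f, 'p::finite, 'e::topological_space, 'r::finite) gte_data \<Rightarrow>
   ('a, 'b, 'm, 'f, 'p, 'e, 'r) local_chart \<Rightarrow> 'r \<Rightarrow> ('e \<Rightarrow> real) \<Rightarrow> 'e \<Rightarrow> real" where
  "dy S c a f v = coord_vec (atlasE S) (chartE S c) v (0, axis a 1) f"

text \<open>The functions \<open>\<rho>\<^sup>i\<^sub>\<alpha>\<close> on \<open>N\<close>, as the matrix with row index \<open>i\<close>: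
  \<open>(\<A>(z\<^sup>\<alpha> t\<^sub>\<alpha>) f) \<circ> h = (\<rho>\<^sup>i\<^sub>\<alpha> \<circ> h) (z\<^sup>\<alpha> \<circ> h) \<partial>(f \<circ> h)/\<partial>x\<^sup>i\<close>.\<close>

definition rho_comp ::
  "('a::topological_space, 'b::topological_space, 'm::finite, 'f, 'p::finite, 'e, 'r::finite) gte_data \<Rightarrow>
   ('a, 'b, 'm, 'f, 'p, 'e, 'r) local_chart \<Rightarrow> 'b \<Rightarrow> real ^ 'p ^ 'm" where
  "rho_comp S c y = (THE R. \<forall>u\<in>vb_sections (atlasN S) (bundleF S). \<forall>f. smooth_near (atlasN S) y f \<longrightarrow>
     anchor S u y f =
       (\<Sum>i\<in>UNIV. \<Sum>\<alpha>\<in>UNIV. R $ i $ \<alpha> * (snd (tpart c) (u y) $ \<alpha>) *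
          coord_vec (atlasM S) (xpart c) (inv (hmap S) y) (axis i 1) (f \<circ> hmap S)))"

abbreviation rho_at ::
  "('a::topological_space, 'b::topological_space, 'm::finite, 'f, 'p::finite, 'e, 'r::finite) gte_data \<Rightarrow>
   ('a, 'b, 'm, 'f, 'p, 'e, 'r) local_chart \<Rightarrow> 'm \<Rightarrow> 'p \<Rightarrow> 'e \<Rightarrow> real" where
  "rho_at S c i \<alpha> v \<equiv> rho_comp S c (hmap S (proj (bundleE S) v)) $ i $ \<alpha>"

text \<open>The frame \<open>t\<^sub>\<alpha>\<close> is only local, while the bracket is given on global sections: at \<open>y\<close> the
  bracket \<open>[t\<^sub>\<alpha>, t\<^sub>\<beta>]\<close> is computed from global sections which agree with \<open>t\<^sub>\<alpha>\<close>, \<open>t\<^sub>\<beta>\<close> near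
  \<open>y\<close>.\<close>

definition L_comp ::
  "('a, 'b::topological_space, 'm::finite, 'f, 'p::finite, 'e, 'r::finite) gte_data \<Rightarrow>
   ('a, 'b, 'm, 'f, 'p, 'e, 'r) local_chart \<Rightarrow> 'b \<Rightarrow> 'p \<Rightarrow> 'p \<Rightarrow> 'p \<Rightarrow> real" where
  "L_comp S c y = (THE L. \<forall>u\<in>vb_sections (atlasN S) (bundleF S). \<forall>w\<in>vb_sections (atlasN S) (bundleF S).
     \<forall>\<alpha> \<beta>. near y u (frame_sec (bundleF S) (tpart c) \<alpha>) \<and> near y w (frame_sec (bundleF S) (tpart c) \<beta>) \<longrightarrow>
       bracket S u w y = fib_elt (bundleF S) (tpart c) y (\<chi> \<gamma>. L \<gamma> \<alpha> \<beta>))"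

abbreviation L_at ::
  "('a, 'b::topological_space, 'm::finite, 'f, 'p::finite, 'e, 'r::finite) gte_data \<Rightarrow>
   ('a, 'b, 'm, 'f, 'p, 'e, 'r) local_chart \<Rightarrow> 'p \<Rightarrow> 'p \<Rightarrow> 'p \<Rightarrow> 'e \<Rightarrow> real" where
  "L_at S c \<gamma> \<alpha> \<beta> v \<equiv> L_comp S c (hmap S (proj (bundleE S) v)) \<gamma> \<alpha> \<beta>"

text \<open>The vector with coordinates \<open>Z\<^sup>\<alpha>\<close>, \<open>Y\<^sup>a\<close> in the natural base at \<open>v\<close>, that is
  \<open>Z\<^sup>\<alpha> T\<^sub>\<alpha> \<oplus> (Z\<^sup>\<alpha> (\<rho>\<^sup>i\<^sub>\<alpha> \<circ> h \<circ> \<pi>) \<partial>/\<partial>x\<^sup>i + Y\<^sup>a \<partial>/\<partial>y\<^sup>a)\<close>.\<close>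

definition natural_vec ::
  "('a::topological_space, 'b::topological_space, 'm::finite, 'f, 'p::finite, 'e::topological_space, 'r::finite) gte_data \<Rightarrow>
   ('a, 'b, 'm, 'f, 'p, 'e, 'r) local_chart \<Rightarrow> 'e \<Rightarrow> real ^ 'p \<Rightarrow> real ^ 'r \<Rightarrow> ('f, 'e) gte" where
  "natural_vec S c v Z Y =
     (fib_elt (bundleF S) (tpart c) (hmap S (proj (bundleE S) v)) Z,
      coord_vec (atlasE S) (chartE S c) v (\<chi> i. \<Sum>\<alpha>\<in>UNIV. Z $ \<alpha> * rho_at S c i \<alpha> v, Y))"

definition gte_fibre ::
  "('a::topological_space, 'b::topological_space, 'm::finite, 'f, 'p::finite, 'e::topological_space, 'r::finite) gte_data \<Rightarrow>
   'e \<Rightarrow> ('f, 'e) gte set" where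
  "gte_fibre S v = {natural_vec S c v Z Y | c Z Y. c \<in> local_charts S \<and> v \<in> dom_E S c}"

definition vertical_fibre ::
  "('a::topological_space, 'b::topological_space, 'm::finite, 'f, 'p::finite, 'e::topological_space, 'r::finite) gte_data \<Rightarrow>
   'e \<Rightarrow> ('f, 'e) gte set" where
  "vertical_fibre S v = {natural_vec S c v 0 Y | c Y. c \<in> local_charts S \<and> v \<in> dom_E S c}"

definition gte_add ::
  "('a, 'b, 'm::finite, 'f, 'p::finite, 'e, 'r::finite) gte_data \<Rightarrow> ('f, 'e) gte \<Rightarrow> ('f, 'e) gte \<Rightarrow> ('f, 'e) gte" where
  "gte_add S X X' = (fib_add (bundleF S) (fst X) (fst X'), \<lambda>f. snd X f + snd X' f)"

definition gte_scale ::
  "('a, 'b, 'm::finite, 'f, 'p::finite, 'e, 'r::finite) gte_data \<Rightarrow> real \<Rightarrow> ('f, 'e) gte \<Rightarrow> ('f, 'e) gte" where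
  "gte_scale S k X = (fib_scale (bundleF S) k (fst X), \<lambda>f. k * snd X f)"

definition Z_coord ::
  "('a, 'b, 'm::finite, 'f, 'p::finite, 'e, 'r::finite) local_chart \<Rightarrow> 'p \<Rightarrow> ('f, 'e) gte \<Rightarrow> real" where
  "Z_coord c \<alpha> X = snd (tpart c) (fst X) $ \<alpha>"

definition Y_coord ::
  "('a, 'b, 'm::finite, 'f, 'p::finite, 'e, 'r::finite) local_chart \<Rightarrow> 'r \<Rightarrow> ('f, 'e) gte \<Rightarrow> real" where
  "Y_coord c a X = snd X (\<lambda>v. snd (ypart c) v $ a)"

definition gte_sections ::
  "('a::topological_space, 'b::topological_space, 'm::finite, 'f, 'p::finite, 'e::topological_space, 'r::finite) gte_data \<Rightarrow>
   ('e \<Rightarrow> ('f, 'e) gte) set" where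
  "gte_sections S = {X. (\<forall>v. X v \<in> gte_fibre S v) \<and>
     (\<forall>c\<in>local_charts S.
        (\<forall>\<alpha>. msmooth_on (atlasE S) (dom_E S c) (\<lambda>v. Z_coord c \<alpha> (X v))) \<and>
        (\<forall>a. msmooth_on (atlasE S) (dom_E S c) (\<lambda>v. Y_coord c a (X v))))}"

text \<open>The anchor \<open>\<rho>~\<close> of \<open>(\<rho>,\<eta>)TE\<close> is the projection to \<open>TE\<close>.\<close>

definition gte_deriv :: "('e \<Rightarrow> ('f, 'e) gte) \<Rightarrow> ('e \<Rightarrow> real) \<Rightarrow> 'e \<Rightarrow> real" where
  "gte_deriv X f v = snd (X v) f"


section \<open>The \<open>(\<rho>,\<eta>)\<close>-connection and adapted frames\<close>

definition Gam ::
  "('a::topological_space, 'b::topological_space, 'm::finite, 'f, 'p::finite, 'e::topological_space, 'r::finite) gte_data \<Rightarrow>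
   ('a, 'b, 'm, 'f, 'p, 'e, 'r) local_chart \<Rightarrow> 'r \<Rightarrow> 'p \<Rightarrow> 'e \<Rightarrow> real" where
  "Gam S c a \<gamma> v = Y_coord c a (conn S v (natural_vec S c v (axis \<gamma> 1) 0))"

definition rho_eta_connection ::
  "('a::topological_space, 'b::topological_space, 'm::finite, 'f, 'p::finite, 'e::topological_space, 'r::finite) gte_data \<Rightarrow> bool" where
  "rho_eta_connection S \<longleftrightarrow>
     (\<forall>v. \<forall>X\<in>gte_fibre S v. conn S v X \<in> vertical_fibre S v) \<and>
     (\<forall>v. \<forall>X\<in>gte_fibre S v. \<forall>X'\<in>gte_fibre S v.
        conn S v (gte_add S X X') = gte_add S (conn S v X) (conn S v X')) \<and>
     (\<forall>v. \<forall>X\<in>gte_fibre S v. \<forall>k. conn S v (gte_scale S k X) = gte_scale S k (conn S v X)) \<and>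
     (\<forall>v. \<forall>X\<in>vertical_fibre S v. conn S v X = X) \<and>
     (\<forall>c\<in>local_charts S. \<forall>a \<gamma>. msmooth_on (atlasE S) (dom_E S c) (Gam S c a \<gamma>))"

definition horizontal_fibre ::
  "('a::topological_space, 'b::topological_space, 'm::finite, 'f, 'p::finite, 'e::topological_space, 'r::finite) gte_data \<Rightarrow>
   'e \<Rightarrow> ('f, 'e) gte set" where
  "horizontal_fibre S v = {X \<in> gte_fibre S v. conn S v X = gte_scale S 0 X}"

definition gte_setting ::
  "('a::{t2_space, second_countable_topology}, 'b::{t2_space, second_countable_topology}, 'm::finite,
    'f::topological_space, 'p::finite, 'e::topological_space, 'r::finite) gte_data \<Rightarrow> bool" where
  "gte_setting S \<longleftrightarrow>
     generalized_lie_algebroid S \<and> vector_bundle (atlasM S) (bundleE S) \<and> rho_eta_connection S"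

text \<open>The vector \<open>Z\<^sup>\<alpha> \<delta>\<^sub>\<alpha> + Y\<^sup>a \<partial>/\<partial>y\<^sup>a\<close> at \<open>v\<close>, where \<open>\<delta>\<^sub>\<alpha>\<close> is the natural base vector with index
  \<open>\<alpha>\<close> minus \<open>\<Gamma>\<^sup>a\<^sub>\<alpha> \<partial>/\<partial>y\<^sup>a\<close>.\<close>

definition adapted_vec ::
  "('a::topological_space, 'b::topological_space, 'm::finite, 'f, 'p::finite, 'e::topological_space, 'r::finite) gte_data \<Rightarrow>
   ('a, 'b, 'm, 'f, 'p, 'e, 'r) local_chart \<Rightarrow> 'e \<Rightarrow> real ^ 'p \<Rightarrow> real ^ 'r \<Rightarrow> ('f, 'e) gte" where
  "adapted_vec S c v Z Y = natural_vec S c v Z (\<chi> a. Y $ a - (\<Sum>\<gamma>\<in>UNIV. Gam S c a \<gamma> v * Z $ \<gamma>))"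

abbreviation delta ::
  "('a::topological_space, 'b::topological_space, 'm::finite, 'f, 'p::finite, 'e::topological_space, 'r::finite) gte_data \<Rightarrow>
   ('a, 'b, 'm, 'f, 'p, 'e, 'r) local_chart \<Rightarrow> 'p \<Rightarrow> 'e \<Rightarrow> ('f, 'e) gte" where
  "delta S c \<alpha> \<equiv> (\<lambda>v. adapted_vec S c v (axis \<alpha> 1) 0)"

abbreviation vdot ::
  "('a::topological_space, 'b::topological_space, 'm::finite, 'f, 'p::finite, 'e::topological_space, 'r::finite) gte_data \<Rightarrow>
   ('a, 'b, 'm, 'f, 'p, 'e, 'r) local_chart \<Rightarrow> 'r \<Rightarrow> 'e \<Rightarrow> ('f, 'e) gte" where
  "vdot S c a \<equiv> (\<lambda>v. adapted_vec S c v 0 (axis a 1))"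

text \<open>The dual frame \<open>(dz\<^sup>\<alpha>, \<delta>y\<^sup>a)\<close>: in the natural base, \<open>dz\<^sup>\<alpha> = Z\<^sup>\<alpha>\<close> and
  \<open>\<delta>y\<^sup>a = Y\<^sup>a + \<Gamma>\<^sup>a\<^sub>\<gamma> Z\<^sup>\<gamma>\<close>. Covectors at \<open>v\<close> vanish outside the fibre over \<open>v\<close>.\<close>

definition dz ::
  "('a::topological_space, 'b::topological_space, 'm::finite, 'f, 'p::finite, 'e::topological_space, 'r::finite) gte_data \<Rightarrow>
   ('a, 'b, 'm, 'f, 'p, 'e, 'r) local_chart \<Rightarrow> 'p \<Rightarrow> 'e \<Rightarrow> ('f, 'e) gte \<Rightarrow> real" where
  "dz S c \<alpha> v X = (if X \<in> gte_fibre S v then Z_coord c \<alpha> X else 0)"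

definition deltay ::
  "('a::topological_space, 'b::topological_space, 'm::finite, 'f, 'p::finite, 'e::topological_space, 'r::finite) gte_data \<Rightarrow>
   ('a, 'b, 'm, 'f, 'p, 'e, 'r) local_chart \<Rightarrow> 'r \<Rightarrow> 'e \<Rightarrow> ('f, 'e) gte \<Rightarrow> real" where
  "deltay S c a v X =
     (if X \<in> gte_fibre S v then Y_coord c a X + (\<Sum>\<gamma>\<in>UNIV. Gam S c a \<gamma> v * Z_coord c \<gamma> X) else 0)"

definition frame ::
  "('a::topological_space, 'b::topological_space, 'm::finite, 'f, 'p::finite, 'e::topological_space, 'r::finite) gte_data \<Rightarrow>
   ('a, 'b, 'm, 'f, 'p, 'e, 'r) local_chart \<Rightarrow> 'e \<Rightarrow> 'p + 'r \<Rightarrow> ('f, 'e) gte" where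
  "frame S c v A = (case A of Inl \<alpha> \<Rightarrow> delta S c \<alpha> v | Inr a \<Rightarrow> vdot S c a v)"

definition coframe ::
  "('a::topological_space, 'b::topological_space, 'm::finite, 'f, 'p::finite, 'e::topological_space, 'r::finite) gte_data \<Rightarrow>
   ('a, 'b, 'm, 'f, 'p, 'e, 'r) local_chart \<Rightarrow> 'e \<Rightarrow> 'p + 'r \<Rightarrow> ('f, 'e) gte \<Rightarrow> real" where
  "coframe S c v A = (case A of Inl \<alpha> \<Rightarrow> dz S c \<alpha> v | Inr a \<Rightarrow> deltay S c a v)"


section \<open>The tensor algebra of \<open>(\<rho>,\<eta>)TE\<close>\<close>

text \<open>A tensor of type \<open>(k, l)\<close> takes a list of \<open>k\<close> covectors and a list of \<open>l\<close> vectors; it is set to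
  zero on all other lists.\<close>

type_synonym ('f, 'e) covector = "('f, 'e) gte \<Rightarrow> real"
type_synonym ('f, 'e) tensor = "('f, 'e) covector list \<Rightarrow> ('f, 'e) gte list \<Rightarrow> real"
type_synonym ('f, 'e) tensor_field = "'e \<Rightarrow> ('f, 'e) tensor"

definition gte_dual ::
  "('a::topological_space, 'b::topological_space, 'm::finite, 'f, 'p::finite, 'e::topological_space, 'r::finite) gte_data \<Rightarrow>
   'e \<Rightarrow> ('f, 'e) covector set" where
  "gte_dual S v = {\<omega>.
     (\<forall>X\<in>gte_fibre S v. \<forall>X'\<in>gte_fibre S v. \<omega> (gte_add S X X') = \<omega> X + \<omega> X') \<and>
     (\<forall>X\<in>gte_fibre S v. \<forall>k. \<omega> (gte_scale S k X) = k * \<omega> X) \<and>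
     (\<forall>X. X \<notin> gte_fibre S v \<longrightarrow> \<omega> X = 0)}"

definition tensors_at ::
  "('a::topological_space, 'b::topological_space, 'm::finite, 'f, 'p::finite, 'e::topological_space, 'r::finite) gte_data \<Rightarrow>
   'e \<Rightarrow> nat \<Rightarrow> nat \<Rightarrow> ('f, 'e) tensor set" where
  "tensors_at S v k l = {T.
     (\<forall>\<omega>s Xs. \<not> (length \<omega>s = k \<and> length Xs = l \<and> set \<omega>s \<subseteq> gte_dual S v \<and> set Xs \<subseteq> gte_fibre S v)
        \<longrightarrow> T \<omega>s Xs = 0) \<and>
     (\<forall>\<omega>s Xs. \<forall>i<k. \<forall>\<omega>\<in>gte_dual S v. \<forall>\<omega>'\<in>gte_dual S v. \<forall>r.
        T (\<omega>s[i := (\<lambda>X. \<omega> X + \<omega>' X)]) Xs = T (\<omega>s[i := \<omega>]) Xs + T (\<omega>s[i := \<omega>']) Xs \<and>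
        T (\<omega>s[i := (\<lambda>X. r * \<omega> X)]) Xs = r * T (\<omega>s[i := \<omega>]) Xs) \<and>
     (\<forall>\<omega>s Xs. \<forall>j<l. \<forall>X\<in>gte_fibre S v. \<forall>X'\<in>gte_fibre S v. \<forall>r.
        T \<omega>s (Xs[j := gte_add S X X']) = T \<omega>s (Xs[j := X]) + T \<omega>s (Xs[j := X']) \<and>
        T \<omega>s (Xs[j := gte_scale S r X]) = r * T \<omega>s (Xs[j := X]))}"

definition tensor_fields ::
  "('a::topological_space, 'b::topological_space, 'm::finite, 'f, 'p::finite, 'e::topological_space, 'r::finite) gte_data \<Rightarrow>
   nat \<Rightarrow> nat \<Rightarrow> ('f, 'e) tensor_field set" where
  "tensor_fields S k l = {T. (\<forall>v. T v \<in> tensors_at S v k l) \<and>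
     (\<forall>c\<in>local_charts S. \<forall>As Bs. length As = k \<and> length Bs = l \<longrightarrow>
        msmooth_on (atlasE S) (dom_E S c)
          (\<lambda>v. T v (map (coframe S c v) As) (map (frame S c v) Bs)))}"

definition tens_zero :: "('f, 'e) tensor_field" where
  "tens_zero = (\<lambda>v \<omega>s Xs. 0)"

definition tens_add :: "('f, 'e) tensor_field \<Rightarrow> ('f, 'e) tensor_field \<Rightarrow> ('f, 'e) tensor_field" where
  "tens_add T T' = (\<lambda>v \<omega>s Xs. T v \<omega>s Xs + T' v \<omega>s Xs)"

definition tens_scale :: "('e \<Rightarrow> real) \<Rightarrow> ('f, 'e) tensor_field \<Rightarrow> ('f, 'e) tensor_field" where
  "tens_scale f T = (\<lambda>v \<omega>s Xs. f v * T v \<omega>s Xs)"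

definition fun_tensor :: "('e \<Rightarrow> real) \<Rightarrow> ('f, 'e) tensor_field" where
  "fun_tensor f = (\<lambda>v \<omega>s Xs. if \<omega>s = [] \<and> Xs = [] then f v else 0)"

definition vec_tensor_at ::
  "('a::topological_space, 'b::topological_space, 'm::finite, 'f, 'p::finite, 'e::topological_space, 'r::finite) gte_data \<Rightarrow>
   'e \<Rightarrow> ('f, 'e) gte \<Rightarrow> ('f, 'e) tensor" where
  "vec_tensor_at S v X = (\<lambda>\<omega>s Xs. case \<omega>s of [\<omega>] \<Rightarrow> if Xs = [] \<and> \<omega> \<in> gte_dual S v then \<omega> X else 0 | _ \<Rightarrow> 0)"

definition vec_tensor ::
  "('a::topological_space, 'b::topological_space, 'm::finite, 'f, 'p::finite, 'e::topological_space, 'r::finite) gte_data \<Rightarrow>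
   ('e \<Rightarrow> ('f, 'e) gte) \<Rightarrow> ('f, 'e) tensor_field" where
  "vec_tensor S X = (\<lambda>v. vec_tensor_at S v (X v))"

text \<open>The first factor is of type \<open>(k, l)\<close>.\<close>

definition tens_prod ::
  "nat \<Rightarrow> nat \<Rightarrow> ('f, 'e) tensor_field \<Rightarrow> ('f, 'e) tensor_field \<Rightarrow> ('f, 'e) tensor_field" where
  "tens_prod k l T T' =
     (\<lambda>v \<omega>s Xs. T v (take k \<omega>s) (take l Xs) * T' v (drop k \<omega>s) (drop l Xs))"

text \<open>Contraction of the \<open>i\<close>-th covector slot with the \<open>j\<close>-th vector slot (counted from 0): the trace,
  computed in any frame at \<open>v\<close>.\<close>

definition insert_at :: "nat \<Rightarrow> 'x \<Rightarrow> 'x list \<Rightarrow> 'x list" where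
  "insert_at i x xs = take i xs @ x # drop i xs"

definition contract ::
  "('a::topological_space, 'b::topological_space, 'm::finite, 'f, 'p::finite, 'e::topological_space, 'r::finite) gte_data \<Rightarrow>
   nat \<Rightarrow> nat \<Rightarrow> ('f, 'e) tensor_field \<Rightarrow> ('f, 'e) tensor_field" where
  "contract S i j T = (\<lambda>v \<omega>s Xs.
     let c = (SOME c. c \<in> local_charts S \<and> v \<in> dom_E S c)
     in \<Sum>A\<in>UNIV. T v (insert_at i (coframe S c v A) \<omega>s) (insert_at j (frame S c v A) Xs))"


section \<open>Distinguished linear connections\<close>

definition covariant_derivative ::
  "('a::topological_space, 'b::topological_space, 'm::finite, 'f, 'p::finite, 'e::topological_space, 'r::finite) gte_data \<Rightarrow>
   (('e \<Rightarrow> ('f, 'e) gte) \<Rightarrow> ('f, 'e) tensor_field \<Rightarrow> ('f, 'e) tensor_field) \<Rightarrow> bool" where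
  "covariant_derivative S D \<longleftrightarrow>
     (let \<Gamma> = gte_sections S; CE = smooth_functions (atlasE S); TF = tensor_fields S
      in (\<forall>X\<in>\<Gamma>. \<forall>k l. \<forall>T\<in>TF k l. D X T \<in> TF k l) \<and>
         (\<forall>X\<in>\<Gamma>. \<forall>X'\<in>\<Gamma>. \<forall>k l. \<forall>T\<in>TF k l.
            D (\<lambda>v. gte_add S (X v) (X' v)) T = tens_add (D X T) (D X' T)) \<and>
         (\<forall>X\<in>\<Gamma>. \<forall>f\<in>CE. \<forall>k l. \<forall>T\<in>TF k l.
            D (\<lambda>v. gte_scale S (f v) (X v)) T = tens_scale f (D X T)) \<and>
         (\<forall>X\<in>\<Gamma>. \<forall>k l. \<forall>T\<in>TF k l. \<forall>T'\<in>TF k l. D X (tens_add T T') = tens_add (D X T) (D X T')) \<and>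
         (\<forall>X\<in>\<Gamma>. \<forall>f\<in>CE. D X (fun_tensor f) = fun_tensor (gte_deriv X f)) \<and>
         (\<forall>X\<in>\<Gamma>. \<forall>k l k' l'. \<forall>T\<in>TF k l. \<forall>T'\<in>TF k' l'.
            D X (tens_prod k l T T') =
              tens_add (tens_prod k l (D X T) T') (tens_prod k l T (D X T'))) \<and>
         (\<forall>X\<in>\<Gamma>. \<forall>k l. \<forall>T\<in>TF (Suc k) (Suc l). \<forall>i\<le>k. \<forall>j\<le>l.
            D X (contract S i j T) = contract S i j (D X T)))"

definition distinguished_linear_connection ::
  "('a::topological_space, 'b::topological_space, 'm::finite, 'f, 'p::finite, 'e::topological_space, 'r::finite) gte_data \<Rightarrow>
   (('e \<Rightarrow> ('f, 'e) gte) \<Rightarrow> ('f, 'e) tensor_field \<Rightarrow> ('f, 'e) tensor_field) \<Rightarrow> bool" where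
  "distinguished_linear_connection S D \<longleftrightarrow>
     covariant_derivative S D \<and>
     (\<forall>X\<in>gte_sections S. \<forall>Y\<in>gte_sections S. (\<forall>v. Y v \<in> horizontal_fibre S v) \<longrightarrow>
        (\<exists>W\<in>gte_sections S. (\<forall>v. W v \<in> horizontal_fibre S v) \<and> D X (vec_tensor S Y) = vec_tensor S W)) \<and>
     (\<forall>X\<in>gte_sections S. \<forall>Y\<in>gte_sections S. (\<forall>v. Y v \<in> vertical_fibre S v) \<longrightarrow>
        (\<exists>W\<in>gte_sections S. (\<forall>v. W v \<in> vertical_fibre S v) \<and> D X (vec_tensor S Y) = vec_tensor S W))"

text \<open>The components of \<open>D\<close> in a local chart, with index order \<open>HH \<alpha> \<beta> \<gamma> = H\<^sup>\<alpha>\<^sub>\<beta>\<^sub>\<gamma>\<close>,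
  \<open>HV a b \<gamma> = H\<^sup>a\<^sub>b\<^sub>\<gamma>\<close>, \<open>VH \<alpha> \<beta> c = V\<^sup>\<alpha>\<^sub>\<beta>\<^sub>c\<close>, \<open>VV a b c = V\<^sup>a\<^sub>b\<^sub>c\<close>. The frames being local, the derivatives
  at \<open>v\<close> are computed from global sections which agree with the frame vectors near \<open>v\<close>.\<close>

definition has_components ::
  "('a::topological_space, 'b::topological_space, 'm::finite, 'f, 'p::finite, 'e::topological_space, 'r::finite) gte_data \<Rightarrow>
   (('e \<Rightarrow> ('f, 'e) gte) \<Rightarrow> ('f, 'e) tensor_field \<Rightarrow> ('f, 'e) tensor_field) \<Rightarrow>
   ('a, 'b, 'm, 'f, 'p, 'e, 'r) local_chart \<Rightarrow>
   ('p \<Rightarrow> 'p \<Rightarrow> 'p \<Rightarrow> 'e \<Rightarrow> real) \<Rightarrow> ('r \<Rightarrow> 'r \<Rightarrow> 'p \<Rightarrow> 'e \<Rightarrow> real) \<Rightarrow>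
   ('p \<Rightarrow> 'p \<Rightarrow> 'r \<Rightarrow> 'e \<Rightarrow> real) \<Rightarrow> ('r \<Rightarrow> 'r \<Rightarrow> 'r \<Rightarrow> 'e \<Rightarrow> real) \<Rightarrow> bool" where
  "has_components S D ch HH HV VH VV \<longleftrightarrow>
     (\<forall>v\<in>dom_E S ch. \<forall>X\<in>gte_sections S. \<forall>Y\<in>gte_sections S.
        (\<forall>\<beta> \<gamma>. near v X (delta S ch \<gamma>) \<and> near v Y (delta S ch \<beta>) \<longrightarrow>
           D X (vec_tensor S Y) v = vec_tensor_at S v (adapted_vec S ch v (\<chi> \<alpha>. HH \<alpha> \<beta> \<gamma> v) 0)) \<and>
        (\<forall>b \<gamma>. near v X (delta S ch \<gamma>) \<and> near v Y (vdot S ch b) \<longrightarrow>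
           D X (vec_tensor S Y) v = vec_tensor_at S v (adapted_vec S ch v 0 (\<chi> a. HV a b \<gamma> v))) \<and>
        (\<forall>\<beta> c. near v X (vdot S ch c) \<and> near v Y (delta S ch \<beta>) \<longrightarrow>
           D X (vec_tensor S Y) v = vec_tensor_at S v (adapted_vec S ch v (\<chi> \<alpha>. VH \<alpha> \<beta> c v) 0)) \<and>
        (\<forall>b c. near v X (vdot S ch c) \<and> near v Y (vdot S ch b) \<longrightarrow>
           D X (vec_tensor S Y) v = vec_tensor_at S v (adapted_vec S ch v 0 (\<chi> a. VV a b c v))))"


section \<open>Metrical structures\<close>

definition gH ::
  "('a::topological_space, 'b::topological_space, 'm::finite, 'f, 'p::finite, 'e::topological_space, 'r::finite) gte_data \<Rightarrow>
   ('f, 'e) tensor_field \<Rightarrow> ('a, 'b, 'm, 'f, 'p, 'e, 'r) local_chart \<Rightarrow> 'p \<Rightarrow> 'p \<Rightarrow> 'e \<Rightarrow> real" where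
  "gH S G c \<alpha> \<beta> v = G v [] [delta S c \<alpha> v, delta S c \<beta> v]"

definition gV ::
  "('a::topological_space, 'b::topological_space, 'm::finite, 'f, 'p::finite, 'e::topological_space, 'r::finite) gte_data \<Rightarrow>
   ('f, 'e) tensor_field \<Rightarrow> ('a, 'b, 'm, 'f, 'p, 'e, 'r) local_chart \<Rightarrow> 'r \<Rightarrow> 'r \<Rightarrow> 'e \<Rightarrow> real" where
  "gV S G c a b v = G v [] [vdot S c a v, vdot S c b v]"

definition gH_inv ::
  "('a::topological_space, 'b::topological_space, 'm::finite, 'f, 'p::finite, 'e::topological_space, 'r::finite) gte_data \<Rightarrow>
   ('f, 'e) tensor_field \<Rightarrow> ('a, 'b, 'm, 'f, 'p, 'e, 'r) local_chart \<Rightarrow> 'p \<Rightarrow> 'p \<Rightarrow> 'e \<Rightarrow> real" where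
  "gH_inv S G c \<alpha> \<beta> v = matrix_inv (\<chi> \<alpha> \<beta>. gH S G c \<alpha> \<beta> v) $ \<alpha> $ \<beta>"

definition gV_inv ::
  "('a::topological_space, 'b::topological_space, 'm::finite, 'f, 'p::finite, 'e::topological_space, 'r::finite) gte_data \<Rightarrow>
   ('f, 'e) tensor_field \<Rightarrow> ('a, 'b, 'm, 'f, 'p, 'e, 'r) local_chart \<Rightarrow> 'r \<Rightarrow> 'r \<Rightarrow> 'e \<Rightarrow> real" where
  "gV_inv S G c a b v = matrix_inv (\<chi> a b. gV S G c a b v) $ a $ b"

definition pseudo_metrical_structure ::
  "('a::topological_space, 'b::topological_space, 'm::finite, 'f, 'p::finite, 'e::topological_space, 'r::finite) gte_data \<Rightarrow>
   ('f, 'e) tensor_field \<Rightarrow> bool" where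
  "pseudo_metrical_structure S G \<longleftrightarrow>
     G \<in> tensor_fields S 0 2 \<and>
     (\<forall>c\<in>local_charts S. \<forall>v\<in>dom_E S c.
        (\<forall>X\<in>gte_fibre S v. \<forall>X'\<in>gte_fibre S v.
           G v [] [X, X'] =
             (\<Sum>\<alpha>\<in>UNIV. \<Sum>\<beta>\<in>UNIV. gH S G c \<alpha> \<beta> v * dz S c \<alpha> v X * dz S c \<beta> v X') +
             (\<Sum>a\<in>UNIV. \<Sum>b\<in>UNIV. gV S G c a b v * deltay S c a v X * deltay S c b v X')) \<and>
        (\<forall>\<alpha> \<beta>. gH S G c \<alpha> \<beta> v = gH S G c \<beta> \<alpha> v) \<and>
        (\<forall>a b. gV S G c a b v = gV S G c b a v) \<and>
        invertible (\<chi> \<alpha> \<beta>. gH S G c \<alpha> \<beta> v) \<and>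
        invertible (\<chi> a b. gV S G c a b v))"

definition metrizes ::
  "('a::topological_space, 'b::topological_space, 'm::finite, 'f, 'p::finite, 'e::topological_space, 'r::finite) gte_data \<Rightarrow>
   (('e \<Rightarrow> ('f, 'e) gte) \<Rightarrow> ('f, 'e) tensor_field \<Rightarrow> ('f, 'e) tensor_field) \<Rightarrow> ('f, 'e) tensor_field \<Rightarrow> bool" where
  "metrizes S D G \<longleftrightarrow> (\<forall>X\<in>gte_sections S. D X G = tens_zero)"

definition depends_on_x ::
  "('a, 'b, 'm::finite, 'f, 'p::finite, 'e, 'r::finite) gte_data \<Rightarrow>
   ('a, 'b, 'm, 'f, 'p, 'e, 'r) local_chart \<Rightarrow> ('e \<Rightarrow> real) \<Rightarrow> bool" where
  "depends_on_x S c f \<longleftrightarrow>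
     (\<forall>v\<in>dom_E S c. \<forall>v'\<in>dom_E S c. proj (bundleE S) v = proj (bundleE S) v' \<longrightarrow> f v = f v')"

definition H_adapted_chart ::
  "('a::topological_space, 'b::topological_space, 'm::finite, 'f, 'p::finite, 'e::topological_space, 'r::finite) gte_data \<Rightarrow>
   ('f, 'e) tensor_field \<Rightarrow> ('a, 'b, 'm, 'f, 'p, 'e, 'r) local_chart \<Rightarrow> bool" where
  "H_adapted_chart S G c \<longleftrightarrow> (\<forall>\<alpha> \<beta>. depends_on_x S c (gH S G c \<alpha> \<beta>))"

definition V_adapted_chart ::
  "('a::topological_space, 'b::topological_space, 'm::finite, 'f, 'p::finite, 'e::topological_space, 'r::finite) gte_data \<Rightarrow>
   ('f, 'e) tensor_field \<Rightarrow> ('a, 'b, 'm, 'f, 'p, 'e, 'r) local_chart \<Rightarrow> bool" where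
  "V_adapted_chart S G c \<longleftrightarrow> (\<forall>a b. depends_on_x S c (gV S G c a b))"

definition H_Riemannian ::
  "('a::topological_space, 'b::topological_space, 'm::finite, 'f, 'p::finite, 'e::topological_space, 'r::finite) gte_data \<Rightarrow>
   ('f, 'e) tensor_field \<Rightarrow> bool" where
  "H_Riemannian S G \<longleftrightarrow> (\<forall>x. \<exists>c\<in>local_charts S. x \<in> base_dom S c \<and> H_adapted_chart S G c)"

definition V_Riemannian ::
  "('a::topological_space, 'b::topological_space, 'm::finite, 'f, 'p::finite, 'e::topological_space, 'r::finite) gte_data \<Rightarrow>
   ('f, 'e) tensor_field \<Rightarrow> bool" where
  "V_Riemannian S G \<longleftrightarrow> (\<forall>x. \<exists>c\<in>local_charts S. x \<in> base_dom S c \<and> V_adapted_chart S G c)"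

text \<open>The horizontal covariant derivative of \<open>g\<^sub>b\<^sub>c\<close> for the vertical-frame coefficients
  \<open>K e b \<gamma> = K\<^sup>e\<^sub>b\<^sub>\<gamma>\<close> of a linear connection, and these coefficients for the Berwald connection.\<close>

definition h_cov_gV ::
  "('a::topological_space, 'b::topological_space, 'm::finite, 'f, 'p::finite, 'e::topological_space, 'r::finite) gte_data \<Rightarrow>
   ('f, 'e) tensor_field \<Rightarrow> ('a, 'b, 'm, 'f, 'p, 'e, 'r) local_chart \<Rightarrow>
   ('r \<Rightarrow> 'r \<Rightarrow> 'p \<Rightarrow> 'e \<Rightarrow> real) \<Rightarrow> 'r \<Rightarrow> 'r \<Rightarrow> 'p \<Rightarrow> 'e \<Rightarrow> real" where
  "h_cov_gV S G ch K b c \<gamma> v =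
     gte_deriv (delta S ch \<gamma>) (gV S G ch b c) v
       - (\<Sum>e\<in>UNIV. K e b \<gamma> v * gV S G ch e c v)
       - (\<Sum>e\<in>UNIV. K e c \<gamma> v * gV S G ch b e v)"

definition berwald_HV ::
  "('a::topological_space, 'b::topological_space, 'm::finite, 'f, 'p::finite, 'e::topological_space, 'r::finite) gte_data \<Rightarrow>
   ('a, 'b, 'm, 'f, 'p, 'e, 'r) local_chart \<Rightarrow> 'r \<Rightarrow> 'r \<Rightarrow> 'p \<Rightarrow> 'e \<Rightarrow> real" where
  "berwald_HV S ch a b \<gamma> v = dy S ch b (Gam S ch a \<gamma>) v"

end

theory Submission
  imports Defs
begin

text \<open>A covariant derivative that preserves the horizontal and the vertical subbundle is given, in the adapted
frames, by block diagonal matrices \<open>\<Omega>(X)\<close> with \<open>D\<^sub>X e\<^sub>B = \<Omega>\<^sup>A\<^sub>B(X) e\<^sub>A\<close>. The formulas of the theorem prescribe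
these matrices in every chart. What has to be shown is that the matrices prescribed in two charts belong to the
same connection, that they define a derivation of the whole tensor algebra, and that they respect the metric.

Two adapted frames are related by a block diagonal matrix \<open>J\<close> whose entries are functions on the base
(\<open>acoord_change\<close>), and the matrices of two charts fit together if \<open>J \<Omega> = dJ + \<Omega>' J\<close>. This is not verified on
the formulas; instead each of the four families of components is recognized as an invariant object.

\<^item> \<open>H\<^sup>\<alpha>\<^sub>\<beta>\<^sub>\<gamma>\<close> and \<open>V\<^sup>a\<^sub>b\<^sub>c\<close> differentiate a subbundle along itself. They are Levi-Civita connections: the only
  metric connections whose torsion is given by the structure functions \<open>L\<close>, and by \<open>0\<close> in the vertical case
  (\<open>levi_civita_unique\<close>). Uniqueness yields the behaviour under a change of frame (\<open>levi_civita_change\<close>), once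
  it is known that \<open>L\<close> transforms like the structure functions of a bracket (\<open>L_comp_transform\<close>).

\<^item> \<open>H\<^sup>a\<^sub>b\<^sub>\<gamma>\<close> and \<open>V\<^sup>\<alpha>\<^sub>\<beta>\<^sub>c\<close> differentiate one subbundle along the other one. They are the mean of an
  invariant connection and its dual with respect to the metric. Such a mean is always metric, and the
  construction commutes with changes of frame (\<open>metric_mean_change\<close>). The invariant connection is the Berwald
  connection in the first case (\<open>berwald_change\<close>) and, since \<open>J\<close> is constant along the fibres of \<open>E\<close>, the
  derivative of the coordinates along the fibres in the second case.

The derivative of a tensor is the derivative of its components, with the coefficients of the arguments frozen,
minus one correction by \<open>\<Omega>\<close> in every slot. In another chart the frozen coefficients vary, and Leibniz' rule for
multilinear expressions (\<open>smooth_family_leibniz\<close>) produces exactly the terms that the inhomogeneous part \<open>dJ\<close> of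
the transformation law removes (\<open>Dat_change\<close>). The axioms of a covariant derivative are then checked in one chart;
that contractions commute with \<open>D\<close> is the invariance of the trace. For the metric, \<open>D\<^sub>X G = 0\<close> is the identity
\<open>dg = \<Omega>\<^sup>T g + g \<Omega>\<close>, which holds for each of the two kinds of blocks.

The second part is about the same connection: in charts in which the metric depends on \<open>x\<close> only, its vertical
derivatives vanish (\<open>dy_zero\<close>) and the formulas of the first part reduce to those of the second.

Since the bracket and \<open>D\<close> act on global sections, while frames are local, bump functions on the base enter at
several places; by them the bracket is seen to be a local operator (\<open>bracket_local_right\<close>).\<close>

section \<open>Calculus of smooth functions\<close>

lemma Ck_on_SucI:
  assumes "\<And>x. x \<in> S \<Longrightarrow> (f has_derivative f' x) (at x)"
    and "\<And>\<xi>. Ck_on k S (\<lambda>x. frechet_derivative f (at x) \<xi>)"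
  shows "Ck_on (Suc k) S f"
  using assms by (auto simp: differentiable_def)

lemma Ck_on_SucD:
  assumes "Ck_on (Suc k) S f" "x \<in> S"
  shows "(f has_derivative frechet_derivative f (at x)) (at x)"
  using assms frechet_derivative_works by auto

lemma Ck_on_cong_imp:
  assumes "open S" "\<And>x. x \<in> S \<Longrightarrow> f x = g x" "Ck_on k S f"
  shows "Ck_on k S g"
  using assms
proof (induction k arbitrary: f g)
  case 0
  then show ?case by (auto cong: continuous_on_cong)
next
  case (Suc k)
  have d: "(g has_derivative frechet_derivative f (at x)) (at x)" if "x \<in> S" for x
    using has_derivative_transform_within_open[OF Ck_on_SucD[OF Suc.prems(3) that] \<open>open S\<close> that] Suc.prems(2)
    by auto
  have "frechet_derivative f (at x) = frechet_derivative g (at x)" if "x \<in> S" for x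
    using frechet_derivative_at[OF d[OF that]] by simp
  then have "Ck_on k S (\<lambda>x. frechet_derivative g (at x) \<xi>)" for \<xi>
    using Suc.IH[OF Suc.prems(1), of "\<lambda>x. frechet_derivative f (at x) \<xi>"] Suc.prems(3) by auto
  then show ?case using Ck_on_SucI[OF d] by blast
qed

lemma Ck_on_derivI:
  assumes "open S" "\<And>x. x \<in> S \<Longrightarrow> (f has_derivative f' x) (at x)"
    and "\<And>\<xi>. Ck_on k S (\<lambda>x. f' x \<xi>)"
  shows "Ck_on (Suc k) S f"
proof (rule Ck_on_SucI[OF assms(2)])
  show "Ck_on k S (\<lambda>x. frechet_derivative f (at x) \<xi>)" for \<xi>
    by (rule Ck_on_cong_imp[OF assms(1) _ assms(3)[of \<xi>]])
      (metis assms(2) frechet_derivative_at)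
qed

lemma Ck_on_Suc_imp: "Ck_on (Suc k) S f \<Longrightarrow> Ck_on k S f"
proof (induction k arbitrary: f)
  case 0
  then have "f differentiable (at x within S)" if "x \<in> S" for x
    using that by (auto intro: differentiable_at_withinI)
  then show ?case
    by (auto intro!: differentiable_imp_continuous_on simp: differentiable_on_def)
next
  case (Suc k)
  then show ?case by auto
qed

lemma Ck_on_subset: "Ck_on k S f \<Longrightarrow> T \<subseteq> S \<Longrightarrow> Ck_on k T f"
  by (induction k arbitrary: f) (auto intro: continuous_on_subset)

lemma Ck_on_local:
  assumes "\<And>x. x \<in> S \<Longrightarrow> \<exists>W. open W \<and> x \<in> W \<and> Ck_on k W f"
  shows "Ck_on k S f"
  using assms
proof (induction k arbitrary: f)
  case 0
  show ?case
    unfolding Ck_on.simps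
    by (rule continuous_at_imp_continuous_on)
      (metis 0 Ck_on.simps(1) continuous_on_eq_continuous_at)
next
  case (Suc k)
  then show ?case by (fastforce intro: Suc.IH)
qed

lemma Ck_on_const: "Ck_on k S (\<lambda>x. c)"
  by (induction k arbitrary: c) auto

lemma Ck_on_bounded_linear:
  assumes "open S" "bounded_linear L" "Ck_on k S f"
  shows "Ck_on k S (\<lambda>x. L (f x))"
  using assms(3)
proof (induction k arbitrary: f)
  case 0
  then show ?case by (auto intro!: bounded_linear.continuous_on[OF assms(2)])
next
  case (Suc k)
  show ?case
    by (rule Ck_on_derivI[OF assms(1)
          bounded_linear.has_derivative[OF assms(2) Ck_on_SucD[OF Suc.prems]]])
      (use Suc in auto)
qed

lemma Ck_on_id: "open S \<Longrightarrow> Ck_on k S (\<lambda>x. x)"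
proof (cases k)
  case (Suc j)
  assume "open S"
  then show ?thesis unfolding Suc
    by (rule Ck_on_derivI[where f' = "\<lambda>x \<xi>. \<xi>"]) (auto intro: Ck_on_const)
qed (auto intro: continuous_on_id)

lemma Ck_on_add:
  assumes "open S" "Ck_on k S f" "Ck_on k S g"
  shows "Ck_on k S (\<lambda>x. f x + g x)"
  using assms(2,3)
proof (induction k arbitrary: f g)
  case 0
  then show ?case by (auto intro!: continuous_on_add)
next
  case (Suc k)
  show ?case
    by (rule Ck_on_derivI[OF assms(1)
          has_derivative_add[OF Ck_on_SucD[OF Suc.prems(1)] Ck_on_SucD[OF Suc.prems(2)]]])
      (use Suc in auto)
qed

lemma Ck_on_bilinear:
  assumes "open S" "bounded_bilinear p" "Ck_on k S f" "Ck_on k S g"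
  shows "Ck_on k S (\<lambda>x. p (f x) (g x))"
  using assms(3,4)
proof (induction k arbitrary: f g)
  case 0
  then show ?case by (auto intro!: bounded_bilinear.continuous_on[OF assms(2)])
next
  case (Suc k)
  have fk: "Ck_on k S f" "Ck_on k S g"
    using Suc.prems Ck_on_Suc_imp by auto
  show ?case
    by (rule Ck_on_derivI[OF assms(1) bounded_bilinear.FDERIV[OF assms(2)
            Ck_on_SucD[OF Suc.prems(1)] Ck_on_SucD[OF Suc.prems(2)]]])
      (use Suc fk in \<open>auto intro!: Ck_on_add[OF assms(1)]\<close>)
qed

lemma Ck_on_sum:
  assumes "open S" "\<And>i. i \<in> I \<Longrightarrow> Ck_on k S (f i)"
  shows "Ck_on k S (\<lambda>x. \<Sum>i\<in>I. f i x)"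
proof (cases "finite I")
  case True
  then show ?thesis using assms(2)
    by (induction I) (auto intro: Ck_on_const Ck_on_add[OF assms(1)])
qed (auto intro: Ck_on_const)

text \<open>The derivative \<open>g'(f x)(f' x \<xi>)\<close> is not itself a composition to which the induction hypothesis applies;
  after expansion of \<open>f' x \<xi>\<close> in a basis it is a sum of products of such functions.\<close>

lemma Ck_on_compose:
  fixes f :: "'v::real_normed_vector \<Rightarrow> 'w::euclidean_space"
  assumes "open S" "open T" "f ` S \<subseteq> T" "Ck_on k S f" "Ck_on k T g"
  shows "Ck_on k S (\<lambda>x. g (f x))"
  using assms(4,5)
proof (induction k arbitrary: g)
  case 0
  then show ?case using assms(3) by (auto intro: continuous_on_compose2)
next
  case (Suc k)
  let ?f' = "\<lambda>x. frechet_derivative f (at x)" and ?g' = "\<lambda>y. frechet_derivative g (at y)"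
  have fx: "f x \<in> T" if "x \<in> S" for x using that assms(3) by auto
  have d: "((\<lambda>x. g (f x)) has_derivative (\<lambda>\<xi>. \<Sum>b\<in>Basis. (?f' x \<xi> \<bullet> b) *\<^sub>R ?g' (f x) b)) (at x)"
    if x: "x \<in> S" for x
  proof -
    have g': "(g has_derivative ?g' (f x)) (at (f x))"
      using Ck_on_SucD[OF Suc.prems(2)] fx x by auto
    have "?g' (f x) (?f' x \<xi>) = (\<Sum>b\<in>Basis. (?f' x \<xi> \<bullet> b) *\<^sub>R ?g' (f x) b)" for \<xi>
    proof -
      have lin: "linear (?g' (f x))" using g' has_derivative_linear by blast
      have "?g' (f x) (?f' x \<xi>) = ?g' (f x) (\<Sum>b\<in>Basis. (?f' x \<xi> \<bullet> b) *\<^sub>R b)"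
        by (simp add: euclidean_representation)
      then show ?thesis by (simp add: linear_sum[OF lin] linear_scale[OF lin])
    qed
    then show ?thesis
      using has_derivative_compose[OF Ck_on_SucD[OF Suc.prems(1) x] g'] by simp
  qed
  have fk: "Ck_on k S f" using Suc.prems Ck_on_Suc_imp by auto
  show ?case
  proof (rule Ck_on_derivI[OF assms(1) d], assumption)
    show "Ck_on k S (\<lambda>x. \<Sum>b\<in>Basis. (?f' x \<xi> \<bullet> b) *\<^sub>R ?g' (f x) b)" for \<xi>
      by (intro Ck_on_sum assms(1) Ck_on_bilinear[OF assms(1) bounded_bilinear_scaleR]
          Ck_on_bounded_linear[OF assms(1) bounded_linear_inner_left] Suc.IH fk)
        (use Suc.prems in auto)
  qed
qed

lemma Ck_on_inverse:
  assumes "0 \<notin> S" "open S" shows "Ck_on k S (inverse :: real \<Rightarrow> real)"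
proof (induction k)
  case 0
  then show ?case using assms by (auto intro!: continuous_intros)
next
  case (Suc k)
  have d: "(inverse has_derivative (\<lambda>h. - (inverse x * inverse x) * h)) (at x)" if "x \<in> S" for x :: real
    using has_derivative_inverse'[of x UNIV] that assms(1) by (auto simp: algebra_simps)
  show ?case
    by (rule Ck_on_derivI[OF assms(2) d], assumption)
      (intro Ck_on_bilinear[OF assms(2) bounded_bilinear_mult] Suc Ck_on_const
        Ck_on_bounded_linear[OF assms(2) bounded_linear_minus[OF bounded_linear_ident]])
qed

lemma smooth_on_cong_imp:
  "open S \<Longrightarrow> (\<And>x. x \<in> S \<Longrightarrow> f x = g x) \<Longrightarrow> smooth_on S f \<Longrightarrow> smooth_on S g"
  unfolding smooth_on_def using Ck_on_cong_imp by blast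

lemma smooth_on_subset: "smooth_on S f \<Longrightarrow> T \<subseteq> S \<Longrightarrow> smooth_on T f"
  unfolding smooth_on_def using Ck_on_subset by blast

lemma smooth_on_local:
  "(\<And>x. x \<in> S \<Longrightarrow> \<exists>W. open W \<and> x \<in> W \<and> smooth_on W f) \<Longrightarrow> smooth_on S f"
  unfolding smooth_on_def using Ck_on_local by metis

lemma smooth_on_const: "smooth_on S (\<lambda>x. c)"
  by (simp add: smooth_on_def Ck_on_const)

lemma smooth_on_id: "open S \<Longrightarrow> smooth_on S (\<lambda>x. x)"
  by (simp add: smooth_on_def Ck_on_id)

lemma smooth_on_bounded_linear:
  "open S \<Longrightarrow> bounded_linear L \<Longrightarrow> smooth_on S f \<Longrightarrow> smooth_on S (\<lambda>x. L (f x))"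
  by (simp add: smooth_on_def Ck_on_bounded_linear)

lemma smooth_on_bilinear:
  "open S \<Longrightarrow> bounded_bilinear p \<Longrightarrow> smooth_on S f \<Longrightarrow> smooth_on S g \<Longrightarrow> smooth_on S (\<lambda>x. p (f x) (g x))"
  by (simp add: smooth_on_def Ck_on_bilinear)

lemma smooth_on_add:
  "open S \<Longrightarrow> smooth_on S f \<Longrightarrow> smooth_on S g \<Longrightarrow> smooth_on S (\<lambda>x. f x + g x)"
  by (simp add: smooth_on_def Ck_on_add)

lemma smooth_on_sum:
  "open S \<Longrightarrow> (\<And>i. i \<in> I \<Longrightarrow> smooth_on S (f i)) \<Longrightarrow> smooth_on S (\<lambda>x. \<Sum>i\<in>I. f i x)"
  by (simp add: smooth_on_def Ck_on_sum)

lemma smooth_on_compose: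
  fixes f :: "'v::real_normed_vector \<Rightarrow> 'w::euclidean_space"
  shows "open S \<Longrightarrow> open T \<Longrightarrow> f ` S \<subseteq> T \<Longrightarrow> smooth_on S f \<Longrightarrow> smooth_on T g \<Longrightarrow> smooth_on S (\<lambda>x. g (f x))"
  unfolding smooth_on_def using Ck_on_compose by blast

lemma smooth_on_inverse: "0 \<notin> S \<Longrightarrow> open S \<Longrightarrow> smooth_on S (inverse :: real \<Rightarrow> real)"
  by (simp add: smooth_on_def Ck_on_inverse)

lemma smooth_on_frechet_derivative:
  "smooth_on S f \<Longrightarrow> smooth_on S (\<lambda>x. frechet_derivative f (at x) \<xi>)"
  unfolding smooth_on_def by (metis Ck_on.simps(2))

lemma smooth_on_has_derivative:
  "smooth_on S f \<Longrightarrow> x \<in> S \<Longrightarrow> (f has_derivative frechet_derivative f (at x)) (at x)"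
  unfolding smooth_on_def using Ck_on_SucD by blast

lemma bounded_linear_axis: "bounded_linear (\<lambda>x. axis i x :: 'w::real_normed_vector ^ 'n::finite)"
proof (rule bounded_linear_intro[where K = 1])
  show "axis i (x + y) = (axis i x + axis i y :: 'w ^ 'n)" for x y
    by (simp add: vec_eq_iff axis_def)
  show "axis i (r *\<^sub>R x) = (r *\<^sub>R axis i x :: 'w ^ 'n)" for r x
    by (simp add: vec_eq_iff axis_def)
  show "norm (axis i x :: 'w ^ 'n) \<le> norm x * 1" for x
    by (simp add: norm_vec_def L2_set_def axis_def if_distrib[of norm] if_distrib[of "\<lambda>t. t\<^sup>2"] cong: if_cong)
qed

lemma vec_sum_axis: "(\<Sum>i\<in>UNIV. axis i (x $ i)) = (x :: 'w::real_normed_vector ^ 'n::finite)"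
  by (simp add: vec_eq_iff axis_def sum.delta)

lemma smooth_on_vecI:
  fixes f :: "_ \<Rightarrow> 'w::real_normed_vector ^ 'n::finite"
  assumes "open S" "\<And>i. smooth_on S (\<lambda>x. f x $ i)"
  shows "smooth_on S f"
proof -
  have "smooth_on S (\<lambda>x. \<Sum>i\<in>UNIV. axis i (f x $ i) :: 'w ^ 'n)"
    by (intro smooth_on_sum smooth_on_bounded_linear[OF _ bounded_linear_axis] assms)
  then show ?thesis by (simp only: vec_sum_axis)
qed

lemma smooth_on_Pair:
  assumes "open S" "smooth_on S f" "smooth_on S g"
  shows "smooth_on S (\<lambda>x. (f x, g x))"
proof -
  have "smooth_on S (\<lambda>x. (f x, 0) + (0, g x))"
    by (intro smooth_on_add assms smooth_on_bounded_linear[OF assms(1) _ assms(2)]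
        smooth_on_bounded_linear[OF assms(1) _ assms(3)] bounded_linear_Pair
        bounded_linear_ident bounded_linear_zero)
  then show ?thesis by simp
qed

text \<open>The functions \<open>x\<^sup>-\<^sup>n e\<^sup>-\<^sup>1\<^sup>/\<^sup>x\<close>, extended by \<open>0\<close>: this family is closed under differentiation up to
  linear combinations.\<close>

definition flat_fun :: "nat \<Rightarrow> real \<Rightarrow> real" where
  "flat_fun n x = (if x \<le> 0 then 0 else inverse x ^ n * exp (- inverse x))"

lemma flat_fun_tendsto_0: "(flat_fun n \<longlongrightarrow> 0) (at 0)"
proof -
  have "((\<lambda>x. inverse x ^ n * exp (- inverse x)) \<longlongrightarrow> 0) (at_right (0::real))"
  proof -
    have "((\<lambda>y::real. y ^ n / exp y) \<longlongrightarrow> 0) at_top"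
      by (rule tendsto_power_div_exp_0)
    then have "((\<lambda>x::real. inverse x ^ n / exp (inverse x)) \<longlongrightarrow> 0) (at_right 0)"
      by (rule filterlim_compose) (rule filterlim_inverse_at_top_right)
    then show ?thesis by (simp add: exp_minus divide_inverse)
  qed
  then have r: "(flat_fun n \<longlongrightarrow> 0) (at_right 0)"
    by (rule Lim_transform_eventually)
      (auto simp: flat_fun_def eventually_at intro!: exI[of _ 1])
  have l: "(flat_fun n \<longlongrightarrow> 0) (at_left 0)"
    by (rule Lim_transform_eventually[OF tendsto_const])
      (auto simp: flat_fun_def eventually_at intro!: exI[of _ 1])
  show ?thesis using l r by (simp add: filterlim_at_split)
qed

lemma flat_fun_deriv:
  "(flat_fun n has_real_derivative flat_fun (n + 2) x - of_nat n * flat_fun (n + 1) x) (at x)"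
proof -
  consider "x < 0" | "x = 0" | "x > 0" by linarith
  then show ?thesis
  proof cases
    case 1
    have "((\<lambda>x. 0) has_real_derivative 0) (at x)" by simp
    then have "(flat_fun n has_real_derivative 0) (at x)"
      by (rule has_field_derivative_transform_within_open[where S = "{..<0}"]) (use 1 in \<open>auto simp: flat_fun_def\<close>)
    then show ?thesis using 1 by (simp add: flat_fun_def)
  next
    case 2
    have "((\<lambda>h. (flat_fun n h - flat_fun n 0) / (h - 0)) \<longlongrightarrow> 0) (at 0)"
      by (rule Lim_transform_eventually[OF flat_fun_tendsto_0[of "n + 1"]])
        (auto simp: flat_fun_def eventually_at divide_inverse intro!: exI[of _ 1])
    then show ?thesis using 2 by (simp add: has_field_derivative_iff flat_fun_def)
  next
    case 3
    have "((\<lambda>x. inverse x ^ n * exp (- inverse x)) has_real_derivative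
        inverse x ^ n * (exp (- inverse x) * (inverse x)\<^sup>2) +
        of_nat n * inverse x ^ (n - 1) * (- (inverse x)\<^sup>2) * exp (- inverse x)) (at x)"
      using 3 by (auto intro!: derivative_eq_intros simp: power2_eq_square)
    moreover have "inverse x ^ n * (exp (- inverse x) * (inverse x)\<^sup>2) +
        of_nat n * inverse x ^ (n - 1) * (- (inverse x)\<^sup>2) * exp (- inverse x)
        = flat_fun (n + 2) x - of_nat n * flat_fun (n + 1) x"
      using 3 by (cases n) (simp_all add: flat_fun_def power2_eq_square algebra_simps)
    ultimately have "((\<lambda>x. inverse x ^ n * exp (- inverse x)) has_real_derivative
        flat_fun (n + 2) x - of_nat n * flat_fun (n + 1) x) (at x)"
      by (simp only:)
    then show ?thesis
      by (rule has_field_derivative_transform_within_open[where S = "{0<..}"]) (use 3 in \<open>auto simp: flat_fun_def\<close>)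
  qed
qed

lemma smooth_on_flat_fun: "smooth_on UNIV (flat_fun n)"
proof -
  have "Ck_on k UNIV (flat_fun n)" for k
  proof (induction k arbitrary: n)
    case 0
    show ?case unfolding Ck_on.simps
      by (rule continuous_at_imp_continuous_on) (use DERIV_isCont flat_fun_deriv in blast)
  next
    case (Suc k)
    have "(flat_fun n has_derivative (\<lambda>h. (flat_fun (n + 2) x + (- of_nat n) * flat_fun (n + 1) x) * h)) (at x)" for x
      using flat_fun_deriv[of n x] by (simp add: has_field_derivative_def)
    then show ?case
      by (rule Ck_on_derivI[OF open_UNIV])
        (intro Ck_on_bilinear[OF open_UNIV bounded_bilinear_mult] Ck_on_const Ck_on_add Suc open_UNIV)
  qed
  then show ?thesis by (simp add: smooth_on_def)
qed

text \<open>For \<open>p\<close> positive exactly on the ball of radius \<open>r\<close> and \<open>q\<close> positive exactly outside the closed ball of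
  radius \<open>r/2\<close>, the sum \<open>p + q\<close> has no zeros and \<open>p / (p + q)\<close> is as required.\<close>

lemma smooth_bump_exists:
  fixes a :: "'v::euclidean_space"
  assumes "0 < r"
  obtains \<psi> :: "'v \<Rightarrow> real" where "smooth_on UNIV \<psi>"
    "\<And>x. dist a x \<le> r / 2 \<Longrightarrow> \<psi> x = 1" "\<And>x. r \<le> dist a x \<Longrightarrow> \<psi> x = 0"
proof -
  let ?d = "\<lambda>x. (x - a) \<bullet> (x - a)"
  let ?p = "\<lambda>x. flat_fun 0 (r\<^sup>2 + (- 1) * ?d x)" and ?q = "\<lambda>x. flat_fun 0 (?d x + - (r/2)\<^sup>2)"
  define \<psi> where "\<psi> x = ?p x * inverse (?p x + ?q x)" for x
  have nn: "flat_fun 0 t \<ge> 0" "t > 0 \<Longrightarrow> flat_fun 0 t > 0" "t \<le> 0 \<Longrightarrow> flat_fun 0 t = 0" for t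
    by (auto simp: flat_fun_def)
  have d: "?d x = (dist a x)\<^sup>2" for x
    by (simp add: power2_norm_eq_inner[symmetric] dist_norm norm_minus_commute)
  have pos: "?p x + ?q x > 0" for x
  proof (cases "dist a x < r")
    case True
    then have "(dist a x)\<^sup>2 < r\<^sup>2" by (simp add: power_strict_mono)
    then have "?p x > 0" unfolding d by (intro nn(2)) simp
    then show ?thesis using nn(1) by (simp add: add_pos_nonneg)
  next
    case False
    then have "(r/2)\<^sup>2 < (dist a x)\<^sup>2" using assms by (intro power_strict_mono) auto
    then have "?q x > 0" unfolding d by (intro nn(2)) simp
    then show ?thesis using nn(1) by (simp add: add_nonneg_pos)
  qed
  have sd: "smooth_on UNIV ?d"
  proof -
    have "smooth_on UNIV (\<lambda>x. x + (- a))"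
      by (intro smooth_on_add smooth_on_id smooth_on_const open_UNIV)
    then have "smooth_on UNIV (\<lambda>x. x - a)" by simp
    then show ?thesis using smooth_on_bilinear[OF open_UNIV bounded_bilinear_inner] by blast
  qed
  have "smooth_on UNIV (\<lambda>x. r\<^sup>2 + (- 1) * ?d x)"
    by (intro smooth_on_add smooth_on_const sd smooth_on_bilinear[OF open_UNIV bounded_bilinear_mult] open_UNIV)
  then have sp: "smooth_on UNIV ?p"
    by (rule smooth_on_compose[OF open_UNIV open_UNIV subset_UNIV _ smooth_on_flat_fun])
  have "smooth_on UNIV (\<lambda>x. ?d x + - (r/2)\<^sup>2)"
    by (intro smooth_on_add smooth_on_const sd open_UNIV)
  then have sq: "smooth_on UNIV ?q"
    by (rule smooth_on_compose[OF open_UNIV open_UNIV subset_UNIV _ smooth_on_flat_fun])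
  have "smooth_on UNIV \<psi>"
    unfolding \<psi>_def
    by (intro smooth_on_bilinear[OF open_UNIV bounded_bilinear_mult] sp)
      (rule smooth_on_compose[OF open_UNIV _ _ smooth_on_add[OF open_UNIV sp sq] smooth_on_inverse, of "{0<..}"],
        use pos in auto)
  moreover have "\<psi> x = 1" if "dist a x \<le> r / 2" for x
  proof -
    have "(dist a x)\<^sup>2 \<le> (r/2)\<^sup>2" using that by (intro power_mono) auto
    then have "?q x = 0" unfolding d by (intro nn(3)) simp
    then show ?thesis using pos[of x] by (simp add: \<psi>_def)
  qed
  moreover have "\<psi> x = 0" if "r \<le> dist a x" for x
  proof -
    have "r\<^sup>2 \<le> (dist a x)\<^sup>2" using that assms by (intro power_mono) auto
    then have "?p x = 0" unfolding d by (intro nn(3)) simp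
    then show ?thesis by (simp add: \<psi>_def)
  qed
  ultimately show ?thesis using that by blast
qed

section \<open>Smooth functions and tangent vectors on a manifold\<close>

text \<open>The total space of a bundle is known to be a product only locally; the local theory of smooth functions
  and tangent vectors is therefore stated without global conditions on the topology, so that it applies
  to the total space as well.\<close>

locale smooth_atlas =
  fixes A :: "('a::topological_space, 'v::euclidean_space) atlas"
  assumes chart_cover: "(\<Union>c\<in>A. fst c) = UNIV"
    and open_chart_dom: "c \<in> A \<Longrightarrow> open (fst c)"
    and open_chart_image: "c \<in> A \<Longrightarrow> open (snd c ` fst c)"
    and chart_homeomorphism: "c \<in> A \<Longrightarrow> homeomorphism (fst c) (snd c ` fst c) (snd c) (chart_inv c)"
    and chart_transition: "c \<in> A \<Longrightarrow> c' \<in> A \<Longrightarrow> smooth_on (snd c ` (fst c \<inter> fst c')) (snd c' \<circ> chart_inv c)"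

lemma manifold_smooth_atlas: "manifold A \<Longrightarrow> smooth_atlas A"
  unfolding manifold_def smooth_atlas_def by blast

lemma msmooth_on_subset: "msmooth_on A U f \<Longrightarrow> V \<subseteq> U \<Longrightarrow> msmooth_on A V f"
  unfolding msmooth_on_def by (meson Int_mono image_mono order_refl smooth_on_subset)

lemma smooth_near_const: "smooth_near A x (\<lambda>_. k)"
  unfolding smooth_near_def msmooth_on_def
  by (intro exI[of _ UNIV]) (auto simp: comp_def smooth_on_const)

lemma matrix_inv_inverse:
  fixes M :: "real ^ 'n ^ 'n::finite"
  assumes "invertible M"
  shows matrix_inv_right: "M ** matrix_inv M = mat 1" and matrix_inv_left: "matrix_inv M ** M = mat 1"
proof -
  have "M ** matrix_inv M = mat 1 \<and> matrix_inv M ** M = mat 1"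
    unfolding matrix_inv_def by (rule someI_ex) (use assms in \<open>simp add: invertible_def\<close>)
  then show "M ** matrix_inv M = mat 1" "matrix_inv M ** M = mat 1" by auto
qed

context smooth_atlas
begin

lemma chart_at: obtains c where "c \<in> A" "x \<in> fst c"
  by (metis UN_E UNIV_I chart_cover that)

lemma chart_inv_left [simp]: "c \<in> A \<Longrightarrow> x \<in> fst c \<Longrightarrow> chart_inv c (snd c x) = x"
  using chart_homeomorphism by (auto simp: homeomorphism_def)

lemma chart_inv_right: "c \<in> A \<Longrightarrow> y \<in> snd c ` fst c \<Longrightarrow> snd c (chart_inv c y) = y"
  using chart_homeomorphism by (auto simp: homeomorphism_def)

lemma open_chart_image_Int:
  assumes "c \<in> A" "open U" shows "open (snd c ` (fst c \<inter> U))"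
proof -
  have "openin (top_of_set (snd c ` fst c)) (snd c ` (fst c \<inter> U))"
    using homeomorphism_imp_open_map[OF chart_homeomorphism[OF assms(1)]] assms(2) by auto
  then show ?thesis
    using open_chart_image[OF assms(1)] by (auto simp: openin_open_eq)
qed

lemma open_chart_vimage:
  assumes "c \<in> A" "open W" shows "open {x \<in> fst c. snd c x \<in> W}"
proof -
  have "continuous_on (fst c) (snd c)"
    using chart_homeomorphism[OF assms(1)] by (simp add: homeomorphism_def)
  then have "open (fst c \<inter> snd c -` W)"
    using assms open_chart_dom continuous_on_open_vimage by (metis Int_commute)
  then show ?thesis by (simp add: Collect_conj_eq vimage_def Int_commute)
qed

text \<open>By smoothness of the transitions one chart suffices.\<close>

lemma smooth_near_iff_chart:
  assumes c: "c \<in> A" "x \<in> fst c"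
  shows "smooth_near A x f \<longleftrightarrow>
    (\<exists>W. open W \<and> snd c x \<in> W \<and> W \<subseteq> snd c ` fst c \<and> smooth_on W (f \<circ> chart_inv c))"
proof
  assume "smooth_near A x f"
  then obtain U where U: "open U" "x \<in> U" "msmooth_on A U f" by (auto simp: smooth_near_def)
  then show "\<exists>W. open W \<and> snd c x \<in> W \<and> W \<subseteq> snd c ` fst c \<and> smooth_on W (f \<circ> chart_inv c)"
    using c by (intro exI[of _ "snd c ` (fst c \<inter> U)"])
      (auto simp: msmooth_on_def open_chart_image_Int)
next
  assume "\<exists>W. open W \<and> snd c x \<in> W \<and> W \<subseteq> snd c ` fst c \<and> smooth_on W (f \<circ> chart_inv c)"
  then obtain W where W: "open W" "snd c x \<in> W" "W \<subseteq> snd c ` fst c" "smooth_on W (f \<circ> chart_inv c)"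
    by blast
  let ?U = "{x \<in> fst c. snd c x \<in> W}"
  have U: "open ?U" using c W open_chart_vimage by blast
  have "smooth_on (snd c' ` (fst c' \<inter> ?U)) (f \<circ> chart_inv c')" if c': "c' \<in> A" for c'
  proof -
    let ?V = "snd c' ` (fst c' \<inter> ?U)"
    have V: "open ?V" using c' U open_chart_image_Int by blast
    have "smooth_on ?V (\<lambda>y. (f \<circ> chart_inv c) ((snd c \<circ> chart_inv c') y))"
    proof (rule smooth_on_compose[OF V W(1) _ _ W(4)])
      show "(snd c \<circ> chart_inv c') ` ?V \<subseteq> W" using c' by auto
      show "smooth_on ?V (snd c \<circ> chart_inv c')"
        by (rule smooth_on_subset[OF chart_transition[OF c' c(1)]]) auto
    qed
    then show ?thesis
      by (rule smooth_on_cong_imp[OF V, rotated]) (use c c' in auto)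
  qed
  then show "smooth_near A x f"
    using U W(2) c(2) unfolding smooth_near_def msmooth_on_def by (intro exI[of _ ?U]) blast
qed

lemma msmooth_on_iff:
  assumes "open U" shows "msmooth_on A U f \<longleftrightarrow> (\<forall>x\<in>U. smooth_near A x f)"
proof
  assume "msmooth_on A U f"
  then show "\<forall>x\<in>U. smooth_near A x f" using assms by (auto simp: smooth_near_def)
next
  assume *: "\<forall>x\<in>U. smooth_near A x f"
  show "msmooth_on A U f"
    unfolding msmooth_on_def
  proof (intro ballI smooth_on_local)
    fix c y assume c: "c \<in> A" and "y \<in> snd c ` (fst c \<inter> U)"
    then obtain x where x: "x \<in> fst c" "x \<in> U" "y = snd c x" by auto
    then show "\<exists>W. open W \<and> y \<in> W \<and> smooth_on W (f \<circ> chart_inv c)"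
      using *[rule_format, OF x(2)] smooth_near_iff_chart[OF c x(1)] by auto
  qed
qed

lemma smooth_near_cong:
  assumes "near x f g" "smooth_near A x f" shows "smooth_near A x g"
proof -
  obtain U where U: "open U" "x \<in> U" "msmooth_on A U f" using assms(2) by (auto simp: smooth_near_def)
  obtain V where V: "open V" "x \<in> V" "\<And>x. x \<in> V \<Longrightarrow> f x = g x"
    using assms(1) unfolding near_def eventually_nhds by blast
  have "msmooth_on A (U \<inter> V) g"
    unfolding msmooth_on_def
  proof
    fix c assume c: "c \<in> A"
    show "smooth_on (snd c ` (fst c \<inter> (U \<inter> V))) (g \<circ> chart_inv c)"
      by (rule smooth_on_cong_imp[OF open_chart_image_Int[OF c open_Int[OF U(1) V(1)]] _
            smooth_on_subset[OF U(3)[unfolded msmooth_on_def, rule_format, OF c]]])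
        (use c V(3) in auto)
  qed
  then show ?thesis using U V by (auto simp: smooth_near_def)
qed

lemma smooth_near_op:
  assumes "\<And>(W :: 'v set) F G. open W \<Longrightarrow> smooth_on W F \<Longrightarrow> smooth_on W G \<Longrightarrow> smooth_on W (\<lambda>y. p (F y) (G y))"
    and "smooth_near A x f" "smooth_near A x g"
  shows "smooth_near A x (\<lambda>x. p (f x) (g x))"
proof -
  obtain U V where U: "open U" "x \<in> U" "msmooth_on A U f" and V: "open V" "x \<in> V" "msmooth_on A V g"
    using assms(2,3) by (auto simp: smooth_near_def)
  have "msmooth_on A (U \<inter> V) (\<lambda>x. p (f x) (g x))"
    unfolding msmooth_on_def
  proof
    fix c assume c: "c \<in> A"
    let ?W = "snd c ` (fst c \<inter> (U \<inter> V))"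
    have "open ?W" using c U V by (intro open_chart_image_Int) auto
    moreover have "smooth_on ?W (f \<circ> chart_inv c)" "smooth_on ?W (g \<circ> chart_inv c)"
      using c msmooth_on_subset[OF U(3), of "U \<inter> V"] msmooth_on_subset[OF V(3), of "U \<inter> V"]
      by (auto simp: msmooth_on_def)
    ultimately show "smooth_on ?W ((\<lambda>x. p (f x) (g x)) \<circ> chart_inv c)"
      using assms(1)[of ?W "f \<circ> chart_inv c" "g \<circ> chart_inv c"] by (simp add: comp_def)
  qed
  then show ?thesis using U V by (auto simp: smooth_near_def)
qed

lemma smooth_near_add:
  "smooth_near A x f \<Longrightarrow> smooth_near A x g \<Longrightarrow> smooth_near A x (\<lambda>x. f x + g x)"
  by (rule smooth_near_op[where p = "(+)"]) (auto intro: smooth_on_add)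

lemma smooth_near_bilinear:
  "bounded_bilinear p \<Longrightarrow> smooth_near A x f \<Longrightarrow> smooth_near A x g \<Longrightarrow> smooth_near A x (\<lambda>x. p (f x) (g x))"
  by (rule smooth_near_op[where p = p]) (auto intro: smooth_on_bilinear)

lemma smooth_near_bounded_linear:
  "bounded_linear L \<Longrightarrow> smooth_near A x f \<Longrightarrow> smooth_near A x (\<lambda>x. L (f x))"
  by (rule smooth_near_op[where p = "\<lambda>u v. L u" and g = f]) (auto intro: smooth_on_bounded_linear)

lemma smooth_near_mult:
  fixes f g :: "'a \<Rightarrow> real"
  shows "smooth_near A x f \<Longrightarrow> smooth_near A x g \<Longrightarrow> smooth_near A x (\<lambda>x. f x * g x)"
  by (rule smooth_near_bilinear[OF bounded_bilinear_mult])

lemma smooth_near_minus: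
  fixes f :: "'a \<Rightarrow> real"
  shows "smooth_near A x f \<Longrightarrow> smooth_near A x (\<lambda>x. - f x)"
  by (rule smooth_near_bounded_linear[OF bounded_linear_minus[OF bounded_linear_ident]])

lemma smooth_near_diff:
  fixes f g :: "'a \<Rightarrow> real"
  shows "smooth_near A x f \<Longrightarrow> smooth_near A x g \<Longrightarrow> smooth_near A x (\<lambda>x. f x - g x)"
  using smooth_near_add[OF _ smooth_near_minus] by simp

lemma smooth_near_sum:
  "(\<And>i. i \<in> I \<Longrightarrow> smooth_near A x (f i)) \<Longrightarrow> smooth_near A x (\<lambda>x. \<Sum>i\<in>I. f i x)"
proof (induction I rule: infinite_finite_induct)
  case (insert i I)
  then show ?case by (simp add: smooth_near_add)
qed (simp_all add: smooth_near_const)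

lemma smooth_near_prod:
  fixes f :: "'i \<Rightarrow> 'a \<Rightarrow> real"
  shows "(\<And>i. i \<in> I \<Longrightarrow> smooth_near A x (f i)) \<Longrightarrow> smooth_near A x (\<lambda>x. \<Prod>i\<in>I. f i x)"
proof (induction I rule: infinite_finite_induct)
  case (insert i I)
  then show ?case by (simp add: smooth_near_mult)
qed (simp_all add: smooth_near_const)

lemma smooth_near_vecI:
  fixes f :: "'a \<Rightarrow> 'w::real_normed_vector ^ 'n::finite"
  assumes "\<And>i. smooth_near A x (\<lambda>x. f x $ i)" shows "smooth_near A x f"
proof -
  have "smooth_near A x (\<lambda>x. \<Sum>i\<in>UNIV. axis i (f x $ i) :: 'w ^ 'n)"
    by (intro smooth_near_sum smooth_near_bounded_linear[OF bounded_linear_axis] assms)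
  then show ?thesis by (simp only: vec_sum_axis)
qed

lemma smooth_near_vecD:
  fixes f :: "'a \<Rightarrow> 'w::real_normed_vector ^ 'n::finite"
  shows "smooth_near A x f \<Longrightarrow> smooth_near A x (\<lambda>x. f x $ i)"
  by (rule smooth_near_bounded_linear[OF bounded_linear_vec_nth])

lemma smooth_near_inverse:
  fixes f :: "'a \<Rightarrow> real"
  assumes "smooth_near A x f" "f x \<noteq> 0" shows "smooth_near A x (\<lambda>x. inverse (f x))"
proof -
  obtain c where c: "c \<in> A" "x \<in> fst c" by (rule chart_at)
  obtain W where W: "open W" "snd c x \<in> W" "W \<subseteq> snd c ` fst c" "smooth_on W (f \<circ> chart_inv c)"
    using assms(1) smooth_near_iff_chart[OF c] by auto
  let ?F = "f \<circ> chart_inv c"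
  let ?V = "W \<inter> ?F -` (- {0})"
  have "continuous_on W ?F" using W(4) unfolding smooth_on_def by (metis Ck_on.simps(1))
  then have V: "open ?V" using W(1) continuous_on_open_vimage[of W ?F] by (metis Int_commute open_delete open_UNIV Compl_eq_Diff_UNIV)
  have "smooth_on ?V (\<lambda>y. inverse (?F y))"
    by (rule smooth_on_compose[OF V _ _ smooth_on_subset[OF W(4)] smooth_on_inverse, of "- {0}"])
      (auto intro: open_delete)
  then show ?thesis unfolding smooth_near_iff_chart[OF c]
    using V W assms(2) c by (intro exI[of _ ?V]) (auto simp: comp_def)
qed

lemma smooth_near_det:
  fixes f :: "'a \<Rightarrow> real ^ 'n ^ 'n::finite"
  assumes "\<And>i j. smooth_near A x (\<lambda>x. f x $ i $ j)" shows "smooth_near A x (\<lambda>x. det (f x))"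
  unfolding det_def
  by (intro smooth_near_sum smooth_near_mult smooth_near_const smooth_near_prod assms)

text \<open>Cramer's rule expresses the inverse by determinants.\<close>

lemma smooth_near_matrix_inv:
  fixes f :: "'a \<Rightarrow> real ^ 'n ^ 'n::finite"
  assumes "\<And>i j. smooth_near A x (\<lambda>x. f x $ i $ j)" "\<forall>\<^sub>F x' in nhds x. invertible (f x')"
  shows "smooth_near A x (\<lambda>x. matrix_inv (f x) $ i $ j)"
proof -
  let ?g = "\<lambda>x. det (\<chi> k l. if l = i then axis j 1 $ k else f x $ k $ l) * inverse (det (f x))"
  have "smooth_near A x ?g"
  proof (intro smooth_near_mult smooth_near_inverse smooth_near_det assms(1))
    show "smooth_near A x (\<lambda>x. (\<chi> k l. if l = i then axis j 1 $ k else f x $ k $ l) $ k $ l)" for k l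
      using assms(1) smooth_near_const by (cases "l = i") auto
    show "det (f x) \<noteq> 0" using assms(2) eventually_nhds_x_imp_x invertible_det_nz by blast
  qed
  moreover have "near x ?g (\<lambda>x. matrix_inv (f x) $ i $ j)"
    unfolding near_def
    using assms(2)
  proof (rule eventually_mono)
    fix y assume i: "invertible (f y)"
    then have "f y *v (matrix_inv (f y) *v axis j 1) = axis j 1"
      by (simp add: matrix_vector_mul_assoc matrix_inv_right)
    then have "matrix_inv (f y) *v axis j 1 = (\<chi> k. det (\<chi> k' l. if l = k then axis j 1 $ k' else f y $ k' $ l) / det (f y))"
      using cramer[of "f y"] i invertible_det_nz[of "f y"] by simp
    then have "(matrix_inv (f y) *v axis j 1) $ i = ?g y"
      by (simp add: divide_inverse)
    then show "?g y = matrix_inv (f y) $ i $ j"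
      by (simp add: matrix_vector_mult_basis column_def)
  qed
  ultimately show ?thesis using smooth_near_cong by blast
qed

lemma smooth_near_coord:
  assumes "c \<in> A" "x \<in> fst c" "bounded_linear L"
  shows "smooth_near A x (\<lambda>x. L (snd c x))"
  unfolding smooth_near_iff_chart[OF assms(1,2)]
proof (intro exI[of _ "snd c ` fst c"] conjI)
  have o: "open (snd c ` fst c)" using assms open_chart_image by blast
  have "smooth_on (snd c ` fst c) L"
    using smooth_on_bounded_linear[OF o assms(3) smooth_on_id[OF o]] by simp
  then show "smooth_on (snd c ` fst c) ((\<lambda>x. L (snd c x)) \<circ> chart_inv c)"
    by (rule smooth_on_cong_imp[OF o, rotated]) (use assms in auto)
qed (use assms open_chart_image in auto)

lemma coord_vec_has_derivative:
  assumes "c \<in> A" "x \<in> fst c" "smooth_near A x f"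
  shows "((f \<circ> chart_inv c) has_derivative (\<lambda>\<xi>. coord_vec A c x \<xi> f)) (at (snd c x))"
  using assms smooth_near_iff_chart[OF assms(1,2), of f] smooth_on_has_derivative
  by (auto simp: coord_vec_def)

lemma coord_vec_eqI:
  assumes "c \<in> A" "x \<in> fst c" "smooth_near A x f"
    and "((f \<circ> chart_inv c) has_derivative f') (at (snd c x))"
  shows "coord_vec A c x \<xi> f = f' \<xi>"
  using has_derivative_unique[OF coord_vec_has_derivative[OF assms(1-3)] assms(4)] by metis

lemma coord_vec_linear:
  assumes "c \<in> A" "x \<in> fst c"
  shows "linear (\<lambda>\<xi>. coord_vec A c x \<xi> f)"
proof (cases "smooth_near A x f")
  case True
  then show ?thesis using has_derivative_linear[OF coord_vec_has_derivative[OF assms]] by blast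
qed (simp add: coord_vec_def linear_iff)

lemma coord_vec_chart_function:
  assumes "c \<in> A" "x \<in> fst c" "bounded_linear L"
  shows "coord_vec A c x \<xi> (\<lambda>x. L (snd c x)) = L \<xi>"
proof (rule coord_vec_eqI[OF assms(1,2) smooth_near_coord[OF assms]])
  have "(L has_derivative L) (at (snd c x))" using assms(3) by (rule bounded_linear_imp_has_derivative)
  then show "((\<lambda>x. L (snd c x)) \<circ> chart_inv c has_derivative L) (at (snd c x))"
    by (rule has_derivative_transform_within_open[OF _ open_chart_image[OF assms(1)]])
      (use assms in auto)
qed

lemma coord_vec_in_tangent_space: "c \<in> A \<Longrightarrow> x \<in> fst c \<Longrightarrow> coord_vec A c x \<xi> \<in> tangent_space A x"
  unfolding tangent_space_def by blast

text \<open>The derivative of the change of coordinates maps the components in one chart to those in another one,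
  by the chain rule.\<close>

lemma tangent_in_chart:
  assumes "w \<in> tangent_space A x" "c \<in> A" "x \<in> fst c"
  obtains \<xi> where "w = coord_vec A c x \<xi>"
proof -
  obtain c' \<zeta> where c': "c' \<in> A" "x \<in> fst c'" and w: "w = coord_vec A c' x \<zeta>"
    using assms(1) by (auto simp: tangent_space_def)
  let ?\<phi> = "snd c \<circ> chart_inv c'"
  let ?\<xi> = "frechet_derivative ?\<phi> (at (snd c' x)) \<zeta>"
  have d\<phi>: "(?\<phi> has_derivative frechet_derivative ?\<phi> (at (snd c' x))) (at (snd c' x))"
    using smooth_on_has_derivative[OF chart_transition[OF c'(1) assms(2)]] c' assms by blast
  have "coord_vec A c' x \<zeta> f = coord_vec A c x ?\<xi> f" for f
  proof (cases "smooth_near A x f")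
    case True
    have "((f \<circ> chart_inv c) has_derivative (\<lambda>\<xi>. coord_vec A c x \<xi> f)) (at (?\<phi> (snd c' x)))"
      using coord_vec_has_derivative[OF assms(2,3) True] c' by simp
    from has_derivative_compose[OF d\<phi> this]
    have "((f \<circ> chart_inv c') has_derivative (\<lambda>\<zeta>. coord_vec A c x (frechet_derivative ?\<phi> (at (snd c' x)) \<zeta>) f)) (at (snd c' x))"
      by (rule has_derivative_transform_within_open[OF _ open_chart_image_Int[OF c'(1) open_chart_dom[OF assms(2)]]])
        (use c' assms in auto)
    then show ?thesis using coord_vec_eqI[OF c' True] by blast
  qed (simp add: coord_vec_def)
  then show ?thesis using that w by blast
qed

lemma tangent_nonsmooth: "w \<in> tangent_space A x \<Longrightarrow> \<not> smooth_near A x f \<Longrightarrow> w f = 0"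
  by (auto simp: tangent_space_def coord_vec_def)

lemma near_sym: "near x f g \<Longrightarrow> near x g f"
  by (simp add: near_def eq_commute)

lemma smooth_near_cong_iff: "near x f g \<Longrightarrow> smooth_near A x f \<longleftrightarrow> smooth_near A x g"
  using smooth_near_cong near_sym by blast

lemma tangent_cong:
  assumes "w \<in> tangent_space A x" "near x f g" shows "w f = w g"
proof (cases "smooth_near A x f")
  case f: True
  then have g: "smooth_near A x g" using assms smooth_near_cong by blast
  obtain c where c: "c \<in> A" "x \<in> fst c" by (rule chart_at)
  obtain \<xi> where w: "w = coord_vec A c x \<xi>" using tangent_in_chart assms(1) c by metis
  obtain V where V: "open V" "x \<in> V" "\<And>x. x \<in> V \<Longrightarrow> f x = g x"
    using assms(2) unfolding near_def eventually_nhds by blast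
  have "((g \<circ> chart_inv c) has_derivative (\<lambda>\<xi>. coord_vec A c x \<xi> f)) (at (snd c x))"
    by (rule has_derivative_transform_within_open[OF coord_vec_has_derivative[OF c f]
          open_chart_image_Int[OF c(1) V(1)]]) (use c V in auto)
  then show ?thesis using coord_vec_eqI[OF c g] w by simp
next
  case False
  then have "\<not> smooth_near A x g" using assms smooth_near_cong near_sym by blast
  then show ?thesis using False assms tangent_nonsmooth by metis
qed

lemma tangent_bilinear:
  assumes "w \<in> tangent_space A x" "smooth_near A x f" "smooth_near A x g"
  shows tangent_add: "w (\<lambda>x. f x + g x) = w f + w g"
    and tangent_mult: "w (\<lambda>x. f x * g x) = f x * w g + w f * g x"
proof -
  obtain c where c: "c \<in> A" "x \<in> fst c" by (rule chart_at)
  obtain \<xi> where w: "w = coord_vec A c x \<xi>" using tangent_in_chart assms(1) c by metis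
  note d = coord_vec_has_derivative[OF c assms(2)] coord_vec_has_derivative[OF c assms(3)]
  show "w (\<lambda>x. f x + g x) = w f + w g"
    unfolding w
    by (rule coord_vec_eqI[OF c smooth_near_add[OF assms(2,3)]])
      (use has_derivative_add[OF d] in \<open>simp add: comp_def\<close>)
  show "w (\<lambda>x. f x * g x) = f x * w g + w f * g x"
    unfolding w
    by (rule coord_vec_eqI[OF c smooth_near_mult[OF assms(2,3)]])
      (use has_derivative_mult[OF d] c in \<open>simp add: comp_def\<close>)
qed

lemma tangent_const:
  assumes "w \<in> tangent_space A x" shows "w (\<lambda>_. k) = 0"
proof -
  obtain c where c: "c \<in> A" "x \<in> fst c" by (rule chart_at)
  obtain \<xi> where w: "w = coord_vec A c x \<xi>" using tangent_in_chart assms(1) c by metis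
  show ?thesis unfolding w
    by (rule coord_vec_eqI[OF c smooth_near_const, where f' = "\<lambda>_. 0"]) (simp add: comp_def)
qed

lemma tangent_cmult:
  assumes "w \<in> tangent_space A x" "smooth_near A x f"
  shows "w (\<lambda>x. k * f x) = k * w f"
  using tangent_mult[OF assms(1) smooth_near_const assms(2)] tangent_const[OF assms(1)] by simp

lemma tangent_sum:
  assumes "w \<in> tangent_space A x" "\<And>i. i \<in> I \<Longrightarrow> smooth_near A x (f i)"
  shows "w (\<lambda>x. \<Sum>i\<in>I. f i x) = (\<Sum>i\<in>I. w (f i))"
  using assms(2)
proof (induction I rule: infinite_finite_induct)
  case (insert i I)
  then show ?case using tangent_add[OF assms(1), of "f i" "\<lambda>x. \<Sum>i\<in>I. f i x"]
    by (simp add: smooth_near_sum)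
qed (simp_all add: tangent_const[OF assms(1)])

lemma smooth_near_coord_vec:
  assumes "c \<in> A" "x \<in> fst c" "smooth_near A x f"
  shows "smooth_near A x (\<lambda>x'. coord_vec A c x' \<xi> f)"
proof -
  obtain W where W: "open W" "snd c x \<in> W" "W \<subseteq> snd c ` fst c" "smooth_on W (f \<circ> chart_inv c)"
    using assms smooth_near_iff_chart[OF assms(1,2)] by auto
  have "smooth_on W ((\<lambda>x'. coord_vec A c x' \<xi> f) \<circ> chart_inv c)"
  proof (rule smooth_on_cong_imp[OF W(1) _ smooth_on_frechet_derivative[OF W(4), of \<xi>]])
    fix y assume y: "y \<in> W"
    then have "y \<in> snd c ` fst c" using W by auto
    then have i: "chart_inv c y \<in> fst c" "snd c (chart_inv c y) = y" using assms(1) chart_inv_right by auto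
    then have "smooth_near A (chart_inv c y) f"
      using y W smooth_near_iff_chart[OF assms(1) i(1)] by auto
    then show "frechet_derivative (f \<circ> chart_inv c) (at y) \<xi> = ((\<lambda>x'. coord_vec A c x' \<xi> f) \<circ> chart_inv c) y"
      using i by (simp add: coord_vec_def)
  qed
  then show ?thesis using W smooth_near_iff_chart[OF assms(1,2)] by blast
qed

lemma tangent_space_add:
  assumes "w \<in> tangent_space A x" "w' \<in> tangent_space A x"
  shows "(\<lambda>f. w f + w' f) \<in> tangent_space A x"
proof -
  obtain c where c: "c \<in> A" "x \<in> fst c" by (rule chart_at)
  obtain \<xi> \<xi>' where "w = coord_vec A c x \<xi>" "w' = coord_vec A c x \<xi>'"
    using tangent_in_chart assms c by metis
  then have "(\<lambda>f. w f + w' f) = coord_vec A c x (\<xi> + \<xi>')"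
    by (intro ext) (simp add: linear_add[OF coord_vec_linear[OF c]])
  then show ?thesis using coord_vec_in_tangent_space c by simp
qed

lemma tangent_space_scale:
  assumes "w \<in> tangent_space A x" shows "(\<lambda>f. k * w f) \<in> tangent_space A x"
proof -
  obtain c where c: "c \<in> A" "x \<in> fst c" by (rule chart_at)
  obtain \<xi> where "w = coord_vec A c x \<xi>" using tangent_in_chart assms c by metis
  then have "(\<lambda>f. k * w f) = coord_vec A c x (k *\<^sub>R \<xi>)"
    by (intro ext) (simp add: linear_scale[OF coord_vec_linear[OF c]])
  then show ?thesis using coord_vec_in_tangent_space c by simp
qed

lemma tangent_space_zero: "(\<lambda>f. 0) \<in> tangent_space A x"
proof -
  obtain c where c: "c \<in> A" "x \<in> fst c" by (rule chart_at)
  show ?thesis using tangent_space_scale[OF coord_vec_in_tangent_space[OF c], of 0 0] by simp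
qed

end

lemma smooth_near_compose_map:
  assumes "smooth_atlas A" "smooth_atlas B" "smooth_map A B \<phi>" "smooth_near B (\<phi> x) f"
  shows "smooth_near A x (\<lambda>x. f (\<phi> x))"
proof -
  interpret A: smooth_atlas A by fact
  interpret B: smooth_atlas B by fact
  obtain c where c: "c \<in> A" "x \<in> fst c" by (rule A.chart_at)
  obtain d where d: "d \<in> B" "\<phi> x \<in> fst d" by (rule B.chart_at)
  obtain W where W: "open W" "snd d (\<phi> x) \<in> W" "W \<subseteq> snd d ` fst d" "smooth_on W (f \<circ> chart_inv d)"
    using assms(4) B.smooth_near_iff_chart[OF d] by auto
  let ?V = "{y \<in> fst d. snd d y \<in> W}"
  let ?U = "snd c ` (fst c \<inter> \<phi> -` ?V)"
  have "open (\<phi> -` ?V)"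
    using assms(3) open_vimage[OF B.open_chart_vimage[OF d(1) W(1)], of \<phi>]
    unfolding smooth_map_def by blast
  then have U: "open ?U" using A.open_chart_image_Int c by blast
  have "smooth_on ?U (\<lambda>y. (f \<circ> chart_inv d) ((snd d \<circ> \<phi> \<circ> chart_inv c) y))"
  proof (rule smooth_on_compose[OF U W(1) _ _ W(4)])
    have "smooth_on (snd c ` (fst c \<inter> \<phi> -` fst d)) (snd d \<circ> \<phi> \<circ> chart_inv c)"
      using assms(3) c d by (auto simp: smooth_map_def)
    then show "smooth_on ?U (snd d \<circ> \<phi> \<circ> chart_inv c)"
      by (rule smooth_on_subset) auto
  qed (use c in auto)
  then have "smooth_on ?U ((\<lambda>x. f (\<phi> x)) \<circ> chart_inv c)"
    by (rule smooth_on_cong_imp[OF U, rotated]) (use c d in auto)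
  then show ?thesis unfolding A.smooth_near_iff_chart[OF c]
    using U c d W by (intro exI[of _ ?U]) auto
qed

text \<open>A bump function in a chart is extended by \<open>0\<close>. The extension is smooth outside the chart because its
  support is compact and hence closed in a Hausdorff space.\<close>

lemma bump_function_exists:
  fixes A :: "('a::t2_space, 'v::euclidean_space) atlas"
  assumes "smooth_atlas A" "open U" "x \<in> U"
  obtains f K where "f \<in> smooth_functions A" "near x f (\<lambda>_. 1)"
    "closed K" "K \<subseteq> U" "\<And>x'. x' \<notin> K \<Longrightarrow> f x' = 0"
proof -
  interpret smooth_atlas A by fact
  obtain c where c: "c \<in> A" "x \<in> fst c" by (rule chart_at)
  have "open (snd c ` (fst c \<inter> U))" "snd c x \<in> snd c ` (fst c \<inter> U)"
    using assms c open_chart_image_Int by auto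
  then obtain r where r: "r > 0" "cball (snd c x) r \<subseteq> snd c ` (fst c \<inter> U)"
    by (meson open_contains_cball)
  obtain \<psi> :: "'v \<Rightarrow> real" where \<psi>: "smooth_on UNIV \<psi>"
    "\<And>y. dist (snd c x) y \<le> r / 2 \<Longrightarrow> \<psi> y = 1" "\<And>y. r \<le> dist (snd c x) y \<Longrightarrow> \<psi> y = 0"
    using smooth_bump_exists[OF r(1)] by metis
  define f where "f x' = (if x' \<in> fst c then \<psi> (snd c x') else 0)" for x'
  define K where "K = chart_inv c ` cball (snd c x) r"
  have "continuous_on (cball (snd c x) r) (chart_inv c)"
    using chart_homeomorphism[OF c(1)] r(2) by (meson homeomorphism_def continuous_on_subset image_mono inf_le1 subset_trans)
  then have K: "closed K" unfolding K_def by (intro compact_imp_closed compact_continuous_image) auto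
  have KU: "K \<subseteq> U" using r(2) c by (force simp: K_def)
  have f0: "f x' = 0" if "x' \<notin> K" for x'
  proof (cases "x' \<in> fst c")
    case True
    then have "snd c x' \<notin> cball (snd c x) r" using that c unfolding K_def by (metis chart_inv_left image_eqI)
    then show ?thesis using True \<psi>(3)[of "snd c x'"] by (simp add: f_def)
  qed (simp add: f_def)
  have "smooth_near A x' f" for x'
  proof (cases "x' \<in> fst c")
    case True
    have "smooth_on (snd c ` fst c) (f \<circ> chart_inv c)"
      by (rule smooth_on_cong_imp[OF open_chart_image[OF c(1)] _ smooth_on_subset[OF \<psi>(1)]])
        (use c in \<open>auto simp: f_def\<close>)
    then show ?thesis using smooth_near_iff_chart[OF c(1) True] open_chart_image[OF c(1)] True by blast
  next
    case False
    then have "x' \<in> - K" using r(2) c unfolding K_def by auto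
    then have "near x' (\<lambda>_. 0) f" unfolding near_def eventually_nhds
      using K f0 by (intro exI[of _ "- K"]) auto
    then show ?thesis using smooth_near_cong smooth_near_const by blast
  qed
  then have "f \<in> smooth_functions A" by (simp add: smooth_functions_def msmooth_on_iff)
  moreover have "near x f (\<lambda>_. 1)"
    unfolding near_def eventually_nhds
    using open_chart_vimage[OF c(1) open_ball, of "snd c x" "r/2"] c r(1) \<psi>(2)
    by (intro exI[of _ "{x' \<in> fst c. snd c x' \<in> ball (snd c x) (r/2)}"]) (auto simp: f_def)
  ultimately show ?thesis using that K KU f0 by blast
qed

section \<open>Vector bundles\<close>

locale vec_bundle = smooth_atlas A
  for A :: "('a::topological_space, 'v::euclidean_space) atlas" +
  fixes B :: "('a, 'e::topological_space, 'r::finite) vbundle"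
  assumes vb: "vector_bundle A B"
begin

lemma triv_at: obtains t where "t \<in> trivs B" "x \<in> fst t"
  using vb unfolding vector_bundle_def by (metis UN_E UNIV_I)

lemma open_triv: "t \<in> trivs B \<Longrightarrow> open (fst t)"
  using vb by (auto simp: vector_bundle_def)

lemma triv_homeomorphism:
  "t \<in> trivs B \<Longrightarrow> \<exists>g. homeomorphism (proj B -` fst t) (fst t \<times> UNIV) (\<lambda>e. (proj B e, snd t e)) g"
  using vb by (auto simp: vector_bundle_def)

lemma fibre_coord_inj:
  assumes "t \<in> trivs B" "proj B e \<in> fst t" "proj B e = proj B e'" "snd t e = snd t e'"
  shows "e = e'"
proof -
  obtain g where g: "homeomorphism (proj B -` fst t) (fst t \<times> UNIV) (\<lambda>e. (proj B e, snd t e)) g"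
    using triv_homeomorphism[OF assms(1)] by blast
  have "proj B e' \<in> fst t" using assms by simp
  then have "g (proj B e, snd t e) = e" "g (proj B e', snd t e') = e'"
    using g assms(2) by (auto simp: homeomorphism_def)
  then show ?thesis using assms(3,4) by metis
qed

lemma fib_elt:
  assumes "t \<in> trivs B" "x \<in> fst t"
  shows proj_fib_elt: "proj B (fib_elt B t x \<xi>) = x" and coord_fib_elt: "snd t (fib_elt B t x \<xi>) = \<xi>"
proof -
  obtain g where g: "homeomorphism (proj B -` fst t) (fst t \<times> UNIV) (\<lambda>e. (proj B e, snd t e)) g"
    using triv_homeomorphism[OF assms(1)] by blast
  have "\<exists>!e. proj B e = x \<and> snd t e = \<xi>"
  proof (rule ex1I)
    have *: "\<And>p. p \<in> fst t \<times> UNIV \<Longrightarrow> (proj B (g p), snd t (g p)) = p"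
      using g by (auto simp: homeomorphism_def)
    show "proj B (g (x, \<xi>)) = x \<and> snd t (g (x, \<xi>)) = \<xi>"
      using *[of "(x, \<xi>)"] assms(2) by simp
    then show "e = g (x, \<xi>)" if "proj B e = x \<and> snd t e = \<xi>" for e
      using that fibre_coord_inj[OF assms(1)] assms(2) by metis
  qed
  then have "proj B (fib_elt B t x \<xi>) = x \<and> snd t (fib_elt B t x \<xi>) = \<xi>"
    unfolding fib_elt_def by (rule theI')
  then show "proj B (fib_elt B t x \<xi>) = x" "snd t (fib_elt B t x \<xi>) = \<xi>" by auto
qed

lemma fib_elt_coord:
  "t \<in> trivs B \<Longrightarrow> proj B e \<in> fst t \<Longrightarrow> fib_elt B t (proj B e) (snd t e) = e"
  using fibre_coord_inj fib_elt by metis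

definition trans_mat :: "('a, 'e, 'r) triv \<Rightarrow> ('a, 'e, 'r) triv \<Rightarrow> 'a \<Rightarrow> real ^ 'r ^ 'r" where
  "trans_mat t t' x = matrix (\<lambda>\<xi>. snd t' (fib_elt B t x \<xi>))"

lemma trans_mat_cases:
  assumes "t \<in> trivs B" "t' \<in> trivs B"
  obtains \<Lambda> where "msmooth_on A (fst t \<inter> fst t') \<Lambda>" "\<And>x. x \<in> fst t \<inter> fst t' \<Longrightarrow> trans_mat t t' x = \<Lambda> x"
    "\<And>e. proj B e \<in> fst t \<inter> fst t' \<Longrightarrow> snd t' e = \<Lambda> (proj B e) *v snd t e"
proof -
  obtain \<Lambda> :: "'a \<Rightarrow> real ^ 'r ^ 'r" where \<Lambda>: "msmooth_on A (fst t \<inter> fst t') \<Lambda>"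
    "\<And>e. proj B e \<in> fst t \<inter> fst t' \<Longrightarrow> snd t' e = \<Lambda> (proj B e) *v snd t e"
    using vb assms unfolding vector_bundle_def by (metis (no_types, lifting))
  have "trans_mat t t' x = \<Lambda> x" if "x \<in> fst t \<inter> fst t'" for x
  proof -
    have "snd t' (fib_elt B t x \<xi>) = \<Lambda> x *v \<xi>" for \<xi>
      using \<Lambda>(2)[of "fib_elt B t x \<xi>"] that fib_elt[OF assms(1)] by auto
    then show ?thesis by (simp add: trans_mat_def)
  qed
  then show ?thesis using that \<Lambda> by blast
qed

lemma trans_mat:
  assumes "t \<in> trivs B" "t' \<in> trivs B" "proj B e \<in> fst t" "proj B e \<in> fst t'"
  shows "snd t' e = trans_mat t t' (proj B e) *v snd t e"
  by (rule trans_mat_cases[OF assms(1,2)]) (use assms in auto)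

lemma trans_mat_fib_elt:
  assumes "t \<in> trivs B" "t' \<in> trivs B" "x \<in> fst t" "x \<in> fst t'"
  shows "snd t' (fib_elt B t x \<xi>) = trans_mat t t' x *v \<xi>"
  using trans_mat[of t t' "fib_elt B t x \<xi>"] assms fib_elt by simp

lemma trans_mat_inverse:
  assumes "t \<in> trivs B" "t' \<in> trivs B" "x \<in> fst t" "x \<in> fst t'"
  shows "trans_mat t' t x ** trans_mat t t' x = mat 1"
proof -
  have "(trans_mat t' t x ** trans_mat t t' x) *v \<xi> = mat 1 *v \<xi>" for \<xi>
    using trans_mat[of t' t "fib_elt B t x \<xi>"] trans_mat_fib_elt[OF assms] assms fib_elt
    by (simp add: matrix_vector_mul_assoc[symmetric])
  then show ?thesis by (simp add: matrix_eq)
qed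

lemma trans_mat_smooth:
  assumes "t \<in> trivs B" "t' \<in> trivs B" "x \<in> fst t" "x \<in> fst t'"
  shows "smooth_near A x (\<lambda>x. trans_mat t t' x $ i $ j)"
proof (rule trans_mat_cases[OF assms(1,2)])
  fix \<Lambda> assume \<Lambda>: "msmooth_on A (fst t \<inter> fst t') \<Lambda>" "\<And>x. x \<in> fst t \<inter> fst t' \<Longrightarrow> trans_mat t t' x = \<Lambda> x"
  have o: "open (fst t \<inter> fst t')" by (intro open_Int open_triv assms)
  then have "smooth_near A x \<Lambda>" using \<Lambda> assms msmooth_on_iff by blast
  moreover have "near x \<Lambda> (trans_mat t t')"
    unfolding near_def eventually_nhds using o \<Lambda>(2) assms by (intro exI[of _ "fst t \<inter> fst t'"]) auto
  ultimately show ?thesis by (intro smooth_near_vecD) (rule smooth_near_cong)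
qed

text \<open>The transitions are linear, so that a sum formed in one trivialization is the sum in all of them.\<close>

lemma fib_add:
  assumes "proj B e = proj B e'"
  shows proj_fib_add: "proj B (fib_add B e e') = proj B e"
    and coord_fib_add: "t \<in> trivs B \<Longrightarrow> proj B e \<in> fst t \<Longrightarrow> snd t (fib_add B e e') = snd t e + snd t e'"
proof -
  obtain s where s: "s \<in> trivs B" "proj B e \<in> fst s" by (rule triv_at)
  let ?P = "\<lambda>e''. proj B e'' = proj B e \<and> (\<forall>t\<in>trivs B. proj B e \<in> fst t \<longrightarrow> snd t e'' = snd t e + snd t e')"
  have "\<exists>!e''. ?P e''"
  proof (rule ex1I)
    let ?e = "fib_elt B s (proj B e) (snd s e + snd s e')"
    have "snd t ?e = snd t e + snd t e'" if "t \<in> trivs B" "proj B e \<in> fst t" for t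
      using trans_mat_fib_elt[OF s(1) that(1) s(2) that(2)] trans_mat[OF s(1) that(1), of e]
        trans_mat[OF s(1) that(1), of e'] s that assms
      by (simp add: matrix_vector_right_distrib)
    then show *: "?P ?e" using fib_elt s by auto
    fix e'' assume "?P e''"
    then show "e'' = ?e" using * s fibre_coord_inj[OF s(1), of e'' ?e] by metis
  qed
  then have *: "?P (fib_add B e e')" unfolding fib_add_def by (rule theI')
  then show "proj B (fib_add B e e') = proj B e" by blast
  show "snd t (fib_add B e e') = snd t e + snd t e'" if "t \<in> trivs B" "proj B e \<in> fst t"
    using * that by blast
qed

lemma fib_scale:
  shows proj_fib_scale: "proj B (fib_scale B k e) = proj B e"
    and coord_fib_scale: "t \<in> trivs B \<Longrightarrow> proj B e \<in> fst t \<Longrightarrow> snd t (fib_scale B k e) = k *\<^sub>R snd t e"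
proof -
  obtain s where s: "s \<in> trivs B" "proj B e \<in> fst s" by (rule triv_at)
  let ?P = "\<lambda>e''. proj B e'' = proj B e \<and> (\<forall>t\<in>trivs B. proj B e \<in> fst t \<longrightarrow> snd t e'' = k *\<^sub>R snd t e)"
  have "\<exists>!e''. ?P e''"
  proof (rule ex1I)
    let ?e = "fib_elt B s (proj B e) (k *\<^sub>R snd s e)"
    have "snd t ?e = k *\<^sub>R snd t e" if "t \<in> trivs B" "proj B e \<in> fst t" for t
      using trans_mat_fib_elt[OF s(1) that(1) s(2) that(2)] trans_mat[OF s(1) that(1), of e] s that
      by (simp add: matrix_vector_mult_scaleR)
    then show *: "?P ?e" using fib_elt s by auto
    fix e'' assume "?P e''"
    then show "e'' = ?e" using * s fibre_coord_inj[OF s(1), of e'' ?e] by metis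
  qed
  then have *: "?P (fib_scale B k e)" unfolding fib_scale_def by (rule theI')
  then show "proj B (fib_scale B k e) = proj B e" by blast
  show "snd t (fib_scale B k e) = k *\<^sub>R snd t e" if "t \<in> trivs B" "proj B e \<in> fst t"
    using * that by blast
qed

lemma fib_add_elt:
  assumes "t \<in> trivs B" "x \<in> fst t"
  shows "fib_add B (fib_elt B t x \<xi>) (fib_elt B t x \<zeta>) = fib_elt B t x (\<xi> + \<zeta>)"
  by (rule fibre_coord_inj[OF assms(1)]) (use assms fib_elt fib_add in simp_all)

lemma fib_scale_elt:
  assumes "t \<in> trivs B" "x \<in> fst t"
  shows "fib_scale B k (fib_elt B t x \<xi>) = fib_elt B t x (k *\<^sub>R \<xi>)"
  by (rule fibre_coord_inj[OF assms(1)]) (use assms fib_elt fib_scale in simp_all)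

lemma vb_sections_proj: "u \<in> vb_sections A B \<Longrightarrow> proj B (u x) = x"
  by (auto simp: vb_sections_def)

lemma vb_sections_smooth:
  assumes "u \<in> vb_sections A B" "t \<in> trivs B" "x \<in> fst t"
  shows "smooth_near A x (\<lambda>x. snd t (u x))"
  using assms msmooth_on_iff[OF open_triv[OF assms(2)]] unfolding vb_sections_def comp_def by blast

text \<open>By smoothness of the transition matrices one trivialization around each point suffices.\<close>

lemma vb_sectionsI:
  assumes p: "\<And>x. proj B (u x) = x"
    and s: "\<And>x. \<exists>t\<in>trivs B. x \<in> fst t \<and> smooth_near A x (\<lambda>x. snd t (u x))"
  shows "u \<in> vb_sections A B"
proof -
  have "smooth_near A x (\<lambda>x. snd t (u x))" if t: "t \<in> trivs B" "x \<in> fst t" for t x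
  proof -
    obtain t' where t': "t' \<in> trivs B" "x \<in> fst t'" "smooth_near A x (\<lambda>x. snd t' (u x))" using s by blast
    have "smooth_near A x (\<lambda>x. \<chi> i. \<Sum>j\<in>UNIV. trans_mat t' t x $ i $ j * snd t' (u x) $ j)"
      by (intro smooth_near_vecI)
        (simp, intro smooth_near_sum smooth_near_mult trans_mat_smooth smooth_near_vecD t t')
    moreover have "near x (\<lambda>x. \<chi> i. \<Sum>j\<in>UNIV. trans_mat t' t x $ i $ j * snd t' (u x) $ j) (\<lambda>x. snd t (u x))"
      unfolding near_def eventually_nhds
    proof (intro exI[of _ "fst t \<inter> fst t'"] conjI ballI)
      show "(\<chi> i. \<Sum>j\<in>UNIV. trans_mat t' t x $ i $ j * snd t' (u x) $ j) = snd t (u x)"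
        if "x \<in> fst t \<inter> fst t'" for x
        using trans_mat[OF t'(1) t(1), of "u x"] that p by (simp add: matrix_vector_mult_def)
    qed (use open_Int[OF open_triv[OF t(1)] open_triv[OF t'(1)]] t t' in blast)+
    ultimately show ?thesis using smooth_near_cong by blast
  qed
  then have "msmooth_on A (fst t) (\<lambda>x. snd t (u x))" if "t \<in> trivs B" for t
    using that msmooth_on_iff[OF open_triv[OF that]] by blast
  then show ?thesis using p unfolding vb_sections_def comp_def by blast
qed

lemma sec_add_section:
  assumes "u \<in> vb_sections A B" "w \<in> vb_sections A B" shows "sec_add B u w \<in> vb_sections A B"
proof (rule vb_sectionsI)
  have p: "proj B (u x) = proj B (w x)" for x using assms vb_sections_proj by metis
  show "proj B (sec_add B u w x) = x" for x using proj_fib_add[OF p] vb_sections_proj[OF assms(1)] by (simp add: sec_add_def)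
  fix x
  obtain t where t: "t \<in> trivs B" "x \<in> fst t" by (rule triv_at)
  have "near x (\<lambda>x. snd t (u x) + snd t (w x)) (\<lambda>x. snd t (sec_add B u w x))"
    unfolding near_def eventually_nhds sec_add_def
    using t open_triv coord_fib_add[OF p] vb_sections_proj[OF assms(1)] by (intro exI[of _ "fst t"]) auto
  then have "smooth_near A x (\<lambda>x. snd t (sec_add B u w x))"
    using smooth_near_cong smooth_near_add vb_sections_smooth assms t by blast
  then show "\<exists>t\<in>trivs B. x \<in> fst t \<and> smooth_near A x (\<lambda>x. snd t (sec_add B u w x))" using t by blast
qed

lemma sec_scale_section:
  assumes "u \<in> vb_sections A B" "f \<in> smooth_functions A" shows "sec_scale B f u \<in> vb_sections A B"
proof (rule vb_sectionsI)
  show "proj B (sec_scale B f u x) = x" for x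
    using proj_fib_scale vb_sections_proj[OF assms(1)] by (simp add: sec_scale_def)
  fix x
  obtain t where t: "t \<in> trivs B" "x \<in> fst t" by (rule triv_at)
  have "near x (\<lambda>x. f x *\<^sub>R snd t (u x)) (\<lambda>x. snd t (sec_scale B f u x))"
    unfolding near_def eventually_nhds sec_scale_def
    using t open_triv coord_fib_scale vb_sections_proj[OF assms(1)] by (intro exI[of _ "fst t"]) auto
  moreover have "smooth_near A x f" using assms(2) msmooth_on_iff[OF open_UNIV] by (auto simp: smooth_functions_def)
  ultimately have "smooth_near A x (\<lambda>x. snd t (sec_scale B f u x))"
    using smooth_near_cong smooth_near_bilinear[OF bounded_bilinear_scaleR] vb_sections_smooth assms t by blast
  then show "\<exists>t\<in>trivs B. x \<in> fst t \<and> smooth_near A x (\<lambda>x. snd t (sec_scale B f u x))" using t by blast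
qed

end

lemma const_smooth_function: "(\<lambda>_. k) \<in> smooth_functions A"
  by (auto simp: smooth_functions_def msmooth_on_def comp_def smooth_on_const)

text \<open>The local section with constant coordinates is multiplied by a bump function and extended by the zero
  section.\<close>

lemma frame_section_exists:
  fixes A :: "('a::t2_space, 'v::euclidean_space) atlas"
    and B :: "('a, 'e::topological_space, 'r::finite) vbundle"
  assumes "vec_bundle A B" "t \<in> trivs B" "x \<in> fst t"
  obtains u where "u \<in> vb_sections A B" "near x u (\<lambda>x'. fib_elt B t x' \<xi>)"
proof -
  interpret vec_bundle A B by fact
  obtain f K where f: "f \<in> smooth_functions A" "near x f (\<lambda>_. 1)" "closed K" "K \<subseteq> fst t"
    "\<And>x'. x' \<notin> K \<Longrightarrow> f x' = 0"
    using bump_function_exists[OF smooth_atlas_axioms open_triv[OF assms(2)] assms(3)] by blast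
  \<comment> \<open>the zero section\<close>
  define z where "z x' = fib_elt B (SOME t. t \<in> trivs B \<and> x' \<in> fst t) x' 0" for x'
  have z: "proj B (z x') = x'" "s \<in> trivs B \<Longrightarrow> x' \<in> fst s \<Longrightarrow> snd s (z x') = 0" for x' s
  proof -
    have *: "(SOME t. t \<in> trivs B \<and> x' \<in> fst t) \<in> trivs B \<and> x' \<in> fst (SOME t. t \<in> trivs B \<and> x' \<in> fst t)"
      by (rule someI_ex) (use triv_at in blast)
    then show "proj B (z x') = x'" unfolding z_def using fib_elt by blast
    show "snd s (z x') = 0" if "s \<in> trivs B" "x' \<in> fst s"
      unfolding z_def using * that trans_mat_fib_elt by simp
  qed
  define u where "u x' = (if x' \<in> fst t then fib_elt B t x' (f x' *\<^sub>R \<xi>) else z x')" for x'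
  have up: "proj B (u x') = x'" for x' using fib_elt[OF assms(2)] z by (auto simp: u_def)
  have "u \<in> vb_sections A B"
  proof (rule vb_sectionsI[OF up])
    fix x'
    obtain s where s: "s \<in> trivs B" "x' \<in> fst s" by (rule triv_at)
    show "\<exists>t\<in>trivs B. x' \<in> fst t \<and> smooth_near A x' (\<lambda>x. snd t (u x))"
    proof (cases "x' \<in> fst t")
      case True
      have "smooth_near A x' f" using f(1) msmooth_on_iff[OF open_UNIV] by (auto simp: smooth_functions_def)
      then have "smooth_near A x' (\<lambda>x'. f x' *\<^sub>R \<xi>)"
        by (rule smooth_near_bounded_linear[OF bounded_linear_scaleR_left])
      moreover have "near x' (\<lambda>x'. f x' *\<^sub>R \<xi>) (\<lambda>x. snd t (u x))"
        unfolding near_def eventually_nhds using True open_triv assms coord_fib_elt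
        by (intro exI[of _ "fst t"]) (auto simp: u_def)
      ultimately show ?thesis using smooth_near_cong True assms by blast
    next
      case False
      have "near x' (\<lambda>_. 0) (\<lambda>x. snd s (u x))"
        unfolding near_def eventually_nhds
      proof (intro exI[of _ "fst s \<inter> - K"] conjI ballI)
        show "open (fst s \<inter> - K)" by (intro open_Int open_triv s open_Compl f(3))
        show "0 = snd s (u y)" if "y \<in> fst s \<inter> - K" for y
          using that f(5) z s trans_mat_fib_elt[OF assms(2) s(1)] by (auto simp: u_def)
      qed (use s f False in auto)
      then show ?thesis using s smooth_near_cong[OF _ smooth_near_const] by blast
    qed
  qed
  moreover have "near x u (\<lambda>x'. fib_elt B t x' \<xi>)"
  proof -
    have "\<forall>\<^sub>F x' in nhds x. x' \<in> fst t" using assms open_triv eventually_nhds_in_open by blast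
    with f(2)[unfolded near_def] show ?thesis unfolding near_def
      by eventually_elim (simp add: u_def)
  qed
  ultimately show ?thesis using that by blast
qed

section \<open>The anchor and the bracket in local frames\<close>

locale gte =
  fixes S :: "('a::{t2_space, second_countable_topology}, 'b::{t2_space, second_countable_topology},
    'm::finite, 'f::topological_space, 'p::finite, 'e::topological_space, 'r::finite) gte_data"
  assumes setting: "gte_setting S"
begin

abbreviation h where "h \<equiv> hmap S"
abbreviation \<eta> where "\<eta> \<equiv> etamap S"
abbreviation \<rho> where "\<rho> \<equiv> rhomap S"
abbreviation \<Gamma>F where "\<Gamma>F \<equiv> vb_sections (atlasN S) (bundleF S)"
abbreviation CN where "CN \<equiv> smooth_functions (atlasN S)"
abbreviation \<pi> where "\<pi> \<equiv> proj (bundleE S)"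
abbreviation \<tau> where "\<tau> \<equiv> \<lambda>t \<alpha>. frame_sec (bundleF S) t \<alpha>"

lemma setting_unfolded:
  "manifold (atlasM S)" "manifold (atlasN S)"
  "diffeomorphism (atlasM S) (atlasN S) h" "diffeomorphism (atlasN S) (atlasM S) \<eta>"
  "vector_bundle (atlasN S) (bundleF S)" "vector_bundle (atlasM S) (bundleE S)"
  "rho_morphism S" "rho_eta_connection S"
  using setting unfolding gte_setting_def generalized_lie_algebroid_def Let_def by blast+

sublocale M: vec_bundle "atlasM S" "bundleE S"
  by (intro vec_bundle.intro manifold_smooth_atlas vec_bundle_axioms.intro setting_unfolded)

sublocale N: vec_bundle "atlasN S" "bundleF S"
  by (intro vec_bundle.intro manifold_smooth_atlas vec_bundle_axioms.intro setting_unfolded)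

lemma bracket_section:
  "u \<in> \<Gamma>F \<Longrightarrow> v \<in> \<Gamma>F \<Longrightarrow> bracket S u v \<in> \<Gamma>F"
  using setting unfolding gte_setting_def generalized_lie_algebroid_def Let_def by metis

lemma bracket_add:
  "u \<in> \<Gamma>F \<Longrightarrow> v \<in> \<Gamma>F \<Longrightarrow> w \<in> \<Gamma>F \<Longrightarrow>
    bracket S u (sec_add (bundleF S) v w) = sec_add (bundleF S) (bracket S u v) (bracket S u w)"
  using setting unfolding gte_setting_def generalized_lie_algebroid_def Let_def by metis

lemma bracket_cmult:
  "u \<in> \<Gamma>F \<Longrightarrow> v \<in> \<Gamma>F \<Longrightarrow>
    bracket S u (sec_scale (bundleF S) (\<lambda>_. k) v) = sec_scale (bundleF S) (\<lambda>_. k) (bracket S u v)"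
  using setting unfolding gte_setting_def generalized_lie_algebroid_def Let_def by metis

lemma bracket_swap:
  "u \<in> \<Gamma>F \<Longrightarrow> v \<in> \<Gamma>F \<Longrightarrow> bracket S u v = sec_scale (bundleF S) (\<lambda>_. -1) (bracket S v u)"
  using setting unfolding gte_setting_def generalized_lie_algebroid_def Let_def by metis

lemma bracket_scale:
  "u \<in> \<Gamma>F \<Longrightarrow> v \<in> \<Gamma>F \<Longrightarrow> f \<in> CN \<Longrightarrow> bracket S u (sec_scale (bundleF S) f v) =
    sec_add (bundleF S) (sec_scale (bundleF S) f (bracket S u v)) (sec_scale (bundleF S) (\<lambda>y. anchor S u y f) v)"
  using setting unfolding gte_setting_def generalized_lie_algebroid_def Let_def by metis

lemma anchor_scale:
  "u \<in> \<Gamma>F \<Longrightarrow> f \<in> CN \<Longrightarrow> anchor S (sec_scale (bundleF S) f u) y g = f y * anchor S u y g"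
  using setting unfolding gte_setting_def generalized_lie_algebroid_def Let_def by metis

lemma h_bij: "bij h" and \<eta>_bij: "bij \<eta>"
  and smooth_h: "smooth_map (atlasM S) (atlasN S) h" and smooth_inv_h: "smooth_map (atlasN S) (atlasM S) (inv h)"
  and smooth_\<eta>: "smooth_map (atlasN S) (atlasM S) \<eta>"
  using setting_unfolded by (auto simp: diffeomorphism_def)

lemma inv_h_h [simp]: "inv h (h x) = x" and h_inv_h [simp]: "h (inv h y) = y"
  using h_bij by (auto simp: bij_def inv_f_f surj_f_inv_f)

lemma smooth_near_h: "smooth_near (atlasN S) (h x) f \<Longrightarrow> smooth_near (atlasM S) x (\<lambda>x. f (h x))"
  by (rule smooth_near_compose_map[OF M.smooth_atlas_axioms N.smooth_atlas_axioms smooth_h])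

lemma smooth_near_inv_h: "smooth_near (atlasM S) (inv h y) f \<Longrightarrow> smooth_near (atlasN S) y (\<lambda>y. f (inv h y))"
  by (rule smooth_near_compose_map[OF N.smooth_atlas_axioms M.smooth_atlas_axioms smooth_inv_h])

lemma near_h: "near y f g \<Longrightarrow> h x = y \<Longrightarrow> near x (\<lambda>x. f (h x)) (\<lambda>x. g (h x))"
proof -
  assume *: "near y f g" "h x = y"
  have "continuous_on UNIV h" using smooth_h by (simp add: smooth_map_def)
  then have "filterlim h (nhds (h x)) (nhds x)"
    by (metis UNIV_I continuous_on_eq_continuous_at isCont_def open_UNIV tendsto_at_iff_tendsto_nhds)
  then show ?thesis using * unfolding near_def filterlim_iff by blast
qed

lemma section_through:
  obtains u where "u \<in> \<Gamma>F" "u (proj (bundleF S) z) = z"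
proof -
  let ?y = "proj (bundleF S) z"
  obtain t where t: "t \<in> trivs (bundleF S)" "?y \<in> fst t" by (rule N.triv_at)
  obtain u where u: "u \<in> \<Gamma>F" "near ?y u (\<lambda>y. fib_elt (bundleF S) t y (snd t z))"
    using frame_section_exists[OF N.vec_bundle_axioms t] by blast
  then have "u ?y = fib_elt (bundleF S) t ?y (snd t z)"
    unfolding near_def using eventually_nhds_x_imp_x by fast
  then show ?thesis using that u t N.fib_elt_coord by metis
qed

text \<open>By definition \<open>\<A> u\<close> at \<open>h (\<eta> y)\<close> is computed from \<open>u\<close> at \<open>y\<close>. If the two points differ, a bump
  function separates them, and the \<open>C\<^sup>\<infinity>\<close>-linearity of \<open>\<A>\<close> forces \<open>\<rho>\<close> to vanish on the fibre over \<open>y\<close>.\<close>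

lemma \<rho>_vanishes:
  assumes "h (\<eta> (proj (bundleF S) z)) \<noteq> proj (bundleF S) z"
  shows "\<rho> z f = 0"
proof -
  let ?y = "proj (bundleF S) z" and ?w = "h (\<eta> (proj (bundleF S) z))"
  obtain u where u: "u \<in> \<Gamma>F" "u ?y = z" by (rule section_through)
  obtain \<phi> K where \<phi>: "\<phi> \<in> CN" "near ?y \<phi> (\<lambda>_. 1)" "closed K" "K \<subseteq> - {?w}" "\<And>x'. x' \<notin> K \<Longrightarrow> \<phi> x' = 0"
    using bump_function_exists[OF N.smooth_atlas_axioms, of "- {?w}" ?y] assms by auto
  have "\<phi> ?y = 1" using \<phi>(2) unfolding near_def using eventually_nhds_x_imp_x by fast
  then have s: "sec_scale (bundleF S) \<phi> u ?y = z"
    unfolding sec_scale_def using u(2) N.fibre_coord_inj N.fib_scale N.triv_at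
    by (metis scaleR_one)
  have "inj (h \<circ> \<eta>)" using h_bij \<eta>_bij by (meson bij_comp bij_is_inj)
  then have i: "inv (h \<circ> \<eta>) ?w = ?y" using inv_f_f[of "h \<circ> \<eta>" ?y] by simp
  have "anchor S (sec_scale (bundleF S) \<phi> u) ?w (\<lambda>y. f (inv h y)) = \<phi> ?w * anchor S u ?w (\<lambda>y. f (inv h y))"
    using anchor_scale u \<phi> by blast
  also have "\<phi> ?w = 0" using \<phi> by blast
  moreover have "(\<lambda>y. f (inv h y)) \<circ> h = f" by (simp add: comp_def)
  ultimately show ?thesis by (simp only: anchor_def i s tangent_map_def mult_zero_left)
qed

text \<open>At the fixed points of \<open>h \<circ> \<eta>\<close> this is the definition of \<open>\<A>\<close>; elsewhere both sides vanish.\<close>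

lemma anchor_eq: "anchor S u y g = \<rho> (u y) (\<lambda>x. g (h x))" if u: "u \<in> \<Gamma>F"
proof (cases "h (\<eta> y) = y")
  case True
  have "inj (h \<circ> \<eta>)" using h_bij \<eta>_bij by (meson bij_comp bij_is_inj)
  then have "inv (h \<circ> \<eta>) y = y" using inv_f_f[of "h \<circ> \<eta>" y] True by simp
  then show ?thesis by (simp add: anchor_def tangent_map_def comp_def)
next
  case False
  have "surj (h \<circ> \<eta>)" using h_bij \<eta>_bij by (meson bij_comp bij_is_surj)
  then have y: "h (\<eta> (inv (h \<circ> \<eta>) y)) = y" using surj_f_inv_f[of "h \<circ> \<eta>" y] by simp
  then have "\<rho> (u (inv (h \<circ> \<eta>) y)) g' = 0" for g'
    using \<rho>_vanishes[of "u (inv (h \<circ> \<eta>) y)"] False N.vb_sections_proj[OF u] by metis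
  moreover have "\<rho> (u y) g' = 0" for g' using \<rho>_vanishes[of "u y"] False N.vb_sections_proj[OF u] by metis
  ultimately show ?thesis by (simp add: anchor_def tangent_map_def)
qed

text \<open>By definition \<open>\<rho> z\<close> is tangent to \<open>M\<close> at \<open>\<eta> y\<close>, where \<open>y\<close> is the base point of \<open>z\<close>. If this point differs
  from \<open>h\<^sup>-\<^sup>1 y\<close>, then \<open>\<rho> z = 0\<close>.\<close>

lemma \<rho>_tangent: "\<rho> z \<in> tangent_space (atlasM S) (inv h (proj (bundleF S) z))"
proof (cases "h (\<eta> (proj (bundleF S) z)) = proj (bundleF S) z")
  case True
  then have "\<eta> (proj (bundleF S) z) = inv h (proj (bundleF S) z)" by (metis inv_h_h)
  then show ?thesis using setting_unfolded(7) unfolding rho_morphism_def by metis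
next
  case False
  then have "\<rho> z = (\<lambda>_. 0)" using \<rho>_vanishes by blast
  then show ?thesis using M.tangent_space_zero by simp
qed

lemma \<rho>_add: "proj (bundleF S) z = proj (bundleF S) z' \<Longrightarrow> \<rho> (fib_add (bundleF S) z z') f = \<rho> z f + \<rho> z' f"
  and \<rho>_scale: "\<rho> (fib_scale (bundleF S) k z) f = k * \<rho> z f"
  using setting_unfolded(7) unfolding rho_morphism_def by (metis (no_types, lifting))+

lemma \<rho>_frame_expansion:
  assumes "t \<in> trivs (bundleF S)" "y \<in> fst t"
  shows "\<rho> (fib_elt (bundleF S) t y \<xi>) f = (\<Sum>\<alpha>\<in>UNIV. \<xi> $ \<alpha> * \<rho> (\<tau> t \<alpha> y) f)"
proof -
  have lin: "linear (\<lambda>\<xi>. \<rho> (fib_elt (bundleF S) t y \<xi>) f)"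
    using \<rho>_add N.fib_add_elt[OF assms] N.fib_scale_elt[OF assms] \<rho>_scale N.proj_fib_elt[OF assms]
    by (intro linearI) (metis, metis real_scaleR_def)
  have "\<rho> (fib_elt (bundleF S) t y \<xi>) f = \<rho> (fib_elt (bundleF S) t y (\<Sum>\<alpha>\<in>UNIV. \<xi> $ \<alpha> *\<^sub>R axis \<alpha> 1)) f"
    by (simp add: basis_expansion scalar_mult_eq_scaleR[symmetric])
  also have "\<dots> = (\<Sum>\<alpha>\<in>UNIV. \<xi> $ \<alpha> * \<rho> (\<tau> t \<alpha> y) f)"
    by (simp add: linear_sum[OF lin] linear_scale[OF lin] frame_sec_def)
  finally show ?thesis .
qed

text \<open>The hypothesis on \<open>\<rho>\<close> gives smoothness for coordinates around \<open>\<eta> y\<close>. This settles the case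
  \<open>\<eta> y = h\<^sup>-\<^sup>1 y\<close>; in the other case the function is zero near \<open>y\<close>.\<close>

lemma \<rho>_frame_smooth:
  assumes "t \<in> trivs (bundleF S)" "c \<in> atlasM S" "y \<in> fst t" "inv h y \<in> fst c"
  shows "smooth_near (atlasN S) y (\<lambda>y. \<rho> (\<tau> t \<alpha> y) (\<lambda>x. snd c x $ i))"
proof (cases "h (\<eta> y) = y")
  case True
  have "msmooth_on (atlasN S) (fst t \<inter> \<eta> -` fst c) (\<lambda>y. \<rho> (\<tau> t \<alpha> y) (\<lambda>x. snd c x $ i))"
    using setting_unfolded(7) assms unfolding rho_morphism_def by blast
  moreover have "open (fst t \<inter> \<eta> -` fst c)"
    using N.open_triv[OF assms(1)] open_vimage[OF M.open_chart_dom[OF assms(2)], of \<eta>] smooth_\<eta>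
    by (auto simp: smooth_map_def)
  moreover have "\<eta> y = inv h y" using True by (metis inv_h_h)
  ultimately show ?thesis using N.msmooth_on_iff assms by auto
next
  case False
  have "continuous_on UNIV (\<lambda>y. h (\<eta> y))"
    using smooth_h smooth_\<eta> unfolding smooth_map_def
    by (metis continuous_on_compose2 subset_UNIV)
  then have "open {y. h (\<eta> y) \<noteq> y}" by (intro open_Collect_neq continuous_on_id)
  then have "near y (\<lambda>_. 0) (\<lambda>y. \<rho> (\<tau> t \<alpha> y) (\<lambda>x. snd c x $ i))"
    unfolding near_def eventually_nhds
  proof (intro exI[of _ "{y. h (\<eta> y) \<noteq> y} \<inter> fst t"] conjI ballI)
    show "0 = \<rho> (\<tau> t \<alpha> y) (\<lambda>x. snd c x $ i)" if "y \<in> {y. h (\<eta> y) \<noteq> y} \<inter> fst t" for y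
      using \<rho>_vanishes[of "\<tau> t \<alpha> y"] that N.proj_fib_elt[OF assms(1)] by (simp add: frame_sec_def)
  qed (use False assms open_Int[OF _ N.open_triv[OF assms(1)]] in blast)+
  then show ?thesis using N.smooth_near_cong smooth_near_const by blast
qed

lemma tangent_coord_expansion:
  assumes "w \<in> tangent_space (atlasM S) x" "c \<in> atlasM S" "x \<in> fst c"
  shows "w = coord_vec (atlasM S) c x (\<chi> i. w (\<lambda>x. snd c x $ i))"
    and "w f = (\<Sum>i\<in>UNIV. w (\<lambda>x. snd c x $ i) * coord_vec (atlasM S) c x (axis i 1) f)"
proof -
  obtain \<xi> where \<xi>: "w = coord_vec (atlasM S) c x \<xi>" using M.tangent_in_chart[OF assms] by blast
  have "w (\<lambda>x. snd c x $ i) = \<xi> $ i" for i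
    unfolding \<xi> by (rule M.coord_vec_chart_function[OF assms(2,3) bounded_linear_vec_nth])
  then have e: "(\<chi> i. w (\<lambda>x. snd c x $ i)) = \<xi>" by (simp add: vec_eq_iff)
  then show 1: "w = coord_vec (atlasM S) c x (\<chi> i. w (\<lambda>x. snd c x $ i))" using \<xi> by simp
  let ?l = "\<lambda>\<xi>. coord_vec (atlasM S) c x \<xi> f"
  have "w f = ?l (\<Sum>i\<in>UNIV. \<xi> $ i *\<^sub>R axis i 1)"
    using \<xi> by (simp add: basis_expansion scalar_mult_eq_scaleR[symmetric])
  then show "w f = (\<Sum>i\<in>UNIV. w (\<lambda>x. snd c x $ i) * ?l (axis i 1))"
    unfolding linear_sum[OF M.coord_vec_linear[OF assms(2,3)]] linear_scale[OF M.coord_vec_linear[OF assms(2,3)]]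
    using e by (simp add: vec_eq_iff)
qed

lemma near_at: "near x f g \<Longrightarrow> f x = g x"
  unfolding near_def using eventually_nhds_x_imp_x by fast

lemma rho_comp_eq:
  assumes "c \<in> local_charts S" "y \<in> fst (tpart c)" "inv h y \<in> fst (xpart c)"
  shows "rho_comp S c y $ i $ \<alpha> = \<rho> (\<tau> (tpart c) \<alpha> y) (\<lambda>x. snd (xpart c) x $ i)"
proof -
  have c: "tpart c \<in> trivs (bundleF S)" "xpart c \<in> atlasM S"
    using assms(1) by (auto simp: local_charts_def tpart_def xpart_def)
  let ?R = "\<chi> i \<alpha>. \<rho> (\<tau> (tpart c) \<alpha> y) (\<lambda>x. snd (xpart c) x $ i)"
  let ?e = "\<lambda>i. coord_vec (atlasM S) (xpart c) (inv h y) (axis i 1)"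
  have "rho_comp S c y = ?R"
    unfolding rho_comp_def
  proof (rule the_equality)
    show "\<forall>u\<in>\<Gamma>F. \<forall>f. smooth_near (atlasN S) y f \<longrightarrow> anchor S u y f =
      (\<Sum>i\<in>UNIV. \<Sum>\<alpha>\<in>UNIV. ?R $ i $ \<alpha> * (snd (tpart c) (u y) $ \<alpha>) * ?e i (f \<circ> h))"
    proof (intro ballI allI impI)
      fix u and f :: "'b \<Rightarrow> real" assume u: "u \<in> \<Gamma>F" and f: "smooth_near (atlasN S) y f"
      have p: "proj (bundleF S) (u y) = y" using u N.vb_sections_proj by blast
      have r: "\<rho> (u y) g = (\<Sum>\<alpha>\<in>UNIV. snd (tpart c) (u y) $ \<alpha> * \<rho> (\<tau> (tpart c) \<alpha> y) g)" for g
        using \<rho>_frame_expansion[OF c(1) assms(2), of "snd (tpart c) (u y)"] N.fib_elt_coord[OF c(1), of "u y"] p assms(2)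
        by simp
      have "anchor S u y f = \<rho> (u y) (f \<circ> h)" using anchor_eq[OF u] by (simp add: comp_def)
      also have "\<dots> = (\<Sum>i\<in>UNIV. \<rho> (u y) (\<lambda>x. snd (xpart c) x $ i) * ?e i (f \<circ> h))"
        by (rule tangent_coord_expansion(2)) (use \<rho>_tangent[of "u y"] c(2) p assms(3) in simp_all)
      also have "\<dots> = (\<Sum>i\<in>UNIV. \<Sum>\<alpha>\<in>UNIV. ?R $ i $ \<alpha> * (snd (tpart c) (u y) $ \<alpha>) * ?e i (f \<circ> h))"
        by (simp add: r sum_distrib_left sum_distrib_right mult_ac)
      finally show "anchor S u y f = (\<Sum>i\<in>UNIV. \<Sum>\<alpha>\<in>UNIV. ?R $ i $ \<alpha> * (snd (tpart c) (u y) $ \<alpha>) * ?e i (f \<circ> h))" .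
    qed
  next
    fix R :: "real ^ 'p ^ 'm"
    assume R: "\<forall>u\<in>\<Gamma>F. \<forall>f. smooth_near (atlasN S) y f \<longrightarrow> anchor S u y f =
      (\<Sum>i\<in>UNIV. \<Sum>\<alpha>\<in>UNIV. R $ i $ \<alpha> * (snd (tpart c) (u y) $ \<alpha>) * ?e i (f \<circ> h))"
    have "R $ i $ \<alpha> = \<rho> (\<tau> (tpart c) \<alpha> y) (\<lambda>x. snd (xpart c) x $ i)" for i \<alpha>
    proof -
      obtain u where u: "u \<in> \<Gamma>F" "near y u (\<lambda>y. fib_elt (bundleF S) (tpart c) y (axis \<alpha> 1))"
        using frame_section_exists[OF N.vec_bundle_axioms c(1) assms(2)] by blast
      then have uy: "u y = \<tau> (tpart c) \<alpha> y" using near_at unfolding frame_sec_def by fast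
      then have u\<beta>: "snd (tpart c) (u y) = axis \<alpha> 1" using N.coord_fib_elt[OF c(1) assms(2)] by (simp add: frame_sec_def)
      have s: "smooth_near (atlasN S) y (\<lambda>y. snd (xpart c) (inv h y) $ i)"
        by (intro smooth_near_inv_h[where f = "\<lambda>x. snd (xpart c) x $ i"] M.smooth_near_coord[OF c(2) assms(3)] bounded_linear_vec_nth)
      have e: "?e j (\<lambda>x. snd (xpart c) x $ i) = (if i = j then 1 else 0)" for j
        using M.coord_vec_chart_function[OF c(2) assms(3) bounded_linear_vec_nth] by (simp add: axis_def)
      have "\<rho> (u y) (\<lambda>x. snd (xpart c) x $ i) = anchor S u y (\<lambda>y. snd (xpart c) (inv h y) $ i)"
        using anchor_eq[OF u(1)] by simp
      also have "\<dots> = (\<Sum>j\<in>UNIV. \<Sum>\<beta>\<in>UNIV. R $ j $ \<beta> * (axis \<alpha> 1 $ \<beta>) * (if i = j then 1 else 0))"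
        using R u(1) s e by (simp add: u\<beta> comp_def)
      also have "\<dots> = (\<Sum>j\<in>UNIV. \<Sum>\<beta>\<in>UNIV. if \<beta> = \<alpha> then (if i = j then R $ j $ \<beta> else 0) else 0)"
        by (intro sum.cong refl) (simp add: axis_def)
      also have "\<dots> = R $ i $ \<alpha>" by simp
      finally show ?thesis using uy by simp
    qed
    then show "R = ?R" by (simp add: vec_eq_iff)
  qed
  then show ?thesis by simp
qed

lemma coord_sec_add:
  "u \<in> \<Gamma>F \<Longrightarrow> w \<in> \<Gamma>F \<Longrightarrow> t \<in> trivs (bundleF S) \<Longrightarrow> y \<in> fst t \<Longrightarrow>
    snd t (sec_add (bundleF S) u w y) = snd t (u y) + snd t (w y)"
  unfolding sec_add_def by (rule N.coord_fib_add) (simp_all add: N.vb_sections_proj)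

lemma coord_sec_scale:
  "u \<in> \<Gamma>F \<Longrightarrow> t \<in> trivs (bundleF S) \<Longrightarrow> y \<in> fst t \<Longrightarrow> snd t (sec_scale (bundleF S) f u y) = f y *\<^sub>R snd t (u y)"
  unfolding sec_scale_def by (rule N.coord_fib_scale) (simp_all add: N.vb_sections_proj)

lemma section_eqI:
  assumes "u \<in> \<Gamma>F" "w \<in> \<Gamma>F" "t \<in> trivs (bundleF S)" "y \<in> fst t" "snd t (u y) = snd t (w y)"
  shows "u y = w y"
  by (rule N.fibre_coord_inj[OF assms(3) _ _ assms(5)]) (use assms N.vb_sections_proj in auto)

lemma bracket_antisym:
  assumes "u \<in> \<Gamma>F" "w \<in> \<Gamma>F" "t \<in> trivs (bundleF S)" "y \<in> fst t"
  shows "snd t (bracket S u w y) = - snd t (bracket S w u y)"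
  using bracket_swap[OF assms(1,2)] coord_sec_scale[OF bracket_section[OF assms(2,1)] assms(3,4), of "\<lambda>_. -1"]
  by simp

lemma bracket_leibniz:
  assumes "u \<in> \<Gamma>F" "w \<in> \<Gamma>F" "f \<in> CN" "t \<in> trivs (bundleF S)" "y \<in> fst t"
  shows "snd t (bracket S u (sec_scale (bundleF S) f w) y) =
    f y *\<^sub>R snd t (bracket S u w y) + \<rho> (u y) (\<lambda>x. f (h x)) *\<^sub>R snd t (w y)"
proof -
  have p: "proj (bundleF S) (sec_scale (bundleF S) f (bracket S u w) y) = y"
    "proj (bundleF S) (sec_scale (bundleF S) (\<lambda>y. anchor S u y f) w y) = y"
    using N.proj_fib_scale N.vb_sections_proj[OF bracket_section[OF assms(1,2)]] N.vb_sections_proj[OF assms(2)]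
    by (auto simp: sec_scale_def)
  show ?thesis
    using bracket_scale[OF assms(1-3)] N.coord_fib_add[of _ _ t] p assms(4,5)
      coord_sec_scale[OF bracket_section[OF assms(1,2)] assms(4,5), of f]
      coord_sec_scale[OF assms(2,4,5), of "\<lambda>y. anchor S u y f"] anchor_eq[OF assms(1)]
    by (simp add: sec_add_def)
qed

text \<open>If \<open>s = w - w'\<close> vanishes near \<open>y\<close> and \<open>f\<close> is a bump function there, then \<open>s = (1 - f) s\<close>; in
  \<open>[u, s](y) = (1 - f)(y) [u, s](y) + (\<A> u (1 - f))(y) s(y)\<close> both terms vanish.\<close>

lemma bracket_local_right:
  assumes "u \<in> \<Gamma>F" "w \<in> \<Gamma>F" "w' \<in> \<Gamma>F" "near y w w'"
  shows "bracket S u w y = bracket S u w' y"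
proof -
  let ?F = "bundleF S"
  obtain t where t: "t \<in> trivs ?F" "y \<in> fst t" by (rule N.triv_at)
  obtain U where U: "open U" "y \<in> U" "\<And>x. x \<in> U \<Longrightarrow> w x = w' x"
    using assms(4) unfolding near_def eventually_nhds by blast
  obtain f K where f: "f \<in> CN" "near y f (\<lambda>_. 1)" "closed K" "K \<subseteq> U" "\<And>x'. x' \<notin> K \<Longrightarrow> f x' = 0"
    using bump_function_exists[OF N.smooth_atlas_axioms U(1,2)] by blast
  let ?m = "sec_scale ?F (\<lambda>_. -1) w'"
  let ?s = "sec_add ?F w ?m" and ?g = "\<lambda>x. 1 - f x"
  have m: "?m \<in> \<Gamma>F" by (rule N.sec_scale_section[OF assms(3) const_smooth_function])
  have s: "?s \<in> \<Gamma>F" by (rule N.sec_add_section[OF assms(2) m])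
  have g: "?g \<in> CN"
    using f(1) unfolding smooth_functions_def mem_Collect_eq N.msmooth_on_iff[OF open_UNIV]
    by (intro ballI N.smooth_near_diff[OF smooth_near_const]) blast
  have sc: "snd t' (?s x) = snd t' (w x) - snd t' (w' x)" if "t' \<in> trivs ?F" "x \<in> fst t'" for t' x
    using coord_sec_add[OF assms(2) m that] coord_sec_scale[OF assms(3) that] by simp
  have gs: "sec_scale ?F ?g ?s = ?s"
  proof
    fix x
    obtain t' where t': "t' \<in> trivs ?F" "x \<in> fst t'" by (rule N.triv_at)
    have "snd t' (sec_scale ?F ?g ?s x) = snd t' (?s x)"
    proof (cases "x \<in> U")
      case True
      then show ?thesis using sc[OF t'] U(3) coord_sec_scale[OF s t', of ?g] by simp
    next
      case False
      then have "f x = 0" using f by blast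
      then show ?thesis using coord_sec_scale[OF s t', of ?g] by simp
    qed
    then show "sec_scale ?F ?g ?s x = ?s x"
      using section_eqI[OF N.sec_scale_section[OF s g] s t'] by blast
  qed
  have "f y = 1" using f(2) near_at by fast
  then have "snd t (bracket S u ?s y) = 0"
    using bracket_leibniz[OF assms(1) s g t] gs sc[OF t] U by simp
  moreover have "snd t (bracket S u ?s y) = snd t (bracket S u w y) - snd t (bracket S u w' y)"
    using bracket_add[OF assms(1,2) m] bracket_cmult[OF assms(1,3), of "-1"]
      coord_sec_add[OF bracket_section[OF assms(1,2)] bracket_section[OF assms(1) m] t]
      coord_sec_scale[OF bracket_section[OF assms(1,3)] t, of "\<lambda>_. -1"] by simp
  ultimately show ?thesis
    using section_eqI[OF bracket_section[OF assms(1,2)] bracket_section[OF assms(1,3)] t] by simp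
qed

lemma bracket_local:
  assumes "u \<in> \<Gamma>F" "u' \<in> \<Gamma>F" "w \<in> \<Gamma>F" "w' \<in> \<Gamma>F" "near y u u'" "near y w w'"
  shows "bracket S u w y = bracket S u' w' y"
proof -
  obtain t where t: "t \<in> trivs (bundleF S)" "y \<in> fst t" by (rule N.triv_at)
  have "snd t (bracket S u w' y) = snd t (bracket S u' w' y)"
    using bracket_antisym[OF assms(1,4) t] bracket_antisym[OF assms(2,4) t] bracket_local_right[OF assms(4,1,2,5)] by simp
  then have "bracket S u w' y = bracket S u' w' y"
    using section_eqI[OF bracket_section[OF assms(1,4)] bracket_section[OF assms(2,4)] t] by blast
  then show ?thesis using bracket_local_right[OF assms(1,3,4,6)] by simp
qed

text \<open>Leibniz' rule for the expansion \<open>w = w\<^sup>\<beta> t\<^sub>\<beta>\<close>, which holds globally after multiplication of the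
  coefficients by a bump function.\<close>

lemma bracket_frame_expansion:
  assumes "z \<in> \<Gamma>F" "w \<in> \<Gamma>F" "t \<in> trivs (bundleF S)" "y \<in> fst t"
    and e: "\<And>\<beta>. e \<beta> \<in> \<Gamma>F" "\<And>\<beta>. near y (e \<beta>) (\<tau> t \<beta>)"
  shows "snd t (bracket S z w y) =
    (\<Sum>\<beta>\<in>UNIV. (snd t (w y) $ \<beta>) *\<^sub>R snd t (bracket S z (e \<beta>) y) +
      \<rho> (z y) (\<lambda>x. snd t (w (h x)) $ \<beta>) *\<^sub>R axis \<beta> 1)"
proof -
  let ?F = "bundleF S"
  note t = assms(3,4)
  obtain f K where f: "f \<in> CN" "near y f (\<lambda>_. 1)" "closed K" "K \<subseteq> fst t" "\<And>x'. x' \<notin> K \<Longrightarrow> f x' = 0"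
    using bump_function_exists[OF N.smooth_atlas_axioms N.open_triv[OF t(1)] t(2)] by blast
  define a where "a \<beta> x = (if x \<in> fst t then f x * snd t (w x) $ \<beta> else 0)" for \<beta> x
  have fs: "smooth_near (atlasN S) x f" for x
    using f(1) N.msmooth_on_iff[OF open_UNIV] by (auto simp: smooth_functions_def)
  have "smooth_near (atlasN S) x (a \<beta>)" for \<beta> x
  proof (cases "x \<in> fst t")
    case True
    have "near x (\<lambda>x. f x * snd t (w x) $ \<beta>) (a \<beta>)"
      unfolding near_def eventually_nhds
      using True N.open_triv[OF t(1)] by (intro exI[of _ "fst t"]) (auto simp: a_def)
    then show ?thesis
      using N.smooth_near_cong N.smooth_near_mult[OF fs N.smooth_near_vecD[OF N.vb_sections_smooth[OF assms(2) t(1) True]]]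
      by blast
  next
    case False
    have "near x (\<lambda>_. 0) (a \<beta>)"
      unfolding near_def eventually_nhds
      using False f by (intro exI[of _ "- K"]) (auto simp: a_def)
    then show ?thesis using N.smooth_near_cong smooth_near_const by blast
  qed
  then have aCN: "a \<beta> \<in> CN" for \<beta> by (simp add: smooth_functions_def N.msmooth_on_iff)
  have near_a: "near y (a \<beta>) (\<lambda>y. snd t (w y) $ \<beta>)" for \<beta>
  proof -
    have "\<forall>\<^sub>F x' in nhds y. x' \<in> fst t" using t N.open_triv eventually_nhds_in_open by blast
    with f(2)[unfolded near_def] show ?thesis unfolding near_def by eventually_elim (simp add: a_def)
  qed
  have "\<exists>W\<in>\<Gamma>F. (\<forall>\<^sub>F x in nhds y. snd t (W x) = (\<Sum>\<beta>\<in>I. a \<beta> x *\<^sub>R axis \<beta> 1)) \<and>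
      snd t (bracket S z W y) = (\<Sum>\<beta>\<in>I. a \<beta> y *\<^sub>R snd t (bracket S z (e \<beta>) y) +
      \<rho> (z y) (\<lambda>x. a \<beta> (h x)) *\<^sub>R axis \<beta> 1)" if "finite I" for I
    using that
  proof (induction I)
    case empty
    have "\<forall>\<^sub>F x in nhds y. x \<in> fst t" using t N.open_triv eventually_nhds_in_open by blast
    then have "\<forall>\<^sub>F x in nhds y. snd t (sec_scale ?F (\<lambda>_. 0) w x) = 0"
      by eventually_elim (simp add: coord_sec_scale[OF assms(2) t(1)])
    then show ?case
      using N.sec_scale_section[OF assms(2) const_smooth_function] bracket_cmult[OF assms(1,2), of 0]
        coord_sec_scale[OF bracket_section[OF assms(1,2)] t, of "\<lambda>_. 0"]
      by (intro bexI[of _ "sec_scale ?F (\<lambda>_. 0) w"]) auto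
  next
    case (insert \<beta> I)
    then obtain W where W: "W \<in> \<Gamma>F" "\<forall>\<^sub>F x in nhds y. snd t (W x) = (\<Sum>\<beta>\<in>I. a \<beta> x *\<^sub>R axis \<beta> 1)"
      "snd t (bracket S z W y) = (\<Sum>\<beta>\<in>I. a \<beta> y *\<^sub>R snd t (bracket S z (e \<beta>) y) +
        \<rho> (z y) (\<lambda>x. a \<beta> (h x)) *\<^sub>R axis \<beta> 1)" by blast
    let ?W = "sec_add ?F (sec_scale ?F (a \<beta>) (e \<beta>)) W"
    have s: "sec_scale ?F (a \<beta>) (e \<beta>) \<in> \<Gamma>F" by (rule N.sec_scale_section[OF e(1) aCN])
    have et: "\<tau> t \<beta> x = fib_elt ?F t x (axis \<beta> 1)" for x by (simp add: frame_sec_def)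
    have "\<forall>\<^sub>F x in nhds y. x \<in> fst t" using t N.open_triv eventually_nhds_in_open by blast
    with W(2) e(2)[unfolded near_def, of \<beta>]
    have "\<forall>\<^sub>F x in nhds y. snd t (?W x) = (\<Sum>\<beta>\<in>insert \<beta> I. a \<beta> x *\<^sub>R axis \<beta> 1)"
    proof eventually_elim
      case (elim x)
      have "snd t (?W x) = a \<beta> x *\<^sub>R snd t (e \<beta> x) + snd t (W x)"
        using coord_sec_add[OF s W(1) t(1) elim(3)] coord_sec_scale[OF e(1) t(1) elim(3)] by simp
      then show ?case using elim insert.hyps N.coord_fib_elt[OF t(1) elim(3)] by (simp add: et)
    qed
    moreover have "e \<beta> y = \<tau> t \<beta> y" by (rule near_at[OF e(2)])
    then have "snd t (e \<beta> y) = axis \<beta> 1"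
      using N.coord_fib_elt[OF t] et by simp
    then have "snd t (bracket S z ?W y) = (\<Sum>\<beta>\<in>insert \<beta> I. a \<beta> y *\<^sub>R snd t (bracket S z (e \<beta>) y) +
        \<rho> (z y) (\<lambda>x. a \<beta> (h x)) *\<^sub>R axis \<beta> 1)"
      using bracket_add[OF assms(1) s W(1)] W(3) insert.hyps
        coord_sec_add[OF bracket_section[OF assms(1) s] bracket_section[OF assms(1) W(1)] t]
        bracket_leibniz[OF assms(1) e(1) aCN t] by simp
    ultimately show ?case using N.sec_add_section[OF s W(1)] by blast
  qed
  from this[OF finite_class.finite_UNIV] obtain W where W: "W \<in> \<Gamma>F"
    "\<forall>\<^sub>F x in nhds y. snd t (W x) = (\<Sum>\<beta>\<in>UNIV. a \<beta> x *\<^sub>R axis \<beta> 1)"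
    "snd t (bracket S z W y) = (\<Sum>\<beta>\<in>UNIV. a \<beta> y *\<^sub>R snd t (bracket S z (e \<beta>) y) +
      \<rho> (z y) (\<lambda>x. a \<beta> (h x)) *\<^sub>R axis \<beta> 1)" by blast
  have "\<forall>\<^sub>F x in nhds y. x \<in> fst t" using t N.open_triv eventually_nhds_in_open by blast
  moreover have "\<forall>\<^sub>F x in nhds y. \<forall>\<beta>. a \<beta> x = snd t (w x) $ \<beta>"
    using near_a unfolding near_def by (simp add: eventually_all_finite)
  ultimately have "near y W w"
    using W(2) unfolding near_def
  proof eventually_elim
    case (elim x)
    then have "snd t (W x) = snd t (w x)"
      by (simp add: basis_expansion scalar_mult_eq_scaleR[symmetric])
    then show ?case using section_eqI[OF W(1) assms(2) t(1) elim(1)] by blast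
  qed
  then have "bracket S z W y = bracket S z w y" using bracket_local_right[OF assms(1) W(1) assms(2)] by blast
  moreover have "\<rho> (z y) (\<lambda>x. a \<beta> (h x)) = \<rho> (z y) (\<lambda>x. snd t (w (h x)) $ \<beta>)" for \<beta>
    using M.tangent_cong[OF \<rho>_tangent] near_h[OF near_a] N.vb_sections_proj[OF assms(1)] by (metis h_inv_h)
  moreover have "a \<beta> y = snd t (w y) $ \<beta>" for \<beta> using near_at[OF near_a] .
  ultimately show ?thesis using W(3) by simp
qed

lemma frame_sections_exist:
  assumes "t \<in> trivs (bundleF S)" "y \<in> fst t"
  obtains e where "\<And>\<beta>. e \<beta> \<in> \<Gamma>F" "\<And>\<beta>. near y (e \<beta>) (\<tau> t \<beta>)"
proof -
  have "\<forall>\<beta>. \<exists>u. u \<in> \<Gamma>F \<and> near y u (\<tau> t \<beta>)"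
    using frame_section_exists[OF N.vec_bundle_axioms assms] unfolding frame_sec_def by metis
  then show ?thesis using that by metis
qed

lemma L_comp_eq:
  assumes c: "c \<in> local_charts S" "y \<in> fst (tpart c)"
    and uw: "u \<in> \<Gamma>F" "w \<in> \<Gamma>F" "near y u (\<tau> (tpart c) \<alpha>)" "near y w (\<tau> (tpart c) \<beta>)"
  shows "L_comp S c y \<gamma> \<alpha> \<beta> = snd (tpart c) (bracket S u w y) $ \<gamma>"
proof -
  let ?t = "tpart c" and ?F = "bundleF S"
  have t: "?t \<in> trivs ?F" "y \<in> fst ?t" using c by (auto simp: local_charts_def tpart_def)
  obtain e where e: "\<And>\<beta>. e \<beta> \<in> \<Gamma>F" "\<And>\<beta>. near y (e \<beta>) (\<tau> ?t \<beta>)"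
    using frame_sections_exist[OF t] by blast
  have trans: "near y u v" if "near y u k" "near y v k" for u v k
    using that unfolding near_def by eventually_elim simp
  have be: "bracket S u w y = bracket S (e \<alpha>) (e \<beta>) y"
    if "u \<in> \<Gamma>F" "w \<in> \<Gamma>F" "near y u (\<tau> ?t \<alpha>)" "near y w (\<tau> ?t \<beta>)" for u w \<alpha> \<beta>
    by (rule bracket_local) (use that e trans in blast)+
  have "L_comp S c y = (\<lambda>\<gamma> \<alpha> \<beta>. snd ?t (bracket S (e \<alpha>) (e \<beta>) y) $ \<gamma>)"
    unfolding L_comp_def
  proof (rule the_equality)
    show "\<forall>u\<in>\<Gamma>F. \<forall>w\<in>\<Gamma>F. \<forall>\<alpha> \<beta>. near y u (\<tau> ?t \<alpha>) \<and> near y w (\<tau> ?t \<beta>) \<longrightarrow>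
      bracket S u w y = fib_elt ?F ?t y (\<chi> \<gamma>. snd ?t (bracket S (e \<alpha>) (e \<beta>) y) $ \<gamma>)"
      using be N.fib_elt_coord[OF t(1)] N.vb_sections_proj[OF bracket_section[OF e(1) e(1)]] t(2)
      by (simp add: vec_lambda_eta) (metis (no_types))
  next
    fix L assume "\<forall>u\<in>\<Gamma>F. \<forall>w\<in>\<Gamma>F. \<forall>\<alpha> \<beta>. near y u (\<tau> ?t \<alpha>) \<and> near y w (\<tau> ?t \<beta>) \<longrightarrow>
      bracket S u w y = fib_elt ?F ?t y (\<chi> \<gamma>. L \<gamma> \<alpha> \<beta>)"
    then have "bracket S (e \<alpha>) (e \<beta>) y = fib_elt ?F ?t y (\<chi> \<gamma>. L \<gamma> \<alpha> \<beta>)" for \<alpha> \<beta>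
      using e by blast
    then have "snd ?t (bracket S (e \<alpha>) (e \<beta>) y) = (\<chi> \<gamma>. L \<gamma> \<alpha> \<beta>)" for \<alpha> \<beta>
      using N.coord_fib_elt[OF t] by simp
    then show "L = (\<lambda>\<gamma> \<alpha> \<beta>. snd ?t (bracket S (e \<alpha>) (e \<beta>) y) $ \<gamma>)" by simp
  qed
  then show ?thesis using be[OF uw] by simp
qed

lemma L_comp_antisym:
  assumes c: "c \<in> local_charts S" "y \<in> fst (tpart c)"
  shows "L_comp S c y \<gamma> \<alpha> \<beta> = - L_comp S c y \<gamma> \<beta> \<alpha>"
proof -
  have t: "tpart c \<in> trivs (bundleF S)" "y \<in> fst (tpart c)" using c by (auto simp: local_charts_def tpart_def)
  obtain e where e: "\<And>\<beta>. e \<beta> \<in> \<Gamma>F" "\<And>\<beta>. near y (e \<beta>) (\<tau> (tpart c) \<beta>)"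
    using frame_sections_exist[OF t] by blast
  have "snd (tpart c) (bracket S (e \<alpha>) (e \<beta>) y) $ \<gamma> = (- snd (tpart c) (bracket S (e \<beta>) (e \<alpha>) y)) $ \<gamma>"
    using bracket_antisym[OF e(1) e(1) t] by metis
  then show ?thesis by (simp only: L_comp_eq[OF c e(1) e(1) e(2) e(2)] vector_uminus_component)
qed

text \<open>The global sections that agree with the frame near \<open>y\<close> compute \<open>L\<close> at all points near \<open>y\<close>.\<close>

lemma L_comp_smooth:
  assumes c: "c \<in> local_charts S" "y \<in> fst (tpart c)"
  shows "smooth_near (atlasN S) y (\<lambda>y. L_comp S c y \<gamma> \<alpha> \<beta>)"
proof -
  have t: "tpart c \<in> trivs (bundleF S)" "y \<in> fst (tpart c)" using c by (auto simp: local_charts_def tpart_def)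
  obtain e where e: "\<And>\<beta>. e \<beta> \<in> \<Gamma>F" "\<And>\<beta>. near y (e \<beta>) (\<tau> (tpart c) \<beta>)"
    using frame_sections_exist[OF t] by blast
  have ev: "\<forall>\<^sub>F x in nhds y. near x (e \<beta>) (\<tau> (tpart c) \<beta>)" for \<beta>
    using e(2)[of \<beta>] unfolding near_def by (subst (asm) eventually_eventually[symmetric])
  have "\<forall>\<^sub>F x in nhds y. x \<in> fst (tpart c)" using t N.open_triv eventually_nhds_in_open by blast
  with ev[of \<alpha>] ev[of \<beta>]
  have "near y (\<lambda>y. snd (tpart c) (bracket S (e \<alpha>) (e \<beta>) y) $ \<gamma>) (\<lambda>y. L_comp S c y \<gamma> \<alpha> \<beta>)"
    unfolding near_def[of y] by eventually_elim (use L_comp_eq[OF c(1) _ e(1) e(1)] in simp)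
  then show ?thesis
    using N.smooth_near_cong N.smooth_near_vecD[OF N.vb_sections_smooth[OF bracket_section[OF e(1) e(1)] t]] by blast
qed

text \<open>The frame vectors of one chart are expanded in those of the other one, in both arguments of the bracket;
  Leibniz' rule produces the two terms with derivatives of the transition matrix.\<close>

lemma L_comp_transform:
  fixes \<alpha> \<beta> \<gamma>' :: 'p
  assumes c: "c \<in> local_charts S" "y \<in> fst (tpart c)" and c': "c' \<in> local_charts S" "y \<in> fst (tpart c')"
  defines "Q \<equiv> N.trans_mat (tpart c) (tpart c')"
  shows "(\<Sum>\<gamma>\<in>UNIV. Q y $ \<gamma>' $ \<gamma> * L_comp S c y \<gamma> \<alpha> \<beta>) =
    (\<Sum>\<alpha>'\<in>UNIV. \<Sum>\<beta>'\<in>UNIV. Q y $ \<alpha>' $ \<alpha> * Q y $ \<beta>' $ \<beta> * L_comp S c' y \<gamma>' \<alpha>' \<beta>')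
    + \<rho> (\<tau> (tpart c) \<alpha> y) (\<lambda>x. Q (h x) $ \<gamma>' $ \<beta>) - \<rho> (\<tau> (tpart c) \<beta> y) (\<lambda>x. Q (h x) $ \<gamma>' $ \<alpha>)"
proof -
  let ?t = "tpart c" and ?t' = "tpart c'" and ?F = "bundleF S"
  have t: "?t \<in> trivs ?F" "y \<in> fst ?t" using c by (auto simp: local_charts_def tpart_def)
  have t': "?t' \<in> trivs ?F" "y \<in> fst ?t'" using c' by (auto simp: local_charts_def tpart_def)
  obtain e where e: "\<And>\<beta>. e \<beta> \<in> \<Gamma>F" "\<And>\<beta>. near y (e \<beta>) (\<tau> ?t \<beta>)"
    using frame_sections_exist[OF t] by blast
  obtain e' where e': "\<And>\<beta>. e' \<beta> \<in> \<Gamma>F" "\<And>\<beta>. near y (e' \<beta>) (\<tau> ?t' \<beta>)"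
    using frame_sections_exist[OF t'] by blast
  have near_e: "near y (\<lambda>y. snd ?t' (e \<beta> y) $ \<beta>') (\<lambda>y. Q y $ \<beta>' $ \<beta>)" for \<beta> \<beta>'
  proof -
    have "\<forall>\<^sub>F x in nhds y. x \<in> fst ?t" "\<forall>\<^sub>F x in nhds y. x \<in> fst ?t'"
      using t t' N.open_triv eventually_nhds_in_open by blast+
    with e(2)[of \<beta>, unfolded near_def] show ?thesis
      unfolding near_def[of _ "\<lambda>y. snd ?t' (e \<beta> y) $ \<beta>'"]
    proof eventually_elim
      case (elim x)
      then show ?case using N.trans_mat_fib_elt[OF t(1) t'(1) elim(2,3)]
        by (simp add: frame_sec_def Q_def matrix_vector_mult_basis column_def)
    qed
  qed
  have Qe: "snd ?t' (e \<beta> y) $ \<beta>' = Q y $ \<beta>' $ \<beta>" for \<beta> \<beta>' using near_at[OF near_e] .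
  have ey: "e \<beta> y = \<tau> ?t \<beta> y" "e' \<beta> y = \<tau> ?t' \<beta> y" for \<beta>
    by (rule near_at[OF e(2)], rule near_at[OF e'(2)])
  have \<rho>Q: "\<rho> (u y) (\<lambda>x. snd ?t' (e \<beta> (h x)) $ \<beta>') = \<rho> (u y) (\<lambda>x. Q (h x) $ \<beta>' $ \<beta>)"
    if "u \<in> \<Gamma>F" for u \<beta> \<beta>'
    using M.tangent_cong[OF \<rho>_tangent] near_h[OF near_e] N.vb_sections_proj[OF that] by (metis h_inv_h)
  have L': "snd ?t' (bracket S (e' \<alpha>) (e' \<beta>) y) $ \<gamma>' = L_comp S c' y \<gamma>' \<alpha> \<beta>" for \<alpha> \<beta>
    using L_comp_eq[OF c' e'(1) e'(1) e'(2) e'(2)] by simp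
  have ax: "(\<Sum>\<beta>\<in>UNIV. k \<beta> * (axis \<beta> 1 :: real ^ 'p) $ \<gamma>') = k \<gamma>'" for k :: "'p \<Rightarrow> real"
    by (simp add: axis_def if_distrib sum.delta cong: if_cong)
  have b1: "snd ?t' (bracket S z (e \<beta>) y) $ \<gamma>' =
      (\<Sum>\<beta>'\<in>UNIV. Q y $ \<beta>' $ \<beta> * snd ?t' (bracket S z (e' \<beta>') y) $ \<gamma>') + \<rho> (z y) (\<lambda>x. Q (h x) $ \<gamma>' $ \<beta>)"
    if "z \<in> \<Gamma>F" for z \<beta>
    using bracket_frame_expansion[OF that e(1) t' e'] \<rho>Q[OF that] by (simp add: Qe sum.distrib ax)
  have b2: "snd ?t' (bracket S (e \<alpha>) (e' \<beta>') y) $ \<gamma>' =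
      (\<Sum>\<alpha>'\<in>UNIV. Q y $ \<alpha>' $ \<alpha> * L_comp S c' y \<gamma>' \<alpha>' \<beta>') - \<rho> (\<tau> ?t' \<beta>' y) (\<lambda>x. Q (h x) $ \<gamma>' $ \<alpha>)" for \<beta>'
    using b1[OF e'(1), of \<beta>' \<alpha>] bracket_antisym[OF e(1) e'(1) t', of \<alpha> \<beta>']
    by (simp add: L' ey L_comp_antisym[OF c', of _ _ \<beta>'] sum_negf)
  have \<rho>t: "\<rho> (\<tau> ?t \<beta> y) f = (\<Sum>\<beta>'\<in>UNIV. Q y $ \<beta>' $ \<beta> * \<rho> (\<tau> ?t' \<beta>' y) f)" for f
  proof -
    have "\<tau> ?t \<beta> y = fib_elt ?F ?t' y (snd ?t' (e \<beta> y))"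
      using N.fib_elt_coord[OF t'(1), of "e \<beta> y"] N.vb_sections_proj[OF e(1)[of \<beta>], of y] t'(2)
      unfolding ey(1)[symmetric] by simp
    then show ?thesis using \<rho>_frame_expansion[OF t'] Qe by simp
  qed
  have "(\<Sum>\<gamma>\<in>UNIV. Q y $ \<gamma>' $ \<gamma> * L_comp S c y \<gamma> \<alpha> \<beta>) = snd ?t' (bracket S (e \<alpha>) (e \<beta>) y) $ \<gamma>'"
    using N.trans_mat[OF t(1) t'(1), of "bracket S (e \<alpha>) (e \<beta>) y"] N.vb_sections_proj[OF bracket_section[OF e(1) e(1)]] t t'
    by (simp add: matrix_vector_mult_def Q_def L_comp_eq[OF c e(1) e(1) e(2) e(2)])
  also have "\<dots> = (\<Sum>\<beta>'\<in>UNIV. Q y $ \<beta>' $ \<beta> * ((\<Sum>\<alpha>'\<in>UNIV. Q y $ \<alpha>' $ \<alpha> * L_comp S c' y \<gamma>' \<alpha>' \<beta>')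
      - \<rho> (\<tau> ?t' \<beta>' y) (\<lambda>x. Q (h x) $ \<gamma>' $ \<alpha>))) + \<rho> (\<tau> ?t \<alpha> y) (\<lambda>x. Q (h x) $ \<gamma>' $ \<beta>)"
    by (simp add: b1[OF e(1)] b2 ey)
  also have "\<dots> = (\<Sum>\<beta>'\<in>UNIV. \<Sum>\<alpha>'\<in>UNIV. Q y $ \<alpha>' $ \<alpha> * Q y $ \<beta>' $ \<beta> * L_comp S c' y \<gamma>' \<alpha>' \<beta>')
    - \<rho> (\<tau> ?t \<beta> y) (\<lambda>x. Q (h x) $ \<gamma>' $ \<alpha>) + \<rho> (\<tau> ?t \<alpha> y) (\<lambda>x. Q (h x) $ \<gamma>' $ \<beta>)"
    by (simp add: \<rho>t right_diff_distrib sum_subtractf sum_distrib_left mult_ac)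
  finally show ?thesis by (subst sum.swap) simp
qed

end

section \<open>The generalized tangent bundle\<close>

context gte
begin

lemma continuous_\<pi>: "continuous_on UNIV \<pi>"
  using M.vb by (simp add: vector_bundle_def)

lemma total_chart_simps:
  "fst (total_chart (bundleE S) c t) = \<pi> -` (fst c \<inter> fst t)"
  "snd (total_chart (bundleE S) c t) v = (snd c (\<pi> v), snd t v)"
  by (simp_all add: total_chart_def)

lemma total_chart_image:
  assumes "c \<in> atlasM S" "t \<in> trivs (bundleE S)" "U \<subseteq> fst c \<inter> fst t"
  shows "snd (total_chart (bundleE S) c t) ` (\<pi> -` U) = (snd c ` U) \<times> UNIV"
proof (intro equalityI subsetI)
  fix p assume "p \<in> (snd c ` U) \<times> (UNIV :: (real ^ 'r) set)"
  then obtain x where x: "x \<in> U" "fst p = snd c x" by auto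
  let ?v = "fib_elt (bundleE S) t x (snd p)"
  have "x \<in> fst t" using x assms by auto
  then have "\<pi> ?v = x" "snd t ?v = snd p" using M.fib_elt[OF assms(2)] by auto
  then show "p \<in> snd (total_chart (bundleE S) c t) ` (\<pi> -` U)"
    using x by (intro image_eqI[of _ _ ?v]) (auto simp: total_chart_simps prod_eq_iff)
qed (auto simp: total_chart_simps)

lemma total_chart_homeomorphism:
  assumes "c \<in> atlasM S" "t \<in> trivs (bundleE S)"
  defines "d \<equiv> total_chart (bundleE S) c t"
  shows "homeomorphism (fst d) (snd d ` fst d) (snd d) (chart_inv d)"
    and "\<And>v. v \<in> fst d \<Longrightarrow> chart_inv d (snd d v) = v"
proof -
  let ?U = "fst c \<inter> fst t"
  obtain g where g: "homeomorphism (\<pi> -` fst t) (fst t \<times> UNIV) (\<lambda>e. (\<pi> e, snd t e)) g"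
    using M.triv_homeomorphism[OF assms(2)] by blast
  have im: "snd d ` fst d = (snd c ` ?U) \<times> UNIV"
    unfolding d_def using total_chart_image[OF assms(1,2) order_refl] by (simp add: total_chart_simps(1))
  have inj: "inj_on (snd d) (fst d)"
  proof (rule inj_onI)
    fix v v' assume v: "v \<in> fst d" "v' \<in> fst d" and e: "snd d v = snd d v'"
    then have *: "\<pi> v \<in> fst c" "\<pi> v' \<in> fst c" "snd c (\<pi> v) = snd c (\<pi> v')" "snd t v = snd t v'" "\<pi> v \<in> fst t"
      by (auto simp: d_def total_chart_simps)
    then have "\<pi> v = \<pi> v'" using M.chart_inv_left[OF assms(1)] by metis
    then show "v = v'" using M.fibre_coord_inj[OF assms(2)] * by blast
  qed
  show left: "chart_inv d (snd d v) = v" if "v \<in> fst d" for v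
    using inv_into_f_f[OF inj that] by (simp add: chart_inv_def)
  have c_snd_t: "continuous_on (\<pi> -` fst t) (\<lambda>e. (\<pi> e, snd t e))"
    using g by (simp add: homeomorphism_def)
  have c1: "continuous_on (fst d) (snd d)"
  proof -
    have "continuous_on (fst d) (\<lambda>v. (snd c (\<pi> v), snd t v))"
    proof (intro continuous_on_Pair)
      show "continuous_on (fst d) (\<lambda>v. snd c (\<pi> v))"
      proof (rule continuous_on_compose2[of "fst c" "snd c"])
        show "continuous_on (fst c) (snd c)"
          using M.chart_homeomorphism[OF assms(1)] unfolding homeomorphism_def by blast
        show "continuous_on (fst d) \<pi>" by (rule continuous_on_subset[OF continuous_\<pi> subset_UNIV])
      qed (auto simp: d_def total_chart_simps)
      show "continuous_on (fst d) (snd t)"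
        using continuous_on_subset[OF continuous_on_snd[OF c_snd_t], of "fst d"]
        by (auto simp: d_def total_chart_simps)
    qed
    then show ?thesis by (simp add: d_def total_chart_def)
  qed
  have gp: "g (\<pi> e, snd t e) = e" if "\<pi> e \<in> fst t" for e
    using g that by (simp add: homeomorphism_def)
  have c2: "continuous_on (snd d ` fst d) (chart_inv d)"
  proof -
    have "continuous_on ((snd c ` ?U) \<times> UNIV) (\<lambda>p. g (chart_inv c (fst p), snd p))"
    proof (rule continuous_on_compose2[of "fst t \<times> UNIV" g])
      show "continuous_on (fst t \<times> UNIV) g" using g by (simp add: homeomorphism_def)
      have "continuous_on (snd c ` fst c) (chart_inv c)"
        using M.chart_homeomorphism[OF assms(1)] by (simp add: homeomorphism_def)
      then have "continuous_on ((snd c ` ?U) \<times> (UNIV :: (real ^ 'r) set)) (\<lambda>p. chart_inv c (fst p))"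
        by (rule continuous_on_compose2) (auto intro!: continuous_on_fst continuous_on_id)
      then show "continuous_on ((snd c ` ?U) \<times> (UNIV :: (real ^ 'r) set)) (\<lambda>p. (chart_inv c (fst p), snd p))"
        by (intro continuous_on_Pair continuous_on_snd continuous_on_id)
    qed (use assms in auto)
    moreover have "g (chart_inv c (fst p), snd p) = chart_inv d p" if p: "p \<in> (snd c ` ?U) \<times> UNIV" for p
    proof -
      from p im obtain v where v: "v \<in> fst d" "p = snd d v" by auto
      then have "\<pi> v \<in> fst c" "\<pi> v \<in> fst t" "p = (snd c (\<pi> v), snd t v)"
        by (auto simp: d_def total_chart_simps)
      then show ?thesis using left[OF v(1)] v(2) gp assms(1) by simp
    qed
    ultimately show ?thesis unfolding im using continuous_on_eq by blast
  qed
  show "homeomorphism (fst d) (snd d ` fst d) (snd d) (chart_inv d)"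
    unfolding homeomorphism_def using c1 c2 left by (auto simp: image_image)
qed

lemma total_chart_transition:
  assumes "c \<in> atlasM S" "t \<in> trivs (bundleE S)" "c' \<in> atlasM S" "t' \<in> trivs (bundleE S)"
  defines "d \<equiv> total_chart (bundleE S) c t" and "d' \<equiv> total_chart (bundleE S) c' t'"
  shows "smooth_on (snd d ` (fst d \<inter> fst d')) (snd d' \<circ> chart_inv d)"
proof -
  let ?U = "fst c \<inter> fst t \<inter> (fst c' \<inter> fst t')"
  let ?W = "(snd c ` ?U) \<times> (UNIV :: (real ^ 'r) set)"
  have im: "snd d ` (fst d \<inter> fst d') = ?W"
  proof -
    have "fst d \<inter> fst d' = \<pi> -` ?U" unfolding d_def d'_def total_chart_simps(1) by blast
    then show ?thesis using total_chart_image[OF assms(1,2), of ?U] unfolding d_def by (simp only: Int_lower1)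
  qed
  have oU: "open ?U" by (intro open_Int M.open_chart_dom M.open_triv assms)
  then have o: "open (snd c ` ?U)" using M.open_chart_image_Int[OF assms(1) oU] by (simp add: Int_absorb1 le_infI1)
  then have oW: "open ?W" by (intro open_Times) auto
  have comp_fst: "smooth_on ?W (\<lambda>p. f (fst p))" if "smooth_on (snd c ` ?U) f" for f :: "_ \<Rightarrow> 'w::real_normed_vector"
    by (rule smooth_on_compose[OF oW o _ smooth_on_bounded_linear[OF oW bounded_linear_fst smooth_on_id[OF oW]] that]) auto
  have "smooth_on ?W (\<lambda>p. ((snd c' \<circ> chart_inv c) (fst p), \<chi> i. \<Sum>j\<in>UNIV. (\<lambda>y. M.trans_mat t t' (chart_inv c y) $ i $ j) (fst p) * (snd p $ j)))"
  proof (intro smooth_on_Pair[OF oW] comp_fst smooth_on_vecI[OF oW])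
    show "smooth_on (snd c ` ?U) (snd c' \<circ> chart_inv c)"
      by (rule smooth_on_subset[OF M.chart_transition[OF assms(1,3)]]) auto
    have tr: "smooth_on (snd c ` ?U) (\<lambda>y. M.trans_mat t t' (chart_inv c y) $ i $ j)" for i j
    proof -
      have "msmooth_on (atlasM S) ?U (\<lambda>x. M.trans_mat t t' x $ i $ j)"
        unfolding M.msmooth_on_iff[OF oU] using M.trans_mat_smooth[OF assms(2,4)] by blast
      then have "smooth_on (snd c ` (fst c \<inter> ?U)) ((\<lambda>x. M.trans_mat t t' x $ i $ j) \<circ> chart_inv c)"
        unfolding msmooth_on_def using assms(1) by blast
      then show ?thesis by (simp add: comp_def Int_absorb1 le_infI1)
    qed
    fix i
    have "smooth_on ?W (\<lambda>p. \<Sum>j\<in>UNIV. (\<lambda>y. M.trans_mat t t' (chart_inv c y) $ i $ j) (fst p) * (snd p $ j))"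
      by (intro smooth_on_sum smooth_on_bilinear[OF oW bounded_bilinear_mult] oW comp_fst tr
          smooth_on_bounded_linear[OF oW bounded_linear_vec_nth]
          smooth_on_bounded_linear[OF oW bounded_linear_snd smooth_on_id[OF oW]])
    then show "smooth_on ?W (\<lambda>p. (\<chi> i. \<Sum>j\<in>UNIV. (\<lambda>y. M.trans_mat t t' (chart_inv c y) $ i $ j) (fst p) * (snd p $ j)) $ i)"
      by simp
  qed
  then show ?thesis unfolding im
  proof (rule smooth_on_cong_imp[OF oW, rotated])
    fix p assume "p \<in> ?W"
    then obtain v where v: "v \<in> fst d" "v \<in> fst d'" "p = snd d v" using im by blast
    then have *: "\<pi> v \<in> fst c" "\<pi> v \<in> fst t" "\<pi> v \<in> fst t'" "p = (snd c (\<pi> v), snd t v)"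
      by (auto simp: d_def d'_def total_chart_simps)
    have "chart_inv d p = v" using total_chart_homeomorphism(2)[OF assms(1,2)] v by (simp add: d_def)
    then show "((snd c' \<circ> chart_inv c) (fst p), \<chi> i. \<Sum>j\<in>UNIV. (\<lambda>y. M.trans_mat t t' (chart_inv c y) $ i $ j) (fst p) * (snd p $ j))
        = (snd d' \<circ> chart_inv d) p"
      using * M.trans_mat[OF assms(2,4) *(2,3)] assms(1)
      by (simp add: d'_def total_chart_simps matrix_vector_mult_def)
  qed
qed

sublocale E: smooth_atlas "atlasE S"
proof
  show "(\<Union>d\<in>atlasE S. fst d) = UNIV"
  proof (intro set_eqI iffI UNIV_I)
    fix v
    obtain c where c: "c \<in> atlasM S" "\<pi> v \<in> fst c" by (rule M.chart_at)
    obtain t where t: "t \<in> trivs (bundleE S)" "\<pi> v \<in> fst t" by (rule M.triv_at)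
    have "total_chart (bundleE S) c t \<in> atlasE S" "v \<in> fst (total_chart (bundleE S) c t)"
      unfolding atlasE_def using c t by (blast, simp add: total_chart_simps)
    then show "v \<in> (\<Union>d\<in>atlasE S. fst d)" by blast
  qed
next
  fix d assume "d \<in> atlasE S"
  then obtain c t where d: "c \<in> atlasM S" "t \<in> trivs (bundleE S)" "d = total_chart (bundleE S) c t"
    by (auto simp: atlasE_def)
  have o: "open (fst c \<inter> fst t)" by (intro open_Int M.open_chart_dom M.open_triv d)
  show "open (fst d)" unfolding d(3) total_chart_simps(1) by (rule open_vimage[OF o continuous_\<pi>])
  show "open (snd d ` fst d)"
    unfolding d(3) total_chart_simps(1) total_chart_image[OF d(1,2) order_refl]
    using M.open_chart_image_Int[OF d(1) o] by (intro open_Times) (simp_all add: Int_assoc[symmetric])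
  show "homeomorphism (fst d) (snd d ` fst d) (snd d) (chart_inv d)"
    unfolding d(3) by (rule total_chart_homeomorphism(1)[OF d(1,2)])
  fix d' assume "d' \<in> atlasE S"
  then obtain c' t' where d': "c' \<in> atlasM S" "t' \<in> trivs (bundleE S)" "d' = total_chart (bundleE S) c' t'"
    by (auto simp: atlasE_def)
  show "smooth_on (snd d ` (fst d \<inter> fst d')) (snd d' \<circ> chart_inv d)"
    unfolding d(3) d'(3) by (rule total_chart_transition[OF d(1,2) d'(1,2)])
qed

abbreviation charts where "charts \<equiv> local_charts S"
abbreviation TE where "TE \<equiv> tangent_space (atlasE S)"
abbreviation smooth where "smooth \<equiv> smooth_near (atlasE S)"

lemma smooth_map_\<pi>: "smooth_map (atlasE S) (atlasM S) \<pi>"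
  unfolding smooth_map_def
proof (intro conjI ballI continuous_\<pi>)
  fix d c' assume d': "d \<in> atlasE S" and c': "c' \<in> atlasM S"
  then obtain c t where d: "c \<in> atlasM S" "t \<in> trivs (bundleE S)" "d = total_chart (bundleE S) c t"
    by (auto simp: atlasE_def)
  let ?W = "snd d ` (fst d \<inter> \<pi> -` fst c')"
  have oW: "open ?W"
    by (rule E.open_chart_image_Int[OF d' open_vimage[OF M.open_chart_dom[OF c'] continuous_\<pi>]])
  have o: "open (snd c ` (fst c \<inter> fst c'))" by (intro M.open_chart_image_Int M.open_chart_dom c' d)
  have "smooth_on ?W (\<lambda>p. (snd c' \<circ> chart_inv c) (fst p))"
    by (rule smooth_on_compose[OF oW o _ smooth_on_bounded_linear[OF oW bounded_linear_fst smooth_on_id[OF oW]] M.chart_transition[OF d(1) c']])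
      (auto simp: d(3) total_chart_simps)
  then show "smooth_on ?W (snd c' \<circ> \<pi> \<circ> chart_inv d)"
  proof (rule smooth_on_cong_imp[OF oW, rotated])
    fix p assume "p \<in> ?W"
    then obtain v where v: "v \<in> fst d" "p = snd d v" by blast
    then show "(snd c' \<circ> chart_inv c) (fst p) = (snd c' \<circ> \<pi> \<circ> chart_inv d) p"
      using E.chart_inv_left[OF d' v(1)] d by (auto simp: total_chart_simps)
  qed
qed

lemma smooth_\<pi>: "smooth_near (atlasM S) (\<pi> v) f \<Longrightarrow> smooth v (\<lambda>v. f (\<pi> v))"
  by (rule smooth_near_compose_map[OF E.smooth_atlas_axioms M.smooth_atlas_axioms smooth_map_\<pi>])

lemma smooth_h\<pi>: "smooth_near (atlasN S) (h (\<pi> v)) f \<Longrightarrow> smooth v (\<lambda>v. f (h (\<pi> v)))"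
  by (rule smooth_\<pi>[where f = "\<lambda>x. f (h x)"]) (rule smooth_near_h)

lemma local_chart_parts:
  assumes "c \<in> charts"
  shows "xpart c \<in> atlasM S" "ypart c \<in> trivs (bundleE S)" "tpart c \<in> trivs (bundleF S)" "chartE S c \<in> atlasE S"
proof -
  show p: "xpart c \<in> atlasM S" "ypart c \<in> trivs (bundleE S)" "tpart c \<in> trivs (bundleF S)"
    using assms by (auto simp: local_charts_def xpart_def ypart_def tpart_def)
  show "chartE S c \<in> atlasE S" unfolding atlasE_def using p by blast
qed

lemma dom_E_parts:
  assumes "v \<in> dom_E S c"
  shows "\<pi> v \<in> fst (xpart c)" "\<pi> v \<in> fst (ypart c)" "h (\<pi> v) \<in> fst (tpart c)" "v \<in> fst (chartE S c)"
  using assms by (auto simp: dom_E_def base_dom_def total_chart_simps)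

lemma open_dom_E:
  assumes "c \<in> charts" shows "open (dom_E S c)"
proof -
  have "open (h -` fst (tpart c))"
    using open_vimage[OF N.open_triv[OF local_chart_parts(3)[OF assms]], of h] smooth_h by (auto simp: smooth_map_def)
  then show ?thesis unfolding dom_E_def base_dom_def
    by (intro open_vimage[OF _ continuous_\<pi>] open_Int M.open_chart_dom M.open_triv local_chart_parts assms)
qed

lemma eventually_dom_E: "c \<in> charts \<Longrightarrow> v \<in> dom_E S c \<Longrightarrow> \<forall>\<^sub>F v' in nhds v. v' \<in> dom_E S c"
  using open_dom_E eventually_nhds_in_open by blast

lemma local_chart_at: obtains c where "c \<in> charts" "v \<in> dom_E S c"
proof -
  obtain d where "d \<in> atlasM S" "\<pi> v \<in> fst d" by (rule M.chart_at)
  moreover obtain t where "t \<in> trivs (bundleE S)" "\<pi> v \<in> fst t" by (rule M.triv_at)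
  moreover obtain s where "s \<in> trivs (bundleF S)" "h (\<pi> v) \<in> fst s" by (rule N.triv_at)
  ultimately show ?thesis using that[of "(d, t, s)"]
    by (simp add: local_charts_def dom_E_def base_dom_def xpart_def ypart_def tpart_def)
qed

lemma smooth_y_coord: "c \<in> charts \<Longrightarrow> v \<in> dom_E S c \<Longrightarrow> smooth v (\<lambda>v. snd (ypart c) v $ a)"
  using E.smooth_near_coord[OF local_chart_parts(4) dom_E_parts(4) bounded_linear_compose[OF bounded_linear_vec_nth bounded_linear_snd], of c v a]
  by (simp add: total_chart_simps)

lemma E_tangent_coord:
  assumes "w \<in> TE v" "c \<in> charts" "v \<in> dom_E S c"
  shows "w = coord_vec (atlasE S) (chartE S c) v
    (\<chi> i. w (\<lambda>v. snd (xpart c) (\<pi> v) $ i), \<chi> a. w (\<lambda>v. snd (ypart c) v $ a))"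
proof -
  note ce = local_chart_parts(4)[OF assms(2)] dom_E_parts(4)[OF assms(3)]
  obtain \<xi> where \<xi>: "w = coord_vec (atlasE S) (chartE S c) v \<xi>" using E.tangent_in_chart[OF assms(1) ce] by blast
  have "w (\<lambda>v. snd (xpart c) (\<pi> v) $ i) = fst \<xi> $ i" for i
    using E.coord_vec_chart_function[OF ce bounded_linear_compose[OF bounded_linear_vec_nth bounded_linear_fst]] \<xi>
    by (simp add: total_chart_simps)
  moreover have "w (\<lambda>v. snd (ypart c) v $ a) = snd \<xi> $ a" for a
    using E.coord_vec_chart_function[OF ce bounded_linear_compose[OF bounded_linear_vec_nth bounded_linear_snd]] \<xi>
    by (simp add: total_chart_simps)
  ultimately show ?thesis using \<xi> by (simp add: vec_lambda_eta)
qed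

lemma coord_vec_y: "c \<in> charts \<Longrightarrow> v \<in> dom_E S c \<Longrightarrow>
    coord_vec (atlasE S) (chartE S c) v \<xi> (\<lambda>v. snd (ypart c) v $ a) = snd \<xi> $ a"
  using E.coord_vec_chart_function[OF local_chart_parts(4) dom_E_parts(4) bounded_linear_compose[OF bounded_linear_vec_nth bounded_linear_snd], of c v]
  by (simp add: total_chart_simps)

lemma coord_vec_\<pi>:
  assumes "c \<in> charts" "v \<in> dom_E S c" "smooth_near (atlasM S) (\<pi> v) f"
  shows "coord_vec (atlasE S) (chartE S c) v \<xi> (\<lambda>v. f (\<pi> v)) = coord_vec (atlasM S) (xpart c) (\<pi> v) (fst \<xi>) f"
proof (rule E.coord_vec_eqI[OF local_chart_parts(4)[OF assms(1)] dom_E_parts(4)[OF assms(2)] smooth_\<pi>[OF assms(3)]])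
  let ?D = "\<lambda>\<zeta>. coord_vec (atlasM S) (xpart c) (\<pi> v) \<zeta> f"
  have "((f \<circ> chart_inv (xpart c)) has_derivative ?D) (at (fst (snd (chartE S c) v)))"
    using M.coord_vec_has_derivative[OF local_chart_parts(1)[OF assms(1)] dom_E_parts(1)[OF assms(2)] assms(3)]
    by (simp add: total_chart_simps)
  then have "((\<lambda>p. (f \<circ> chart_inv (xpart c)) (fst p)) has_derivative (\<lambda>\<xi>. ?D (fst \<xi>))) (at (snd (chartE S c) v))"
    by (rule has_derivative_compose[OF has_derivative_fst[OF has_derivative_ident]])
  then show "((\<lambda>v. f (\<pi> v)) \<circ> chart_inv (chartE S c) has_derivative (\<lambda>\<xi>. ?D (fst \<xi>))) (at (snd (chartE S c) v))"
  proof (rule has_derivative_transform_within_open[OF _ E.open_chart_image[OF local_chart_parts(4)[OF assms(1)]]])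
    show "snd (chartE S c) v \<in> snd (chartE S c) ` fst (chartE S c)" using dom_E_parts(4)[OF assms(2)] by blast
    fix p assume "p \<in> snd (chartE S c) ` fst (chartE S c)"
    then obtain u where u: "u \<in> fst (chartE S c)" "p = snd (chartE S c) u" by blast
    then show "(f \<circ> chart_inv (xpart c)) (fst p) = ((\<lambda>v. f (\<pi> v)) \<circ> chart_inv (chartE S c)) p"
      using E.chart_inv_left[OF local_chart_parts(4)[OF assms(1)] u(1)] local_chart_parts(1)[OF assms(1)]
      by (simp add: total_chart_simps)
  qed
qed

subsection \<open>Fibres\<close>

lemma rho_at_eq:
  assumes "c \<in> charts" "v \<in> dom_E S c"
  shows "rho_at S c i \<alpha> v = \<rho> (\<tau> (tpart c) \<alpha> (h (\<pi> v))) (\<lambda>x. snd (xpart c) x $ i)"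
  by (rule rho_comp_eq) (use assms dom_E_parts[OF assms(2)] in auto)

text \<open>A description of the fibres that does not mention charts: a pair belongs to the fibre if its two components
  have the same image in \<open>TM\<close>, under \<open>\<rho>\<close> and under the differential of \<open>\<pi>\<close>.\<close>

definition gte_vector :: "'e \<Rightarrow> ('f, 'e) gte \<Rightarrow> bool" where
  "gte_vector v X \<longleftrightarrow> proj (bundleF S) (fst X) = h (\<pi> v) \<and> snd X \<in> TE v \<and>
    (\<forall>f. smooth_near (atlasM S) (\<pi> v) f \<longrightarrow> snd X (\<lambda>v. f (\<pi> v)) = \<rho> (fst X) f)"

lemma natural_vec_parts:
  assumes "c \<in> charts" "v \<in> dom_E S c"
  shows gte_vector_natural_vec: "gte_vector v (natural_vec S c v Z Y)"
    and "snd (tpart c) (fst (natural_vec S c v Z Y)) = Z"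
    and "Y_coord c a (natural_vec S c v Z Y) = Y $ a"
proof -
  note t = local_chart_parts(3)[OF assms(1)] dom_E_parts(3)[OF assms(2)]
  note x = local_chart_parts(1)[OF assms(1)] dom_E_parts(1)[OF assms(2)]
  let ?z = "fib_elt (bundleF S) (tpart c) (h (\<pi> v)) Z"
  have pz: "proj (bundleF S) ?z = h (\<pi> v)" using N.proj_fib_elt[OF t] .
  have R: "(\<Sum>\<alpha>\<in>UNIV. Z $ \<alpha> * rho_at S c i \<alpha> v) = \<rho> ?z (\<lambda>x. snd (xpart c) x $ i)" for i
    using \<rho>_frame_expansion[OF t, of Z] by (simp add: rho_at_eq[OF assms])
  have \<rho>z: "\<rho> ?z \<in> tangent_space (atlasM S) (\<pi> v)" using \<rho>_tangent[of ?z] pz by simp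
  show "gte_vector v (natural_vec S c v Z Y)"
    unfolding gte_vector_def natural_vec_def fst_conv snd_conv R
  proof (intro conjI allI impI pz)
    show "coord_vec (atlasE S) (chartE S c) v (\<chi> i. \<rho> ?z (\<lambda>x. snd (xpart c) x $ i), Y) \<in> TE v"
      using E.coord_vec_in_tangent_space local_chart_parts(4)[OF assms(1)] dom_E_parts(4)[OF assms(2)] by blast
    fix f :: "'a \<Rightarrow> real" assume f: "smooth_near (atlasM S) (\<pi> v) f"
    show "coord_vec (atlasE S) (chartE S c) v (\<chi> i. \<rho> ?z (\<lambda>x. snd (xpart c) x $ i), Y) (\<lambda>v. f (\<pi> v)) = \<rho> ?z f"
      using coord_vec_\<pi>[OF assms f] tangent_coord_expansion(1)[OF \<rho>z x] by simp
  qed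
  show "snd (tpart c) (fst (natural_vec S c v Z Y)) = Z"
    using N.coord_fib_elt[OF t] by (simp add: natural_vec_def)
  show "Y_coord c a (natural_vec S c v Z Y) = Y $ a"
    using coord_vec_y[OF assms] by (simp add: natural_vec_def Y_coord_def)
qed

lemma natural_vec_coords:
  assumes "c \<in> charts" "v \<in> dom_E S c" "gte_vector v X"
  shows "natural_vec S c v (snd (tpart c) (fst X)) (\<chi> a. Y_coord c a X) = X"
proof -
  note t = local_chart_parts(3)[OF assms(1)] dom_E_parts(3)[OF assms(2)]
  note x = local_chart_parts(1)[OF assms(1)] dom_E_parts(1)[OF assms(2)]
  have X: "proj (bundleF S) (fst X) = h (\<pi> v)" "snd X \<in> TE v"
    "\<And>f. smooth_near (atlasM S) (\<pi> v) f \<Longrightarrow> snd X (\<lambda>v. f (\<pi> v)) = \<rho> (fst X) f"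
    using assms(3) by (auto simp: gte_vector_def)
  have z: "fib_elt (bundleF S) (tpart c) (h (\<pi> v)) (snd (tpart c) (fst X)) = fst X"
    using N.fib_elt_coord[OF t(1), of "fst X"] X(1) t(2) by simp
  have R: "(\<Sum>\<alpha>\<in>UNIV. snd (tpart c) (fst X) $ \<alpha> * rho_at S c i \<alpha> v) = \<rho> (fst X) (\<lambda>x. snd (xpart c) x $ i)" for i
    using \<rho>_frame_expansion[OF t, of "snd (tpart c) (fst X)"] by (simp add: rho_at_eq[OF assms(1,2)] z)
  also have "\<rho> (fst X) (\<lambda>x. snd (xpart c) x $ i) = snd X (\<lambda>v. snd (xpart c) (\<pi> v) $ i)" for i
    by (rule X(3)[symmetric], rule M.smooth_near_coord[OF x bounded_linear_vec_nth])
  finally have "coord_vec (atlasE S) (chartE S c) v (\<chi> i. \<Sum>\<alpha>\<in>UNIV. snd (tpart c) (fst X) $ \<alpha> * rho_at S c i \<alpha> v, \<chi> a. Y_coord c a X) = snd X"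
    using E_tangent_coord[OF X(2) assms(1,2)] by (simp add: Y_coord_def)
  then show ?thesis by (simp add: natural_vec_def z)
qed

lemma gte_fibre_iff: "X \<in> gte_fibre S v \<longleftrightarrow> gte_vector v X"
proof
  show "gte_vector v X" if "X \<in> gte_fibre S v"
    using that gte_vector_natural_vec by (auto simp: gte_fibre_def)
  show "X \<in> gte_fibre S v" if "gte_vector v X"
  proof -
    obtain c where "c \<in> charts" "v \<in> dom_E S c" by (rule local_chart_at)
    then show ?thesis using natural_vec_coords[OF _ _ that, of c, symmetric] unfolding gte_fibre_def by blast
  qed
qed

lemma gte_vectorD:
  assumes "gte_vector v X"
  shows gte_vector_proj: "proj (bundleF S) (fst X) = h (\<pi> v)" and gte_vector_tangent: "snd X \<in> TE v"
    and gte_vector_\<pi>: "smooth_near (atlasM S) (\<pi> v) f \<Longrightarrow> snd X (\<lambda>v. f (\<pi> v)) = \<rho> (fst X) f"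
  using assms by (auto simp: gte_vector_def)

lemma gte_vector_add:
  assumes "gte_vector v X" "gte_vector v X'" shows "gte_vector v (gte_add S X X')"
proof -
  have p: "proj (bundleF S) (fst X) = proj (bundleF S) (fst X')" using assms gte_vector_proj by simp
  show ?thesis
    using assms N.proj_fib_add[OF p] \<rho>_add[OF p] E.tangent_space_add
    by (auto simp: gte_vector_def gte_add_def)
qed

lemma gte_vector_scale: "gte_vector v X \<Longrightarrow> gte_vector v (gte_scale S k X)"
  using N.proj_fib_scale \<rho>_scale E.tangent_space_scale by (auto simp: gte_vector_def gte_scale_def)

lemma gte_vector_eqI:
  assumes "c \<in> charts" "v \<in> dom_E S c" "gte_vector v X" "gte_vector v X'"
    "snd (tpart c) (fst X) = snd (tpart c) (fst X')" "\<And>a. Y_coord c a X = Y_coord c a X'"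
  shows "X = X'"
proof -
  have "natural_vec S c v (snd (tpart c) (fst X)) (\<chi> a. Y_coord c a X) =
      natural_vec S c v (snd (tpart c) (fst X')) (\<chi> a. Y_coord c a X')"
    by (simp only: assms(5,6))
  then show ?thesis by (simp only: natural_vec_coords[OF assms(1-3)] natural_vec_coords[OF assms(1,2,4)])
qed

lemma coord_gte_add:
  assumes "c \<in> charts" "v \<in> dom_E S c" "gte_vector v X" "gte_vector v X'"
  shows "snd (tpart c) (fst (gte_add S X X')) = snd (tpart c) (fst X) + snd (tpart c) (fst X')"
    and "Y_coord c a (gte_add S X X') = Y_coord c a X + Y_coord c a X'"
proof -
  have p: "proj (bundleF S) (fst X) = proj (bundleF S) (fst X')" using assms gte_vector_proj by simp
  show "snd (tpart c) (fst (gte_add S X X')) = snd (tpart c) (fst X) + snd (tpart c) (fst X')"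
    using N.coord_fib_add[OF p local_chart_parts(3)[OF assms(1)]] dom_E_parts(3)[OF assms(2)] gte_vector_proj[OF assms(3)]
    by (simp add: gte_add_def)
qed (simp add: gte_add_def Y_coord_def)

lemma coord_gte_scale:
  assumes "c \<in> charts" "v \<in> dom_E S c" "gte_vector v X"
  shows "snd (tpart c) (fst (gte_scale S k X)) = k *\<^sub>R snd (tpart c) (fst X)"
    and "Y_coord c a (gte_scale S k X) = k * Y_coord c a X"
  using N.coord_fib_scale[OF local_chart_parts(3)[OF assms(1)]] dom_E_parts(3)[OF assms(2)] gte_vector_proj[OF assms(3)]
  by (simp_all add: gte_scale_def Y_coord_def)

lemma vertical_fibre_iff:
  assumes "c \<in> charts" "v \<in> dom_E S c"
  shows "X \<in> vertical_fibre S v \<longleftrightarrow> gte_vector v X \<and> snd (tpart c) (fst X) = 0"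
proof
  assume "X \<in> vertical_fibre S v"
  then obtain c' Y where c': "c' \<in> charts" "v \<in> dom_E S c'" and X: "X = natural_vec S c' v 0 Y"
    by (auto simp: vertical_fibre_def)
  have g: "gte_vector v X" using gte_vector_natural_vec[OF c'] X by simp
  have "snd (tpart c) (fst X) = N.trans_mat (tpart c') (tpart c) (h (\<pi> v)) *v snd (tpart c') (fst X)"
    using N.trans_mat[OF local_chart_parts(3)[OF c'(1)] local_chart_parts(3)[OF assms(1)]]
      dom_E_parts(3)[OF assms(2)] dom_E_parts(3)[OF c'(2)] gte_vector_proj[OF g] by metis
  then show "gte_vector v X \<and> snd (tpart c) (fst X) = 0"
    using g natural_vec_parts(2)[OF c'] X by simp
next
  assume "gte_vector v X \<and> snd (tpart c) (fst X) = 0"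
  then have "X = natural_vec S c v 0 (\<chi> a. Y_coord c a X)" using natural_vec_coords[OF assms, of X] by simp
  then show "X \<in> vertical_fibre S v" unfolding vertical_fibre_def using assms by blast
qed

lemma conn_facts:
  shows conn_vertical: "gte_vector v X \<Longrightarrow> conn S v X \<in> vertical_fibre S v"
    and conn_add: "gte_vector v X \<Longrightarrow> gte_vector v X' \<Longrightarrow> conn S v (gte_add S X X') = gte_add S (conn S v X) (conn S v X')"
    and conn_scale: "gte_vector v X \<Longrightarrow> conn S v (gte_scale S k X) = gte_scale S k (conn S v X)"
    and conn_id: "X \<in> vertical_fibre S v \<Longrightarrow> conn S v X = X"
    and Gam_msmooth: "c \<in> charts \<Longrightarrow> msmooth_on (atlasE S) (dom_E S c) (Gam S c a \<gamma>)"
  using setting_unfolded(8) unfolding rho_eta_connection_def by (auto simp: gte_fibre_iff)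

lemma conn_gte_vector: "gte_vector v X \<Longrightarrow> gte_vector v (conn S v X)"
  using conn_vertical vertical_fibre_iff local_chart_at by metis

lemma natural_vec_linear:
  assumes "c \<in> charts" "v \<in> dom_E S c"
  shows "natural_vec S c v (Z + Z') (Y + Y') = gte_add S (natural_vec S c v Z Y) (natural_vec S c v Z' Y')"
    and "natural_vec S c v (k *\<^sub>R Z) (k *\<^sub>R Y) = gte_scale S k (natural_vec S c v Z Y)"
  by (rule gte_vector_eqI[OF assms];
    simp add: gte_vector_add gte_vector_scale coord_gte_add[OF assms] coord_gte_scale[OF assms] natural_vec_parts[OF assms])+

text \<open>A vector is the sum of a vertical one, which the connection fixes, and a combination of the first half of
  the natural base, on which the values of the connection are the functions \<open>\<Gamma>\<close>.\<close>

lemma Y_coord_conn: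
  assumes "c \<in> charts" "v \<in> dom_E S c" "gte_vector v X"
  shows "Y_coord c a (conn S v X) = Y_coord c a X + (\<Sum>\<gamma>\<in>UNIV. Gam S c a \<gamma> v * snd (tpart c) (fst X) $ \<gamma>)"
proof -
  note np = natural_vec_parts[OF assms(1,2)]
  let ?Z = "snd (tpart c) (fst X)" and ?Y = "\<chi> a. Y_coord c a X"
  let ?l = "\<lambda>Z. Y_coord c a (conn S v (natural_vec S c v Z 0))"
  have lin: "linear ?l"
  proof (rule linearI)
    show "?l (Z + Z') = ?l Z + ?l Z'" for Z Z'
      using natural_vec_linear(1)[OF assms(1,2), of Z Z' 0 0] conn_add[OF np(1) np(1)]
        coord_gte_add(2)[OF assms(1,2) conn_gte_vector[OF np(1)] conn_gte_vector[OF np(1)]] by simp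
    show "?l (k *\<^sub>R Z) = k *\<^sub>R ?l Z" for k Z
      using natural_vec_linear(2)[OF assms(1,2), of k Z 0] conn_scale[OF np(1)]
        coord_gte_scale(2)[OF assms(1,2) conn_gte_vector[OF np(1)]] by simp
  qed
  have "natural_vec S c v 0 ?Y \<in> vertical_fibre S v" using vertical_fibre_iff[OF assms(1,2)] np by simp
  then have "conn S v X = gte_add S (conn S v (natural_vec S c v ?Z 0)) (natural_vec S c v 0 ?Y)"
    using natural_vec_coords[OF assms] natural_vec_linear(1)[OF assms(1,2), of ?Z 0 0 ?Y]
      conn_add[OF np(1) np(1), of ?Z 0 0 ?Y] conn_id by simp
  then have "Y_coord c a (conn S v X) = ?l ?Z + Y_coord c a X"
    using coord_gte_add(2)[OF assms(1,2) conn_gte_vector[OF np(1)] np(1)] np(3) by simp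
  also have "?l ?Z = ?l (\<Sum>\<gamma>\<in>UNIV. ?Z $ \<gamma> *\<^sub>R axis \<gamma> 1)"
    by (simp add: basis_expansion scalar_mult_eq_scaleR[symmetric])
  also have "\<dots> = (\<Sum>\<gamma>\<in>UNIV. Gam S c a \<gamma> v * ?Z $ \<gamma>)"
    unfolding linear_sum[OF lin] linear_scale[OF lin] by (simp add: Gam_def mult.commute)
  finally show ?thesis by simp
qed

subsection \<open>Adapted coordinates\<close>

lemma sum_UNIV_Plus: "(\<Sum>A\<in>UNIV. f A) = (\<Sum>\<alpha>\<in>UNIV. f (Inl \<alpha>)) + (\<Sum>a\<in>UNIV. f (Inr a))"
  for f :: "'x::finite + 'y::finite \<Rightarrow> 'z::comm_monoid_add"
  using sum.Plus[of "UNIV :: 'x set" "UNIV :: 'y set" f] by simp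

text \<open>Coordinates in the adapted frame. Both halves of the frame are indexed by one sum type, so that changes of
  frame and connections are single matrices.\<close>

definition acoord where "acoord c v X = (\<chi> A. coframe S c v A X)"

definition avec where "avec c v \<xi> = adapted_vec S c v (\<chi> \<alpha>. \<xi> $ Inl \<alpha>) (\<chi> a. \<xi> $ Inr a)"

lemma acoord_nth:
  assumes "c \<in> charts" "v \<in> dom_E S c" "gte_vector v X"
  shows "acoord c v X $ Inl \<alpha> = snd (tpart c) (fst X) $ \<alpha>"
    and "acoord c v X $ Inr a = Y_coord c a (conn S v X)"
  using assms by (simp_all add: acoord_def coframe_def dz_def deltay_def gte_fibre_iff Z_coord_def Y_coord_conn)

lemma avec_gte_vector: "c \<in> charts \<Longrightarrow> v \<in> dom_E S c \<Longrightarrow> gte_vector v (avec c v \<xi>)"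
  by (simp add: avec_def adapted_vec_def natural_vec_parts)

lemma acoord_avec:
  assumes "c \<in> charts" "v \<in> dom_E S c" shows "acoord c v (avec c v \<xi>) = \<xi>"
proof -
  have "acoord c v (avec c v \<xi>) $ A = \<xi> $ A" for A
    using acoord_nth[OF assms avec_gte_vector[OF assms]] Y_coord_conn[OF assms avec_gte_vector[OF assms]]
    by (cases A) (simp_all add: avec_def adapted_vec_def natural_vec_parts[OF assms])
  then show ?thesis by (simp add: vec_eq_iff)
qed

lemma acoord_inj:
  assumes "c \<in> charts" "v \<in> dom_E S c" "gte_vector v X" "gte_vector v X'" "acoord c v X = acoord c v X'"
  shows "X = X'"
proof -
  have Z: "snd (tpart c) (fst X) $ \<alpha> = snd (tpart c) (fst X') $ \<alpha>" for \<alpha>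
    using acoord_nth(1)[OF assms(1-3)] acoord_nth(1)[OF assms(1,2,4)] assms(5) by metis
  have "Y_coord c a (conn S v X) = Y_coord c a (conn S v X')" for a
    using acoord_nth(2)[OF assms(1-3)] acoord_nth(2)[OF assms(1,2,4)] assms(5) by metis
  then have "Y_coord c a X = Y_coord c a X'" for a
    using Y_coord_conn[OF assms(1-3)] Y_coord_conn[OF assms(1,2,4)] Z by simp
  then show ?thesis using gte_vector_eqI[OF assms(1-4)] Z by (simp add: vec_eq_iff)
qed

lemma avec_acoord: "c \<in> charts \<Longrightarrow> v \<in> dom_E S c \<Longrightarrow> gte_vector v X \<Longrightarrow> avec c v (acoord c v X) = X"
  using acoord_inj avec_gte_vector acoord_avec by metis

lemma acoord_add:
  assumes "c \<in> charts" "v \<in> dom_E S c" "gte_vector v X" "gte_vector v X'"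
  shows "acoord c v (gte_add S X X') = acoord c v X + acoord c v X'"
proof -
  have "acoord c v (gte_add S X X') $ A = (acoord c v X + acoord c v X') $ A" for A
    using acoord_nth[OF assms(1,2)] assms gte_vector_add conn_add conn_gte_vector coord_gte_add[OF assms(1,2)]
    by (cases A) simp_all
  then show ?thesis by (simp add: vec_eq_iff)
qed

lemma acoord_scale:
  assumes "c \<in> charts" "v \<in> dom_E S c" "gte_vector v X"
  shows "acoord c v (gte_scale S k X) = k *\<^sub>R acoord c v X"
proof -
  have "acoord c v (gte_scale S k X) $ A = (k *\<^sub>R acoord c v X) $ A" for A
    using acoord_nth[OF assms(1,2)] assms gte_vector_scale conn_scale conn_gte_vector coord_gte_scale[OF assms(1,2)]
    by (cases A) simp_all
  then show ?thesis by (simp add: vec_eq_iff)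
qed

lemma avec_add: "c \<in> charts \<Longrightarrow> v \<in> dom_E S c \<Longrightarrow> avec c v (\<xi> + \<zeta>) = gte_add S (avec c v \<xi>) (avec c v \<zeta>)"
  by (rule acoord_inj, assumption, assumption) (simp_all add: avec_gte_vector gte_vector_add acoord_add acoord_avec)

lemma avec_scale: "c \<in> charts \<Longrightarrow> v \<in> dom_E S c \<Longrightarrow> avec c v (k *\<^sub>R \<xi>) = gte_scale S k (avec c v \<xi>)"
  by (rule acoord_inj, assumption, assumption) (simp_all add: avec_gte_vector gte_vector_scale acoord_scale acoord_avec)

lemma frame_avec: "frame S c v A = avec c v (axis A 1)"
  by (cases A) (simp_all add: frame_def avec_def axis_def zero_vec_def)

lemma vertical_acoord:
  assumes "c \<in> charts" "v \<in> dom_E S c"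
  shows "X \<in> vertical_fibre S v \<longleftrightarrow> gte_vector v X \<and> (\<forall>\<alpha>. acoord c v X $ Inl \<alpha> = 0)"
  by (cases "gte_vector v X") (simp_all add: vertical_fibre_iff[OF assms] acoord_nth(1)[OF assms] vec_eq_iff)

lemma horizontal_acoord:
  assumes "c \<in> charts" "v \<in> dom_E S c"
  shows "X \<in> horizontal_fibre S v \<longleftrightarrow> gte_vector v X \<and> (\<forall>a. acoord c v X $ Inr a = 0)"
proof (cases "gte_vector v X")
  case True
  have "conn S v X \<in> vertical_fibre S v" using conn_vertical[OF True] .
  then have z: "snd (tpart c) (fst (conn S v X)) = 0" using vertical_fibre_iff[OF assms] by blast
  have "conn S v X = gte_scale S 0 X \<longleftrightarrow> (\<forall>a. Y_coord c a (conn S v X) = 0)"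
    using gte_vector_eqI[OF assms conn_gte_vector[OF True] gte_vector_scale[OF True, of 0]]
      coord_gte_scale[OF assms True, where k = 0] z by force
  then show ?thesis using True acoord_nth(2)[OF assms True] by (simp add: horizontal_fibre_def gte_fibre_iff)
qed (simp add: horizontal_fibre_def gte_fibre_iff)

text \<open>The matrix of the change of adapted frames is block diagonal and depends on the base point only.\<close>

definition trH where "trH c c' v = N.trans_mat (tpart c) (tpart c') (h (\<pi> v))"
definition trV where "trV c c' v = M.trans_mat (ypart c) (ypart c') (\<pi> v)"

definition blockm :: "real ^ 'p ^ 'p \<Rightarrow> real ^ 'r ^ 'r \<Rightarrow> real ^ ('p + 'r) ^ ('p + 'r)" where
  "blockm P Q = (\<chi> A B. case A of
     Inl \<alpha> \<Rightarrow> (case B of Inl \<beta> \<Rightarrow> P $ \<alpha> $ \<beta> | Inr b \<Rightarrow> 0)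
   | Inr a \<Rightarrow> (case B of Inl \<beta> \<Rightarrow> 0 | Inr b \<Rightarrow> Q $ a $ b))"

lemma blockm_nth [simp]:
  "blockm P Q $ Inl \<alpha> $ Inl \<beta> = P $ \<alpha> $ \<beta>" "blockm P Q $ Inr a $ Inr b = Q $ a $ b"
  "blockm P Q $ Inl \<alpha> $ Inr b = 0" "blockm P Q $ Inr a $ Inl \<beta> = 0"
  by (simp_all add: blockm_def)

lemma blockm_mult: "blockm P Q ** blockm P' Q' = blockm (P ** P') (Q ** Q')"
proof -
  have "(blockm P Q ** blockm P' Q') $ A $ B = blockm (P ** P') (Q ** Q') $ A $ B" for A B
    by (cases A; cases B) (simp_all add: matrix_matrix_mult_def sum_UNIV_Plus)
  then show ?thesis by (simp add: vec_eq_iff)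
qed

lemma blockm_one: "blockm (mat 1) (mat 1) = mat 1"
proof -
  have "blockm (mat 1) (mat 1) $ A $ B = (mat 1 :: real ^ ('p + 'r) ^ ('p + 'r)) $ A $ B" for A B
    by (cases A; cases B) (simp_all add: mat_def)
  then show ?thesis by (simp add: vec_eq_iff)
qed

definition tr where "tr c c' v = blockm (trH c c' v) (trV c c' v)"

lemma tr_inverse:
  assumes "c \<in> charts" "v \<in> dom_E S c" "c' \<in> charts" "v \<in> dom_E S c'"
  shows trH_inverse: "trH c' c v ** trH c c' v = mat 1" and trV_inverse: "trV c' c v ** trV c c' v = mat 1"
    and tr_inverse': "tr c' c v ** tr c c' v = mat 1"
proof -
  show H: "trH c' c v ** trH c c' v = mat 1"
    unfolding trH_def by (rule N.trans_mat_inverse) (use assms local_chart_parts dom_E_parts in auto)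
  show V: "trV c' c v ** trV c c' v = mat 1"
    unfolding trV_def by (rule M.trans_mat_inverse) (use assms local_chart_parts dom_E_parts in auto)
  show "tr c' c v ** tr c c' v = mat 1" by (simp add: tr_def blockm_mult H V blockm_one)
qed

lemma tr_smooth:
  assumes "c \<in> charts" "v \<in> dom_E S c" "c' \<in> charts" "v \<in> dom_E S c'"
  shows trH_smooth: "smooth v (\<lambda>v. trH c c' v $ \<alpha> $ \<beta>)" and trV_smooth: "smooth v (\<lambda>v. trV c c' v $ a $ b)"
    and tr_smooth': "smooth v (\<lambda>v. tr c c' v $ A $ B)"
proof -
  show H: "smooth v (\<lambda>v. trH c c' v $ \<alpha> $ \<beta>)" for \<alpha> \<beta>
    unfolding trH_def by (rule smooth_h\<pi>, rule N.trans_mat_smooth) (use assms local_chart_parts dom_E_parts in auto)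
  show V: "smooth v (\<lambda>v. trV c c' v $ a $ b)" for a b
    unfolding trV_def by (rule smooth_\<pi>, rule M.trans_mat_smooth) (use assms local_chart_parts dom_E_parts in auto)
  show "smooth v (\<lambda>v. tr c c' v $ A $ B)"
    by (cases A; cases B) (simp_all add: tr_def H V smooth_near_const)
qed

text \<open>On the vertical part this is Leibniz' rule for \<open>y'\<^sup>a = \<Lambda>\<^sup>a\<^sub>b(x) y\<^sup>b\<close>: vertical vectors do not
  differentiate functions of \<open>x\<close>.\<close>

lemma acoord_change:
  assumes "c \<in> charts" "v \<in> dom_E S c" "c' \<in> charts" "v \<in> dom_E S c'" "gte_vector v X"
  shows "acoord c' v X = tr c c' v *v acoord c v X"
proof -
  note c = assms(1,2) and c' = assms(3,4) and X = assms(5)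
  have H: "acoord c' v X $ Inl \<alpha> = (tr c c' v *v acoord c v X) $ Inl \<alpha>" for \<alpha>
    using N.trans_mat[OF local_chart_parts(3)[OF c(1)] local_chart_parts(3)[OF c'(1)], of "fst X"]
      gte_vector_proj[OF X] dom_E_parts(3)[OF c(2)] dom_E_parts(3)[OF c'(2)]
    by (simp add: acoord_nth[OF c X] acoord_nth[OF c' X] matrix_vector_mult_def sum_UNIV_Plus tr_def trH_def)
  let ?W = "conn S v X" and ?\<Lambda> = "M.trans_mat (ypart c) (ypart c')"
  have W: "gte_vector v ?W" "snd (tpart c) (fst ?W) = 0"
    using conn_vertical[OF X] vertical_fibre_iff[OF c] by auto
  note wt = gte_vector_tangent[OF W(1)]
  have zero: "\<rho> (fst ?W) f = 0" for f
    using \<rho>_frame_expansion[OF local_chart_parts(3)[OF c(1)], of "h (\<pi> v)" 0]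
      N.fib_elt_coord[OF local_chart_parts(3)[OF c(1)], of "fst ?W"] W(2) gte_vector_proj[OF W(1)] dom_E_parts(3)[OF c(2)] by simp
  have sm\<Lambda>: "smooth_near (atlasM S) (\<pi> v) (\<lambda>x. ?\<Lambda> x $ a $ b)" for a b
    by (rule M.trans_mat_smooth) (use c c' local_chart_parts dom_E_parts in auto)
  have V: "acoord c' v X $ Inr a = (tr c c' v *v acoord c v X) $ Inr a" for a
  proof -
    have "near v (\<lambda>v. snd (ypart c') v $ a) (\<lambda>v. \<Sum>b\<in>UNIV. ?\<Lambda> (\<pi> v) $ a $ b * snd (ypart c) v $ b)"
      unfolding near_def using eventually_dom_E[OF c] eventually_dom_E[OF c']
    proof eventually_elim
      case (elim u)
      then show ?case
        using M.trans_mat[OF local_chart_parts(2)[OF c(1)] local_chart_parts(2)[OF c'(1)] dom_E_parts(2)[OF elim(1)] dom_E_parts(2)[OF elim(2)]]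
        by (simp add: matrix_vector_mult_def)
    qed
    then have "Y_coord c' a ?W = snd ?W (\<lambda>v. \<Sum>b\<in>UNIV. ?\<Lambda> (\<pi> v) $ a $ b * snd (ypart c) v $ b)"
      unfolding Y_coord_def by (rule E.tangent_cong[OF wt])
    also have "\<dots> = (\<Sum>b\<in>UNIV. snd ?W (\<lambda>v. ?\<Lambda> (\<pi> v) $ a $ b * snd (ypart c) v $ b))"
      by (intro E.tangent_sum[OF wt] E.smooth_near_mult smooth_\<pi>[OF sm\<Lambda>] smooth_y_coord[OF c])
    also have "\<dots> = (\<Sum>b\<in>UNIV. ?\<Lambda> (\<pi> v) $ a $ b * Y_coord c b ?W)"
      by (intro sum.cong refl)
        (simp add: E.tangent_mult[OF wt smooth_\<pi>[OF sm\<Lambda>] smooth_y_coord[OF c]] gte_vector_\<pi>[OF W(1) sm\<Lambda>] zero Y_coord_def)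
    finally show ?thesis
      by (simp add: acoord_nth[OF c X] acoord_nth[OF c' X] matrix_vector_mult_def sum_UNIV_Plus tr_def trV_def)
  qed
  have "acoord c' v X $ A = (tr c c' v *v acoord c v X) $ A" for A by (cases A) (simp_all only: H V)
  then show ?thesis by (simp add: vec_eq_iff)
qed

lemma avec_change:
  assumes "c \<in> charts" "v \<in> dom_E S c" "c' \<in> charts" "v \<in> dom_E S c'"
  shows "avec c v \<xi> = avec c' v (tr c c' v *v \<xi>)"
  using avec_acoord[OF assms(3,4) avec_gte_vector[OF assms(1,2)]] acoord_change[OF assms avec_gte_vector[OF assms(1,2)]]
    acoord_avec[OF assms(1,2)] by metis

subsection \<open>Sections and derivatives along them\<close>

lemma Gam_smooth: "c \<in> charts \<Longrightarrow> v \<in> dom_E S c \<Longrightarrow> smooth v (Gam S c a \<gamma>)"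
  using Gam_msmooth E.msmooth_on_iff[OF open_dom_E] by blast

lemma rho_at_smooth:
  assumes "c \<in> charts" "v \<in> dom_E S c" shows "smooth v (\<lambda>v. rho_at S c i \<alpha> v)"
proof -
  have "smooth v (\<lambda>v. \<rho> (\<tau> (tpart c) \<alpha> (h (\<pi> v))) (\<lambda>x. snd (xpart c) x $ i))"
    by (rule smooth_h\<pi>, rule \<rho>_frame_smooth) (use assms local_chart_parts dom_E_parts in auto)
  moreover have "near v (\<lambda>v. \<rho> (\<tau> (tpart c) \<alpha> (h (\<pi> v))) (\<lambda>x. snd (xpart c) x $ i)) (\<lambda>v. rho_at S c i \<alpha> v)"
    unfolding near_def using eventually_dom_E[OF assms] by eventually_elim (simp add: rho_at_eq[OF assms(1)])
  ultimately show ?thesis using E.smooth_near_cong by blast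
qed

lemma natural_vec_deriv:
  assumes "c \<in> charts" "v \<in> dom_E S c"
  shows "snd (natural_vec S c v Z Y) f =
    (\<Sum>i\<in>UNIV. (\<Sum>\<alpha>\<in>UNIV. Z $ \<alpha> * rho_at S c i \<alpha> v) * dx S c i f v) + (\<Sum>a\<in>UNIV. Y $ a * dy S c a f v)"
proof -
  note lin = E.coord_vec_linear[OF local_chart_parts(4)[OF assms(1)] dom_E_parts(4)[OF assms(2)], of f]
  define x where "x = (\<chi> i. \<Sum>\<alpha>\<in>UNIV. Z $ \<alpha> * rho_at S c i \<alpha> v)"
  have "(x, Y) = (\<Sum>i\<in>UNIV. x $ i *\<^sub>R (axis i 1, 0)) + (\<Sum>a\<in>UNIV. Y $ a *\<^sub>R (0, axis a 1))"
    by (simp add: prod_eq_iff fst_sum snd_sum basis_expansion scalar_mult_eq_scaleR[symmetric])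
  then have "coord_vec (atlasE S) (chartE S c) v (x, Y) f =
      (\<Sum>i\<in>UNIV. x $ i *\<^sub>R coord_vec (atlasE S) (chartE S c) v (axis i 1, 0) f) +
      (\<Sum>a\<in>UNIV. Y $ a *\<^sub>R coord_vec (atlasE S) (chartE S c) v (0, axis a 1) f)"
    by (simp only: linear_add[OF lin] linear_sum[OF lin] linear_scale[OF lin])
  then show ?thesis by (simp add: natural_vec_def dx_def dy_def x_def)
qed

lemma dx_smooth: "c \<in> charts \<Longrightarrow> v \<in> dom_E S c \<Longrightarrow> smooth v f \<Longrightarrow> smooth v (\<lambda>v. dx S c i f v)"
  and dy_smooth: "c \<in> charts \<Longrightarrow> v \<in> dom_E S c \<Longrightarrow> smooth v f \<Longrightarrow> smooth v (\<lambda>v. dy S c a f v)"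
  unfolding dx_def dy_def
  by (rule E.smooth_near_coord_vec[OF local_chart_parts(4) dom_E_parts(4)]; assumption)+

lemma avec_deriv_smooth:
  assumes "c \<in> charts" "v \<in> dom_E S c" "\<And>A. smooth v (\<lambda>v. \<xi> v $ A)" "smooth v f"
  shows "smooth v (\<lambda>v. snd (avec c v (\<xi> v)) f)"
proof -
  let ?g = "\<lambda>v. (\<Sum>i\<in>UNIV. (\<Sum>\<alpha>\<in>UNIV. \<xi> v $ Inl \<alpha> * rho_at S c i \<alpha> v) * dx S c i f v) +
    (\<Sum>a\<in>UNIV. (\<xi> v $ Inr a - (\<Sum>\<gamma>\<in>UNIV. Gam S c a \<gamma> v * \<xi> v $ Inl \<gamma>)) * dy S c a f v)"
  have "smooth v ?g"
    by (intro E.smooth_near_add E.smooth_near_sum E.smooth_near_mult E.smooth_near_diff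
        assms(3) rho_at_smooth dx_smooth dy_smooth Gam_smooth assms(1,2,4))
  moreover have "near v ?g (\<lambda>v. snd (avec c v (\<xi> v)) f)"
    unfolding near_def using eventually_dom_E[OF assms(1,2)]
    by eventually_elim (simp add: avec_def adapted_vec_def natural_vec_deriv[OF assms(1)])
  ultimately show ?thesis using E.smooth_near_cong by blast
qed

text \<open>Natural and adapted coordinates differ by \<open>\<Gamma>\<^sup>a\<^sub>\<gamma> Z\<^sup>\<gamma>\<close>, and \<open>\<Gamma>\<close> is smooth.\<close>

lemma gte_sections_iff:
  "X \<in> gte_sections S \<longleftrightarrow> (\<forall>v. gte_vector v (X v)) \<and>
    (\<forall>c\<in>charts. \<forall>v\<in>dom_E S c. \<forall>A. smooth v (\<lambda>v. acoord c v (X v) $ A))"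
proof -
  have *: "((\<forall>\<alpha>. msmooth_on (atlasE S) (dom_E S c) (\<lambda>v. Z_coord c \<alpha> (X v))) \<and>
        (\<forall>a. msmooth_on (atlasE S) (dom_E S c) (\<lambda>v. Y_coord c a (X v)))) \<longleftrightarrow>
      (\<forall>v\<in>dom_E S c. \<forall>A. smooth v (\<lambda>v. acoord c v (X v) $ A))"
    if X: "\<forall>v. gte_vector v (X v)" and c: "c \<in> charts" for c
  proof -
    have nZ: "near v (\<lambda>v. acoord c v (X v) $ Inl \<alpha>) (\<lambda>v. Z_coord c \<alpha> (X v))" if "v \<in> dom_E S c" for v \<alpha>
      unfolding near_def using eventually_dom_E[OF c that]
      by eventually_elim (simp add: acoord_nth[OF c] X Z_coord_def)
    have nY: "near v (\<lambda>v. acoord c v (X v) $ Inr a)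
        (\<lambda>v. Y_coord c a (X v) + (\<Sum>\<gamma>\<in>UNIV. Gam S c a \<gamma> v * Z_coord c \<gamma> (X v)))" if "v \<in> dom_E S c" for v a
      unfolding near_def using eventually_dom_E[OF c that]
      by eventually_elim (simp add: acoord_nth[OF c] X Z_coord_def Y_coord_conn[OF c])
    have Z: "smooth v (\<lambda>v. acoord c v (X v) $ Inl \<alpha>) \<longleftrightarrow> smooth v (\<lambda>v. Z_coord c \<alpha> (X v))"
      if "v \<in> dom_E S c" for v \<alpha>
      by (rule E.smooth_near_cong_iff[OF nZ[OF that]])
    have Y: "smooth v (\<lambda>v. acoord c v (X v) $ Inr a) \<longleftrightarrow> smooth v (\<lambda>v. Y_coord c a (X v))"
      if v: "v \<in> dom_E S c" and z: "\<And>\<alpha>. smooth v (\<lambda>v. Z_coord c \<alpha> (X v))" for v a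
    proof -
      have s: "smooth v (\<lambda>v. \<Sum>\<gamma>\<in>UNIV. Gam S c a \<gamma> v * Z_coord c \<gamma> (X v))"
        by (intro E.smooth_near_sum E.smooth_near_mult Gam_smooth c v z)
      have "smooth v (\<lambda>v. acoord c v (X v) $ Inr a) \<longleftrightarrow>
        smooth v (\<lambda>v. Y_coord c a (X v) + (\<Sum>\<gamma>\<in>UNIV. Gam S c a \<gamma> v * Z_coord c \<gamma> (X v)))"
        by (rule E.smooth_near_cong_iff[OF nY[OF v]])
      also have "\<dots> \<longleftrightarrow> smooth v (\<lambda>v. Y_coord c a (X v))"
        using E.smooth_near_add[OF _ s] E.smooth_near_diff[OF _ s] by fastforce
      finally show ?thesis .
    qed
    have split: "(\<forall>A. smooth v (\<lambda>v. acoord c v (X v) $ A)) \<longleftrightarrow>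
      (\<forall>\<alpha>. smooth v (\<lambda>v. acoord c v (X v) $ Inl \<alpha>)) \<and> (\<forall>a. smooth v (\<lambda>v. acoord c v (X v) $ Inr a))" for v
      by (metis sum.exhaust)
    show ?thesis
      unfolding E.msmooth_on_iff[OF open_dom_E[OF c]] split
      using Z Y by blast
  qed
  show ?thesis unfolding gte_sections_def mem_Collect_eq gte_fibre_iff using * by blast
qed

lemma gte_sections_vector: "X \<in> gte_sections S \<Longrightarrow> gte_vector v (X v)"
  using gte_sections_iff by blast

lemma gte_sections_smooth:
  "X \<in> gte_sections S \<Longrightarrow> c \<in> charts \<Longrightarrow> v \<in> dom_E S c \<Longrightarrow> smooth v (\<lambda>v. acoord c v (X v) $ A)"
  using gte_sections_iff by blast

lemma gte_deriv_smooth: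
  assumes "X \<in> gte_sections S" "smooth v f" shows "smooth v (\<lambda>v. snd (X v) f)"
proof -
  obtain c where c: "c \<in> charts" "v \<in> dom_E S c" by (rule local_chart_at)
  have "near v (\<lambda>v. snd (avec c v (acoord c v (X v))) f) (\<lambda>v. snd (X v) f)"
    unfolding near_def using eventually_dom_E[OF c]
    by eventually_elim (simp add: avec_acoord[OF c(1) _ gte_sections_vector[OF assms(1)]])
  then show ?thesis
    using E.smooth_near_cong avec_deriv_smooth[OF c gte_sections_smooth[OF assms(1) c] assms(2)] by blast
qed

end

section \<open>Multilinear functions of lists\<close>

primrec mlin :: "nat \<Rightarrow> ((real ^ 'n::finite) list \<Rightarrow> real) \<Rightarrow> bool" where
  "mlin 0 P \<longleftrightarrow> True"
| "mlin (Suc n) P \<longleftrightarrow> (\<forall>zs. length zs = n \<longrightarrow> linear (\<lambda>x. P (x # zs))) \<and> (\<forall>x. mlin n (\<lambda>zs. P (x # zs)))"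

lemma mlin_update:
  "mlin n P \<Longrightarrow> i < n \<Longrightarrow> length zs = n \<Longrightarrow> linear (\<lambda>x. P (zs[i := x]))"
proof (induction n arbitrary: P i zs)
  case (Suc n)
  then obtain z zs' where zs: "zs = z # zs'" "length zs' = n" by (metis length_Suc_conv)
  show ?case
  proof (cases i)
    case 0
    then show ?thesis using Suc.prems zs by simp
  next
    case (Suc j)
    then show ?thesis using Suc.IH[of "\<lambda>zs. P (z # zs)" j zs'] Suc.prems zs by simp
  qed
qed simp

lemma mlinI:
  "(\<And>i zs. i < n \<Longrightarrow> length zs = n \<Longrightarrow> linear (\<lambda>x. P (zs[i := x]))) \<Longrightarrow> mlin n P"
proof (induction n arbitrary: P)
  case (Suc n)
  have "linear (\<lambda>x. P (x # zs))" if "length zs = n" for zs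
    using Suc.prems[of 0 "0 # zs"] that by simp
  moreover have "mlin n (\<lambda>zs. P (x # zs))" for x
  proof (rule Suc.IH)
    fix i and zs :: "(real ^ 'a) list" assume "i < n" "length zs = n"
    then show "linear (\<lambda>y. P (x # zs[i := y]))" using Suc.prems[of "Suc i" "x # zs"] by simp
  qed
  ultimately show ?case by simp
qed simp

text \<open>The sum over all slots \<open>i\<close> of the value of \<open>F\<close> on the list of the first components, with the
  entry \<open>i\<close> replaced by the second component.\<close>

primrec slot_sum :: "('x list \<Rightarrow> real) \<Rightarrow> ('x \<times> 'x) list \<Rightarrow> real" where
  "slot_sum F [] = 0"
| "slot_sum F (p # ps) = F (snd p # map fst ps) + slot_sum (\<lambda>zs. F (fst p # zs)) ps"

lemma slot_sum_append:
  "slot_sum F (ps @ qs) = slot_sum (\<lambda>zs. F (zs @ map fst qs)) ps + slot_sum (\<lambda>zs. F (map fst ps @ zs)) qs"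
  by (induction ps arbitrary: F) simp_all

lemma slot_sum_cong:
  "ps = qs \<Longrightarrow> (\<And>zs. length zs = length qs \<Longrightarrow> F zs = G zs) \<Longrightarrow> slot_sum F ps = slot_sum G qs"
proof (induction qs arbitrary: ps F G)
  case (Cons q qs)
  have "slot_sum (\<lambda>zs. F (fst q # zs)) qs = slot_sum (\<lambda>zs. G (fst q # zs)) qs"
    by (rule Cons.IH) (simp_all add: Cons.prems)
  then show ?case using Cons.prems(1) by (simp add: Cons.prems(2))
qed simp

lemma slot_sum_add: "slot_sum (\<lambda>zs. F zs + G zs) ps = slot_sum F ps + slot_sum G ps"
  by (induction ps arbitrary: F G) simp_all

lemma slot_sum_cmult: "slot_sum (\<lambda>zs. k * F zs) ps = k * slot_sum F ps"
  by (induction ps arbitrary: F) (simp_all add: distrib_left)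

lemma slot_sum_cmult_right: "slot_sum (\<lambda>zs. F zs * k) ps = slot_sum F ps * k"
  by (induction ps arbitrary: F) (simp_all add: distrib_right)

lemma slot_sum_zero: "slot_sum (\<lambda>zs. 0) ps = 0"
  by (induction ps) simp_all

lemma slot_sum_sum: "slot_sum (\<lambda>zs. \<Sum>A\<in>I. F A zs) ps = (\<Sum>A\<in>I. slot_sum (F A) ps)"
  by (induction I rule: infinite_finite_induct) (simp_all add: slot_sum_zero slot_sum_add)

lemma slot_sum_relabel:
  assumes "\<And>zs. length zs = length ys \<Longrightarrow> F zs = G (map2 t ys zs)"
  shows "slot_sum F (map (\<lambda>y. (g y, d y)) ys) = slot_sum G (map (\<lambda>y. (t y (g y), t y (d y))) ys)"
  using assms
proof (induction ys arbitrary: F G)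
  case (Cons y ys)
  have m: "map2 t ys (map g ys) = map (\<lambda>y. t y (g y)) ys"
    by (induction ys) simp_all
  have "slot_sum (\<lambda>zs. F (g y # zs)) (map (\<lambda>y. (g y, d y)) ys) =
      slot_sum (\<lambda>zs. G (t y (g y) # zs)) (map (\<lambda>y. (t y (g y), t y (d y))) ys)"
    by (rule Cons.IH) (simp add: Cons.prems)
  then show ?case using Cons.prems[of "d y # map g ys"] by (simp add: m comp_def)
qed simp

lemma slot_sum_add_right:
  assumes "mlin (length ys) F"
  shows "slot_sum F (map (\<lambda>y. (g y, d y + d' y)) ys) =
    slot_sum F (map (\<lambda>y. (g y, d y)) ys) + slot_sum F (map (\<lambda>y. (g y, d' y)) ys)"
  using assms
proof (induction ys arbitrary: F)
  case (Cons y ys)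
  have lin: "linear (\<lambda>x. F (x # map g ys))" and ml: "mlin (length ys) (\<lambda>zs. F (g y # zs))"
    using Cons.prems by auto
  show ?case using Cons.IH[OF ml] linear_add[OF lin] by (simp add: comp_def)
qed simp

lemma slot_sum_scale_right:
  assumes "mlin (length ys) F"
  shows "slot_sum F (map (\<lambda>y. (g y, k *\<^sub>R d y)) ys) = k * slot_sum F (map (\<lambda>y. (g y, d y)) ys)"
  using assms
proof (induction ys arbitrary: F)
  case (Cons y ys)
  have lin: "linear (\<lambda>x. F (x # map g ys))" and ml: "mlin (length ys) (\<lambda>zs. F (g y # zs))"
    using Cons.prems by auto
  show ?case using Cons.IH[OF ml] linear_scale[OF lin] by (simp add: comp_def distrib_left)
qed simp

lemma slot_sum_diff:
  assumes "mlin (length ys) F"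
  shows "slot_sum F (map (\<lambda>y. (g y, d y - d' y)) ys) =
      slot_sum F (map (\<lambda>y. (g y, d y)) ys) - slot_sum F (map (\<lambda>y. (g y, d' y)) ys)"
  using slot_sum_add_right[OF assms, of g d "\<lambda>y. (-1) *\<^sub>R d' y"] slot_sum_scale_right[OF assms, of g "-1" d'] by simp

lemma mlin_slot_sum:
  assumes "mlin (length ys) F" "\<And>y. linear (d y)"
  shows "mlin (length ys) (\<lambda>zs. slot_sum F (map2 (\<lambda>y z. (z, d y z)) ys zs))"
  using assms(1)
proof (induction ys arbitrary: F)
  case (Cons y ys)
  have lin: "linear (\<lambda>x. F (x # zs))" if "length zs = length ys" for zs using Cons.prems that by simp
  have ml: "mlin (length ys) (\<lambda>zs. F (x # zs))" for x using Cons.prems by simp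
  have f: "map fst (map2 (\<lambda>y z. (z, d y z)) ys zs) = zs" if "length zs = length ys" for zs
    using that by (intro nth_equalityI) auto
  have "linear (\<lambda>x. slot_sum F (map2 (\<lambda>y z. (z, d y z)) (y # ys) (x # zs)))" if l: "length zs = length ys" for zs
  proof (rule linearI)
    let ?ps = "map2 (\<lambda>y z. (z, d y z)) ys zs"
    have lp: "length ?ps = length ys" using l by simp
    show "slot_sum F (map2 (\<lambda>y z. (z, d y z)) (y # ys) ((x + x') # zs)) =
        slot_sum F (map2 (\<lambda>y z. (z, d y z)) (y # ys) (x # zs)) + slot_sum F (map2 (\<lambda>y z. (z, d y z)) (y # ys) (x' # zs))" for x x'
    proof -
      have "slot_sum (\<lambda>zs. F ((x + x') # zs)) ?ps = slot_sum (\<lambda>zs. F (x # zs) + F (x' # zs)) ?ps"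
        by (rule slot_sum_cong) (use lp linear_add[OF lin] in auto)
      then show ?thesis using f[OF l] linear_add[OF lin[OF l]] linear_add[OF assms(2)]
        by (simp add: slot_sum_add)
    qed
    show "slot_sum F (map2 (\<lambda>y z. (z, d y z)) (y # ys) ((k *\<^sub>R x) # zs)) =
        k *\<^sub>R slot_sum F (map2 (\<lambda>y z. (z, d y z)) (y # ys) (x # zs))" for k x
    proof -
      have "slot_sum (\<lambda>zs. F ((k *\<^sub>R x) # zs)) ?ps = slot_sum (\<lambda>zs. k * F (x # zs)) ?ps"
        by (rule slot_sum_cong) (use lp linear_scale[OF lin] in auto)
      then show ?thesis using f[OF l] linear_scale[OF lin[OF l]] linear_scale[OF assms(2)]
        by (simp add: slot_sum_cmult distrib_left)
    qed
  qed
  moreover have "mlin (length ys) (\<lambda>zs. slot_sum F (map2 (\<lambda>y z. (z, d y z)) (y # ys) (x # zs)))" for x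
  proof (rule mlinI)
    fix i and zs :: "(real ^ 'a) list" assume i: "i < length ys" "length zs = length ys"
    have "linear (\<lambda>u. F (d y x # zs[i := u]))" by (rule mlin_update[OF ml i])
    moreover have "linear (\<lambda>u. slot_sum (\<lambda>zs. F (x # zs)) (map2 (\<lambda>y z. (z, d y z)) ys (zs[i := u])))"
      by (rule mlin_update[OF Cons.IH[OF ml] i])
    ultimately have "linear (\<lambda>u. F (d y x # zs[i := u]) + slot_sum (\<lambda>zs. F (x # zs)) (map2 (\<lambda>y z. (z, d y z)) ys (zs[i := u])))"
      by (rule linear_compose_add)
    then show "linear (\<lambda>u. slot_sum F (map2 (\<lambda>y z. (z, d y z)) (y # ys) (x # zs[i := u])))"
      using f i by simp
  qed
  ultimately show ?case by simp
qed simp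

context smooth_atlas
begin

text \<open>The model is a tensor field written in the coordinates of a chart. Its components are multilinear only over
  the domain of the chart, which is a neighbourhood of \<open>v\<close>; smoothness on basis vectors entails smoothness
  on all smooth arguments.\<close>

definition smooth_family :: "nat \<Rightarrow> 'a \<Rightarrow> ('a \<Rightarrow> (real ^ 'n::finite) list \<Rightarrow> real) \<Rightarrow> bool" where
  "smooth_family n v P \<longleftrightarrow> (\<forall>\<^sub>F v' in nhds v. mlin n (P v')) \<and>
    (\<forall>As. length As = n \<longrightarrow> smooth_near A v (\<lambda>v'. P v' (map (\<lambda>B. axis B 1) As)))"

lemma smooth_family_Cons:
  assumes "smooth_family (Suc n) v P" shows "smooth_family n v (\<lambda>v' zs. P v' (axis B 1 # zs))"
proof -
  have "smooth_near A v (\<lambda>v'. P v' (map (\<lambda>B. axis B 1) (B # As)))" if "length As = n" for As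
    using assms that unfolding smooth_family_def by (metis length_Cons)
  moreover have "\<forall>\<^sub>F v' in nhds v. mlin n (\<lambda>zs. P v' (axis B 1 # zs))"
    using assms unfolding smooth_family_def by (auto elim: eventually_mono)
  ultimately show ?thesis by (simp add: smooth_family_def)
qed

lemma vec_expand: "x = (\<Sum>B\<in>UNIV. x $ B *\<^sub>R axis B 1)" for x :: "real ^ 'n::finite"
  by (simp add: basis_expansion scalar_mult_eq_scaleR[symmetric])

lemma mlin_expand:
  assumes "mlin (Suc n) P" "length zs = n" shows "P (x # zs) = (\<Sum>B\<in>UNIV. x $ B * P (axis B 1 # zs))"
proof -
  have lin: "linear (\<lambda>x. P (x # zs))" using assms by simp
  have "P (x # zs) = P ((\<Sum>B\<in>UNIV. x $ B *\<^sub>R axis B 1) # zs)" using vec_expand[of x] by simp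
  then show ?thesis by (simp add: linear_sum[OF lin] linear_scale[OF lin])
qed

lemma smooth_family_smooth:
  assumes "smooth_family (length fs) v P" "\<And>f B. f \<in> set fs \<Longrightarrow> smooth_near A v (\<lambda>v'. f v' $ B)"
  shows "smooth_near A v (\<lambda>v'. P v' (map (\<lambda>f. f v') fs))"
  using assms
proof (induction fs arbitrary: P)
  case Nil
  then show ?case by (simp add: smooth_family_def)
next
  case (Cons f fs)
  have "smooth_near A v (\<lambda>v'. P v' (axis B 1 # map (\<lambda>f. f v') fs))" for B
    by (rule Cons.IH[of "\<lambda>v' zs. P v' (axis B 1 # zs)"]) (use Cons.prems in \<open>auto intro: smooth_family_Cons\<close>)
  then have "smooth_near A v (\<lambda>v'. \<Sum>B\<in>UNIV. f v' $ B * P v' (axis B 1 # map (\<lambda>f. f v') fs))"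
    using Cons.prems by (intro smooth_near_sum smooth_near_mult) auto
  moreover have "near v (\<lambda>v'. \<Sum>B\<in>UNIV. f v' $ B * P v' (axis B 1 # map (\<lambda>f. f v') fs)) (\<lambda>v'. P v' (map (\<lambda>f. f v') (f # fs)))"
  proof -
    have "\<forall>\<^sub>F v' in nhds v. mlin (Suc (length fs)) (P v')" using Cons.prems(1) by (simp add: smooth_family_def)
    then show ?thesis unfolding near_def
    proof eventually_elim
      case (elim v')
      show ?case using mlin_expand[OF elim, of "map (\<lambda>f. f v') fs" "f v'"] by simp
    qed
  qed
  ultimately show ?case using smooth_near_cong by blast
qed

text \<open>Expansion of the first argument in the basis reduces this to the product rule: one term in which the family is
  differentiated and the arguments are frozen at \<open>v\<close>, and one term for the derivative of each argument.\<close>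

lemma smooth_family_leibniz:
  assumes w: "w \<in> tangent_space A v"
    and "smooth_family (length fs) v P" "\<And>f B. f \<in> set fs \<Longrightarrow> smooth_near A v (\<lambda>v'. f v' $ B)"
  shows "w (\<lambda>v'. P v' (map (\<lambda>f. f v') fs)) = w (\<lambda>v'. P v' (map (\<lambda>f. f v) fs)) +
    slot_sum (P v) (map (\<lambda>f. (f v, \<chi> B. w (\<lambda>v'. f v' $ B))) fs)"
  using assms(2,3)
proof (induction fs arbitrary: P)
  case (Cons f fs)
  let ?Q = "\<lambda>B v' zs. P v' (axis B 1 # zs)" and ?wf = "\<chi> B. w (\<lambda>v'. f v' $ B)"
  let ?ps = "map (\<lambda>f. (f v, \<chi> B. w (\<lambda>v'. f v' $ B))) fs"
  have Q: "smooth_family (length fs) v (?Q B)" for B using smooth_family_Cons Cons.prems(1) by auto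
  have fs: "smooth_near A v (\<lambda>v'. g v' $ B)" if "g \<in> set fs" for g B using Cons.prems(2) that by simp
  have f: "smooth_near A v (\<lambda>v'. f v' $ B)" for B using Cons.prems(2) by simp
  have Qs: "smooth_near A v (\<lambda>v'. ?Q B v' (map (\<lambda>f. f v') fs))" for B
    by (rule smooth_family_smooth[OF Q fs])
  have "smooth_near A v (\<lambda>v'. ?Q B v' (map (\<lambda>f. f v') (map (\<lambda>f _. f v) fs)))" for B
    by (rule smooth_family_smooth) (auto simp: Q smooth_near_const)
  then have Qc: "smooth_near A v (\<lambda>v'. ?Q B v' (map (\<lambda>f. f v) fs))" for B by (simp add: comp_def)
  have ml: "\<forall>\<^sub>F v' in nhds v. mlin (Suc (length fs)) (P v')" using Cons.prems(1) by (simp add: smooth_family_def)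
  then have mlv: "mlin (Suc (length fs)) (P v)" by (rule eventually_nhds_x_imp_x)
  have e: "near v (\<lambda>v'. P v' (g v' # map (\<lambda>f. f v') hs)) (\<lambda>v'. \<Sum>B\<in>UNIV. g v' $ B * ?Q B v' (map (\<lambda>f. f v') hs))"
    if "length hs = length fs" for g hs
    unfolding near_def using ml
  proof eventually_elim
    case (elim v')
    show ?case by (rule mlin_expand[OF elim]) (simp add: that)
  qed
  have "w (\<lambda>v'. P v' (map (\<lambda>f. f v') (f # fs))) = w (\<lambda>v'. \<Sum>B\<in>UNIV. f v' $ B * ?Q B v' (map (\<lambda>f. f v') fs))"
    using tangent_cong[OF w e[of fs f]] by simp
  also have "\<dots> = (\<Sum>B\<in>UNIV. f v $ B * w (\<lambda>v'. ?Q B v' (map (\<lambda>f. f v') fs)) + ?wf $ B * ?Q B v (map (\<lambda>f. f v) fs))"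
    by (simp add: tangent_sum[OF w smooth_near_mult[OF f Qs]] tangent_mult[OF w f Qs])
  also have "\<dots> = (\<Sum>B\<in>UNIV. f v $ B * w (\<lambda>v'. ?Q B v' (map (\<lambda>f. f v) fs))) +
      (\<Sum>B\<in>UNIV. f v $ B * slot_sum (?Q B v) ?ps) + (\<Sum>B\<in>UNIV. ?wf $ B * ?Q B v (map (\<lambda>f. f v) fs))"
    by (simp add: Cons.IH[OF Q fs] distrib_left sum.distrib)
  also have "(\<Sum>B\<in>UNIV. ?wf $ B * ?Q B v (map (\<lambda>f. f v) fs)) = P v (?wf # map (\<lambda>f. f v) fs)"
    by (rule mlin_expand[symmetric, OF mlv]) simp
  also have "(\<Sum>B\<in>UNIV. f v $ B * slot_sum (?Q B v) ?ps) = slot_sum (\<lambda>zs. P v (f v # zs)) ?ps"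
  proof -
    have "slot_sum (\<lambda>zs. P v (f v # zs)) ?ps = slot_sum (\<lambda>zs. \<Sum>B\<in>UNIV. f v $ B * ?Q B v zs) ?ps"
      by (rule slot_sum_cong[OF refl], rule mlin_expand[OF mlv]) simp
    then show ?thesis by (simp add: slot_sum_sum slot_sum_cmult)
  qed
  also have "(\<Sum>B\<in>UNIV. f v $ B * w (\<lambda>v'. ?Q B v' (map (\<lambda>f. f v) fs))) = w (\<lambda>v'. P v' (map (\<lambda>f. f v) (f # fs)))"
  proof -
    have "w (\<lambda>v'. P v' (map (\<lambda>f. f v) (f # fs))) = w (\<lambda>v'. \<Sum>B\<in>UNIV. f v $ B * ?Q B v' (map (\<lambda>f. f v) fs))"
      using tangent_cong[OF w e[of "map (\<lambda>f _. f v) fs" "\<lambda>_. f v"]] by (simp add: comp_def)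
    then show ?thesis
      by (simp add: tangent_sum[OF w smooth_near_mult[OF smooth_near_const Qc]] tangent_cmult[OF w Qc])
  qed
  finally show ?case by (simp add: comp_def)
qed simp

lemma smooth_family_slot_sum:
  assumes "smooth_family (length fs) v P"
    "\<And>p B. p \<in> set fs \<Longrightarrow> smooth_near A v (\<lambda>v'. fst p v' $ B) \<and> smooth_near A v (\<lambda>v'. snd p v' $ B)"
  shows "smooth_near A v (\<lambda>v'. slot_sum (P v') (map (\<lambda>p. (fst p v', snd p v')) fs))"
  using assms
proof (induction fs arbitrary: P)
  case (Cons p fs)
  let ?Q = "\<lambda>B v' zs. P v' (axis B 1 # zs)"
  let ?ps = "\<lambda>v'. map (\<lambda>p. (fst p v', snd p v')) fs"
  have Q: "smooth_family (length fs) v (?Q B)" for B using smooth_family_Cons Cons.prems(1) by auto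
  have sp: "smooth_near A v (\<lambda>v'. fst q v' $ B)" "smooth_near A v (\<lambda>v'. snd q v' $ B)"
    if "q \<in> set (p # fs)" for q B using Cons.prems(2)[OF that] by auto
  have "smooth_near A v (\<lambda>v'. P v' (map (\<lambda>f. f v') (snd p # map fst fs)))"
  proof (rule smooth_family_smooth[where P = P and fs = "snd p # map fst fs"])
    show "smooth_near A v (\<lambda>v'. f v' $ B)" if "f \<in> set (snd p # map fst fs)" for f B
    proof -
      have "f = snd p \<or> f \<in> fst ` set fs" using that by simp
      then obtain q where "q \<in> set (p # fs)" "f = fst q \<or> f = snd q"
        by (metis imageE list.set_intros(1) list.set_intros(2))
      then show ?thesis using sp by blast
    qed
  qed (use Cons.prems(1) in simp)
  moreover have "smooth_near A v (\<lambda>v'. \<Sum>B\<in>UNIV. fst p v' $ B * slot_sum (?Q B v') (?ps v'))"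
  proof (intro smooth_near_sum smooth_near_mult)
    fix B
    show "smooth_near A v (\<lambda>v'. fst p v' $ B)" using sp by simp
    show "smooth_near A v (\<lambda>v'. slot_sum (?Q B v') (?ps v'))"
      by (rule Cons.IH[OF Q]) (use sp in simp)
  qed
  ultimately have s: "smooth_near A v (\<lambda>v'. P v' (map (\<lambda>f. f v') (snd p # map fst fs)) +
      (\<Sum>B\<in>UNIV. fst p v' $ B * slot_sum (?Q B v') (?ps v')))" by (rule smooth_near_add)
  have "\<forall>\<^sub>F v' in nhds v. mlin (Suc (length fs)) (P v')" using Cons.prems(1) by (simp add: smooth_family_def)
  then have "near v (\<lambda>v'. P v' (map (\<lambda>f. f v') (snd p # map fst fs)) +
      (\<Sum>B\<in>UNIV. fst p v' $ B * slot_sum (?Q B v') (?ps v')))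
    (\<lambda>v'. slot_sum (P v') (map (\<lambda>p. (fst p v', snd p v')) (p # fs)))"
    unfolding near_def
  proof eventually_elim
    case (elim v')
    have "slot_sum (\<lambda>zs. P v' (fst p v' # zs)) (?ps v') = slot_sum (\<lambda>zs. \<Sum>B\<in>UNIV. fst p v' $ B * ?Q B v' zs) (?ps v')"
      by (rule slot_sum_cong[OF refl], rule mlin_expand[OF elim]) simp
    then show ?case by (simp add: slot_sum_sum slot_sum_cmult comp_def)
  qed
  then show ?case using s smooth_near_cong by blast
qed (simp add: smooth_near_const)

lemma smooth_family_deriv_mlin:
  assumes "w \<in> tangent_space A v" "smooth_family n v P"
  shows "mlin n (\<lambda>zs. w (\<lambda>v'. P v' zs))"
proof (rule mlinI)
  fix i and zs :: "(real ^ 'b) list" assume i: "i < n" "length zs = n"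
  have ml: "\<forall>\<^sub>F v' in nhds v. mlin n (P v')" using assms(2) by (simp add: smooth_family_def)
  have s: "smooth_near A v (\<lambda>v'. P v' us)" if "length us = n" for us
  proof -
    have "smooth_near A v (\<lambda>v'. P v' (map (\<lambda>f. f v') (map (\<lambda>u _. u) us)))"
      by (rule smooth_family_smooth) (use assms(2) that in \<open>auto simp: smooth_near_const\<close>)
    then show ?thesis by (simp add: comp_def)
  qed
  show "linear (\<lambda>x. w (\<lambda>v'. P v' (zs[i := x])))"
  proof (rule linearI)
    fix x y k
    have "near v (\<lambda>v'. P v' (zs[i := x + y])) (\<lambda>v'. P v' (zs[i := x]) + P v' (zs[i := y]))"
      unfolding near_def using ml by eventually_elim (use linear_add[OF mlin_update[OF _ i]] in blast)
    then show "w (\<lambda>v'. P v' (zs[i := x + y])) = w (\<lambda>v'. P v' (zs[i := x])) + w (\<lambda>v'. P v' (zs[i := y]))"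
      using tangent_cong[OF assms(1)] tangent_add[OF assms(1) s s] i by simp
    have "near v (\<lambda>v'. P v' (zs[i := k *\<^sub>R x])) (\<lambda>v'. k * P v' (zs[i := x]))"
      unfolding near_def using ml
    proof eventually_elim
      case (elim v')
      show ?case using linear_scale[OF mlin_update[OF elim i], of k x] by simp
    qed
    then show "w (\<lambda>v'. P v' (zs[i := k *\<^sub>R x])) = k *\<^sub>R w (\<lambda>v'. P v' (zs[i := x]))"
      using tangent_cong[OF assms(1)] tangent_cmult[OF assms(1) s] i by simp
  qed
qed

end

section \<open>Tensors in coordinates\<close>

context gte
begin

text \<open>A covector at \<open>v\<close> corresponds to the vector of its values on the adapted frame; \<open>coef\<close> and \<open>acov\<close> are the
  two directions of this correspondence.\<close>

definition coef where "coef c v \<omega> = (\<chi> A. \<omega> (frame S c v A))"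

definition acov where "acov c v a X = (if gte_vector v X then a \<bullet> acoord c v X else 0)"

lemma coframe_acov: "coframe S c v A = acov c v (axis A 1)"
proof
  fix X show "coframe S c v A X = acov c v (axis A 1) X"
    by (cases A) (simp_all add: acov_def acoord_def inner_axis' coframe_def dz_def deltay_def gte_fibre_iff)
qed

lemma gte_dualD:
  assumes "\<omega> \<in> gte_dual S v"
  shows "gte_vector v X \<Longrightarrow> gte_vector v X' \<Longrightarrow> \<omega> (gte_add S X X') = \<omega> X + \<omega> X'"
    and "gte_vector v X \<Longrightarrow> \<omega> (gte_scale S k X) = k * \<omega> X"
    and "\<not> gte_vector v X \<Longrightarrow> \<omega> X = 0"
  using assms unfolding gte_dual_def mem_Collect_eq Ball_def gte_fibre_iff by blast+

lemma acov_dual: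
  assumes "c \<in> charts" "v \<in> dom_E S c" shows "acov c v a \<in> gte_dual S v"
  using assms gte_vector_add gte_vector_scale acoord_add acoord_scale
  by (simp add: gte_dual_def gte_fibre_iff acov_def inner_add_right)

lemma coef_acov:
  assumes "c \<in> charts" "v \<in> dom_E S c" shows "coef c v (acov c v a) = a"
  using assms by (simp add: coef_def acov_def frame_avec avec_gte_vector acoord_avec inner_axis vec_eq_iff)

lemma dual_avec:
  assumes "c \<in> charts" "v \<in> dom_E S c" "\<omega> \<in> gte_dual S v"
  shows "\<omega> (avec c v \<xi>) = coef c v \<omega> \<bullet> \<xi>"
proof -
  have lin: "linear (\<lambda>\<xi>. \<omega> (avec c v \<xi>))"
    using avec_add[OF assms(1,2)] avec_scale[OF assms(1,2)] gte_dualD[OF assms(3)] avec_gte_vector[OF assms(1,2)]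
    by (intro linearI) simp_all
  have "\<omega> (avec c v \<xi>) = \<omega> (avec c v (\<Sum>B\<in>UNIV. \<xi> $ B *\<^sub>R axis B 1))" using E.vec_expand[of \<xi>] by simp
  then show ?thesis
    by (simp add: linear_sum[OF lin] linear_scale[OF lin] coef_def frame_avec inner_vec_def mult.commute)
qed

lemma acov_coef:
  assumes "c \<in> charts" "v \<in> dom_E S c" "\<omega> \<in> gte_dual S v" shows "acov c v (coef c v \<omega>) = \<omega>"
proof
  fix X show "acov c v (coef c v \<omega>) X = \<omega> X"
    using dual_avec[OF assms, of "acoord c v X"] avec_acoord[OF assms(1,2), of X] gte_dualD(3)[OF assms(3), of X]
    by (cases "gte_vector v X") (simp_all add: acov_def)
qed

lemma acov_add: "acov c v (a + b) = (\<lambda>X. acov c v a X + acov c v b X)"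
  and acov_scale: "acov c v (k *\<^sub>R a) = (\<lambda>X. k * acov c v a X)"
  by (auto simp: acov_def inner_add_left)

lemma acov_change:
  assumes "c \<in> charts" "v \<in> dom_E S c" "c' \<in> charts" "v \<in> dom_E S c'"
  shows "acov c v a = acov c' v (transpose (tr c' c v) *v a)"
proof
  fix X show "acov c v a X = acov c' v (transpose (tr c' c v) *v a) X"
    using acoord_change[OF assms(3,4,1,2), of X]
    by (simp add: acov_def dot_lmul_matrix vector_transpose_matrix)
qed

lemma coef_change:
  assumes "c \<in> charts" "v \<in> dom_E S c" "c' \<in> charts" "v \<in> dom_E S c'" "\<omega> \<in> gte_dual S v"
  shows "coef c' v \<omega> = transpose (tr c' c v) *v coef c v \<omega>"
  using acov_change[OF assms(1-4), of "coef c v \<omega>"] acov_coef[OF assms(1,2,5)] coef_acov[OF assms(3,4)] by metis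

abbreviation TF where "TF \<equiv> tensor_fields S"

definition valid_args where
  "valid_args v \<omega>s Xs \<longleftrightarrow> set \<omega>s \<subseteq> gte_dual S v \<and> (\<forall>X\<in>set Xs. gte_vector v X)"

lemma valid_args_iff: "valid_args v \<omega>s Xs \<longleftrightarrow> set \<omega>s \<subseteq> gte_dual S v \<and> set Xs \<subseteq> gte_fibre S v"
  using gte_fibre_iff unfolding valid_args_def by blast

lemma TF_zero:
  assumes "T \<in> TF k l" "\<not> (length \<omega>s = k \<and> length Xs = l \<and> valid_args v \<omega>s Xs)"
  shows "T v \<omega>s Xs = 0"
proof -
  have t: "T v \<in> tensors_at S v k l" using assms(1) unfolding tensor_fields_def by blast
  show ?thesis
    using assms(2)[unfolded valid_args_iff]
    by (rule t[unfolded tensors_at_def mem_Collect_eq, THEN conjunct1, rule_format])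
qed

lemma TF_linear:
  assumes "T \<in> TF k l"
  shows TF_cov_add: "i < k \<Longrightarrow> \<omega> \<in> gte_dual S v \<Longrightarrow> \<omega>' \<in> gte_dual S v \<Longrightarrow>
      T v (\<omega>s[i := (\<lambda>X. \<omega> X + \<omega>' X)]) Xs = T v (\<omega>s[i := \<omega>]) Xs + T v (\<omega>s[i := \<omega>']) Xs"
    and TF_cov_scale: "i < k \<Longrightarrow> \<omega> \<in> gte_dual S v \<Longrightarrow> T v (\<omega>s[i := (\<lambda>X. r * \<omega> X)]) Xs = r * T v (\<omega>s[i := \<omega>]) Xs"
    and TF_vec_add: "i < l \<Longrightarrow> gte_vector v X \<Longrightarrow> gte_vector v X' \<Longrightarrow>
      T v \<omega>s (Xs[i := gte_add S X X']) = T v \<omega>s (Xs[i := X]) + T v \<omega>s (Xs[i := X'])"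
    and TF_vec_scale: "i < l \<Longrightarrow> gte_vector v X \<Longrightarrow> T v \<omega>s (Xs[i := gte_scale S r X]) = r * T v \<omega>s (Xs[i := X])"
proof -
  have t: "T v \<in> tensors_at S v k l" for v using assms unfolding tensor_fields_def by blast
  have fib: "gte_vector v X \<Longrightarrow> X \<in> gte_fibre S v" for v X by (simp add: gte_fibre_iff)
  note ax = t[unfolded tensors_at_def mem_Collect_eq, THEN conjunct2]
  note cov = ax[THEN conjunct1, rule_format] and vec = ax[THEN conjunct2, rule_format]
  show "i < k \<Longrightarrow> \<omega> \<in> gte_dual S v \<Longrightarrow> \<omega>' \<in> gte_dual S v \<Longrightarrow>
      T v (\<omega>s[i := (\<lambda>X. \<omega> X + \<omega>' X)]) Xs = T v (\<omega>s[i := \<omega>]) Xs + T v (\<omega>s[i := \<omega>']) Xs"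
    by (rule cov[THEN conjunct1])
  show "i < k \<Longrightarrow> \<omega> \<in> gte_dual S v \<Longrightarrow> T v (\<omega>s[i := (\<lambda>X. r * \<omega> X)]) Xs = r * T v (\<omega>s[i := \<omega>]) Xs"
    by (rule cov[THEN conjunct2])
  show "i < l \<Longrightarrow> gte_vector v X \<Longrightarrow> gte_vector v X' \<Longrightarrow>
      T v \<omega>s (Xs[i := gte_add S X X']) = T v \<omega>s (Xs[i := X]) + T v \<omega>s (Xs[i := X'])"
    by (rule vec[THEN conjunct1, OF _ fib fib])
  show "i < l \<Longrightarrow> gte_vector v X \<Longrightarrow> T v \<omega>s (Xs[i := gte_scale S r X]) = r * T v \<omega>s (Xs[i := X])"
    by (rule vec[THEN conjunct2, OF _ fib fib])
qed

lemma TF_smooth: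
  assumes "T \<in> TF k l" "c \<in> charts" "v \<in> dom_E S c" "length As = k" "length Bs = l"
  shows "smooth v (\<lambda>v. T v (map (coframe S c v) As) (map (frame S c v) Bs))"
  using assms E.msmooth_on_iff[OF open_dom_E[OF assms(2)]] unfolding tensor_fields_def by blast

text \<open>Multilinearity has to be verified on admissible arguments only: the values on all other lists are zero.\<close>

lemma TFI:
  assumes z: "\<And>v \<omega>s Xs. \<not> (length \<omega>s = k \<and> length Xs = l \<and> valid_args v \<omega>s Xs) \<Longrightarrow> T v \<omega>s Xs = 0"
    and c: "\<And>v \<omega>s Xs i. length \<omega>s = k \<Longrightarrow> length Xs = l \<Longrightarrow> valid_args v \<omega>s Xs \<Longrightarrow> i < k \<Longrightarrow>
      (\<forall>\<omega>\<in>gte_dual S v. \<forall>\<omega>'\<in>gte_dual S v. \<forall>r.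
        T v (\<omega>s[i := (\<lambda>X. \<omega> X + \<omega>' X)]) Xs = T v (\<omega>s[i := \<omega>]) Xs + T v (\<omega>s[i := \<omega>']) Xs \<and>
        T v (\<omega>s[i := (\<lambda>X. r * \<omega> X)]) Xs = r * T v (\<omega>s[i := \<omega>]) Xs)"
    and x: "\<And>v \<omega>s Xs i. length \<omega>s = k \<Longrightarrow> length Xs = l \<Longrightarrow> valid_args v \<omega>s Xs \<Longrightarrow> i < l \<Longrightarrow>
      (\<forall>X X' r. gte_vector v X \<longrightarrow> gte_vector v X' \<longrightarrow>
        T v \<omega>s (Xs[i := gte_add S X X']) = T v \<omega>s (Xs[i := X]) + T v \<omega>s (Xs[i := X']) \<and>
        T v \<omega>s (Xs[i := gte_scale S r X]) = r * T v \<omega>s (Xs[i := X]))"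
    and s: "\<And>c v As Bs. c \<in> charts \<Longrightarrow> v \<in> dom_E S c \<Longrightarrow> length As = k \<Longrightarrow> length Bs = l \<Longrightarrow>
      smooth v (\<lambda>v. T v (map (coframe S c v) As) (map (frame S c v) Bs))"
  shows "T \<in> TF k l"
proof -
  have dual: "(\<lambda>X. \<omega> X + \<omega>' X) \<in> gte_dual S v" "(\<lambda>X. r * \<omega> X) \<in> gte_dual S v"
    if "\<omega> \<in> gte_dual S v" "\<omega>' \<in> gte_dual S v" for \<omega> \<omega>' v r
    using that unfolding gte_dual_def by (auto simp: algebra_simps)
  (* an update with an admissible entry keeps a list inadmissible if another entry is; if only the
     overwritten entry is inadmissible, the list can be repaired without changing the updates *)
  have cov: "T v (\<omega>s[i := (\<lambda>X. \<omega> X + \<omega>' X)]) Xs = T v (\<omega>s[i := \<omega>]) Xs + T v (\<omega>s[i := \<omega>']) Xs \<and>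
      T v (\<omega>s[i := (\<lambda>X. r * \<omega> X)]) Xs = r * T v (\<omega>s[i := \<omega>]) Xs"
    if i: "i < k" and d: "\<omega> \<in> gte_dual S v" "\<omega>' \<in> gte_dual S v" for v \<omega>s Xs i \<omega> \<omega>' r
  proof (cases "length (\<omega>s[i := \<omega>]) = k \<and> length Xs = l \<and> valid_args v (\<omega>s[i := \<omega>]) Xs")
    case True
    then show ?thesis using c[of "\<omega>s[i := \<omega>]" Xs v i] i d by simp
  next
    case False
    have "\<not> (length (\<omega>s[i := \<theta>]) = k \<and> length Xs = l \<and> valid_args v (\<omega>s[i := \<theta>]) Xs)" if "\<theta> \<in> gte_dual S v" for \<theta>
    proof
      assume *: "length (\<omega>s[i := \<theta>]) = k \<and> length Xs = l \<and> valid_args v (\<omega>s[i := \<theta>]) Xs"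
      have "set ((\<omega>s[i := \<theta>])[i := \<omega>]) \<subseteq> insert \<omega> (set (\<omega>s[i := \<theta>]))" by (rule set_update_subset_insert)
      then have "valid_args v (\<omega>s[i := \<omega>]) Xs" using * d(1) by (auto simp: valid_args_def)
      then show False using False * by simp
    qed
    then show ?thesis using z dual[OF d] d by simp
  qed
  have vec: "T v \<omega>s (Xs[i := gte_add S X X']) = T v \<omega>s (Xs[i := X]) + T v \<omega>s (Xs[i := X']) \<and>
      T v \<omega>s (Xs[i := gte_scale S r X]) = r * T v \<omega>s (Xs[i := X])"
    if i: "i < l" and d: "gte_vector v X" "gte_vector v X'" for v \<omega>s Xs i X X' r
  proof (cases "length \<omega>s = k \<and> length (Xs[i := X]) = l \<and> valid_args v \<omega>s (Xs[i := X])")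
    case True
    then show ?thesis using x[of \<omega>s "Xs[i := X]" v i, rule_format, OF _ _ _ i d] by simp
  next
    case False
    have "\<not> (length \<omega>s = k \<and> length (Xs[i := Y]) = l \<and> valid_args v \<omega>s (Xs[i := Y]))" if "gte_vector v Y" for Y
    proof
      assume *: "length \<omega>s = k \<and> length (Xs[i := Y]) = l \<and> valid_args v \<omega>s (Xs[i := Y])"
      have "set ((Xs[i := Y])[i := X]) \<subseteq> insert X (set (Xs[i := Y]))" by (rule set_update_subset_insert)
      then have "valid_args v \<omega>s (Xs[i := X])" using * d(1) by (auto simp: valid_args_def)
      then show False using False * by simp
    qed
    then show ?thesis using z gte_vector_add[OF d] gte_vector_scale[OF d(1)] d by simp
  qed
  have "T v \<in> tensors_at S v k l" for v
    unfolding tensors_at_def mem_Collect_eq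
  proof (intro conjI allI impI ballI)
    fix \<omega>s Xs assume "\<not> (length \<omega>s = k \<and> length Xs = l \<and> set \<omega>s \<subseteq> gte_dual S v \<and> set Xs \<subseteq> gte_fibre S v)"
    then show "T v \<omega>s Xs = 0" using z unfolding valid_args_iff by blast
  qed (use cov vec in \<open>simp_all only: gte_fibre_iff\<close>)
  then show ?thesis
    unfolding tensor_fields_def using s E.msmooth_on_iff[OF open_dom_E] by blast
qed

lemma TF_eqI:
  assumes "T \<in> TF k l" "T' \<in> TF k l"
    and "\<And>v \<omega>s Xs. length \<omega>s = k \<Longrightarrow> length Xs = l \<Longrightarrow> valid_args v \<omega>s Xs \<Longrightarrow> T v \<omega>s Xs = T' v \<omega>s Xs"
  shows "T = T'"
proof (intro ext)
  fix v \<omega>s Xs show "T v \<omega>s Xs = T' v \<omega>s Xs"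
    using assms(3) TF_zero[OF assms(1)] TF_zero[OF assms(2)] by metis
qed

text \<open>The components of a tensor field as a function of one list of coefficient vectors, the covectors first.
  In this form both kinds of arguments can be treated alike.\<close>

definition Tc where
  "Tc c T k v zs = T v (map (acov c v) (take k zs)) (map (avec c v) (drop k zs))"

lemma Tc_append: "length as = k \<Longrightarrow> Tc c T k v (as @ bs) = T v (map (acov c v) as) (map (avec c v) bs)"
  by (simp add: Tc_def)

lemma Tc_mlin:
  assumes T: "T \<in> TF k l" and c: "c \<in> charts" "v \<in> dom_E S c" shows "mlin (k + l) (Tc c T k v)"
proof (rule mlinI)
  fix i and zs :: "(real ^ ('p + 'r)) list" assume i: "i < k + l" "length zs = k + l"
  show "linear (\<lambda>x. Tc c T k v (zs[i := x]))"
  proof (cases "i < k")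
    case True
    show ?thesis unfolding Tc_def
      by (rule linearI)
        (use True in \<open>simp_all add: take_update_swap map_update acov_add acov_scale TF_linear[OF T] acov_dual[OF c]\<close>)
  next
    case False
    then have "drop k (zs[i := x]) = (drop k zs)[i - k := x]" "take k (zs[i := x]) = take k zs" for x
      by (simp_all add: drop_update_swap)
    then show ?thesis unfolding Tc_def
      by (intro linearI)
        (use False i in \<open>simp_all add: map_update avec_add[OF c] avec_scale[OF c] TF_linear[OF T] avec_gte_vector[OF c]\<close>)
  qed
qed

lemma Tc_smooth_family:
  assumes T: "T \<in> TF k l" and c: "c \<in> charts" "v \<in> dom_E S c"
  shows "E.smooth_family (k + l) v (Tc c T k)"
  unfolding E.smooth_family_def
proof (intro conjI allI impI)
  show "\<forall>\<^sub>F v' in nhds v. mlin (k + l) (Tc c T k v')"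
    using eventually_dom_E[OF c] by eventually_elim (rule Tc_mlin[OF T c(1)])
  fix As :: "('p + 'r) list" assume l: "length As = k + l"
  have "Tc c T k v' (map (\<lambda>B. axis B 1) As) = T v' (map (coframe S c v') (take k As)) (map (frame S c v') (drop k As))" for v'
    by (simp add: Tc_def coframe_acov[abs_def] frame_avec[abs_def] take_map drop_map comp_def)
  then show "smooth v (\<lambda>v'. Tc c T k v' (map (\<lambda>B. axis B 1) As))"
    using TF_smooth[OF T c, of "take k As" "drop k As"] l by simp
qed

text \<open>The tags record which slots belong to covectors. The coefficients in these transform, and are differentiated,
  contragrediently.\<close>

definition slots where "slots \<omega>s Xs = map Inl \<omega>s @ map Inr Xs"

definition slot_coord where "slot_coord c v = case_sum (coef c v) (acoord c v)"

definition slot_change where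
  "slot_change c c' v y z = (case y of Inl _ \<Rightarrow> transpose (tr c' c v) *v z | Inr _ \<Rightarrow> tr c c' v *v z)"

lemma slots_simps [simp]:
  "length (slots \<omega>s Xs) = length \<omega>s + length Xs"
  "map f (slots \<omega>s Xs) = map (f \<circ> Inl) \<omega>s @ map (f \<circ> Inr) Xs"
  by (simp_all add: slots_def)

lemma Tc_slots:
  assumes "c \<in> charts" "v \<in> dom_E S c" "valid_args v \<omega>s Xs"
  shows "Tc c T (length \<omega>s) v (map (slot_coord c v) (slots \<omega>s Xs)) = T v \<omega>s Xs"
proof -
  have "map (acov c v \<circ> coef c v) \<omega>s = \<omega>s" "map (avec c v \<circ> acoord c v) Xs = Xs"
    using assms acov_coef[OF assms(1,2)] avec_acoord[OF assms(1,2)]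
    by (auto simp: valid_args_def intro!: map_idI)
  then show ?thesis by (simp add: Tc_append slot_coord_def comp_def)
qed

lemma Tc_change:
  assumes "c \<in> charts" "v \<in> dom_E S c" "c' \<in> charts" "v \<in> dom_E S c'" "length zs = length \<omega>s + length Xs"
  shows "Tc c T (length \<omega>s) v zs = Tc c' T (length \<omega>s) v (map2 (slot_change c c' v) (slots \<omega>s Xs) zs)"
proof -
  let ?k = "length \<omega>s"
  define as bs where "as = take ?k zs" and "bs = drop ?k zs"
  have zs: "zs = as @ bs" "length as = ?k" "length bs = length Xs" using assms(5) by (simp_all add: as_def bs_def)
  have "map2 (slot_change c c' v) (map Inl \<omega>s) as = map (\<lambda>a. transpose (tr c' c v) *v a) as"
    using zs(2) by (intro nth_equalityI) (auto simp: slot_change_def)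
  moreover have "map2 (slot_change c c' v) (map Inr Xs) bs = map (\<lambda>b. tr c c' v *v b) bs"
    using zs(3) by (intro nth_equalityI) (auto simp: slot_change_def)
  ultimately have "map2 (slot_change c c' v) (slots \<omega>s Xs) zs =
      map (\<lambda>a. transpose (tr c' c v) *v a) as @ map (\<lambda>b. tr c c' v *v b) bs"
    using zs by (simp add: slots_def)
  then show ?thesis
    using zs(2) by (simp add: zs(1) Tc_append acov_change[OF assms(1-4), abs_def] avec_change[OF assms(1-4), abs_def] comp_def)
qed

end

section \<open>The covariant derivative of tensors\<close>

lemma map2_map_self: "map2 f ys (map g ys) = map (\<lambda>y. f y (g y)) ys"
  by (induction ys) simp_all

lemma length_insert_at [simp]: "length (insert_at i x xs) = Suc (length xs)"
  by (simp add: insert_at_def)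

lemma map_insert_at: "map f (insert_at i x xs) = insert_at i (f x) (map f xs)"
  by (simp add: insert_at_def take_map drop_map)

lemma set_insert_at: "set (insert_at i x xs) = insert x (set xs)"
  by (metis (no_types, opaque_lifting) Un_insert_right append_take_drop_id insert_at_def list.simps(15) set_append)

lemma insert_at_update_new: "i \<le> length xs \<Longrightarrow> (insert_at i y xs)[i := x] = insert_at i x xs"
  by (simp add: insert_at_def list_update_append)

lemma insert_at_update:
  "i \<le> length xs \<Longrightarrow> insert_at i x (xs[m := y]) = (insert_at i x xs)[(if m < i then m else Suc m) := y]"
proof (induction xs arbitrary: i m)
  case (Cons a xs)
  then show ?case
    by (cases i; cases m) (simp_all add: insert_at_def)
qed (simp add: insert_at_def)

lemma slot_sum_insert_at:
  "i \<le> length ps \<Longrightarrow> slot_sum F (insert_at i p ps) =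
    F (insert_at i (snd p) (map fst ps)) + slot_sum (\<lambda>zs. F (insert_at i (fst p) zs)) ps"
proof (induction ps arbitrary: i F)
  case (Cons q ps)
  show ?case
  proof (cases i)
    case (Suc j)
    have s: "insert_at (Suc j) x (y # ys) = y # insert_at j x ys" for x y :: 'z and ys by (simp add: insert_at_def)
    show ?thesis using Cons.IH[of j "\<lambda>zs. F (fst q # zs)"] Cons.prems Suc
      by (simp add: insert_at_def take_map drop_map)
  qed (simp add: insert_at_def)
qed (simp add: insert_at_def)

text \<open>All covectors precede all vectors, so that the slots of a tensor product interleave those of its factors.\<close>

lemma slot_sum_product:
  assumes "\<And>z1 z2 z3 z4. length z1 = length p1 \<Longrightarrow> length z2 = length p2 \<Longrightarrow> length z3 = length p3 \<Longrightarrow>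
    length z4 = length p4 \<Longrightarrow> F (z1 @ z2 @ z3 @ z4) = G (z1 @ z3) * H (z2 @ z4)"
  shows "slot_sum F (p1 @ p2 @ p3 @ p4) =
    slot_sum G (p1 @ p3) * H (map fst p2 @ map fst p4) + G (map fst p1 @ map fst p3) * slot_sum H (p2 @ p4)"
proof -
  let ?f = "map fst"
  have "slot_sum (\<lambda>z. F (z @ ?f p2 @ ?f p3 @ ?f p4)) p1 = slot_sum (\<lambda>z. G (z @ ?f p3) * H (?f p2 @ ?f p4)) p1"
    "slot_sum (\<lambda>z. F (?f p1 @ z @ ?f p3 @ ?f p4)) p2 = slot_sum (\<lambda>z. G (?f p1 @ ?f p3) * H (z @ ?f p4)) p2"
    "slot_sum (\<lambda>z. F (?f p1 @ ?f p2 @ z @ ?f p4)) p3 = slot_sum (\<lambda>z. G (?f p1 @ z) * H (?f p2 @ ?f p4)) p3"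
    "slot_sum (\<lambda>z. F (?f p1 @ ?f p2 @ ?f p3 @ z)) p4 = slot_sum (\<lambda>z. G (?f p1 @ ?f p3) * H (?f p2 @ z)) p4"
    by (rule slot_sum_cong; simp add: assms)+
  then show ?thesis
    by (simp add: slot_sum_append slot_sum_cmult slot_sum_cmult_right algebra_simps)
qed

lemma transpose_add: "transpose (P + Q) = transpose P + transpose Q"
  by (simp add: transpose_def vec_eq_iff)

lemma matrix_vector_axis: "(M *v axis B 1) $ A = (M :: real ^ 'n ^ 'm) $ A $ B"
  by (simp add: matrix_vector_mult_basis column_def)

text \<open>Both sides are \<open>M\<^sup>A\<^sub>B \<beta>(e\<^sup>B, e\<^sub>A)\<close>.\<close>

lemma bilinear_trace:
  fixes \<beta> :: "real ^ 'n \<Rightarrow> real ^ 'n \<Rightarrow> real"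
  assumes "\<And>b. linear (\<lambda>a. \<beta> a b)" "\<And>a. linear (\<beta> a)"
  shows "(\<Sum>A\<in>UNIV. \<beta> (transpose M *v axis A 1) (axis A 1)) = (\<Sum>A\<in>UNIV. \<beta> (axis A 1) (M *v axis A 1))"
proof -
  have ex: "x = (\<Sum>B\<in>UNIV. x $ B *\<^sub>R axis B 1)" for x :: "real ^ 'n"
    by (simp add: basis_expansion scalar_mult_eq_scaleR[symmetric])
  have e1: "\<beta> a b = (\<Sum>B\<in>UNIV. a $ B * \<beta> (axis B 1) b)" for a b
  proof -
    have "\<beta> a b = \<beta> (\<Sum>B\<in>UNIV. a $ B *\<^sub>R axis B 1) b" using ex[of a] by simp
    then show ?thesis by (simp add: linear_sum[OF assms(1)] linear_scale[OF assms(1)])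
  qed
  have e2: "\<beta> a b = (\<Sum>B\<in>UNIV. b $ B * \<beta> a (axis B 1))" for a b
  proof -
    have "\<beta> a b = \<beta> a (\<Sum>B\<in>UNIV. b $ B *\<^sub>R axis B 1)" using ex[of b] by simp
    then show ?thesis by (simp add: linear_sum[OF assms(2)] linear_scale[OF assms(2)])
  qed
  have "(\<Sum>A\<in>UNIV. \<beta> (transpose M *v axis A 1) (axis A 1)) = (\<Sum>A\<in>UNIV. \<Sum>B\<in>UNIV. M $ A $ B * \<beta> (axis B 1) (axis A 1))"
    by (intro sum.cong refl trans[OF e1]) (simp only: matrix_vector_axis, simp add: transpose_def)
  also have "\<dots> = (\<Sum>B\<in>UNIV. \<Sum>A\<in>UNIV. M $ A $ B * \<beta> (axis B 1) (axis A 1))" by (rule sum.swap)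
  also have "\<dots> = (\<Sum>A\<in>UNIV. \<beta> (axis A 1) (M *v axis A 1))"
    by (intro sum.cong refl trans[OF _ e2[symmetric]]) (simp only: matrix_vector_axis)
  finally show ?thesis .
qed

text \<open>A linear connection is given by matrices \<open>Om c v X\<close> of functions, linear in \<open>X\<close>, such that
  \<open>D\<^sub>X e\<^sub>B = Om\<^sup>A\<^sub>B e\<^sub>A\<close> in the adapted frame of the chart \<open>c\<close>.\<close>

locale gte_connection = gte S
  for S :: "('a::{t2_space, second_countable_topology}, 'b::{t2_space, second_countable_topology},
    'm::finite, 'f::topological_space, 'p::finite, 'e::topological_space, 'r::finite) gte_data" +
  fixes Om :: "('a, 'b, 'm, 'f, 'p, 'e, 'r) local_chart \<Rightarrow> 'e \<Rightarrow> ('f, 'e) gte \<Rightarrow> real ^ ('p + 'r) ^ ('p + 'r)"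
  assumes Om_add: "c \<in> charts \<Longrightarrow> v \<in> dom_E S c \<Longrightarrow> gte_vector v X \<Longrightarrow> gte_vector v X' \<Longrightarrow>
      Om c v (gte_add S X X') = Om c v X + Om c v X'"
    and Om_scale: "c \<in> charts \<Longrightarrow> v \<in> dom_E S c \<Longrightarrow> gte_vector v X \<Longrightarrow>
      Om c v (gte_scale S k X) = k *\<^sub>R Om c v X"
    and Om_smooth: "c \<in> charts \<Longrightarrow> v \<in> dom_E S c \<Longrightarrow> W \<in> gte_sections S \<Longrightarrow> smooth v (\<lambda>v. Om c v (W v) $ A $ B)"
    and Om_change: "c \<in> charts \<Longrightarrow> v \<in> dom_E S c \<Longrightarrow> c' \<in> charts \<Longrightarrow> v \<in> dom_E S c' \<Longrightarrow> gte_vector v X \<Longrightarrow>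
      tr c c' v ** Om c v X = (\<chi> A B. snd X (\<lambda>v. tr c c' v $ A $ B)) + Om c' v X ** tr c c' v"
    and Om_block: "c \<in> charts \<Longrightarrow> v \<in> dom_E S c \<Longrightarrow> gte_vector v X \<Longrightarrow> Om c v X $ Inl \<alpha> $ Inr b = 0"
      "c \<in> charts \<Longrightarrow> v \<in> dom_E S c \<Longrightarrow> gte_vector v X \<Longrightarrow> Om c v X $ Inr a $ Inl \<beta> = 0"
begin

definition slot_deriv where
  "slot_deriv c v X y z = (case y of Inl _ \<Rightarrow> - (transpose (Om c v X) *v z) | Inr _ \<Rightarrow> Om c v X *v z)"

text \<open>The derivative of the components with constant coefficients, corrected in every slot. The lists \<open>\<omega>s\<close> and \<open>Xs\<close>
  enter only by their lengths, as the kinds of the slots, while \<open>zs\<close> contains the coefficients; this makes the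
  dependence on the coefficients multilinear.\<close>

definition Dco where
  "Dco c v X T \<omega>s Xs zs = snd X (\<lambda>v'. Tc c T (length \<omega>s) v' zs) -
    slot_sum (Tc c T (length \<omega>s) v) (map2 (\<lambda>y z. (z, slot_deriv c v X y z)) (slots \<omega>s Xs) zs)"

definition Dat where
  "Dat c v X T \<omega>s Xs = Dco c v X T \<omega>s Xs (map (slot_coord c v) (slots \<omega>s Xs))"

definition D where
  "D X T v \<omega>s Xs = (if valid_args v \<omega>s Xs
     then Dat (SOME c. c \<in> charts \<and> v \<in> dom_E S c) v (X v) T \<omega>s Xs else 0)"

definition cov_pairs where "cov_pairs c v X = map (\<lambda>\<omega>. (coef c v \<omega>, - (transpose (Om c v X) *v coef c v \<omega>)))"
definition vec_pairs where "vec_pairs c v X = map (\<lambda>Y. (acoord c v Y, Om c v X *v acoord c v Y))"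

lemma Dat_unfold:
  "Dat c v X T \<omega>s Xs = snd X (\<lambda>v'. Tc c T (length \<omega>s) v' (map (coef c v) \<omega>s @ map (acoord c v) Xs)) -
    slot_sum (Tc c T (length \<omega>s) v) (cov_pairs c v X \<omega>s @ vec_pairs c v X Xs)"
  unfolding Dat_def Dco_def map2_map_self
  by (simp only: slots_simps map_map comp_def slot_coord_def cov_pairs_def vec_pairs_def slot_deriv_def sum.case)

lemma Tc_wrong_length:
  assumes "T \<in> TF k l" "\<not> (k' = k \<and> n = k + l)" "length zs = n" "k' \<le> n" shows "Tc c T k' v zs = 0"
  unfolding Tc_def by (rule TF_zero[OF assms(1)]) (use assms in auto)

lemma Dat_wrong_length:
  assumes T: "T \<in> TF k l" and n: "\<not> (length \<omega>s = k \<and> length Xs = l)" and X: "gte_vector v X"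
  shows "Dat c v X T \<omega>s Xs = 0"
proof -
  have z: "Tc c T (length \<omega>s) v' zs = 0" if "length zs = length \<omega>s + length Xs" for v' zs
    by (rule Tc_wrong_length[OF T _ that]) (use n in auto)
  have "slot_sum (Tc c T (length \<omega>s) v) (cov_pairs c v X \<omega>s @ vec_pairs c v X Xs) =
      slot_sum (\<lambda>_. 0) (cov_pairs c v X \<omega>s @ vec_pairs c v X Xs)"
    by (rule slot_sum_cong[OF refl]) (rule z, simp add: cov_pairs_def vec_pairs_def)
  then show ?thesis unfolding Dat_unfold
    using E.tangent_const[OF gte_vector_tangent[OF X], of 0] by (simp add: z slot_sum_zero)
qed

lemma deriv_matrix_vector:
  assumes "w \<in> TE v" "\<And>A B. smooth v (\<lambda>v. M v $ A $ B)"
  shows "(\<chi> A. w (\<lambda>v. (M v *v a) $ A)) = (\<chi> A B. w (\<lambda>v. M v $ A $ B)) *v (a :: real ^ 'n)"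
proof -
  have "w (\<lambda>v. (M v *v a) $ A) = (\<Sum>B\<in>UNIV. w (\<lambda>v. M v $ A $ B) * a $ B)" for A
  proof -
    have s: "smooth v (\<lambda>v. a $ B * M v $ A $ B)" for B by (intro E.smooth_near_mult smooth_near_const assms(2))
    have "w (\<lambda>v. (M v *v a) $ A) = w (\<lambda>v. \<Sum>B\<in>UNIV. a $ B * M v $ A $ B)"
      by (simp add: matrix_vector_mult_def mult.commute)
    then show ?thesis by (simp add: E.tangent_sum[OF assms(1) s] E.tangent_cmult[OF assms] mult.commute)
  qed
  then show ?thesis by (simp add: vec_eq_iff matrix_vector_mult_def)
qed

text \<open>Constant coefficients in the chart \<open>c\<close> are variable ones in \<open>c'\<close>. Leibniz' rule yields one term with the
  derivative of the transition matrix for each slot, and \<open>Om_change\<close> absorbs it in the correction of this slot.\<close>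

lemma Dat_change:
  assumes T: "T \<in> TF k l" and c: "c \<in> charts" "v \<in> dom_E S c" and c': "c' \<in> charts" "v \<in> dom_E S c'"
    and X: "gte_vector v X" and val: "valid_args v \<omega>s Xs" and len: "length \<omega>s = k" "length Xs = l"
  shows "Dat c v X T \<omega>s Xs = Dat c' v X T \<omega>s Xs"
proof -
  let ?ys = "slots \<omega>s Xs" and ?g = "slot_coord c v" and ?w = "snd X" and ?F = "Tc c T k" and ?F' = "Tc c' T k"
  note w = gte_vector_tangent[OF X]
  let ?sc = "slot_change c c'" and ?sd = "slot_deriv c v X" and ?sd' = "slot_deriv c' v X"
  let ?fs = "map (\<lambda>y v'. ?sc v' y (?g y)) ?ys"
  let ?d = "\<lambda>y. \<chi> B. ?w (\<lambda>v'. ?sc v' y (?g y) $ B)"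
  have fam: "E.smooth_family (length ?fs) v ?F'" using Tc_smooth_family[OF T c'] len by simp
  have trs: "smooth v (\<lambda>v. tr c c' v $ A $ B)" "smooth v (\<lambda>v. transpose (tr c' c v) $ A $ B)" for A B
    using tr_smooth'[OF c c'] tr_smooth'[OF c' c] by (simp_all add: transpose_def)
  have fs: "smooth v (\<lambda>v'. f v' $ B)" if "f \<in> set ?fs" for f B
  proof -
    from that obtain y where f: "f = (\<lambda>v'. ?sc v' y (?g y))" by (auto simp: slots_def)
    show ?thesis
    proof (cases y)
      case (Inl \<omega>)
      have "smooth v (\<lambda>v'. \<Sum>A\<in>UNIV. transpose (tr c' c v') $ B $ A * ?g y $ A)"
        by (intro E.smooth_near_sum E.smooth_near_mult trs smooth_near_const)
      then show ?thesis by (simp add: f Inl slot_change_def matrix_vector_mult_def del: transpose_matrix_vector)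
    next
      case (Inr Y)
      have "smooth v (\<lambda>v'. \<Sum>A\<in>UNIV. tr c c' v' $ B $ A * ?g y $ A)"
        by (intro E.smooth_near_sum E.smooth_near_mult trs smooth_near_const)
      then show ?thesis by (simp add: f Inr slot_change_def matrix_vector_mult_def)
    qed
  qed
  have "near v (\<lambda>v'. ?F v' (map ?g ?ys)) (\<lambda>v'. ?F' v' (map (\<lambda>f. f v') ?fs))"
    unfolding near_def using eventually_dom_E[OF c] eventually_dom_E[OF c']
  proof eventually_elim
    case (elim v')
    have "?F v' (map ?g ?ys) = ?F' v' (map2 (?sc v') ?ys (map ?g ?ys))"
      using Tc_change[OF c(1) elim(1) c'(1) elim(2), of "map ?g ?ys" \<omega>s Xs T] len by simp
    also have "map2 (?sc v') ?ys (map ?g ?ys) = map (\<lambda>f. f v') ?fs"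
      by (simp only: map2_map_self map_map comp_def)
    finally show ?case .
  qed
  then have "?w (\<lambda>v'. ?F v' (map ?g ?ys)) = ?w (\<lambda>v'. ?F' v' (map (\<lambda>f. f v') ?fs))"
    by (rule E.tangent_cong[OF w])
  also have "\<dots> = ?w (\<lambda>v'. ?F' v' (map (\<lambda>f. f v) ?fs)) + slot_sum (?F' v) (map (\<lambda>f. (f v, \<chi> B. ?w (\<lambda>v'. f v' $ B))) ?fs)"
    by (rule E.smooth_family_leibniz[OF w fam fs])
  also have "map (\<lambda>f. f v) ?fs = map (slot_coord c' v) ?ys"
  proof -
    have "?sc v y (?g y) = slot_coord c' v y" if "y \<in> set ?ys" for y
      using that val coef_change[OF c c'] acoord_change[OF c c']
      by (auto simp: slots_def slot_change_def slot_coord_def valid_args_def simp del: transpose_matrix_vector)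
    then show ?thesis by (simp only: map_map comp_def cong: map_cong)
  qed
  finally have 1: "?w (\<lambda>v'. ?F v' (map ?g ?ys)) =
      ?w (\<lambda>v'. ?F' v' (map (slot_coord c' v) ?ys)) + slot_sum (?F' v) (map (\<lambda>y. (?sc v y (?g y), ?d y)) ?ys)"
    by (simp only: map_map comp_def)
  have 2: "slot_sum (?F v) (map (\<lambda>y. (?g y, ?sd y (?g y))) ?ys) =
      slot_sum (?F' v) (map (\<lambda>y. (?sc v y (?g y), ?sc v y (?sd y (?g y)))) ?ys)"
    by (rule slot_sum_relabel) (use Tc_change[OF c c', of _ \<omega>s Xs T] len in simp)
  have 3: "?sc v y (?sd y (?g y)) - ?d y = ?sd' y (?sc v y (?g y))" for y
  proof (cases y)
    case (Inl \<omega>)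
    let ?W = "\<chi> A B. ?w (\<lambda>v. tr c' c v $ A $ B)" and ?a = "?g y" and ?I = "tr c' c v"
    have "?d y = (\<chi> A B. ?w (\<lambda>v. transpose (tr c' c v) $ A $ B)) *v ?a"
      using deriv_matrix_vector[OF w trs(2)] by (simp add: Inl slot_change_def del: transpose_matrix_vector)
    also have "(\<chi> A B. ?w (\<lambda>v. transpose (tr c' c v) $ A $ B)) = transpose ?W" by (simp add: transpose_def)
    finally have d: "?d y = transpose ?W *v ?a" .
    have "transpose (Om c' v X) ** transpose ?I = transpose ?W + transpose ?I ** transpose (Om c v X)"
      using arg_cong[OF Om_change[OF c' c X], of transpose] by (simp only: matrix_transpose_mul transpose_add)
    then have "(transpose (Om c' v X) ** transpose ?I) *v ?a = (transpose ?W + transpose ?I ** transpose (Om c v X)) *v ?a"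
      by (rule arg_cong)
    then have "transpose (Om c' v X) *v (transpose ?I *v ?a) = transpose ?W *v ?a + transpose ?I *v (transpose (Om c v X) *v ?a)"
      by (simp only: matrix_vector_mul_assoc[symmetric] matrix_vector_mult_add_rdistrib)
    moreover have "transpose ?I *v - (transpose (Om c v X) *v ?a) = - (transpose ?I *v (transpose (Om c v X) *v ?a))"
      by (simp only: vec.neg)
    ultimately show ?thesis unfolding d by (simp add: Inl slot_change_def slot_deriv_def del: transpose_matrix_vector)
  next
    case (Inr Y)
    let ?W = "\<chi> A B. ?w (\<lambda>v. tr c c' v $ A $ B)" and ?b = "?g y" and ?J = "tr c c' v"
    have d: "?d y = ?W *v ?b"
      using deriv_matrix_vector[OF w trs(1)] by (simp add: Inr slot_change_def)
    have "(?J ** Om c v X) *v ?b = (?W + Om c' v X ** ?J) *v ?b"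
      by (rule arg_cong[OF Om_change[OF c c' X]])
    then have "?J *v (Om c v X *v ?b) = ?W *v ?b + Om c' v X *v (?J *v ?b)"
      by (simp only: matrix_vector_mul_assoc[symmetric] matrix_vector_mult_add_rdistrib)
    then show ?thesis unfolding d by (simp add: Inr slot_change_def slot_deriv_def)
  qed
  have ml: "mlin (length ?ys) (?F' v)" using Tc_mlin[OF T c'] len by simp
  have "slot_sum (?F v) (map (\<lambda>y. (?g y, ?sd y (?g y))) ?ys) - slot_sum (?F' v) (map (\<lambda>y. (?sc v y (?g y), ?d y)) ?ys) =
      slot_sum (?F' v) (map (\<lambda>y. (?sc v y (?g y), ?sd' y (?sc v y (?g y)))) ?ys)"
    unfolding 2 slot_sum_diff[OF ml, symmetric] 3 ..
  also have "map (\<lambda>y. (?sc v y (?g y), ?sd' y (?sc v y (?g y)))) ?ys = map (\<lambda>y. (slot_coord c' v y, ?sd' y (slot_coord c' v y))) ?ys"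
  proof -
    have "?sc v y (?g y) = slot_coord c' v y" if "y \<in> set ?ys" for y
      using that val coef_change[OF c c'] acoord_change[OF c c']
      by (auto simp: slots_def slot_change_def slot_coord_def valid_args_def simp del: transpose_matrix_vector)
    then show ?thesis by (simp only: cong: map_cong)
  qed
  finally show ?thesis
    using 1 unfolding Dat_def Dco_def len map2_map_self by linarith
qed

lemma D_eq:
  assumes "T \<in> TF k l" "c \<in> charts" "v \<in> dom_E S c" "gte_vector v (X v)" "valid_args v \<omega>s Xs"
  shows "D X T v \<omega>s Xs = Dat c v (X v) T \<omega>s Xs"
proof -
  let ?c = "SOME c. c \<in> charts \<and> v \<in> dom_E S c"
  have c: "?c \<in> charts \<and> v \<in> dom_E S ?c" by (rule someI) (use assms in blast)
  show ?thesis
  proof (cases "length \<omega>s = k \<and> length Xs = l")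
    case True
    then show ?thesis using Dat_change[OF assms(1) _ _ assms(2,3,4,5), of ?c] c assms(5) by (simp add: D_def)
  next
    case False
    then show ?thesis using Dat_wrong_length[OF assms(1) False assms(4)] by (simp add: D_def)
  qed
qed

lemma Dco_mlin:
  fixes \<omega>s :: "('f, 'e) covector list" and Xs :: "('f, 'e) gte list"
  assumes T: "T \<in> TF (length \<omega>s) (length Xs)" and c: "c \<in> charts" "v \<in> dom_E S c" and X: "gte_vector v X"
  shows "mlin (length \<omega>s + length Xs) (Dco c v X T \<omega>s Xs)"
proof -
  have l: "linear (slot_deriv c v X y)" for y :: "('f, 'e) covector + ('f, 'e) gte"
    by (cases y) (simp_all add: slot_deriv_def linear_iff vec.add vec.scale scalar_mult_eq_scaleR[symmetric] del: transpose_matrix_vector)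
  have 1: "mlin (length \<omega>s + length Xs) (\<lambda>zs. snd X (\<lambda>v'. Tc c T (length \<omega>s) v' zs))"
    by (rule E.smooth_family_deriv_mlin[OF gte_vector_tangent[OF X] Tc_smooth_family[OF T c]])
  have 2: "mlin (length \<omega>s + length Xs) (\<lambda>zs. slot_sum (Tc c T (length \<omega>s) v) (map2 (\<lambda>y z. (z, slot_deriv c v X y z)) (slots \<omega>s Xs) zs))"
    using mlin_slot_sum[of "slots \<omega>s Xs" "Tc c T (length \<omega>s) v" "slot_deriv c v X"] Tc_mlin[OF T c] l by simp
  show ?thesis
    by (rule mlinI) (use linear_compose_sub[OF mlin_update[OF 1] mlin_update[OF 2]] in \<open>simp add: Dco_def\<close>)
qed

lemma Dco_cong:
  assumes "length \<omega>s = length \<omega>s'" "length Xs = length Xs'"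
  shows "Dco c v X T \<omega>s Xs = Dco c v X T \<omega>s' Xs'"
proof -
  have "map2 (\<lambda>y z. (z, slot_deriv c v X y z)) (slots \<omega>s Xs) zs = map2 (\<lambda>y z. (z, slot_deriv c v X y z)) (slots \<omega>s' Xs') zs" for zs
    using assms by (intro nth_equalityI) (auto simp: slots_def nth_append slot_deriv_def)
  then show ?thesis by (simp add: Dco_def assms fun_eq_iff)
qed

lemma D_tensor:
  assumes T: "T \<in> TF k l" and X: "X \<in> gte_sections S"
  shows "D X T \<in> TF k l"
proof (rule TFI)
  fix v \<omega>s Xs assume "\<not> (length \<omega>s = k \<and> length Xs = l \<and> valid_args v \<omega>s Xs)"
  then show "D X T v \<omega>s Xs = 0"
    by (cases "valid_args v \<omega>s Xs") (simp_all add: D_def Dat_wrong_length[OF T _ gte_sections_vector[OF X]])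
next
  fix v \<omega>s Xs i
  assume len: "length \<omega>s = k" "length Xs = l" and val: "valid_args v \<omega>s Xs" and i: "i < k"
  obtain c where c: "c \<in> charts" "v \<in> dom_E S c" by (rule local_chart_at)
  note Xv = gte_sections_vector[OF X, of v]
  let ?zs = "map (slot_coord c v) (slots \<omega>s Xs)"
  have ml: "mlin (k + l) (Dco c v (X v) T \<omega>s Xs)" using Dco_mlin[of T \<omega>s Xs, OF _ c Xv] T len by simp
  have up: "D X T v (\<omega>s[i := \<omega>]) Xs = Dco c v (X v) T \<omega>s Xs (?zs[i := coef c v \<omega>])" if d: "\<omega> \<in> gte_dual S v" for \<omega>
  proof -
    have "set (\<omega>s[i := \<omega>]) \<subseteq> insert \<omega> (set \<omega>s)" by (rule set_update_subset_insert)
    then have "valid_args v (\<omega>s[i := \<omega>]) Xs" using val d by (auto simp: valid_args_def)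
    then have "D X T v (\<omega>s[i := \<omega>]) Xs = Dat c v (X v) T (\<omega>s[i := \<omega>]) Xs" by (rule D_eq[where X = X, OF T c Xv])
    also have "\<dots> = Dco c v (X v) T \<omega>s Xs (map (slot_coord c v) (slots (\<omega>s[i := \<omega>]) Xs))"
      unfolding Dat_def by (rule fun_cong[OF Dco_cong]) simp_all
    also have "map (slot_coord c v) (slots (\<omega>s[i := \<omega>]) Xs) = ?zs[i := coef c v \<omega>]"
      using i len by (simp add: map_update list_update_append1 slot_coord_def)
    finally show ?thesis .
  qed
  have lin: "linear (\<lambda>x. Dco c v (X v) T \<omega>s Xs (?zs[i := x]))" by (rule mlin_update[OF ml]) (use i len in auto)
  have dual: "(\<lambda>X. \<omega> X + \<omega>' X) \<in> gte_dual S v" "(\<lambda>X. r * \<omega> X) \<in> gte_dual S v"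
    if "\<omega> \<in> gte_dual S v" "\<omega>' \<in> gte_dual S v" for \<omega> \<omega>' r
    using that unfolding gte_dual_def by (auto simp: algebra_simps)
  have co: "coef c v (\<lambda>X. \<omega> X + \<omega>' X) = coef c v \<omega> + coef c v \<omega>'" "coef c v (\<lambda>X. r * \<omega> X) = r *\<^sub>R coef c v \<omega>" for \<omega> \<omega>' r
    by (simp_all add: coef_def vec_eq_iff)
  show "\<forall>\<omega>\<in>gte_dual S v. \<forall>\<omega>'\<in>gte_dual S v. \<forall>r.
      D X T v (\<omega>s[i := (\<lambda>X. \<omega> X + \<omega>' X)]) Xs = D X T v (\<omega>s[i := \<omega>]) Xs + D X T v (\<omega>s[i := \<omega>']) Xs \<and>
      D X T v (\<omega>s[i := (\<lambda>X. r * \<omega> X)]) Xs = r * D X T v (\<omega>s[i := \<omega>]) Xs"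
    by (intro ballI allI) (simp add: up dual co linear_add[OF lin] linear_scale[OF lin] del: slots_simps)
next
  fix v \<omega>s Xs i
  assume len: "length \<omega>s = k" "length Xs = l" and val: "valid_args v \<omega>s Xs" and i: "i < l"
  obtain c where c: "c \<in> charts" "v \<in> dom_E S c" by (rule local_chart_at)
  note Xv = gte_sections_vector[OF X, of v]
  let ?zs = "map (slot_coord c v) (slots \<omega>s Xs)"
  have ml: "mlin (k + l) (Dco c v (X v) T \<omega>s Xs)" using Dco_mlin[of T \<omega>s Xs, OF _ c Xv] T len by simp
  have up: "D X T v \<omega>s (Xs[i := Y]) = Dco c v (X v) T \<omega>s Xs (?zs[k + i := acoord c v Y])" if d: "gte_vector v Y" for Y
  proof -
    have "set (Xs[i := Y]) \<subseteq> insert Y (set Xs)" by (rule set_update_subset_insert)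
    then have "valid_args v \<omega>s (Xs[i := Y])" using val d unfolding valid_args_def by blast
    then have "D X T v \<omega>s (Xs[i := Y]) = Dat c v (X v) T \<omega>s (Xs[i := Y])" by (rule D_eq[where X = X, OF T c Xv])
    also have "\<dots> = Dco c v (X v) T \<omega>s Xs (map (slot_coord c v) (slots \<omega>s (Xs[i := Y])))"
      unfolding Dat_def by (rule fun_cong[OF Dco_cong]) simp_all
    also have "map (slot_coord c v) (slots \<omega>s (Xs[i := Y])) = ?zs[k + i := acoord c v Y]"
      using i len by (simp add: map_update list_update_append slot_coord_def)
    finally show ?thesis .
  qed
  have lin: "linear (\<lambda>x. Dco c v (X v) T \<omega>s Xs (?zs[k + i := x]))" by (rule mlin_update[OF ml]) (use i len in auto)
  show "\<forall>Y Y' r. gte_vector v Y \<longrightarrow> gte_vector v Y' \<longrightarrow>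
      D X T v \<omega>s (Xs[i := gte_add S Y Y']) = D X T v \<omega>s (Xs[i := Y]) + D X T v \<omega>s (Xs[i := Y']) \<and>
      D X T v \<omega>s (Xs[i := gte_scale S r Y]) = r * D X T v \<omega>s (Xs[i := Y])"
    by (intro allI impI) (simp add: up gte_vector_add gte_vector_scale acoord_add[OF c] acoord_scale[OF c]
        linear_add[OF lin] linear_scale[OF lin] del: slots_simps)
next
  fix c v and As Bs :: "('p + 'r) list"
  assume c: "c \<in> charts" "v \<in> dom_E S c" and len: "length As = k" "length Bs = l"
  let ?e = "\<lambda>B. axis B 1 :: real ^ ('p + 'r)"
  let ?fs = "map (\<lambda>B. (\<lambda>_. ?e B, \<lambda>v. - (transpose (Om c v (X v)) *v ?e B))) As @ map (\<lambda>B. (\<lambda>_. ?e B, \<lambda>v. Om c v (X v) *v ?e B)) Bs"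
  have fam: "E.smooth_family (k + l) v (Tc c T k)" by (rule Tc_smooth_family[OF T c])
  have 1: "smooth v (\<lambda>v'. snd (X v') (\<lambda>u. Tc c T k u (map ?e (As @ Bs))))"
    by (rule gte_deriv_smooth[OF X], rule fam[unfolded E.smooth_family_def, THEN conjunct2, rule_format])
      (simp add: len)
  have 2: "smooth v (\<lambda>v'. slot_sum (Tc c T k v') (map (\<lambda>p. (fst p v', snd p v')) ?fs))"
  proof (rule E.smooth_family_slot_sum)
    show "E.smooth_family (length ?fs) v (Tc c T k)" using fam len by simp
    have s: "smooth v (\<lambda>v. (M v *v ?e B) $ A)" if "\<And>A B. smooth v (\<lambda>v. M v $ A $ B)" for M :: "'e \<Rightarrow> real ^ ('p + 'r) ^ ('p + 'r)" and A B
      using that by (simp add: matrix_vector_axis)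
    have t: "smooth v (\<lambda>v. transpose (Om c v (X v)) $ A $ B)" for A B
      using Om_smooth[OF c X, of B A] by (simp add: transpose_def)
    fix p :: "('e \<Rightarrow> real ^ ('p + 'r)) \<times> ('e \<Rightarrow> real ^ ('p + 'r))" and B
    assume "p \<in> set ?fs"
    then show "smooth v (\<lambda>v'. fst p v' $ B) \<and> smooth v (\<lambda>v'. snd p v' $ B)"
      using s[of "\<lambda>v. Om c v (X v)", OF Om_smooth[OF c X]] s[of "\<lambda>v. transpose (Om c v (X v))", OF t]
      by (auto simp: smooth_near_const E.smooth_near_minus simp del: transpose_matrix_vector)
  qed
  have "near v (\<lambda>v'. snd (X v') (\<lambda>u. Tc c T k u (map ?e (As @ Bs))) - slot_sum (Tc c T k v') (map (\<lambda>p. (fst p v', snd p v')) ?fs))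
      (\<lambda>v. D X T v (map (coframe S c v) As) (map (frame S c v) Bs))"
    unfolding near_def using eventually_dom_E[OF c]
  proof eventually_elim
    case (elim v')
    have val: "valid_args v' (map (coframe S c v') As) (map (frame S c v') Bs)"
      using acov_dual[OF c(1) elim] avec_gte_vector[OF c(1) elim] by (auto simp: valid_args_def coframe_acov frame_avec)
    have "map (coef c v') (map (coframe S c v') As) = map ?e As" "map (acoord c v') (map (frame S c v') Bs) = map ?e Bs"
      using coef_acov[OF c(1) elim] acoord_avec[OF c(1) elim] by (simp_all add: coframe_acov frame_avec)
    then show ?case
      using D_eq[where X = X, OF T c(1) elim gte_sections_vector[OF X] val] len coef_acov[OF c(1) elim] acoord_avec[OF c(1) elim]
      by (simp add: Dat_unfold cov_pairs_def vec_pairs_def comp_def coframe_acov frame_avec del: transpose_matrix_vector)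
  qed
  then show "smooth v (\<lambda>v. D X T v (map (coframe S c v) As) (map (frame S c v) Bs))"
    by (rule E.smooth_near_cong[OF _ E.smooth_near_diff[OF 1 2]])
qed

end

subsection \<open>Products, contractions, functions and vectors\<close>

context gte
begin

lemma insert_at_valid:
  "valid_args v (insert_at i \<omega> \<omega>s) (insert_at j X Xs) \<longleftrightarrow> \<omega> \<in> gte_dual S v \<and> gte_vector v X \<and> valid_args v \<omega>s Xs"
  unfolding valid_args_def set_insert_at by blast

lemma insert_bilinear:
  assumes T: "T \<in> TF (Suc k) (Suc l)" and c: "c \<in> charts" "v \<in> dom_E S c"
    and len: "length \<omega>s = k" "length Xs = l" and i: "i \<le> k" "j \<le> l"
  shows "linear (\<lambda>a. T v (insert_at i (acov c v a) \<omega>s) (insert_at j (avec c v b) Xs))"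
    and "linear (\<lambda>b. T v (insert_at i (acov c v a) \<omega>s) (insert_at j (avec c v b) Xs))"
proof -
  let ?o = "\<lambda>\<omega>. insert_at i \<omega> \<omega>s" and ?x = "\<lambda>X. insert_at j X Xs"
  have o: "?o \<omega> = (?o undefined)[i := \<omega>]" for \<omega> by (rule insert_at_update_new[symmetric]) (use len i in simp)
  have x: "?x X = (?x undefined)[j := X]" for X by (rule insert_at_update_new[symmetric]) (use len i in simp)
  have i': "i < Suc k" "j < Suc l" using i by auto
  show "linear (\<lambda>a. T v (?o (acov c v a)) (?x (avec c v b)))"
    by (subst o, rule linearI) (simp_all only: acov_add acov_scale TF_cov_add[OF T i'(1) acov_dual[OF c] acov_dual[OF c]]
        TF_cov_scale[OF T i'(1) acov_dual[OF c]] real_scaleR_def)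
  show "linear (\<lambda>b. T v (?o (acov c v a)) (?x (avec c v b)))"
    by (subst x, rule linearI) (simp_all only: avec_add[OF c] avec_scale[OF c]
        TF_vec_add[OF T i'(2) avec_gte_vector[OF c] avec_gte_vector[OF c]] TF_vec_scale[OF T i'(2) avec_gte_vector[OF c]] real_scaleR_def)
qed

text \<open>Independence of the frame is the invariance of the trace.\<close>

lemma contract_eq:
  assumes T: "T \<in> TF (Suc k) (Suc l)" and i: "i \<le> k" "j \<le> l" and c: "c \<in> charts" "v \<in> dom_E S c"
  shows "contract S i j T v \<omega>s Xs = (\<Sum>A\<in>UNIV. T v (insert_at i (coframe S c v A) \<omega>s) (insert_at j (frame S c v A) Xs))"
proof (cases "length \<omega>s = k \<and> length Xs = l \<and> valid_args v \<omega>s Xs")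
  case False
  have "T v (insert_at i \<omega> \<omega>s) (insert_at j X Xs) = 0" for \<omega> X
    by (rule TF_zero[OF T]) (use False insert_at_valid in auto)
  then show ?thesis by (simp add: contract_def Let_def)
next
  case True
  let ?c = "SOME c. c \<in> charts \<and> v \<in> dom_E S c"
  have "?c \<in> charts \<and> v \<in> dom_E S ?c" by (rule someI) (use c in blast)
  then have d: "?c \<in> charts" "v \<in> dom_E S ?c" by auto
  define \<beta> where "\<beta> a b = T v (insert_at i (acov c v a) \<omega>s) (insert_at j (avec c v b) Xs)" for a b
  have lin: "linear (\<lambda>a. \<beta> a b)" "linear (\<beta> a)" for a b
    using insert_bilinear[OF T c _ _ i] True by (simp_all add: \<beta>_def[abs_def])
  let ?J = "tr ?c c v" and ?I = "tr c ?c v"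
  have lin': "linear (\<lambda>b. \<beta> a (?J *v b))" for a
    using linear_compose[OF matrix_vector_mul_linear[of ?J] lin(2)[of a]] by (simp add: comp_def)
  have "contract S i j T v \<omega>s Xs = (\<Sum>A\<in>UNIV. T v (insert_at i (coframe S ?c v A) \<omega>s) (insert_at j (frame S ?c v A) Xs))"
    by (simp add: contract_def Let_def)
  also have "\<dots> = (\<Sum>A\<in>UNIV. \<beta> (transpose ?I *v axis A 1) (?J *v axis A 1))"
    by (simp only: coframe_acov frame_avec acov_change[OF d c] avec_change[OF d c] \<beta>_def)
  also have "\<dots> = (\<Sum>A\<in>UNIV. \<beta> (axis A 1) (?J *v (?I *v axis A 1)))"
    by (rule bilinear_trace[of "\<lambda>a b. \<beta> a (?J *v b)", OF lin(1) lin'])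
  also have "\<dots> = (\<Sum>A\<in>UNIV. \<beta> (axis A 1) (axis A 1))"
    by (simp add: matrix_vector_mul_assoc tr_inverse'[OF c d])
  finally show ?thesis by (simp only: coframe_acov frame_avec \<beta>_def)
qed

lemma contract_tensor:
  assumes T: "T \<in> TF (Suc k) (Suc l)" and i: "i \<le> k" "j \<le> l"
  shows "contract S i j T \<in> TF k l"
proof (rule TFI)
  fix v \<omega>s Xs assume n: "\<not> (length \<omega>s = k \<and> length Xs = l \<and> valid_args v \<omega>s Xs)"
  have "T v (insert_at i \<omega> \<omega>s) (insert_at j X Xs) = 0" for \<omega> X
    by (rule TF_zero[OF T]) (use n insert_at_valid in auto)
  then show "contract S i j T v \<omega>s Xs = 0" by (simp add: contract_def Let_def)
next
  fix v m and \<omega>s :: "('f, 'e) covector list" and Xs :: "('f, 'e) gte list"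
  assume len: "length \<omega>s = k" "length Xs = l" and m: "m < k"
  obtain c where c: "c \<in> charts" "v \<in> dom_E S c" by (rule local_chart_at)
  let ?m = "if m < i then m else Suc m"
  have u: "insert_at i x (\<omega>s[m := y]) = (insert_at i x \<omega>s)[?m := y]" for x y using len i by (simp add: insert_at_update)
  have m': "?m < Suc k" using m by auto
  show "\<forall>\<omega>\<in>gte_dual S v. \<forall>\<omega>'\<in>gte_dual S v. \<forall>r.
      contract S i j T v (\<omega>s[m := (\<lambda>X. \<omega> X + \<omega>' X)]) Xs = contract S i j T v (\<omega>s[m := \<omega>]) Xs + contract S i j T v (\<omega>s[m := \<omega>']) Xs \<and>
      contract S i j T v (\<omega>s[m := (\<lambda>X. r * \<omega> X)]) Xs = r * contract S i j T v (\<omega>s[m := \<omega>]) Xs"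
    by (intro ballI allI)
      (simp only: contract_eq[OF T i c] u TF_cov_add[OF T m'] TF_cov_scale[OF T m'] sum.distrib sum_distrib_left simp_thms)
next
  fix v m and \<omega>s :: "('f, 'e) covector list" and Xs :: "('f, 'e) gte list"
  assume len: "length \<omega>s = k" "length Xs = l" and m: "m < l"
  obtain c where c: "c \<in> charts" "v \<in> dom_E S c" by (rule local_chart_at)
  let ?m = "if m < j then m else Suc m"
  have u: "insert_at j x (Xs[m := y]) = (insert_at j x Xs)[?m := y]" for x y using len i by (simp add: insert_at_update)
  have m': "?m < Suc l" using m by auto
  show "\<forall>X X' r. gte_vector v X \<longrightarrow> gte_vector v X' \<longrightarrow>
      contract S i j T v \<omega>s (Xs[m := gte_add S X X']) = contract S i j T v \<omega>s (Xs[m := X]) + contract S i j T v \<omega>s (Xs[m := X']) \<and>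
      contract S i j T v \<omega>s (Xs[m := gte_scale S r X]) = r * contract S i j T v \<omega>s (Xs[m := X])"
    by (intro allI impI)
      (simp only: contract_eq[OF T i c] u TF_vec_add[OF T m'] TF_vec_scale[OF T m'] sum.distrib sum_distrib_left simp_thms)
next
  fix c v and As Bs :: "('p + 'r) list" assume c: "c \<in> charts" "v \<in> dom_E S c" and len: "length As = k" "length Bs = l"
  have "smooth v (\<lambda>v. \<Sum>A\<in>UNIV. T v (map (coframe S c v) (insert_at i A As)) (map (frame S c v) (insert_at j A Bs)))"
    by (intro E.smooth_near_sum TF_smooth[OF T c]) (simp_all add: len)
  moreover have "near v (\<lambda>v. \<Sum>A\<in>UNIV. T v (map (coframe S c v) (insert_at i A As)) (map (frame S c v) (insert_at j A Bs)))
      (\<lambda>v. contract S i j T v (map (coframe S c v) As) (map (frame S c v) Bs))"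
    unfolding near_def using eventually_dom_E[OF c] by eventually_elim (simp add: contract_eq[OF T i c(1)] map_insert_at)
  ultimately show "smooth v (\<lambda>v. contract S i j T v (map (coframe S c v) As) (map (frame S c v) Bs))"
    using E.smooth_near_cong by blast
qed

lemma tens_prod_tensor:
  assumes T: "T \<in> TF k l" and T': "T' \<in> TF k' l'"
  shows "tens_prod k l T T' \<in> TF (k + k') (l + l')"
proof (rule TFI)
  have split: "valid_args v \<omega>s Xs \<longleftrightarrow> valid_args v (take k \<omega>s) (take l Xs) \<and> valid_args v (drop k \<omega>s) (drop l Xs)" for v \<omega>s Xs
    using set_append[of "take k \<omega>s" "drop k \<omega>s"] set_append[of "take l Xs" "drop l Xs"]
    unfolding valid_args_def append_take_drop_id by blast
  show "tens_prod k l T T' v \<omega>s Xs = 0" if n: "\<not> (length \<omega>s = k + k' \<and> length Xs = l + l' \<and> valid_args v \<omega>s Xs)" for v \<omega>s Xs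
  proof -
    have "\<not> (length (take k \<omega>s) = k \<and> length (take l Xs) = l \<and> valid_args v (take k \<omega>s) (take l Xs)) \<or>
      \<not> (length (drop k \<omega>s) = k' \<and> length (drop l Xs) = l' \<and> valid_args v (drop k \<omega>s) (drop l Xs))"
      using n split[of v \<omega>s Xs] by auto
    then have "T v (take k \<omega>s) (take l Xs) = 0 \<or> T' v (drop k \<omega>s) (drop l Xs) = 0"
      using TF_zero[OF T] TF_zero[OF T'] by blast
    then show ?thesis by (auto simp: tens_prod_def)
  qed
next
  fix v i and \<omega>s :: "('f, 'e) covector list" and Xs :: "('f, 'e) gte list"
  assume len: "length \<omega>s = k + k'" and i: "i < k + k'"
  show "\<forall>\<omega>\<in>gte_dual S v. \<forall>\<omega>'\<in>gte_dual S v. \<forall>r.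
      tens_prod k l T T' v (\<omega>s[i := (\<lambda>X. \<omega> X + \<omega>' X)]) Xs = tens_prod k l T T' v (\<omega>s[i := \<omega>]) Xs + tens_prod k l T T' v (\<omega>s[i := \<omega>']) Xs \<and>
      tens_prod k l T T' v (\<omega>s[i := (\<lambda>X. r * \<omega> X)]) Xs = r * tens_prod k l T T' v (\<omega>s[i := \<omega>]) Xs"
  proof (cases "i < k")
    case True
    then have "take k (\<omega>s[i := \<omega>]) = (take k \<omega>s)[i := \<omega>]" "drop k (\<omega>s[i := \<omega>]) = drop k \<omega>s" for \<omega>
      by (simp_all add: take_update_swap)
    then show ?thesis
      using TF_cov_add[OF T True] TF_cov_scale[OF T True] by (simp add: tens_prod_def distrib_right)
  next
    case False
    then have *: "take k (\<omega>s[i := \<omega>]) = take k \<omega>s" "drop k (\<omega>s[i := \<omega>]) = (drop k \<omega>s)[i - k := \<omega>]" for \<omega>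
      by (simp_all add: drop_update_swap)
    have i': "i - k < k'" using False i by simp
    show ?thesis
      using TF_cov_add[OF T' i'] TF_cov_scale[OF T' i'] by (simp add: tens_prod_def distrib_left *)
  qed
next
  fix v i and \<omega>s :: "('f, 'e) covector list" and Xs :: "('f, 'e) gte list"
  assume len: "length Xs = l + l'" and i: "i < l + l'"
  show "\<forall>X X' r. gte_vector v X \<longrightarrow> gte_vector v X' \<longrightarrow>
      tens_prod k l T T' v \<omega>s (Xs[i := gte_add S X X']) = tens_prod k l T T' v \<omega>s (Xs[i := X]) + tens_prod k l T T' v \<omega>s (Xs[i := X']) \<and>
      tens_prod k l T T' v \<omega>s (Xs[i := gte_scale S r X]) = r * tens_prod k l T T' v \<omega>s (Xs[i := X])"
  proof (cases "i < l")
    case True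
    then have *: "take l (Xs[i := X]) = (take l Xs)[i := X]" "drop l (Xs[i := X]) = drop l Xs" for X
      by (simp_all add: take_update_swap)
    show ?thesis
      by (intro allI impI) (simp add: tens_prod_def distrib_right * TF_vec_add[OF T True] TF_vec_scale[OF T True])
  next
    case False
    then have *: "take l (Xs[i := X]) = take l Xs" "drop l (Xs[i := X]) = (drop l Xs)[i - l := X]" for X
      by (simp_all add: drop_update_swap)
    have i': "i - l < l'" using False i by simp
    show ?thesis
      by (intro allI impI) (simp add: tens_prod_def distrib_left * TF_vec_add[OF T' i'] TF_vec_scale[OF T' i'])
  qed
next
  fix c v and As Bs :: "('p + 'r) list" assume c: "c \<in> charts" "v \<in> dom_E S c" and len: "length As = k + k'" "length Bs = l + l'"
  show "smooth v (\<lambda>v. tens_prod k l T T' v (map (coframe S c v) As) (map (frame S c v) Bs))"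
    unfolding tens_prod_def take_map drop_map
    by (intro E.smooth_near_mult TF_smooth[OF T c] TF_smooth[OF T' c]) (simp_all add: len)
qed

lemma tens_add_tensor: "T \<in> TF k l \<Longrightarrow> T' \<in> TF k l \<Longrightarrow> tens_add T T' \<in> TF k l"
  by (rule TFI) (simp_all add: tens_add_def TF_zero TF_cov_add TF_cov_scale TF_vec_add TF_vec_scale distrib_left
      TF_smooth E.smooth_near_add)

lemma fun_tensor_tensor: "f \<in> smooth_functions (atlasE S) \<Longrightarrow> fun_tensor f \<in> TF 0 0"
  by (rule TFI) (auto simp: fun_tensor_def valid_args_def smooth_functions_def E.msmooth_on_iff)

lemma vec_tensor_apply:
  "vec_tensor S Y v \<omega>s Xs = (if length \<omega>s = 1 \<and> Xs = [] \<and> hd \<omega>s \<in> gte_dual S v then hd \<omega>s (Y v) else 0)"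
  by (auto simp: vec_tensor_def vec_tensor_at_def length_Suc_conv split: list.splits)

lemma vec_tensor_tensor:
  assumes Y: "Y \<in> gte_sections S" shows "vec_tensor S Y \<in> TF 1 0"
proof (rule TFI)
  show "vec_tensor S Y v \<omega>s Xs = 0" if "\<not> (length \<omega>s = 1 \<and> length Xs = 0 \<and> valid_args v \<omega>s Xs)" for v \<omega>s Xs
    using that by (cases \<omega>s) (auto simp: vec_tensor_apply valid_args_def)
  have dual: "(\<lambda>X. \<omega> X + \<omega>' X) \<in> gte_dual S v" "(\<lambda>X. r * \<omega> X) \<in> gte_dual S v"
    if "\<omega> \<in> gte_dual S v" "\<omega>' \<in> gte_dual S v" for \<omega> \<omega>' v r
    using that unfolding gte_dual_def by (auto simp: algebra_simps)
  show "\<forall>\<omega>\<in>gte_dual S v. \<forall>\<omega>'\<in>gte_dual S v. \<forall>r.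
      vec_tensor S Y v (\<omega>s[i := (\<lambda>X. \<omega> X + \<omega>' X)]) Xs = vec_tensor S Y v (\<omega>s[i := \<omega>]) Xs + vec_tensor S Y v (\<omega>s[i := \<omega>']) Xs \<and>
      vec_tensor S Y v (\<omega>s[i := (\<lambda>X. r * \<omega> X)]) Xs = r * vec_tensor S Y v (\<omega>s[i := \<omega>]) Xs"
    if "length \<omega>s = 1" "length Xs = 0" "i < 1" for v \<omega>s Xs i
    using that dual by (cases \<omega>s) (auto simp: vec_tensor_apply)
  fix c v and As Bs :: "('p + 'r) list" assume c: "c \<in> charts" "v \<in> dom_E S c" and len: "length As = 1" "length Bs = 0"
  then obtain A where A: "As = [A]" "Bs = []" by (cases As) auto
  have "near v (\<lambda>v. acoord c v (Y v) $ A) (\<lambda>v. vec_tensor S Y v (map (coframe S c v) As) (map (frame S c v) Bs))"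
    unfolding near_def using eventually_dom_E[OF c]
    by eventually_elim (simp add: A vec_tensor_apply coframe_acov acov_dual[OF c(1)] acov_def gte_sections_vector[OF Y] inner_axis')
  then show "smooth v (\<lambda>v. vec_tensor S Y v (map (coframe S c v) As) (map (frame S c v) Bs))"
    using E.smooth_near_cong gte_sections_smooth[OF Y c] by blast
qed simp

lemma vec_tensor_at_cong:
  "c \<in> charts \<Longrightarrow> v \<in> dom_E S c \<Longrightarrow> gte_vector v X \<Longrightarrow>
    (\<And>A. t [acov c v (axis A 1)] [] = acoord c v X $ A) \<Longrightarrow>
    (\<And>a b. t [acov c v (a + b)] [] = t [acov c v a] [] + t [acov c v b] []) \<Longrightarrow>
    (\<And>k a. t [acov c v (k *\<^sub>R a)] [] = k * t [acov c v a] []) \<Longrightarrow>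
    (\<And>\<omega>s Xs. \<not> (length \<omega>s = 1 \<and> length Xs = 0 \<and> valid_args v \<omega>s Xs) \<Longrightarrow> t \<omega>s Xs = 0) \<Longrightarrow>
    t = vec_tensor_at S v X"
proof (intro ext)
  fix \<omega>s Xs
  assume c: "c \<in> charts" "v \<in> dom_E S c" and X: "gte_vector v X" and ax: "\<And>A. t [acov c v (axis A 1)] [] = acoord c v X $ A"
    and ad: "\<And>a b. t [acov c v (a + b)] [] = t [acov c v a] [] + t [acov c v b] []"
    and sc: "\<And>k a. t [acov c v (k *\<^sub>R a)] [] = k * t [acov c v a] []"
    and z: "\<And>\<omega>s Xs. \<not> (length \<omega>s = 1 \<and> length Xs = 0 \<and> valid_args v \<omega>s Xs) \<Longrightarrow> t \<omega>s Xs = 0"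
  have lin: "linear (\<lambda>a. t [acov c v a] [])" by (rule linearI) (simp_all add: ad sc)
  have e: "t [acov c v a] [] = a \<bullet> acoord c v X" for a
  proof -
    have "t [acov c v a] [] = t [acov c v (\<Sum>B\<in>UNIV. a $ B *\<^sub>R axis B 1)] []" using E.vec_expand[of a] by simp
    then show ?thesis by (simp add: linear_sum[OF lin] linear_scale[OF lin] ax inner_vec_def)
  qed
  show "t \<omega>s Xs = vec_tensor_at S v X \<omega>s Xs"
  proof (cases "length \<omega>s = 1 \<and> length Xs = 0 \<and> valid_args v \<omega>s Xs")
    case True
    then obtain \<omega> where \<omega>: "\<omega>s = [\<omega>]" "Xs = []" "\<omega> \<in> gte_dual S v" by (cases \<omega>s) (auto simp: valid_args_def)
    then have "\<omega> = acov c v (coef c v \<omega>)" using acov_coef[OF c] by simp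
    then have "t [\<omega>] [] = acov c v (coef c v \<omega>) X" using e X by (metis acov_def)
    then show ?thesis using \<omega> acov_coef[OF c \<omega>(3)] by (simp add: vec_tensor_at_def)
  next
    case False
    then have "vec_tensor_at S v X \<omega>s Xs = 0"
      by (auto simp: vec_tensor_at_def valid_args_def split: list.splits)
    then show ?thesis using z[OF False] by simp
  qed
qed

lemma TF_vector:
  assumes T: "T \<in> TF 1 0" and c: "c \<in> charts" "v \<in> dom_E S c"
  shows "T v = vec_tensor_at S v (avec c v (\<chi> A. T v [coframe S c v A] []))"
proof (rule vec_tensor_at_cong[OF c avec_gte_vector[OF c]])
  show "T v [acov c v (axis A 1)] [] = acoord c v (avec c v (\<chi> A. T v [coframe S c v A] [])) $ A" for A
    by (simp add: acoord_avec[OF c] coframe_acov)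
  show "T v [acov c v (a + b)] [] = T v [acov c v a] [] + T v [acov c v b] []" for a b
    using TF_cov_add[OF T, of 0 _ _ _ "[undefined]" "[]"] acov_dual[OF c] by (simp add: acov_add)
  show "T v [acov c v (k *\<^sub>R a)] [] = k * T v [acov c v a] []" for k a
    using TF_cov_scale[OF T, of 0 _ _ "[undefined]" _ "[]"] acov_dual[OF c] by (simp add: acov_scale)
qed (rule TF_zero[OF T])

text \<open>The fibres have finite dimension, so that a function on covectors is the evaluation at a vector.\<close>

lemma TF_vector_section:
  assumes T: "T \<in> TF 1 0"
  obtains W where "W \<in> gte_sections S" "T = vec_tensor S W"
    "\<And>c v A. c \<in> charts \<Longrightarrow> v \<in> dom_E S c \<Longrightarrow> acoord c v (W v) $ A = T v [coframe S c v A] []"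
proof -
  define W where "W v = avec (SOME c. c \<in> charts \<and> v \<in> dom_E S c) v
    (\<chi> A. T v [coframe S (SOME c. c \<in> charts \<and> v \<in> dom_E S c) v A] [])" for v
  have d: "(SOME c. c \<in> charts \<and> v \<in> dom_E S c) \<in> charts \<and> v \<in> dom_E S (SOME c. c \<in> charts \<and> v \<in> dom_E S c)" for v
    by (rule someI_ex) (use local_chart_at in blast)
  have Tv: "T v = vec_tensor_at S v (W v)" for v unfolding W_def by (rule TF_vector[OF T]) (use d in blast)+
  have g: "gte_vector v (W v)" for v unfolding W_def by (rule avec_gte_vector) (use d in blast)+
  have co: "acoord c v (W v) $ A = T v [coframe S c v A] []" if c: "c \<in> charts" "v \<in> dom_E S c" for c v A
    unfolding Tv using acov_dual[OF c] g by (simp add: vec_tensor_at_def coframe_acov acov_def inner_axis')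
  have "smooth v (\<lambda>v. acoord c v (W v) $ A)" if c: "c \<in> charts" "v \<in> dom_E S c" for c v A
  proof -
    have "near v (\<lambda>v. T v (map (coframe S c v) [A]) (map (frame S c v) [])) (\<lambda>v. acoord c v (W v) $ A)"
      unfolding near_def using eventually_dom_E[OF c] by eventually_elim (simp add: co[OF c(1)])
    then show ?thesis by (rule E.smooth_near_cong) (rule TF_smooth[OF T c]; simp)
  qed
  then have "W \<in> gte_sections S" using g gte_sections_iff by blast
  moreover have "T = vec_tensor S W" using Tv by (auto simp: vec_tensor_def)
  ultimately show ?thesis using that co by blast
qed

end

subsection \<open>The axioms of a distinguished linear connection\<close>

context gte_connection
begin

lemma D_valid_eqI:
  assumes "T \<in> TF k l" "T' \<in> TF k l"
    "\<And>v c \<omega>s Xs. length \<omega>s = k \<Longrightarrow> length Xs = l \<Longrightarrow> valid_args v \<omega>s Xs \<Longrightarrow> c \<in> charts \<Longrightarrow> v \<in> dom_E S c \<Longrightarrow>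
      T v \<omega>s Xs = T' v \<omega>s Xs"
  shows "T = T'"
  by (rule TF_eqI[OF assms(1,2)]) (use assms(3) local_chart_at in metis)

lemma D_add_left:
  assumes "X \<in> gte_sections S" "X' \<in> gte_sections S" "T \<in> TF k l"
  shows "D (\<lambda>v. gte_add S (X v) (X' v)) T = tens_add (D X T) (D X' T)"
proof (intro ext)
  fix v \<omega>s Xs
  note XX = gte_sections_vector[OF assms(1), of v] gte_sections_vector[OF assms(2), of v]
  obtain c where c: "c \<in> charts" "v \<in> dom_E S c" by (rule local_chart_at)
  show "D (\<lambda>v. gte_add S (X v) (X' v)) T v \<omega>s Xs = tens_add (D X T) (D X' T) v \<omega>s Xs"
  proof (cases "valid_args v \<omega>s Xs \<and> length \<omega>s = k \<and> length Xs = l")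
    case False
    then consider "\<not> valid_args v \<omega>s Xs" | "\<not> (length \<omega>s = k \<and> length Xs = l)" by blast
    then show ?thesis
      by cases (simp_all add: D_def tens_add_def Dat_wrong_length[OF assms(3) _ XX(1)]
          Dat_wrong_length[OF assms(3) _ XX(2)] Dat_wrong_length[OF assms(3) _ gte_vector_add[OF XX]])
  next
    case True
    let ?ys = "slots \<omega>s Xs"
    have ml: "mlin (length ?ys) (Tc c T (length \<omega>s) v)" using Tc_mlin[OF assms(3) c] True by simp
    have sd: "slot_deriv c v (gte_add S (X v) (X' v)) y z = slot_deriv c v (X v) y z + slot_deriv c v (X' v) y z" for y :: "('f, 'e) covector + ('f, 'e) gte" and z
      by (cases y) (simp_all add: slot_deriv_def Om_add[OF c XX] transpose_add matrix_vector_mult_add_rdistrib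
          del: transpose_matrix_vector)
    have "Dat c v (gte_add S (X v) (X' v)) T \<omega>s Xs = Dat c v (X v) T \<omega>s Xs + Dat c v (X' v) T \<omega>s Xs"
      unfolding Dat_def Dco_def map2_map_self sd slot_sum_add_right[OF ml] by (simp add: gte_add_def)
    then show ?thesis
      using D_eq[where X = X, OF assms(3) c XX(1)] D_eq[where X = X', OF assms(3) c XX(2)]
        D_eq[where X = "\<lambda>v. gte_add S (X v) (X' v)", OF assms(3) c gte_vector_add[OF XX]] True
      by (simp add: tens_add_def)
  qed
qed

lemma D_scale_left:
  assumes "X \<in> gte_sections S" "T \<in> TF k l"
  shows "D (\<lambda>v. gte_scale S (f v) (X v)) T = tens_scale f (D X T)"
proof (intro ext)
  fix v \<omega>s Xs
  note XX = gte_sections_vector[OF assms(1), of v]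
  obtain c where c: "c \<in> charts" "v \<in> dom_E S c" by (rule local_chart_at)
  show "D (\<lambda>v. gte_scale S (f v) (X v)) T v \<omega>s Xs = tens_scale f (D X T) v \<omega>s Xs"
  proof (cases "valid_args v \<omega>s Xs \<and> length \<omega>s = k \<and> length Xs = l")
    case False
    then consider "\<not> valid_args v \<omega>s Xs" | "\<not> (length \<omega>s = k \<and> length Xs = l)" by blast
    then show ?thesis
      by cases (simp_all add: D_def tens_scale_def Dat_wrong_length[OF assms(2) _ XX] Dat_wrong_length[OF assms(2) _ gte_vector_scale[OF XX]])
  next
    case True
    let ?ys = "slots \<omega>s Xs"
    have ml: "mlin (length ?ys) (Tc c T (length \<omega>s) v)" using Tc_mlin[OF assms(2) c] True by simp
    have tsc: "transpose (r *\<^sub>R M) = r *\<^sub>R transpose M" for r and M :: "real ^ ('p + 'r) ^ ('p + 'r)"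
      by (simp add: transpose_def vec_eq_iff)
    have sd: "slot_deriv c v (gte_scale S r (X v)) y z = r *\<^sub>R slot_deriv c v (X v) y z" for y :: "('f, 'e) covector + ('f, 'e) gte" and r z
      by (cases y) (simp_all add: slot_deriv_def Om_scale[OF c XX] tsc scaleR_matrix_vector_assoc[symmetric] del: transpose_matrix_vector)
    have "Dat c v (gte_scale S (f v) (X v)) T \<omega>s Xs = f v * Dat c v (X v) T \<omega>s Xs"
      unfolding Dat_def Dco_def map2_map_self sd slot_sum_scale_right[OF ml] by (simp add: gte_scale_def right_diff_distrib)
    then show ?thesis
      using D_eq[where X = X, OF assms(2) c XX] D_eq[where X = "\<lambda>v. gte_scale S (f v) (X v)", OF assms(2) c gte_vector_scale[OF XX]] True
      by (simp add: tens_scale_def)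
  qed
qed

lemma Tc_smooth:
  assumes "T \<in> TF k l" "c \<in> charts" "v \<in> dom_E S c" "length zs = k + l"
  shows "smooth v (\<lambda>v. Tc c T k v zs)"
proof -
  have "smooth v (\<lambda>v'. Tc c T k v' (map (\<lambda>f. f v') (map (\<lambda>z _. z) zs)))"
    by (rule E.smooth_family_smooth) (use assms Tc_smooth_family in \<open>auto simp: smooth_near_const\<close>)
  then show ?thesis by (simp add: comp_def)
qed

lemma D_add_right:
  assumes X: "X \<in> gte_sections S" and T: "T \<in> TF k l" and T': "T' \<in> TF k l"
  shows "D X (tens_add T T') = tens_add (D X T) (D X T')"
proof (rule D_valid_eqI[OF D_tensor[OF tens_add_tensor[OF T T'] X] tens_add_tensor[OF D_tensor[OF T X] D_tensor[OF T' X]]])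
  fix v c \<omega>s Xs assume len: "length \<omega>s = k" "length Xs = l" and val: "valid_args v \<omega>s Xs" and c: "c \<in> charts" "v \<in> dom_E S c"
  note Xv = gte_sections_vector[OF X, of v]
  have Tc: "Tc c (tens_add T T') k v' zs = Tc c T k v' zs + Tc c T' k v' zs" for v' zs by (simp add: Tc_def tens_add_def)
  have "Dat c v (X v) (tens_add T T') \<omega>s Xs = Dat c v (X v) T \<omega>s Xs + Dat c v (X v) T' \<omega>s Xs"
    unfolding Dat_unfold len Tc slot_sum_add
    by (simp add: E.tangent_add[OF gte_vector_tangent[OF Xv] Tc_smooth[OF T c] Tc_smooth[OF T' c]] len)
  then show "D X (tens_add T T') v \<omega>s Xs = tens_add (D X T) (D X T') v \<omega>s Xs"
    using D_eq[where X = X, OF T c Xv val] D_eq[where X = X, OF T' c Xv val]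
      D_eq[where X = X, OF tens_add_tensor[OF T T'] c Xv val] by (simp add: tens_add_def)
qed

lemma D_fun:
  assumes X: "X \<in> gte_sections S" and f: "f \<in> smooth_functions (atlasE S)"
  shows "D X (fun_tensor f) = fun_tensor (gte_deriv X f)"
proof (rule D_valid_eqI[OF D_tensor[OF fun_tensor_tensor[OF f] X] fun_tensor_tensor])
  have "smooth v f" for v
    using f unfolding smooth_functions_def mem_Collect_eq E.msmooth_on_iff[OF open_UNIV] by blast
  then show "gte_deriv X f \<in> smooth_functions (atlasE S)"
    using gte_deriv_smooth[OF X] by (simp add: smooth_functions_def E.msmooth_on_iff gte_deriv_def[abs_def])
  fix v c and \<omega>s :: "('f, 'e) covector list" and Xs :: "('f, 'e) gte list"
  assume len: "length \<omega>s = 0" "length Xs = 0" and val: "valid_args v \<omega>s Xs" and c: "c \<in> charts" "v \<in> dom_E S c"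
  show "D X (fun_tensor f) v \<omega>s Xs = fun_tensor (gte_deriv X f) v \<omega>s Xs"
    using D_eq[where X = X, OF fun_tensor_tensor[OF f] c gte_sections_vector[OF X] val] len
    by (simp add: Dat_unfold Tc_def fun_tensor_def gte_deriv_def cov_pairs_def vec_pairs_def)
qed

lemma pairs_simps [simp]:
  "map fst (cov_pairs c v X \<omega>s) = map (coef c v) \<omega>s" "map fst (vec_pairs c v X Xs) = map (acoord c v) Xs"
  "length (cov_pairs c v X \<omega>s) = length \<omega>s" "length (vec_pairs c v X Xs) = length Xs"
  "cov_pairs c v X (\<omega>s @ \<omega>s') = cov_pairs c v X \<omega>s @ cov_pairs c v X \<omega>s'"
  "vec_pairs c v X (Xs @ Xs') = vec_pairs c v X Xs @ vec_pairs c v X Xs'"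
  by (simp_all add: cov_pairs_def vec_pairs_def comp_def)

lemma D_prod:
  assumes X: "X \<in> gte_sections S" and T: "T \<in> TF k l" and T': "T' \<in> TF k' l'"
  shows "D X (tens_prod k l T T') = tens_add (tens_prod k l (D X T) T') (tens_prod k l T (D X T'))"
proof (rule D_valid_eqI[OF D_tensor[OF tens_prod_tensor[OF T T'] X]
      tens_add_tensor[OF tens_prod_tensor[OF D_tensor[OF T X] T'] tens_prod_tensor[OF T D_tensor[OF T' X]]]])
  fix v c \<omega>s Xs assume len: "length \<omega>s = k + k'" "length Xs = l + l'" and val: "valid_args v \<omega>s Xs"
    and c: "c \<in> charts" "v \<in> dom_E S c"
  note Xv = gte_sections_vector[OF X, of v]
  note w = gte_vector_tangent[OF Xv]
  define \<omega>1 \<omega>2 X1 X2 where "\<omega>1 = take k \<omega>s" and "\<omega>2 = drop k \<omega>s" and "X1 = take l Xs" and "X2 = drop l Xs"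
  have s: "\<omega>s = \<omega>1 @ \<omega>2" "Xs = X1 @ X2" "length \<omega>1 = k" "length \<omega>2 = k'" "length X1 = l" "length X2 = l'"
    using len by (simp_all add: \<omega>1_def \<omega>2_def X1_def X2_def)
  have v1: "valid_args v \<omega>1 X1" and v2: "valid_args v \<omega>2 X2" using val unfolding s valid_args_def set_append by blast+
  let ?T = "Tc c T k" and ?T' = "Tc c T' k'" and ?P = "Tc c (tens_prod k l T T') (k + k')"
  let ?c = "map (coef c v)" and ?a = "map (acoord c v)"
  have P: "?P v' (z1 @ z2 @ z3 @ z4) = ?T v' (z1 @ z3) * ?T' v' (z2 @ z4)"
    if "length z1 = k" "length z2 = k'" "length z3 = l" "length z4 = l'" for v' z1 z2 z3 z4
    using that by (simp add: Tc_def tens_prod_def)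
  have "slot_sum (?P v) (cov_pairs c v (X v) \<omega>s @ vec_pairs c v (X v) Xs) =
      slot_sum (?T v) (cov_pairs c v (X v) \<omega>1 @ vec_pairs c v (X v) X1) * ?T' v (?c \<omega>2 @ ?a X2) +
      ?T v (?c \<omega>1 @ ?a X1) * slot_sum (?T' v) (cov_pairs c v (X v) \<omega>2 @ vec_pairs c v (X v) X2)"
    using slot_sum_product[of "cov_pairs c v (X v) \<omega>1" "cov_pairs c v (X v) \<omega>2" "vec_pairs c v (X v) X1" "vec_pairs c v (X v) X2" "?P v" "?T v" "?T' v"]
    by (simp add: s P)
  moreover have "snd (X v) (\<lambda>v'. ?P v' (?c \<omega>s @ ?a Xs)) =
      ?T v (?c \<omega>1 @ ?a X1) * snd (X v) (\<lambda>v'. ?T' v' (?c \<omega>2 @ ?a X2)) +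
      snd (X v) (\<lambda>v'. ?T v' (?c \<omega>1 @ ?a X1)) * ?T' v (?c \<omega>2 @ ?a X2)"
    using E.tangent_mult[OF w Tc_smooth[OF T c, of "?c \<omega>1 @ ?a X1"] Tc_smooth[OF T' c, of "?c \<omega>2 @ ?a X2"]]
    by (simp add: s P)
  moreover have "?T v (?c \<omega>1 @ ?a X1) = T v \<omega>1 X1" "?T' v (?c \<omega>2 @ ?a X2) = T' v \<omega>2 X2"
    using Tc_slots[OF c v1, of T] Tc_slots[OF c v2, of T'] by (simp_all add: s slot_coord_def comp_def)
  ultimately have "Dat c v (X v) (tens_prod k l T T') \<omega>s Xs =
      Dat c v (X v) T \<omega>1 X1 * T' v \<omega>2 X2 + T v \<omega>1 X1 * Dat c v (X v) T' \<omega>2 X2"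
    unfolding Dat_unfold len s(3,4) by (simp add: algebra_simps)
  then show "D X (tens_prod k l T T') v \<omega>s Xs = tens_add (tens_prod k l (D X T) T') (tens_prod k l T (D X T')) v \<omega>s Xs"
    using D_eq[where X = X, OF T c Xv v1] D_eq[where X = X, OF T' c Xv v2] D_eq[where X = X, OF tens_prod_tensor[OF T T'] c Xv val]
    by (simp add: tens_add_def tens_prod_def \<omega>1_def \<omega>2_def X1_def X2_def)
qed

text \<open>The corrections in the two contracted slots have opposite signs and cancel by \<open>bilinear_trace\<close>.\<close>

lemma D_contract:
  assumes X: "X \<in> gte_sections S" and T: "T \<in> TF (Suc k) (Suc l)" and i: "i \<le> k" "j \<le> l"
  shows "D X (contract S i j T) = contract S i j (D X T)"
proof (rule D_valid_eqI[OF D_tensor[OF contract_tensor[OF T i] X] contract_tensor[OF D_tensor[OF T X] i]])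
  fix v c \<omega>s Xs assume len: "length \<omega>s = k" "length Xs = l" and val: "valid_args v \<omega>s Xs" and c: "c \<in> charts" "v \<in> dom_E S c"
  note Xv = gte_sections_vector[OF X, of v]
  note w = gte_vector_tangent[OF Xv]
  let ?C = "contract S i j T" and ?T = "Tc c T (Suc k)"
  let ?a = "map (coef c v) \<omega>s" and ?b = "map (acoord c v) Xs" and ?\<Omega> = "Om c v (X v)"
  let ?e = "\<lambda>A. axis A 1 :: real ^ ('p + 'r)"
  let ?ps = "cov_pairs c v (X v) \<omega>s" and ?qs = "vec_pairs c v (X v) Xs"
  have C: "Tc c ?C k v' zs = (\<Sum>A\<in>UNIV. ?T v' (insert_at i (?e A) (take k zs) @ insert_at j (?e A) (drop k zs)))"
    if "v' \<in> dom_E S c" "length zs = k + l" for v' zs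
    using that i by (simp add: Tc_def contract_eq[OF T i c(1)] coframe_acov frame_avec map_insert_at)
  have sm: "smooth v (\<lambda>v'. ?T v' (insert_at i (?e A) ?a @ insert_at j (?e A) ?b))" for A
    by (rule Tc_smooth[OF T c]) (simp add: len)
  have "near v (\<lambda>v'. Tc c ?C k v' (?a @ ?b)) (\<lambda>v'. \<Sum>A\<in>UNIV. ?T v' (insert_at i (?e A) ?a @ insert_at j (?e A) ?b))"
    unfolding near_def using eventually_dom_E[OF c] by eventually_elim (simp add: C len)
  then have 1: "snd (X v) (\<lambda>v'. Tc c ?C k v' (?a @ ?b)) =
      (\<Sum>A\<in>UNIV. snd (X v) (\<lambda>v'. ?T v' (insert_at i (?e A) ?a @ insert_at j (?e A) ?b)))"
    using E.tangent_sum[OF w sm] by (simp only: E.tangent_cong[OF w])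
  let ?G = "\<lambda>A zs. ?T v (insert_at i (?e A) (take k zs) @ insert_at j (?e A) (drop k zs))"
  have 2: "slot_sum (Tc c ?C k v) (?ps @ ?qs) = (\<Sum>A\<in>UNIV. slot_sum (?G A) (?ps @ ?qs))"
    unfolding slot_sum_sum[symmetric] by (rule slot_sum_cong[OF refl]) (simp add: C[OF c(2)] len)
  define \<beta> where "\<beta> x y = ?T v (insert_at i x ?a @ insert_at j y ?b)" for x y
  have \<beta>: "\<beta> x y = T v (insert_at i (acov c v x) (map (acov c v) ?a)) (insert_at j (avec c v y) (map (avec c v) ?b))" for x y
    by (simp add: \<beta>_def Tc_append len map_insert_at del: map_map)
  have lin: "linear (\<lambda>x. \<beta> x y)" "linear (\<beta> x)" for x y
    using insert_bilinear[OF T c _ _ i] len by (simp_all add: \<beta>[abs_def])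
  have cancel: "(\<Sum>A\<in>UNIV. \<beta> (- (transpose ?\<Omega> *v ?e A)) (?e A)) + (\<Sum>A\<in>UNIV. \<beta> (?e A) (?\<Omega> *v ?e A)) = 0"
    using bilinear_trace[OF lin, of ?\<Omega>] linear_neg[OF lin(1)] by (simp add: sum_negf del: transpose_matrix_vector)
  have 3: "slot_sum (?T v) (cov_pairs c v (X v) (insert_at i (coframe S c v A) \<omega>s) @ vec_pairs c v (X v) (insert_at j (frame S c v A) Xs)) =
      \<beta> (- (transpose ?\<Omega> *v ?e A)) (?e A) + \<beta> (?e A) (?\<Omega> *v ?e A) + slot_sum (?G A) (?ps @ ?qs)" for A
  proof -
    have p: "cov_pairs c v (X v) (insert_at i (coframe S c v A) \<omega>s) = insert_at i (?e A, - (transpose ?\<Omega> *v ?e A)) ?ps"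
      "vec_pairs c v (X v) (insert_at j (frame S c v A) Xs) = insert_at j (?e A, ?\<Omega> *v ?e A) ?qs"
      by (simp_all add: cov_pairs_def vec_pairs_def map_insert_at coframe_acov frame_avec coef_acov[OF c] acoord_avec[OF c] del: transpose_matrix_vector)
    have g1: "slot_sum (\<lambda>zs. ?T v (insert_at i (?e A) zs @ insert_at j (?e A) ?b)) ?ps = slot_sum (\<lambda>zs. ?G A (zs @ ?b)) ?ps"
      by (rule slot_sum_cong[OF refl]) (simp add: len)
    have g2: "slot_sum (\<lambda>zs. ?T v (insert_at i (?e A) ?a @ insert_at j (?e A) zs)) ?qs = slot_sum (\<lambda>zs. ?G A (?a @ zs)) ?qs"
      by (rule slot_sum_cong[OF refl]) (simp add: len)
    show ?thesis
      using i g1 g2 unfolding p slot_sum_append by (simp add: slot_sum_insert_at len map_insert_at \<beta>_def del: transpose_matrix_vector)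
  qed
  have "contract S i j (D X T) v \<omega>s Xs = (\<Sum>A\<in>UNIV. D X T v (insert_at i (coframe S c v A) \<omega>s) (insert_at j (frame S c v A) Xs))"
    by (rule contract_eq[OF D_tensor[OF T X] i c])
  also have "\<dots> = (\<Sum>A\<in>UNIV. Dat c v (X v) T (insert_at i (coframe S c v A) \<omega>s) (insert_at j (frame S c v A) Xs))"
    by (intro sum.cong refl D_eq[where X = X, OF T c Xv])
      (simp add: insert_at_valid val coframe_acov frame_avec acov_dual[OF c] avec_gte_vector[OF c])
  also have "\<dots> = (\<Sum>A\<in>UNIV. snd (X v) (\<lambda>v'. ?T v' (insert_at i (?e A) ?a @ insert_at j (?e A) ?b))) -
      (\<Sum>A\<in>UNIV. \<beta> (- (transpose ?\<Omega> *v ?e A)) (?e A) + \<beta> (?e A) (?\<Omega> *v ?e A) + slot_sum (?G A) (?ps @ ?qs))"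
    unfolding Dat_unfold length_insert_at len 3 sum_subtractf
    by (simp add: map_insert_at coframe_acov frame_avec coef_acov[OF c] acoord_avec[OF c])
  also have "\<dots> = Dat c v (X v) ?C \<omega>s Xs"
    unfolding Dat_unfold len 1 2 using cancel by (simp add: sum.distrib)
  finally show "D X ?C v \<omega>s Xs = contract S i j (D X T) v \<omega>s Xs"
    using D_eq[where X = X, OF contract_tensor[OF T i] c Xv val] by simp
qed

lemma D_vector:
  assumes X: "X \<in> gte_sections S" and Y: "Y \<in> gte_sections S" and c: "c \<in> charts" "v \<in> dom_E S c"
  shows "D X (vec_tensor S Y) v [coframe S c v A] [] =
    snd (X v) (\<lambda>v'. acoord c v' (Y v') $ A) + (Om c v (X v) *v acoord c v (Y v)) $ A"
proof -
  note Xv = gte_sections_vector[OF X, of v] and Yv = gte_sections_vector[OF Y]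
  have val: "valid_args v [coframe S c v A] []" using acov_dual[OF c] by (simp add: valid_args_def coframe_acov)
  have Tc: "Tc c (vec_tensor S Y) (Suc 0) v' [a] = a \<bullet> acoord c v' (Y v')" if "v' \<in> dom_E S c" for v' a
    using acov_dual[OF c(1) that] by (simp add: Tc_def vec_tensor_apply acov_def Yv)
  have "near v (\<lambda>v'. Tc c (vec_tensor S Y) (Suc 0) v' [axis A 1]) (\<lambda>v'. acoord c v' (Y v') $ A)"
    unfolding near_def using eventually_dom_E[OF c] by eventually_elim (simp add: Tc inner_axis')
  then have 1: "snd (X v) (\<lambda>v'. Tc c (vec_tensor S Y) (Suc 0) v' [axis A 1]) = snd (X v) (\<lambda>v'. acoord c v' (Y v') $ A)"
    by (rule E.tangent_cong[OF gte_vector_tangent[OF Xv]])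
  have "(transpose (Om c v (X v)) *v axis A 1) \<bullet> acoord c v (Y v) = axis A 1 \<bullet> (Om c v (X v) *v acoord c v (Y v))"
    by (simp add: dot_lmul_matrix)
  then have 2: "(transpose (Om c v (X v)) *v axis A 1) \<bullet> acoord c v (Y v) = (Om c v (X v) *v acoord c v (Y v)) $ A"
    by (simp only: inner_axis' real_scaleR_def inner_real_def mult_1)
  show ?thesis
    using D_eq[where X = X, OF vec_tensor_tensor[OF Y] c Xv val] 1 2
    by (simp add: Dat_unfold cov_pairs_def vec_pairs_def coframe_acov coef_acov[OF c] Tc[OF c(2)] inner_minus_left del: transpose_matrix_vector)
qed

text \<open>A section of one subbundle is a section whose coordinates in the other one vanish; as the connection matrices
  are block diagonal, this property is inherited by its derivative.\<close>

lemma D_distinguished: "distinguished_linear_connection S D"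
  unfolding distinguished_linear_connection_def covariant_derivative_def Let_def
proof (intro conjI ballI allI impI)
  fix X Y assume X: "X \<in> gte_sections S" and Y: "Y \<in> gte_sections S"
  obtain W where W: "W \<in> gte_sections S" "D X (vec_tensor S Y) = vec_tensor S W"
    "\<And>c v A. c \<in> charts \<Longrightarrow> v \<in> dom_E S c \<Longrightarrow> acoord c v (W v) $ A = D X (vec_tensor S Y) v [coframe S c v A] []"
    using TF_vector_section[OF D_tensor[OF vec_tensor_tensor[OF Y] X]] by metis
  have co: "acoord c v (W v) $ A = snd (X v) (\<lambda>v'. acoord c v' (Y v') $ A) + (\<Sum>B\<in>UNIV. Om c v (X v) $ A $ B * acoord c v (Y v) $ B)"
    if "c \<in> charts" "v \<in> dom_E S c" for c v A
    using W(3)[OF that] D_vector[OF X Y that] by (simp add: matrix_vector_mult_def)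
  have z: "snd (X v) (\<lambda>v'. acoord c v' (Y v') $ A) = 0"
    if c: "c \<in> charts" "v \<in> dom_E S c" and "\<And>v. v \<in> dom_E S c \<Longrightarrow> acoord c v (Y v) $ A = 0" for c v A
  proof -
    have n: "near v (\<lambda>v'. acoord c v' (Y v') $ A) (\<lambda>_. 0)"
      unfolding near_def using eventually_dom_E[OF c] by eventually_elim (use that(3) in simp)
    note w = gte_vector_tangent[OF gte_sections_vector[OF X, of v]]
    show ?thesis using E.tangent_cong[OF w n] E.tangent_const[OF w] by simp
  qed
  { assume h: "\<forall>v. Y v \<in> horizontal_fibre S v"
    have "W v \<in> horizontal_fibre S v" for v
    proof -
      obtain c where c: "c \<in> charts" "v \<in> dom_E S c" by (rule local_chart_at)
      have Y0: "acoord c u (Y u) $ Inr a = 0" if "u \<in> dom_E S c" for u a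
        using h horizontal_acoord[OF c(1) that] by blast
      have "acoord c v (W v) $ Inr a = 0" for a
        using co[OF c] z[OF c Y0] Om_block(2)[OF c gte_sections_vector[OF X]] Y0[OF c(2)] by (simp add: sum_UNIV_Plus)
      then show ?thesis using horizontal_acoord[OF c] gte_sections_vector[OF W(1)] by blast
    qed
    then show "\<exists>W\<in>gte_sections S. (\<forall>v. W v \<in> horizontal_fibre S v) \<and> D X (vec_tensor S Y) = vec_tensor S W"
      using W by blast }
  { assume h: "\<forall>v. Y v \<in> vertical_fibre S v"
    have "W v \<in> vertical_fibre S v" for v
    proof -
      obtain c where c: "c \<in> charts" "v \<in> dom_E S c" by (rule local_chart_at)
      have Y0: "acoord c u (Y u) $ Inl \<alpha> = 0" if "u \<in> dom_E S c" for u \<alpha>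
        using h vertical_acoord[OF c(1) that] by blast
      have "acoord c v (W v) $ Inl \<alpha> = 0" for \<alpha>
        using co[OF c] z[OF c Y0] Om_block(1)[OF c gte_sections_vector[OF X]] Y0[OF c(2)] by (simp add: sum_UNIV_Plus)
      then show ?thesis using vertical_acoord[OF c] gte_sections_vector[OF W(1)] by blast
    qed
    then show "\<exists>W\<in>gte_sections S. (\<forall>v. W v \<in> vertical_fibre S v) \<and> D X (vec_tensor S Y) = vec_tensor S W"
      using W by blast }
qed (rule D_tensor D_add_left D_scale_left D_add_right D_fun D_prod D_contract; assumption)+

text \<open>The adapted coordinates of a frame vector are constant, so that only the connection matrix contributes.\<close>

lemma D_frame:
  assumes X: "X \<in> gte_sections S" and Y: "Y \<in> gte_sections S" and c: "c \<in> charts" "v \<in> dom_E S c"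
    and near: "near v X (\<lambda>v. frame S c v C)" "near v Y (\<lambda>v. frame S c v B)"
  shows "D X (vec_tensor S Y) v = vec_tensor_at S v (avec c v (\<chi> A. Om c v (frame S c v C) $ A $ B))"
proof -
  have Xv: "X v = frame S c v C" "Y v = frame S c v B" using near near_at by fast+
  have n: "near v (\<lambda>v'. acoord c v' (Y v') $ A) (\<lambda>_. axis B 1 $ A)" for A
    using near(2) eventually_dom_E[OF c] unfolding near_def
    by eventually_elim (simp add: frame_avec acoord_avec[OF c(1)])
  note w = gte_vector_tangent[OF gte_sections_vector[OF X, of v]]
  have z: "snd (X v) (\<lambda>v'. acoord c v' (Y v') $ A) = 0" for A
    using E.tangent_cong[OF w n] E.tangent_const[OF w] by simp
  have "D X (vec_tensor S Y) v [coframe S c v A] [] = Om c v (frame S c v C) $ A $ B" for A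
    using D_vector[OF X Y c, of A] z by (simp only: Xv frame_avec acoord_avec[OF c] matrix_vector_axis add_0)
  then show ?thesis using TF_vector[OF D_tensor[OF vec_tensor_tensor[OF Y] X] c] by simp
qed

end

section \<open>Matrix algebra of metric connections\<close>

lemma matrix_mult_linear:
  fixes A :: "real ^ 'n ^ 'm" and B :: "real ^ 'k ^ 'n"
  shows matrix_mult_linear_left: "linear (\<lambda>A. A ** B)" and matrix_mult_linear_right: "linear (\<lambda>B. A ** B)"
  by (auto simp: linear_iff matrix_matrix_mult_def vec_eq_iff distrib_left distrib_right sum.distrib sum_distrib_left mult_ac)

lemma transpose_linear: "linear (transpose :: real ^ 'n ^ 'm \<Rightarrow> real ^ 'm ^ 'n)"
  by (simp add: linear_iff transpose_def vec_eq_iff)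

lemmas matrix_mult_simps =
  linear_add[OF matrix_mult_linear_left] linear_add[OF matrix_mult_linear_right]
  linear_diff[OF matrix_mult_linear_left] linear_diff[OF matrix_mult_linear_right]
  linear_scale[OF matrix_mult_linear_left] linear_scale[OF matrix_mult_linear_right]
  linear_sum[OF matrix_mult_linear_left] linear_sum[OF matrix_mult_linear_right]
  linear_add[OF transpose_linear] linear_diff[OF transpose_linear] linear_scale[OF transpose_linear]
  linear_sum[OF transpose_linear] matrix_transpose_mul transpose_transpose

lemma symmetric_matrix_nth: "transpose M = M \<Longrightarrow> M $ i $ j = M $ j $ i"
  by (drule arg_cong[where f = "\<lambda>M. M $ j $ i"]) (simp only: transpose_def vec_lambda_beta)

text \<open>For a linear connection with matrix \<open>B\<close> and a metric \<open>g\<close> with derivative \<open>dg\<close>, the metric dual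
  connection has the matrix \<open>g\<^sup>-\<^sup>1 (dg - B\<^sup>T g)\<close>; the mean value of a connection and its dual is metric.\<close>

definition metric_mean :: "real ^ 'n ^ 'n \<Rightarrow> real ^ 'n ^ 'n \<Rightarrow> real ^ 'n ^ 'n \<Rightarrow> real ^ 'n ^ 'n" where
  "metric_mean g B dg = B + (1 / 2) *\<^sub>R (matrix_inv g ** (dg - transpose B ** g - g ** B))"

lemma metric_mean_metric:
  fixes g :: "real ^ 'n ^ 'n"
  assumes "invertible g" "transpose g = g" "transpose dg = dg"
  shows "transpose (metric_mean g B dg) ** g + g ** metric_mean g B dg = dg"
proof -
  let ?M = "dg - transpose B ** g - g ** B"
  have M: "transpose ?M = ?M" by (simp add: matrix_mult_simps assms(2,3))
  have 1: "g ** metric_mean g B dg = g ** B + (1 / 2) *\<^sub>R ?M"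
    unfolding metric_mean_def by (simp only: matrix_mult_simps(2,6) matrix_mul_assoc matrix_inv_right[OF assms(1)] matrix_mul_lid)
  have "transpose (metric_mean g B dg) ** g = transpose (g ** metric_mean g B dg)"
    by (simp only: matrix_transpose_mul assms(2))
  also have "\<dots> = transpose B ** g + (1 / 2) *\<^sub>R ?M"
    unfolding 1 using M by (simp only: matrix_mult_simps(9,11,13) assms(2))
  finally have "transpose (metric_mean g B dg) ** g + g ** metric_mean g B dg =
      transpose B ** g + g ** B + ((1 / 2) *\<^sub>R ?M + (1 / 2) *\<^sub>R ?M)"
    unfolding 1 by simp
  also have "(1 / 2) *\<^sub>R ?M + (1 / 2) *\<^sub>R ?M = ?M" by (simp flip: scaleR_add_left)
  finally show ?thesis by simp
qed

lemma metric_mean_sum: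
  "metric_mean g (\<Sum>i\<in>I. k i *\<^sub>R B i) (\<Sum>i\<in>I. k i *\<^sub>R dg i) = (\<Sum>i\<in>I. k i *\<^sub>R metric_mean g (B i) (dg i))"
  unfolding metric_mean_def
  by (simp only: matrix_mult_simps sum_subtractf[symmetric] scaleR_diff_right[symmetric] sum.distrib scaleR_add_right
      scaleR_sum_right scaleR_left_commute scaleR_scaleR mult.commute)

text \<open>The terms with \<open>dJ\<close> in \<open>dg\<close>, \<open>B\<^sup>T g\<close> and \<open>g B\<close> cancel in \<open>dg - B\<^sup>T g - g B\<close>, which is therefore transformed
  like \<open>g\<close>.\<close>

lemma metric_mean_change:
  fixes g g' J :: "real ^ 'n ^ 'n"
  assumes g: "g = transpose J ** g' ** J"
    and dg: "dg = transpose dJ ** g' ** J + transpose J ** dg' ** J + transpose J ** g' ** dJ"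
    and B: "J ** B = dJ + B' ** J"
    and inv: "invertible g" "invertible g'" "J ** I = mat 1"
  shows "J ** metric_mean g B dg = dJ + metric_mean g' B' dg' ** J"
proof -
  let ?M = "dg - transpose B ** g - g ** B" and ?M' = "dg' - transpose B' ** g' - g' ** B'"
  have gi: "J ** matrix_inv g ** transpose J = matrix_inv g'"
  proof -
    have "transpose I ** transpose J = mat 1" using arg_cong[OF inv(3), of transpose] by (simp add: matrix_transpose_mul)
    then have "g' ** J = transpose I ** g"
      unfolding g by (simp add: matrix_mul_assoc)
    then have "g' ** (J ** matrix_inv g ** transpose J) = transpose I ** (g ** matrix_inv g) ** transpose J"
      by (simp add: matrix_mul_assoc)
    then have "g' ** (J ** matrix_inv g ** transpose J) = mat 1"
      using \<open>transpose I ** transpose J = mat 1\<close> by (simp add: matrix_inv_right[OF inv(1)])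
    then have "matrix_inv g' ** (g' ** (J ** matrix_inv g ** transpose J)) = matrix_inv g'" by simp
    then show ?thesis by (simp add: matrix_mul_assoc matrix_inv_left[OF inv(2)])
  qed
  have dJ: "dJ = J ** B - B' ** J" using B by simp
  have M: "?M = transpose J ** ?M' ** J"
    unfolding dg g dJ by (simp only: matrix_mult_simps matrix_mul_assoc) simp
  have "J ** (matrix_inv g ** ?M) = (J ** matrix_inv g ** transpose J) ** ?M' ** J"
    unfolding M by (simp only: matrix_mul_assoc)
  then have "J ** (matrix_inv g ** ?M) = matrix_inv g' ** ?M' ** J" by (simp only: gi)
  then show ?thesis
    unfolding metric_mean_def by (simp only: matrix_mult_simps(1,2,5,6) B) simp
qed

text \<open>The Levi-Civita connection of a metric \<open>g\<close> in a frame with structure functions \<open>L\<close>; \<open>dg \<gamma>\<close> is the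
  derivative of \<open>g\<close> along the frame vector \<open>\<gamma>\<close>.\<close>

definition levi_civita ::
  "real ^ 'n ^ 'n \<Rightarrow> ('n \<Rightarrow> real ^ 'n ^ 'n) \<Rightarrow> ('n \<Rightarrow> 'n \<Rightarrow> 'n \<Rightarrow> real) \<Rightarrow> 'n \<Rightarrow> real ^ 'n ^ 'n" where
  "levi_civita g dg L \<gamma> = (\<chi> \<alpha> \<beta>. 1/2 * (\<Sum>\<epsilon>\<in>UNIV. matrix_inv g $ \<alpha> $ \<epsilon> *
     (dg \<gamma> $ \<epsilon> $ \<beta> + dg \<beta> $ \<epsilon> $ \<gamma> - dg \<epsilon> $ \<beta> $ \<gamma> + (\<Sum>\<theta>\<in>UNIV. g $ \<theta> $ \<epsilon> * L \<theta> \<gamma> \<beta>)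
      - (\<Sum>\<theta>\<in>UNIV. g $ \<beta> $ \<theta> * L \<theta> \<gamma> \<epsilon>) - (\<Sum>\<theta>\<in>UNIV. g $ \<theta> $ \<gamma> * L \<theta> \<beta> \<epsilon>))))"

lemma levi_civita_lowered:
  fixes g :: "real ^ 'n ^ 'n"
  assumes "invertible g"
  shows "(g ** levi_civita g dg L \<gamma>) $ \<epsilon> $ \<beta> = 1/2 *
     (dg \<gamma> $ \<epsilon> $ \<beta> + dg \<beta> $ \<epsilon> $ \<gamma> - dg \<epsilon> $ \<beta> $ \<gamma> + (\<Sum>\<theta>\<in>UNIV. g $ \<theta> $ \<epsilon> * L \<theta> \<gamma> \<beta>)
      - (\<Sum>\<theta>\<in>UNIV. g $ \<beta> $ \<theta> * L \<theta> \<gamma> \<epsilon>) - (\<Sum>\<theta>\<in>UNIV. g $ \<theta> $ \<gamma> * L \<theta> \<beta> \<epsilon>))"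
proof -
  define K :: "real ^ 'n ^ 'n" where "K = (\<chi> \<epsilon> \<beta>. dg \<gamma> $ \<epsilon> $ \<beta> + dg \<beta> $ \<epsilon> $ \<gamma> - dg \<epsilon> $ \<beta> $ \<gamma> + (\<Sum>\<theta>\<in>UNIV. g $ \<theta> $ \<epsilon> * L \<theta> \<gamma> \<beta>)
      - (\<Sum>\<theta>\<in>UNIV. g $ \<beta> $ \<theta> * L \<theta> \<gamma> \<epsilon>) - (\<Sum>\<theta>\<in>UNIV. g $ \<theta> $ \<gamma> * L \<theta> \<beta> \<epsilon>))"
  have "levi_civita g dg L \<gamma> = (1/2) *\<^sub>R (matrix_inv g ** K)"
    by (simp add: levi_civita_def K_def matrix_matrix_mult_def vec_eq_iff)
  then have "g ** levi_civita g dg L \<gamma> = (1/2) *\<^sub>R K"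
    by (simp only: matrix_mult_simps(6) matrix_mul_assoc matrix_inv_right[OF assms] matrix_mul_lid)
  then show ?thesis by (simp add: K_def)
qed

lemma invertible_cancel_left:
  fixes g :: "real ^ 'n ^ 'n" and A B :: "real ^ 'k ^ 'n"
  assumes "invertible g" "g ** A = g ** B" shows "A = B"
proof -
  have "matrix_inv g ** (g ** A) = matrix_inv g ** (g ** B)" using assms(2) by simp
  then show ?thesis by (simp add: matrix_mul_assoc matrix_inv_left[OF assms(1)])
qed

lemma levi_civita_metric:
  fixes g :: "real ^ 'n ^ 'n"
  assumes g: "invertible g" "transpose g = g" and dg: "\<And>\<gamma>. transpose (dg \<gamma>) = dg \<gamma>"
    and L: "\<And>\<theta> \<alpha> \<beta>. L \<theta> \<alpha> \<beta> = - L \<theta> \<beta> \<alpha>"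
  shows "transpose (levi_civita g dg L \<gamma>) ** g + g ** levi_civita g dg L \<gamma> = dg \<gamma>"
proof -
  have s: "g $ \<alpha> $ \<beta> = g $ \<beta> $ \<alpha>" for \<alpha> \<beta> by (rule symmetric_matrix_nth[OF g(2)])
  have ds: "dg \<gamma> $ \<alpha> $ \<beta> = dg \<gamma> $ \<beta> $ \<alpha>" for \<gamma> \<alpha> \<beta> by (rule symmetric_matrix_nth[OF dg])
  have l: "(\<Sum>\<theta>\<in>UNIV. g $ \<theta> $ \<epsilon> * L \<theta> \<alpha> \<beta>) = - (\<Sum>\<theta>\<in>UNIV. g $ \<theta> $ \<epsilon> * L \<theta> \<beta> \<alpha>)" for \<alpha> \<beta> \<epsilon>
  proof -
    have "(\<Sum>\<theta>\<in>UNIV. g $ \<theta> $ \<epsilon> * L \<theta> \<alpha> \<beta>) = (\<Sum>\<theta>\<in>UNIV. - (g $ \<theta> $ \<epsilon> * L \<theta> \<beta> \<alpha>))"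
    proof (rule sum.cong[OF refl])
      fix \<theta> show "g $ \<theta> $ \<epsilon> * L \<theta> \<alpha> \<beta> = - (g $ \<theta> $ \<epsilon> * L \<theta> \<beta> \<alpha>)" using L[of \<theta> \<alpha> \<beta>] by simp
    qed
    then show ?thesis by (simp only: sum_negf)
  qed
  have "transpose (levi_civita g dg L \<gamma>) ** g = transpose (g ** levi_civita g dg L \<gamma>)"
    by (simp only: matrix_transpose_mul g(2))
  moreover have "(transpose (g ** levi_civita g dg L \<gamma>) + g ** levi_civita g dg L \<gamma>) $ \<epsilon> $ \<beta> = dg \<gamma> $ \<epsilon> $ \<beta>" for \<epsilon> \<beta>
  proof -
    have "(transpose (g ** levi_civita g dg L \<gamma>) + g ** levi_civita g dg L \<gamma>) $ \<epsilon> $ \<beta> =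
        (g ** levi_civita g dg L \<gamma>) $ \<beta> $ \<epsilon> + (g ** levi_civita g dg L \<gamma>) $ \<epsilon> $ \<beta>" by (simp add: transpose_def)
    then show ?thesis
      unfolding levi_civita_lowered[OF g(1)] s[of \<beta>] s[of \<epsilon>] using l[of \<gamma> \<beta> \<epsilon>] l[of \<gamma> \<epsilon> \<beta>] l[of \<gamma> \<epsilon> \<beta>] l[of \<gamma> \<beta> \<epsilon>] l[of \<gamma> \<epsilon> \<beta>]
        l[of \<epsilon> \<beta> \<gamma>] ds[of \<epsilon> \<beta> \<gamma>] ds[of \<beta> \<epsilon> \<gamma>] ds[of \<gamma> \<epsilon> \<beta>] by (simp add: field_simps)
  qed
  ultimately show ?thesis by (simp add: vec_eq_iff)
qed

lemma levi_civita_torsion: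
  fixes g :: "real ^ 'n ^ 'n"
  assumes g: "invertible g" "transpose g = g" and dg: "\<And>\<gamma>. transpose (dg \<gamma>) = dg \<gamma>"
    and L: "\<And>\<theta> \<alpha> \<beta>. L \<theta> \<alpha> \<beta> = - L \<theta> \<beta> \<alpha>"
  shows "levi_civita g dg L \<gamma> $ \<alpha> $ \<beta> - levi_civita g dg L \<beta> $ \<alpha> $ \<gamma> = L \<alpha> \<gamma> \<beta>"
proof -
  let ?A = "\<chi> \<alpha> (_ :: 'n). levi_civita g dg L \<gamma> $ \<alpha> $ \<beta> - levi_civita g dg L \<beta> $ \<alpha> $ \<gamma>"
  let ?B = "\<chi> \<alpha> (_ :: 'n). L \<alpha> \<gamma> \<beta>"
  have s: "g $ \<alpha> $ \<beta> = g $ \<beta> $ \<alpha>" for \<alpha> \<beta> by (rule symmetric_matrix_nth[OF g(2)])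
  have ds: "dg \<gamma> $ \<alpha> $ \<beta> = dg \<gamma> $ \<beta> $ \<alpha>" for \<gamma> \<alpha> \<beta> by (rule symmetric_matrix_nth[OF dg])
  have l: "(\<Sum>\<theta>\<in>UNIV. g $ \<theta> $ \<epsilon> * L \<theta> \<alpha> \<beta>) = - (\<Sum>\<theta>\<in>UNIV. g $ \<theta> $ \<epsilon> * L \<theta> \<beta> \<alpha>)" for \<alpha> \<beta> \<epsilon>
  proof -
    have "(\<Sum>\<theta>\<in>UNIV. g $ \<theta> $ \<epsilon> * L \<theta> \<alpha> \<beta>) = (\<Sum>\<theta>\<in>UNIV. - (g $ \<theta> $ \<epsilon> * L \<theta> \<beta> \<alpha>))"
    proof (rule sum.cong[OF refl])
      fix \<theta> show "g $ \<theta> $ \<epsilon> * L \<theta> \<alpha> \<beta> = - (g $ \<theta> $ \<epsilon> * L \<theta> \<beta> \<alpha>)" using L[of \<theta> \<alpha> \<beta>] by simp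
    qed
    then show ?thesis by (simp only: sum_negf)
  qed
  have "(g ** ?A) $ \<epsilon> $ k = (g ** ?B) $ \<epsilon> $ k" for \<epsilon> k
  proof -
    have "(g ** ?A) $ \<epsilon> $ k = (g ** levi_civita g dg L \<gamma>) $ \<epsilon> $ \<beta> - (g ** levi_civita g dg L \<beta>) $ \<epsilon> $ \<gamma>"
      by (simp add: matrix_matrix_mult_def right_diff_distrib sum_subtractf)
    also have "\<dots> = (\<Sum>\<theta>\<in>UNIV. g $ \<theta> $ \<epsilon> * L \<theta> \<gamma> \<beta>)"
      unfolding levi_civita_lowered[OF g(1)] s[of \<beta>] s[of \<gamma>] using l[of \<epsilon> \<beta> \<gamma>] ds[of \<epsilon> \<beta> \<gamma>] by (simp add: field_simps)
    also have "\<dots> = (g ** ?B) $ \<epsilon> $ k" by (simp add: matrix_matrix_mult_def s[of _ \<epsilon>])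
    finally show ?thesis .
  qed
  then have "g ** ?A = g ** ?B" by (simp add: vec_eq_iff)
  then have "?A = ?B" by (rule invertible_cancel_left[OF g(1)])
  then show ?thesis by (simp add: vec_eq_iff)
qed

text \<open>The difference of two metric connections with the same torsion is, with lowered index, antisymmetric
  in one pair of indices and symmetric in another one; such a tensor vanishes.\<close>

lemma levi_civita_unique:
  fixes g :: "real ^ 'n ^ 'n"
  assumes g: "invertible g" "transpose g = g" and dg: "\<And>\<gamma>. transpose (dg \<gamma>) = dg \<gamma>"
    and L: "\<And>\<theta> \<alpha> \<beta>. L \<theta> \<alpha> \<beta> = - L \<theta> \<beta> \<alpha>"
    and m: "\<And>\<gamma>. transpose (\<Omega> \<gamma>) ** g + g ** \<Omega> \<gamma> = dg \<gamma>"
    and t: "\<And>\<gamma> \<alpha> \<beta>. \<Omega> \<gamma> $ \<alpha> $ \<beta> - \<Omega> \<beta> $ \<alpha> $ \<gamma> = L \<alpha> \<gamma> \<beta>"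
  shows "\<Omega> \<gamma> = levi_civita g dg L \<gamma>"
proof -
  let ?LC = "levi_civita g dg L"
  define T where "T \<gamma> = g ** (\<Omega> \<gamma> - ?LC \<gamma>)" for \<gamma>
  have anti: "T \<gamma> $ \<epsilon> $ \<beta> = - T \<gamma> $ \<beta> $ \<epsilon>" for \<gamma> \<beta> \<epsilon>
  proof -
    have "transpose (T \<gamma>) = transpose (\<Omega> \<gamma>) ** g - transpose (?LC \<gamma>) ** g"
      unfolding T_def by (simp only: matrix_mult_simps g(2))
    also have "\<dots> = - T \<gamma>"
      unfolding T_def using m[of \<gamma>] levi_civita_metric[where g = g and dg = dg and L = L and \<gamma> = \<gamma>, OF g dg L]
      by (simp only: matrix_mult_simps(4)) (simp add: algebra_simps)
    finally have "transpose (T \<gamma>) $ \<beta> $ \<epsilon> = (- T \<gamma>) $ \<beta> $ \<epsilon>" by (simp only:)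
    then show ?thesis by (simp only: transpose_def vec_lambda_beta vector_uminus_component)
  qed
  have sym: "T \<gamma> $ \<epsilon> $ \<beta> = T \<beta> $ \<epsilon> $ \<gamma>" for \<gamma> \<beta> \<epsilon>
  proof -
    have "(\<Omega> \<gamma> - ?LC \<gamma>) $ \<theta> $ \<beta> = (\<Omega> \<beta> - ?LC \<beta>) $ \<theta> $ \<gamma>" for \<theta>
      using t[of \<gamma> \<theta> \<beta>] levi_civita_torsion[where g = g and dg = dg and L = L and \<gamma> = \<gamma> and \<alpha> = \<theta> and \<beta> = \<beta>, OF g dg L] by simp
    then show ?thesis by (simp add: T_def matrix_matrix_mult_def)
  qed
  \<comment> \<open>alternating the two symmetries three times returns to the same indices with the sign \<open>-1\<close>\<close>
  have "T \<gamma> $ \<epsilon> $ \<beta> = 0" for \<epsilon> \<beta>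
    using sym[of \<gamma> \<epsilon> \<beta>] anti[of \<beta> \<epsilon> \<gamma>] sym[of \<beta> \<gamma> \<epsilon>] anti[of \<epsilon> \<gamma> \<beta>] sym[of \<epsilon> \<beta> \<gamma>] anti[of \<gamma> \<beta> \<epsilon>] by linarith
  then have "g ** (\<Omega> \<gamma> - ?LC \<gamma>) = g ** 0" unfolding T_def[symmetric] by (simp add: vec_eq_iff matrix_matrix_mult_def)
  then have "\<Omega> \<gamma> - ?LC \<gamma> = 0" by (rule invertible_cancel_left[OF g(1)])
  then show ?thesis by simp
qed

text \<open>The matrices \<open>J\<^sup>-\<^sup>1 (dJ + N J)\<close>, with the Levi-Civita matrices \<open>N\<close> of the other frame, are metric and have
  torsion \<open>L\<close>. By uniqueness they are the Levi-Civita matrices of \<open>g\<close>.\<close>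

lemma levi_civita_change:
  fixes g g' J I :: "real ^ 'n ^ 'n"
  assumes g: "invertible g" "transpose g = g" and dgs: "\<And>\<gamma>. transpose (dg \<gamma>) = dg \<gamma>"
    and L: "\<And>\<theta> \<alpha> \<beta>. L \<theta> \<alpha> \<beta> = - L \<theta> \<beta> \<alpha>"
    and g': "invertible g'" "transpose g' = g'" and dgs': "\<And>\<gamma>. transpose (dg' \<gamma>) = dg' \<gamma>"
    and L': "\<And>\<theta> \<alpha> \<beta>. L' \<theta> \<alpha> \<beta> = - L' \<theta> \<beta> \<alpha>"
    and gg: "g = transpose J ** g' ** J"
    and dg: "\<And>\<gamma>. dg \<gamma> = transpose (dJ \<gamma>) ** g' ** J + transpose J ** (\<Sum>\<gamma>'\<in>UNIV. J $ \<gamma>' $ \<gamma> *\<^sub>R dg' \<gamma>') ** J + transpose J ** g' ** dJ \<gamma>"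
    and LL: "\<And>\<alpha> \<beta> \<gamma>'. (\<Sum>\<gamma>\<in>UNIV. J $ \<gamma>' $ \<gamma> * L \<gamma> \<alpha> \<beta>) =
      (\<Sum>\<alpha>'\<in>UNIV. \<Sum>\<beta>'\<in>UNIV. J $ \<alpha>' $ \<alpha> * J $ \<beta>' $ \<beta> * L' \<gamma>' \<alpha>' \<beta>') + dJ \<alpha> $ \<gamma>' $ \<beta> - dJ \<beta> $ \<gamma>' $ \<alpha>"
    and inv: "J ** I = mat 1" "I ** J = mat 1"
  shows "J ** levi_civita g dg L \<gamma> = dJ \<gamma> + (\<Sum>\<gamma>'\<in>UNIV. J $ \<gamma>' $ \<gamma> *\<^sub>R levi_civita g' dg' L' \<gamma>') ** J"
proof -
  let ?LC' = "levi_civita g' dg' L'"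
  define N where "N \<gamma> = (\<Sum>\<gamma>'\<in>UNIV. J $ \<gamma>' $ \<gamma> *\<^sub>R ?LC' \<gamma>')" for \<gamma>
  define \<Omega> where "\<Omega> \<gamma> = I ** (dJ \<gamma> + N \<gamma> ** J)" for \<gamma>
  have J\<Omega>: "J ** \<Omega> \<gamma> = dJ \<gamma> + N \<gamma> ** J" for \<gamma> unfolding \<Omega>_def by (simp add: matrix_mul_assoc inv)
  have "transpose (\<Omega> \<gamma>) ** g + g ** \<Omega> \<gamma> = dg \<gamma>" for \<gamma>
  proof -
    have "(\<Sum>\<gamma>'\<in>UNIV. J $ \<gamma>' $ \<gamma> *\<^sub>R dg' \<gamma>') = (\<Sum>\<gamma>'\<in>UNIV. J $ \<gamma>' $ \<gamma> *\<^sub>R (transpose (?LC' \<gamma>') ** g' + g' ** ?LC' \<gamma>'))"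
      by (simp only: levi_civita_metric[OF g' dgs' L'])
    also have "\<dots> = transpose (N \<gamma>) ** g' + g' ** N \<gamma>"
      unfolding N_def by (simp only: matrix_mult_simps scaleR_add_right sum.distrib)
    finally have d: "(\<Sum>\<gamma>'\<in>UNIV. J $ \<gamma>' $ \<gamma> *\<^sub>R dg' \<gamma>') = transpose (N \<gamma>) ** g' + g' ** N \<gamma>" .
    have "transpose (\<Omega> \<gamma>) ** g + g ** \<Omega> \<gamma> = transpose (J ** \<Omega> \<gamma>) ** g' ** J + transpose J ** g' ** (J ** \<Omega> \<gamma>)"
      unfolding gg by (simp only: matrix_transpose_mul matrix_mul_assoc)
    also have "\<dots> = dg \<gamma>"
      unfolding J\<Omega> dg d by (simp only: matrix_mult_simps matrix_mul_assoc) simp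
    finally show ?thesis .
  qed
  moreover have "\<Omega> \<gamma> $ \<alpha> $ \<beta> - \<Omega> \<beta> $ \<alpha> $ \<gamma> = L \<alpha> \<gamma> \<beta>" for \<gamma> \<alpha> \<beta>
  proof -
    let ?A = "\<chi> \<alpha>. \<Omega> \<gamma> $ \<alpha> $ \<beta> - \<Omega> \<beta> $ \<alpha> $ \<gamma>" and ?B = "\<chi> \<alpha>. L \<alpha> \<gamma> \<beta>"
    have NJ: "(N \<gamma> ** J) $ \<theta> $ \<beta> = (\<Sum>\<beta>'\<in>UNIV. \<Sum>\<gamma>'\<in>UNIV. J $ \<gamma>' $ \<gamma> * J $ \<beta>' $ \<beta> * ?LC' \<gamma>' $ \<theta> $ \<beta>')" for \<gamma> \<beta> \<theta>
      by (simp add: N_def matrix_matrix_mult_def sum_distrib_left sum_distrib_right sum_component mult_ac)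
    have "(J *v ?A) $ \<theta> = (J *v ?B) $ \<theta>" for \<theta>
    proof -
      have "(J *v ?A) $ \<theta> = (J ** \<Omega> \<gamma>) $ \<theta> $ \<beta> - (J ** \<Omega> \<beta>) $ \<theta> $ \<gamma>"
        by (simp add: matrix_vector_mult_def matrix_matrix_mult_def right_diff_distrib sum_subtractf)
      also have "\<dots> = dJ \<gamma> $ \<theta> $ \<beta> - dJ \<beta> $ \<theta> $ \<gamma> + ((N \<gamma> ** J) $ \<theta> $ \<beta> - (N \<beta> ** J) $ \<theta> $ \<gamma>)"
        unfolding J\<Omega> by simp
      also have "(N \<beta> ** J) $ \<theta> $ \<gamma> = (\<Sum>\<beta>'\<in>UNIV. \<Sum>\<gamma>'\<in>UNIV. J $ \<gamma>' $ \<gamma> * J $ \<beta>' $ \<beta> * ?LC' \<beta>' $ \<theta> $ \<gamma>')"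
        unfolding NJ by (subst sum.swap) (simp add: mult_ac)
      also have "(N \<gamma> ** J) $ \<theta> $ \<beta> - (\<Sum>\<beta>'\<in>UNIV. \<Sum>\<gamma>'\<in>UNIV. J $ \<gamma>' $ \<gamma> * J $ \<beta>' $ \<beta> * ?LC' \<beta>' $ \<theta> $ \<gamma>') =
          (\<Sum>\<beta>'\<in>UNIV. \<Sum>\<gamma>'\<in>UNIV. J $ \<gamma>' $ \<gamma> * J $ \<beta>' $ \<beta> * L' \<theta> \<gamma>' \<beta>')"
        unfolding NJ sum_subtractf[symmetric] right_diff_distrib[symmetric] levi_civita_torsion[OF g' dgs' L'] ..
      also have "\<dots> = (\<Sum>\<gamma>'\<in>UNIV. \<Sum>\<beta>'\<in>UNIV. J $ \<gamma>' $ \<gamma> * J $ \<beta>' $ \<beta> * L' \<theta> \<gamma>' \<beta>')" by (rule sum.swap)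
      also have "dJ \<gamma> $ \<theta> $ \<beta> - dJ \<beta> $ \<theta> $ \<gamma> + \<dots> = (J *v ?B) $ \<theta>"
        using LL[of \<theta> \<gamma> \<beta>] by (simp add: matrix_vector_mult_def)
      finally show ?thesis .
    qed
    then have "J *v ?A = J *v ?B" by (simp add: vec_eq_iff)
    then have "I *v (J *v ?A) = I *v (J *v ?B)" by (rule arg_cong)
    then have "?A = ?B" by (simp add: matrix_vector_mul_assoc inv)
    then show ?thesis by (simp add: vec_eq_iff)
  qed
  ultimately have "\<Omega> \<gamma> = levi_civita g dg L \<gamma>" by (intro levi_civita_unique[OF g dgs L])
  then show ?thesis using J\<Omega>[of \<gamma>] by (simp only: N_def)
qed

section \<open>Derivatives of matrices of functions\<close>

context gte
begin

definition dmat :: "('f, 'e) gte \<Rightarrow> ('e \<Rightarrow> real ^ 'y ^ 'x) \<Rightarrow> real ^ 'y ^ 'x" where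
  "dmat X M = (\<chi> i j. snd X (\<lambda>v. M v $ i $ j))"

lemma dmat_nth [simp]: "dmat X M $ i $ j = snd X (\<lambda>v. M v $ i $ j)"
  by (simp add: dmat_def)

lemma dmat_cong:
  assumes "gte_vector v X" "\<forall>\<^sub>F v in nhds v. M v = N v" shows "dmat X M = dmat X N"
proof -
  have "near v (\<lambda>v. M v $ i $ j) (\<lambda>v. N v $ i $ j)" for i j
    unfolding near_def using assms(2) by eventually_elim simp
  then show ?thesis using E.tangent_cong[OF gte_vector_tangent[OF assms(1)]] by (simp add: vec_eq_iff)
qed

lemma dmat_transpose: "dmat X (\<lambda>v. transpose (M v)) = transpose (dmat X M)"
  by (simp add: dmat_def transpose_def)

lemma dmat_mult:
  fixes M :: "'e \<Rightarrow> real ^ 'y ^ 'x" and N :: "'e \<Rightarrow> real ^ 'z ^ 'y"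
  assumes X: "gte_vector v X" and M: "\<And>i j. smooth v (\<lambda>v. M v $ i $ j)" and N: "\<And>i j. smooth v (\<lambda>v. N v $ i $ j)"
  shows "dmat X (\<lambda>v. M v ** N v) = dmat X M ** N v + M v ** dmat X N"
proof -
  note w = gte_vector_tangent[OF X]
  have "snd X (\<lambda>v. \<Sum>k\<in>UNIV. M v $ i $ k * N v $ k $ j) =
      (\<Sum>k\<in>UNIV. snd X (\<lambda>v. M v $ i $ k) * N v $ k $ j) + (\<Sum>k\<in>UNIV. M v $ i $ k * snd X (\<lambda>v. N v $ k $ j))" for i j
    by (simp add: E.tangent_sum[OF w E.smooth_near_mult[OF M N]] E.tangent_mult[OF w M N] sum.distrib add.commute)
  then show ?thesis by (simp add: vec_eq_iff matrix_matrix_mult_def)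
qed

lemma matrix_mult_smooth:
  fixes M :: "'e \<Rightarrow> real ^ 'y ^ 'x" and N :: "'e \<Rightarrow> real ^ 'z ^ 'y"
  assumes "\<And>i j. smooth v (\<lambda>v. M v $ i $ j)" "\<And>i j. smooth v (\<lambda>v. N v $ i $ j)"
  shows "smooth v (\<lambda>v. (M v ** N v) $ i $ j)"
  by (simp add: matrix_matrix_mult_def E.smooth_near_sum E.smooth_near_mult assms)

lemma avec_deriv:
  assumes "c \<in> charts" "v \<in> dom_E S c"
  shows "snd (avec c v \<xi>) f = (\<Sum>A\<in>UNIV. \<xi> $ A * snd (frame S c v A) f)"
proof -
  have lin: "linear (\<lambda>\<xi>. snd (avec c v \<xi>) f)"
    by (rule linearI) (simp_all add: avec_add[OF assms] avec_scale[OF assms] gte_add_def gte_scale_def)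
  have "snd (avec c v \<xi>) f = snd (avec c v (\<Sum>B\<in>UNIV. \<xi> $ B *\<^sub>R axis B 1)) f" using E.vec_expand[of \<xi>] by simp
  then show ?thesis by (simp add: linear_sum[OF lin] linear_scale[OF lin] frame_avec)
qed

lemma dmat_expand:
  assumes "c \<in> charts" "v \<in> dom_E S c" "gte_vector v X"
  shows "dmat X M = (\<Sum>A\<in>UNIV. acoord c v X $ A *\<^sub>R dmat (frame S c v A) M)"
proof -
  have "snd X f = (\<Sum>A\<in>UNIV. acoord c v X $ A * snd (frame S c v A) f)" for f
    using avec_deriv[OF assms(1,2), of "acoord c v X"] avec_acoord[OF assms] by simp
  then show ?thesis by (simp add: vec_eq_iff)
qed

lemma frame_gte_vector: "c \<in> charts \<Longrightarrow> v \<in> dom_E S c \<Longrightarrow> gte_vector v (frame S c v A)"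
  by (simp add: frame_avec avec_gte_vector)

lemma acoord_frame:
  "c \<in> charts \<Longrightarrow> v \<in> dom_E S c \<Longrightarrow> acoord c v (frame S c v A) = axis A 1"
  by (simp add: frame_avec acoord_avec)

lemma acoord_frame_change:
  assumes "c \<in> charts" "v \<in> dom_E S c" "c' \<in> charts" "v \<in> dom_E S c'"
  shows "acoord c' v (frame S c v A) $ B = tr c c' v $ B $ A"
  using acoord_change[OF assms frame_gte_vector[OF assms(1,2)]] acoord_frame[OF assms(1,2)]
  by (simp add: matrix_vector_axis)

lemma frame_deriv_change:
  assumes "c \<in> charts" "v \<in> dom_E S c" "c' \<in> charts" "v \<in> dom_E S c'"
  shows "snd (frame S c v A) f = (\<Sum>B\<in>UNIV. tr c c' v $ B $ A * snd (frame S c' v B) f)"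
  using avec_deriv[OF assms(3,4), of "acoord c' v (frame S c v A)"] avec_acoord[OF assms(3,4) frame_gte_vector[OF assms(1,2)]]
  by (simp add: acoord_frame_change[OF assms])

lemma dmat_frame_change:
  assumes "c \<in> charts" "v \<in> dom_E S c" "c' \<in> charts" "v \<in> dom_E S c'"
  shows "dmat (frame S c v A) M = (\<Sum>B\<in>UNIV. tr c c' v $ B $ A *\<^sub>R dmat (frame S c' v B) M)"
  using dmat_expand[OF assms(3,4) frame_gte_vector[OF assms(1,2)]] by (simp add: acoord_frame_change[OF assms])

lemma frame_Inr_deriv:
  assumes "c \<in> charts" "v \<in> dom_E S c" shows "snd (frame S c v (Inr b)) f = dy S c b f v"
proof -
  have "(\<Sum>a\<in>UNIV. axis b 1 $ a * dy S c a f v) = (\<Sum>a\<in>UNIV. if a = b then dy S c a f v else 0)"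
    by (intro sum.cong refl) (simp add: axis_def)
  then show ?thesis by (simp add: frame_def adapted_vec_def natural_vec_deriv[OF assms] vec_lambda_eta)
qed

lemma frame_Inl_deriv:
  assumes "c \<in> charts" "v \<in> dom_E S c"
  shows "snd (frame S c v (Inl \<gamma>)) f = (\<Sum>i\<in>UNIV. rho_at S c i \<gamma> v * dx S c i f v) - (\<Sum>a\<in>UNIV. Gam S c a \<gamma> v * dy S c a f v)"
proof -
  have ax: "(\<Sum>\<alpha>\<in>UNIV. axis \<gamma> 1 $ \<alpha> * k \<alpha>) = k \<gamma>" "(\<Sum>\<alpha>\<in>UNIV. k \<alpha> * axis \<gamma> 1 $ \<alpha>) = k \<gamma>" for k :: "'p \<Rightarrow> real"
  proof -
    have "(\<Sum>\<alpha>\<in>UNIV. axis \<gamma> 1 $ \<alpha> * k \<alpha>) = (\<Sum>\<alpha>\<in>UNIV. if \<alpha> = \<gamma> then k \<alpha> else 0)"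
      by (intro sum.cong refl) (simp add: axis_def)
    then show "(\<Sum>\<alpha>\<in>UNIV. axis \<gamma> 1 $ \<alpha> * k \<alpha>) = k \<gamma>" by simp
    then show "(\<Sum>\<alpha>\<in>UNIV. k \<alpha> * axis \<gamma> 1 $ \<alpha>) = k \<gamma>" by (simp add: mult.commute)
  qed
  show ?thesis by (simp add: frame_def adapted_vec_def natural_vec_deriv[OF assms] ax sum_negf)
qed

lemma frame_deriv_smooth: "c \<in> charts \<Longrightarrow> v \<in> dom_E S c \<Longrightarrow> smooth v f \<Longrightarrow> smooth v (\<lambda>v. snd (frame S c v A) f)"
  unfolding frame_avec by (rule avec_deriv_smooth) (auto intro: smooth_near_const)

lemma frame_Inl_base:
  assumes "c \<in> charts" "v \<in> dom_E S c" "smooth_near (atlasM S) (\<pi> v) f"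
  shows "snd (frame S c v (Inl \<gamma>)) (\<lambda>v. f (\<pi> v)) = \<rho> (\<tau> (tpart c) \<gamma> (h (\<pi> v))) f"
proof -
  have "fst (frame S c v (Inl \<gamma>)) = \<tau> (tpart c) \<gamma> (h (\<pi> v))"
    by (simp add: frame_def adapted_vec_def natural_vec_def frame_sec_def)
  then show ?thesis using gte_vector_\<pi>[OF frame_gte_vector[OF assms(1,2), of "Inl \<gamma>"] assms(3)] by simp
qed

lemma frame_Inr_base:
  assumes "c \<in> charts" "v \<in> dom_E S c" "smooth_near (atlasM S) (\<pi> v) f"
  shows "snd (frame S c v (Inr b)) (\<lambda>v. f (\<pi> v)) = 0"
proof -
  have "fst (frame S c v (Inr b)) = fib_elt (bundleF S) (tpart c) (h (\<pi> v)) 0"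
    by (simp add: frame_def adapted_vec_def natural_vec_def)
  then show ?thesis using gte_vector_\<pi>[OF frame_gte_vector[OF assms(1,2), of "Inr b"] assms(3)]
      \<rho>_frame_expansion[OF local_chart_parts(3)[OF assms(1)] dom_E_parts(3)[OF assms(2)], of 0] by simp
qed

lemma tr_base:
  assumes "c \<in> charts" "v \<in> dom_E S c" "c' \<in> charts" "v \<in> dom_E S c'"
  shows "smooth_near (atlasM S) (\<pi> v) (\<lambda>x. N.trans_mat (tpart c) (tpart c') (h x) $ i $ j)"
    and "smooth_near (atlasM S) (\<pi> v) (\<lambda>x. M.trans_mat (ypart c) (ypart c') x $ a $ b)"
  by (rule smooth_near_h, rule N.trans_mat_smooth; use assms local_chart_parts dom_E_parts in auto)
    (rule M.trans_mat_smooth; use assms local_chart_parts dom_E_parts in auto)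

lemma dmat_tr_vertical:
  assumes "c \<in> charts" "v \<in> dom_E S c" "c' \<in> charts" "v \<in> dom_E S c'"
  shows "dmat (frame S c v (Inr b)) (trH c c') = 0" "dmat (frame S c v (Inr b)) (trV c c') = 0"
  using frame_Inr_base[OF assms(1,2) tr_base(1)[OF assms]] frame_Inr_base[OF assms(1,2) tr_base(2)[OF assms]]
  by (simp_all add: vec_eq_iff trH_def trV_def)

text \<open>On functions of \<open>x\<close> the adapted frame vector \<open>\<delta>\<^sub>\<alpha>\<close> acts as \<open>\<rho>(t\<^sub>\<alpha>)\<close>; this turns the law of the structure
  functions on \<open>N\<close> into one on \<open>E\<close>.\<close>

lemma L_at_change:
  assumes "c \<in> charts" "v \<in> dom_E S c" "c' \<in> charts" "v \<in> dom_E S c'"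
  shows "(\<Sum>\<gamma>\<in>UNIV. trH c c' v $ \<gamma>' $ \<gamma> * L_at S c \<gamma> \<alpha> \<beta> v) =
    (\<Sum>\<alpha>'\<in>UNIV. \<Sum>\<beta>'\<in>UNIV. trH c c' v $ \<alpha>' $ \<alpha> * trH c c' v $ \<beta>' $ \<beta> * L_at S c' \<gamma>' \<alpha>' \<beta>' v)
    + dmat (frame S c v (Inl \<alpha>)) (trH c c') $ \<gamma>' $ \<beta> - dmat (frame S c v (Inl \<beta>)) (trH c c') $ \<gamma>' $ \<alpha>"
  using L_comp_transform[OF assms(1) dom_E_parts(3)[OF assms(2)] assms(3) dom_E_parts(3)[OF assms(4)], of \<gamma>' \<alpha> \<beta>]
    frame_Inl_base[OF assms(1,2) tr_base(1)[OF assms]]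
  by (simp add: trH_def)

definition berwald where "berwald c v \<gamma> = (\<chi> a b. dy S c b (Gam S c a \<gamma>) v)"

lemma frame_Inl_y:
  assumes "c \<in> charts" "v \<in> dom_E S c"
  shows "snd (frame S c v (Inl \<gamma>)) (\<lambda>v. snd (ypart c) v $ a) = - Gam S c a \<gamma> v"
proof -
  have "(\<Sum>\<alpha>\<in>UNIV. Gam S c a \<alpha> v * axis \<gamma> 1 $ \<alpha>) = (\<Sum>\<alpha>\<in>UNIV. if \<alpha> = \<gamma> then Gam S c a \<alpha> v else 0)"
    by (intro sum.cong refl) (simp add: axis_def)
  then show ?thesis using natural_vec_parts(3)[OF assms, of a "axis \<gamma> 1"]
    by (simp add: frame_def adapted_vec_def Y_coord_def)
qed

text \<open>The transformation of \<open>\<Gamma>\<close> comes from \<open>\<delta>\<^sub>\<gamma> y\<^sup>a = -\<Gamma>\<^sup>a\<^sub>\<gamma>\<close> and \<open>y'\<^sup>a = \<Lambda>\<^sup>a\<^sub>b y\<^sup>b\<close>; its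
  derivative in the direction of the fibre is the law of the Berwald coefficients.\<close>

lemma Gam_change:
  assumes "c \<in> charts" "v \<in> dom_E S c" "c' \<in> charts" "v \<in> dom_E S c'"
  shows "(\<Sum>b\<in>UNIV. trV c c' v $ a $ b * Gam S c b \<gamma> v) =
    (\<Sum>b\<in>UNIV. dmat (frame S c v (Inl \<gamma>)) (trV c c') $ a $ b * snd (ypart c) v $ b)
    + (\<Sum>\<gamma>'\<in>UNIV. trH c c' v $ \<gamma>' $ \<gamma> * Gam S c' a \<gamma>' v)"
proof -
  note c = assms(1,2) and c' = assms(3,4)
  let ?X = "frame S c v (Inl \<gamma>)"
  note w = gte_vector_tangent[OF frame_gte_vector[OF c, of "Inl \<gamma>"]]
  have "near v (\<lambda>v. snd (ypart c') v $ a) (\<lambda>v. \<Sum>b\<in>UNIV. trV c c' v $ a $ b * snd (ypart c) v $ b)"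
    unfolding near_def using eventually_dom_E[OF c] eventually_dom_E[OF c']
  proof eventually_elim
    case (elim u)
    then show ?case
      using M.trans_mat[OF local_chart_parts(2)[OF c(1)] local_chart_parts(2)[OF c'(1)] dom_E_parts(2)[OF elim(1)] dom_E_parts(2)[OF elim(2)]]
      by (simp add: matrix_vector_mult_def trV_def)
  qed
  then have "snd ?X (\<lambda>v. snd (ypart c') v $ a) = snd ?X (\<lambda>v. \<Sum>b\<in>UNIV. trV c c' v $ a $ b * snd (ypart c) v $ b)"
    by (rule E.tangent_cong[OF w])
  also have "\<dots> = (\<Sum>b\<in>UNIV. snd ?X (\<lambda>v. trV c c' v $ a $ b * snd (ypart c) v $ b))"
    by (intro E.tangent_sum[OF w] E.smooth_near_mult trV_smooth[OF assms] smooth_y_coord[OF c])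
  also have "\<dots> = (\<Sum>b\<in>UNIV. - (trV c c' v $ a $ b * Gam S c b \<gamma> v) + dmat ?X (trV c c') $ a $ b * snd (ypart c) v $ b)"
    by (intro sum.cong refl) (simp add: E.tangent_mult[OF w trV_smooth[OF assms] smooth_y_coord[OF c]] frame_Inl_y[OF c])
  also have "\<dots> = - (\<Sum>b\<in>UNIV. trV c c' v $ a $ b * Gam S c b \<gamma> v) + (\<Sum>b\<in>UNIV. dmat ?X (trV c c') $ a $ b * snd (ypart c) v $ b)"
    by (simp only: sum.distrib sum_negf)
  finally have 1: "snd ?X (\<lambda>v. snd (ypart c') v $ a) =
    - (\<Sum>b\<in>UNIV. trV c c' v $ a $ b * Gam S c b \<gamma> v) + (\<Sum>b\<in>UNIV. dmat ?X (trV c c') $ a $ b * snd (ypart c) v $ b)" .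
  have "snd ?X (\<lambda>v. snd (ypart c') v $ a) = - (\<Sum>\<gamma>'\<in>UNIV. trH c c' v $ \<gamma>' $ \<gamma> * Gam S c' a \<gamma>' v)"
    unfolding frame_deriv_change[OF assms] sum_UNIV_Plus by (simp add: tr_def frame_Inl_y[OF c'] sum_negf)
  then show ?thesis using 1 by simp
qed

lemma \<rho>_frame_base_smooth:
  assumes "c \<in> charts" "v \<in> dom_E S c" "smooth_near (atlasM S) (\<pi> v) f"
  shows "smooth_near (atlasM S) (\<pi> v) (\<lambda>x. \<rho> (\<tau> (tpart c) \<gamma> (h x)) f)"
proof -
  note x = local_chart_parts(1)[OF assms(1)] dom_E_parts(1)[OF assms(2)]
  note t = local_chart_parts(3)[OF assms(1)] dom_E_parts(3)[OF assms(2)]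
  let ?g = "\<lambda>x. \<Sum>i\<in>UNIV. \<rho> (\<tau> (tpart c) \<gamma> (h x)) (\<lambda>x. snd (xpart c) x $ i) * coord_vec (atlasM S) (xpart c) x (axis i 1) f"
  have "smooth_near (atlasM S) (\<pi> v) ?g"
    by (intro M.smooth_near_sum M.smooth_near_mult M.smooth_near_coord_vec[OF x assms(3)]
        smooth_near_h[where f = "\<lambda>y. \<rho> (\<tau> (tpart c) \<gamma> y) (\<lambda>x. snd (xpart c) x $ _)"] \<rho>_frame_smooth[OF t(1) x(1) t(2)])
      (simp add: x)
  moreover have "near (\<pi> v) ?g (\<lambda>x. \<rho> (\<tau> (tpart c) \<gamma> (h x)) f)"
  proof -
    have o: "open (fst (xpart c) \<inter> h -` fst (tpart c))"
      using open_vimage[OF N.open_triv[OF t(1)], of h] smooth_h M.open_chart_dom[OF x(1)] by (auto simp: smooth_map_def)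
    have "?g u = \<rho> (\<tau> (tpart c) \<gamma> (h u)) f" if u: "u \<in> fst (xpart c) \<inter> h -` fst (tpart c)" for u
    proof -
      have "\<rho> (\<tau> (tpart c) \<gamma> (h u)) \<in> tangent_space (atlasM S) u"
        using \<rho>_tangent[of "\<tau> (tpart c) \<gamma> (h u)"] N.proj_fib_elt[OF t(1), of "h u"] u by (simp add: frame_sec_def)
      from tangent_coord_expansion(2)[OF this x(1), of f] show ?thesis using u by simp
    qed
    then show ?thesis unfolding near_def eventually_nhds using o x t by (intro exI[of _ "fst (xpart c) \<inter> h -` fst (tpart c)"]) auto
  qed
  ultimately show ?thesis using M.smooth_near_cong by blast
qed

lemma berwald_change:
  assumes "c \<in> charts" "v \<in> dom_E S c" "c' \<in> charts" "v \<in> dom_E S c'"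
  shows "trV c c' v ** berwald c v \<gamma> = dmat (frame S c v (Inl \<gamma>)) (trV c c') +
    (\<Sum>\<gamma>'\<in>UNIV. trH c c' v $ \<gamma>' $ \<gamma> *\<^sub>R berwald c' v \<gamma>') ** trV c c' v"
proof -
  note c = assms(1,2) and c' = assms(3,4)
  let ?dJ = "\<lambda>v. dmat (frame S c v (Inl \<gamma>)) (trV c c')"
  have dJ_base: "\<forall>\<^sub>F v in nhds v. ?dJ v $ a $ b = \<rho> (\<tau> (tpart c) \<gamma> (h (\<pi> v))) (\<lambda>x. M.trans_mat (ypart c) (ypart c') x $ a $ b)" for a b
    using eventually_dom_E[OF c] eventually_dom_E[OF c']
    by eventually_elim (simp add: frame_Inl_base[OF c(1) _ tr_base(2)[OF c(1) _ c'(1)]] trV_def)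
  have dJ_smooth: "smooth v (\<lambda>v. ?dJ v $ a $ b)" for a b
    unfolding dmat_nth by (rule frame_deriv_smooth[OF c trV_smooth[OF assms]])
  have "(trV c c' v ** berwald c v \<gamma>) $ a $ d =
      (?dJ v + (\<Sum>\<gamma>'\<in>UNIV. trH c c' v $ \<gamma>' $ \<gamma> *\<^sub>R berwald c' v \<gamma>') ** trV c c' v) $ a $ d" for a d
  proof -
    let ?Y = "frame S c v (Inr d)"
    note w = gte_vector_tangent[OF frame_gte_vector[OF c, of "Inr d"]]
    have zV: "snd ?Y (\<lambda>v. trV c c' v $ a $ b) = 0" for b
      using dmat_tr_vertical(2)[OF assms, of d] by (simp add: vec_eq_iff)
    have zH: "snd ?Y (\<lambda>v. trH c c' v $ \<gamma>' $ \<gamma>) = 0" for \<gamma>'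
      using dmat_tr_vertical(1)[OF assms, of d] by (simp add: vec_eq_iff)
    have zJ: "snd ?Y (\<lambda>v. ?dJ v $ a $ b) = 0" for b
      using E.tangent_cong[OF w, of "\<lambda>v. ?dJ v $ a $ b"] dJ_base[of a b, folded near_def]
        frame_Inr_base[OF c \<rho>_frame_base_smooth[OF c tr_base(2)[OF assms]]] by simp
    have y: "snd ?Y (\<lambda>v. snd (ypart c) v $ b) = (if b = d then 1 else 0)" for b
      using natural_vec_parts(3)[OF c, of b 0 "axis d 1"] by (simp add: frame_def adapted_vec_def Y_coord_def axis_def)
    have dY: "snd ?Y f = (\<Sum>b\<in>UNIV. trV c c' v $ b $ d * dy S c' b f v)" for f
      unfolding frame_deriv_change[OF assms] sum_UNIV_Plus by (simp add: tr_def frame_Inr_deriv[OF c'])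
    have s1: "smooth v (\<lambda>v. trV c c' v $ a $ b * Gam S c b \<gamma> v)" for b
      by (intro E.smooth_near_mult trV_smooth[OF assms] Gam_smooth[OF c])
    have s2: "smooth v (\<lambda>v. ?dJ v $ a $ b * snd (ypart c) v $ b)" for b
      by (intro E.smooth_near_mult dJ_smooth smooth_y_coord[OF c])
    have s3: "smooth v (\<lambda>v. trH c c' v $ \<gamma>' $ \<gamma> * Gam S c' a \<gamma>' v)" for \<gamma>'
      by (intro E.smooth_near_mult trH_smooth[OF assms] Gam_smooth[OF c'])
    have "near v (\<lambda>v. \<Sum>b\<in>UNIV. trV c c' v $ a $ b * Gam S c b \<gamma> v)
      (\<lambda>v. (\<Sum>b\<in>UNIV. ?dJ v $ a $ b * snd (ypart c) v $ b) + (\<Sum>\<gamma>'\<in>UNIV. trH c c' v $ \<gamma>' $ \<gamma> * Gam S c' a \<gamma>' v))"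
      unfolding near_def using eventually_dom_E[OF c] eventually_dom_E[OF c']
      by eventually_elim (rule Gam_change[OF c(1) _ c'(1)])
    from E.tangent_cong[OF w this]
    have "(\<Sum>b\<in>UNIV. snd ?Y (\<lambda>v. trV c c' v $ a $ b * Gam S c b \<gamma> v)) =
        (\<Sum>b\<in>UNIV. snd ?Y (\<lambda>v. ?dJ v $ a $ b * snd (ypart c) v $ b)) +
        (\<Sum>\<gamma>'\<in>UNIV. snd ?Y (\<lambda>v. trH c c' v $ \<gamma>' $ \<gamma> * Gam S c' a \<gamma>' v))"
      by (simp only: E.tangent_sum[OF w s1] E.tangent_sum[OF w s2] E.tangent_sum[OF w s3]
          E.tangent_add[OF w E.smooth_near_sum[OF s2] E.smooth_near_sum[OF s3]])
    moreover have "snd ?Y (\<lambda>v. trV c c' v $ a $ b * Gam S c b \<gamma> v) = trV c c' v $ a $ b * berwald c v \<gamma> $ b $ d" for b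
      by (simp only: E.tangent_mult[OF w trV_smooth[OF assms] Gam_smooth[OF c]] zV mult_zero_left add_0_right)
        (simp add: berwald_def frame_Inr_deriv[OF c])
    moreover have "snd ?Y (\<lambda>v. ?dJ v $ a $ b * snd (ypart c) v $ b) = (if b = d then ?dJ v $ a $ b else 0)" for b
      unfolding E.tangent_mult[OF w dJ_smooth smooth_y_coord[OF c]] zJ y by simp
    moreover have "snd ?Y (\<lambda>v. trH c c' v $ \<gamma>' $ \<gamma> * Gam S c' a \<gamma>' v) =
        (\<Sum>b\<in>UNIV. trH c c' v $ \<gamma>' $ \<gamma> * berwald c' v \<gamma>' $ a $ b * trV c c' v $ b $ d)" for \<gamma>'
      unfolding E.tangent_mult[OF w trH_smooth[OF assms] Gam_smooth[OF c']] zH dY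
      by (simp add: berwald_def sum_distrib_left mult_ac)
    ultimately have "(\<Sum>b\<in>UNIV. trV c c' v $ a $ b * berwald c v \<gamma> $ b $ d) = ?dJ v $ a $ d +
        (\<Sum>\<gamma>'\<in>UNIV. \<Sum>b\<in>UNIV. trH c c' v $ \<gamma>' $ \<gamma> * berwald c' v \<gamma>' $ a $ b * trV c c' v $ b $ d)" by simp
    also have "(\<Sum>\<gamma>'\<in>UNIV. \<Sum>b\<in>UNIV. trH c c' v $ \<gamma>' $ \<gamma> * berwald c' v \<gamma>' $ a $ b * trV c c' v $ b $ d) =
        (\<Sum>b\<in>UNIV. \<Sum>\<gamma>'\<in>UNIV. trH c c' v $ \<gamma>' $ \<gamma> * berwald c' v \<gamma>' $ a $ b * trV c c' v $ b $ d)" by (rule sum.swap)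
    finally show ?thesis by (simp add: matrix_matrix_mult_def sum_component sum_distrib_right)
  qed
  then show ?thesis by (simp add: vec_eq_iff)
qed

end

section \<open>The canonical metric connection\<close>

lemma sum_axis_scaleR: "(\<Sum>A\<in>UNIV. axis C 1 $ A *\<^sub>R f A) = f C"
  for f :: "'n::finite \<Rightarrow> 'z::real_vector" and C :: 'n
proof -
  have "(\<Sum>A\<in>UNIV. axis C 1 $ A *\<^sub>R f A) = (\<Sum>A\<in>UNIV. if A = C then f A else 0)"
    by (intro sum.cong refl) (simp add: axis_def)
  then show ?thesis by simp
qed

lemma (in gte) blockm_transpose: "transpose (blockm P Q) = blockm (transpose P) (transpose Q)"
proof -
  have "transpose (blockm P Q) $ A $ B = blockm (transpose P) (transpose Q) $ A $ B" for A B
    by (cases A; cases B) (simp_all add: transpose_def)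
  then show ?thesis by (simp add: vec_eq_iff)
qed

locale gte_metric = gte S
  for S :: "('a::{t2_space, second_countable_topology}, 'b::{t2_space, second_countable_topology},
    'm::finite, 'f::topological_space, 'p::finite, 'e::topological_space, 'r::finite) gte_data" +
  fixes G :: "('f, 'e) tensor_field"
  assumes metric: "pseudo_metrical_structure S G"
begin

definition gHm where "gHm c v = (\<chi> \<alpha> \<beta>. gH S G c \<alpha> \<beta> v)"
definition gVm where "gVm c v = (\<chi> a b. gV S G c a b v)"

lemma G_tensor: "G \<in> TF 0 2"
  using metric by (simp add: pseudo_metrical_structure_def)

lemma metric_at:
  assumes "c \<in> charts" "v \<in> dom_E S c"
  shows gHm_symmetric: "transpose (gHm c v) = gHm c v" and gVm_symmetric: "transpose (gVm c v) = gVm c v"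
    and gHm_invertible: "invertible (gHm c v)" and gVm_invertible: "invertible (gVm c v)"
    and G_formula: "gte_vector v X \<Longrightarrow> gte_vector v X' \<Longrightarrow> G v [] [X, X'] =
      acoord c v X \<bullet> (blockm (gHm c v) (gVm c v) *v acoord c v X')"
proof -
  have m: "\<forall>X\<in>gte_fibre S v. \<forall>X'\<in>gte_fibre S v. G v [] [X, X'] =
        (\<Sum>\<alpha>\<in>UNIV. \<Sum>\<beta>\<in>UNIV. gH S G c \<alpha> \<beta> v * dz S c \<alpha> v X * dz S c \<beta> v X') +
        (\<Sum>a\<in>UNIV. \<Sum>b\<in>UNIV. gV S G c a b v * deltay S c a v X * deltay S c b v X')"
    "\<forall>\<alpha> \<beta>. gH S G c \<alpha> \<beta> v = gH S G c \<beta> \<alpha> v" "\<forall>a b. gV S G c a b v = gV S G c b a v"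
    "invertible (\<chi> \<alpha> \<beta>. gH S G c \<alpha> \<beta> v)" "invertible (\<chi> a b. gV S G c a b v)"
    using metric assms unfolding pseudo_metrical_structure_def by blast+
  show "transpose (gHm c v) = gHm c v" "transpose (gVm c v) = gVm c v"
    unfolding gHm_def gVm_def transpose_def vec_eq_iff vec_lambda_beta using m(2,3) by blast+
  show "invertible (gHm c v)" "invertible (gVm c v)" using m(4,5) by (simp_all add: gHm_def gVm_def)
  assume X: "gte_vector v X" "gte_vector v X'"
  have "G v [] [X, X'] = (\<Sum>\<alpha>\<in>UNIV. \<Sum>\<beta>\<in>UNIV. gH S G c \<alpha> \<beta> v * dz S c \<alpha> v X * dz S c \<beta> v X') +
        (\<Sum>a\<in>UNIV. \<Sum>b\<in>UNIV. gV S G c a b v * deltay S c a v X * deltay S c b v X')"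
    using m(1) X gte_fibre_iff by blast
  then show "G v [] [X, X'] = acoord c v X \<bullet> (blockm (gHm c v) (gVm c v) *v acoord c v X')"
    by (simp add: inner_vec_def sum_UNIV_Plus matrix_vector_mult_def gHm_def gVm_def acoord_def coframe_def
        sum_distrib_left mult_ac)
qed

lemma metric_smooth:
  assumes "c \<in> charts" "v \<in> dom_E S c"
  shows gHm_smooth: "smooth v (\<lambda>v. gHm c v $ \<alpha> $ \<beta>)" and gVm_smooth: "smooth v (\<lambda>v. gVm c v $ a $ b)"
  using TF_smooth[OF G_tensor assms, of "[]" "[Inl \<alpha>, Inl \<beta>]"] TF_smooth[OF G_tensor assms, of "[]" "[Inr a, Inr b]"]
  by (simp_all add: gHm_def gVm_def gH_def gV_def frame_def)

lemma metric_change: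
  assumes "c \<in> charts" "v \<in> dom_E S c" "c' \<in> charts" "v \<in> dom_E S c'"
  shows gHm_change: "gHm c v = transpose (trH c c' v) ** gHm c' v ** trH c c' v"
    and gVm_change: "gVm c v = transpose (trV c c' v) ** gVm c' v ** trV c c' v"
proof -
  have "G v [] [frame S c v A, frame S c v B] = (\<Sum>C\<in>UNIV. tr c c' v $ C $ A * (\<Sum>D\<in>UNIV. blockm (gHm c' v) (gVm c' v) $ C $ D * tr c c' v $ D $ B))" for A B
    unfolding G_formula[OF assms(3,4) frame_gte_vector[OF assms(1,2)] frame_gte_vector[OF assms(1,2)]]
    by (simp add: inner_vec_def matrix_vector_mult_def acoord_frame_change[OF assms])
  then have *: "G v [] [frame S c v A, frame S c v B] = (transpose (tr c c' v) ** (blockm (gHm c' v) (gVm c' v) ** tr c c' v)) $ A $ B" for A B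
    by (simp add: matrix_matrix_mult_def transpose_def)
  have "gHm c v $ \<alpha> $ \<beta> = (transpose (trH c c' v) ** gHm c' v ** trH c c' v) $ \<alpha> $ \<beta>" for \<alpha> \<beta>
    using *[of "Inl \<alpha>" "Inl \<beta>"] by (simp add: gHm_def[of c v] gH_def frame_def tr_def blockm_transpose blockm_mult matrix_mul_assoc)
  moreover have "gVm c v $ a $ b = (transpose (trV c c' v) ** gVm c' v ** trV c c' v) $ a $ b" for a b
    using *[of "Inr a" "Inr b"] by (simp add: gVm_def[of c v] gV_def frame_def tr_def blockm_transpose blockm_mult matrix_mul_assoc)
  ultimately show "gHm c v = transpose (trH c c' v) ** gHm c' v ** trH c c' v"
    "gVm c v = transpose (trV c c' v) ** gVm c' v ** trV c c' v" by (simp_all add: vec_eq_iff)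
qed

lemma dmat_metric_symmetric:
  assumes "c \<in> charts" "v \<in> dom_E S c" "gte_vector v X"
  shows "transpose (dmat X (gHm c)) = dmat X (gHm c)" "transpose (dmat X (gVm c)) = dmat X (gVm c)"
  unfolding dmat_transpose[symmetric]
  by (rule dmat_cong[OF assms(3)], use eventually_dom_E[OF assms(1,2)] in eventually_elim, rule gHm_symmetric[OF assms(1)], assumption)
    (rule dmat_cong[OF assms(3)], use eventually_dom_E[OF assms(1,2)] in eventually_elim, rule gVm_symmetric[OF assms(1)], assumption)

lemma dmat_metric_change:
  assumes c: "c \<in> charts" "v \<in> dom_E S c" and c': "c' \<in> charts" "v \<in> dom_E S c'" and X: "gte_vector v X"
  shows "dmat X (gHm c) = transpose (dmat X (trH c c')) ** gHm c' v ** trH c c' v +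
      transpose (trH c c' v) ** dmat X (gHm c') ** trH c c' v + transpose (trH c c' v) ** gHm c' v ** dmat X (trH c c')"
    and "dmat X (gVm c) = transpose (dmat X (trV c c')) ** gVm c' v ** trV c c' v +
      transpose (trV c c' v) ** dmat X (gVm c') ** trV c c' v + transpose (trV c c' v) ** gVm c' v ** dmat X (trV c c')"
proof -
  have "dmat X (gHm c) = dmat X (\<lambda>v. transpose (trH c c' v) ** gHm c' v ** trH c c' v)"
    by (rule dmat_cong[OF X], use eventually_dom_E[OF c] eventually_dom_E[OF c'] in eventually_elim) (rule gHm_change[OF c(1) _ c'(1)])
  moreover have t: "smooth v (\<lambda>v. transpose (trH c c' v) $ i $ j)" for i j
    using trH_smooth[OF c c'] by (simp add: transpose_def)
  ultimately show "dmat X (gHm c) = transpose (dmat X (trH c c')) ** gHm c' v ** trH c c' v +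
      transpose (trH c c' v) ** dmat X (gHm c') ** trH c c' v + transpose (trH c c' v) ** gHm c' v ** dmat X (trH c c')"
    by (simp add: dmat_mult[OF X matrix_mult_smooth[OF t gHm_smooth[OF c']] trH_smooth[OF c c']]
        dmat_mult[OF X t gHm_smooth[OF c']] dmat_transpose linear_add[OF matrix_mult_linear_left])
  have "dmat X (gVm c) = dmat X (\<lambda>v. transpose (trV c c' v) ** gVm c' v ** trV c c' v)"
    by (rule dmat_cong[OF X], use eventually_dom_E[OF c] eventually_dom_E[OF c'] in eventually_elim) (rule gVm_change[OF c(1) _ c'(1)])
  moreover have t: "smooth v (\<lambda>v. transpose (trV c c' v) $ i $ j)" for i j
    using trV_smooth[OF c c'] by (simp add: transpose_def)
  ultimately show "dmat X (gVm c) = transpose (dmat X (trV c c')) ** gVm c' v ** trV c c' v +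
      transpose (trV c c' v) ** dmat X (gVm c') ** trV c c' v + transpose (trV c c' v) ** gVm c' v ** dmat X (trV c c')"
    by (simp add: dmat_mult[OF X matrix_mult_smooth[OF t gVm_smooth[OF c']] trV_smooth[OF c c']]
        dmat_mult[OF X t gVm_smooth[OF c']] dmat_transpose linear_add[OF matrix_mult_linear_left])
qed

text \<open>The connection matrices of the two subbundles along a frame vector. Each is characterized by
  invariant data: the one along its own subbundle is a Levi-Civita connection, the other one is the mean of an
  invariant connection (the vertical derivative, the Berwald connection) and its metric dual.\<close>

definition conH where
  "conH c v A = (case A of
     Inl \<gamma> \<Rightarrow> levi_civita (gHm c v) (\<lambda>\<gamma>. dmat (frame S c v (Inl \<gamma>)) (gHm c)) (\<lambda>\<theta> \<gamma> \<beta>. L_at S c \<theta> \<gamma> \<beta> v) \<gamma>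
   | Inr a \<Rightarrow> metric_mean (gHm c v) 0 (dmat (frame S c v (Inr a)) (gHm c)))"

definition conV where
  "conV c v A = (case A of
     Inl \<gamma> \<Rightarrow> metric_mean (gVm c v) (berwald c v \<gamma>) (dmat (frame S c v (Inl \<gamma>)) (gVm c))
   | Inr a \<Rightarrow> levi_civita (gVm c v) (\<lambda>a. dmat (frame S c v (Inr a)) (gVm c)) (\<lambda>_ _ _. 0) a)"

lemma L_at_antisym:
  "c \<in> charts \<Longrightarrow> v \<in> dom_E S c \<Longrightarrow> L_at S c \<theta> \<alpha> \<beta> v = - L_at S c \<theta> \<beta> \<alpha> v"
  by (rule L_comp_antisym[OF _ dom_E_parts(3)])

lemma con_metric:
  assumes c: "c \<in> charts" "v \<in> dom_E S c"
  shows "transpose (conH c v A) ** gHm c v + gHm c v ** conH c v A = dmat (frame S c v A) (gHm c)"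
    and "transpose (conV c v A) ** gVm c v + gVm c v ** conV c v A = dmat (frame S c v A) (gVm c)"
proof -
  note s = dmat_metric_symmetric[OF c frame_gte_vector[OF c]]
  show "transpose (conH c v A) ** gHm c v + gHm c v ** conH c v A = dmat (frame S c v A) (gHm c)"
  proof (cases A)
    case (Inl \<gamma>)
    show ?thesis unfolding Inl conH_def sum.case
      by (rule levi_civita_metric[OF gHm_invertible[OF c] gHm_symmetric[OF c] s(1) L_at_antisym[OF c]])
  next
    case (Inr a)
    show ?thesis unfolding Inr conH_def sum.case
      by (rule metric_mean_metric[OF gHm_invertible[OF c] gHm_symmetric[OF c] s(1)])
  qed
  show "transpose (conV c v A) ** gVm c v + gVm c v ** conV c v A = dmat (frame S c v A) (gVm c)"
  proof (cases A)
    case (Inl \<gamma>)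
    show ?thesis unfolding Inl conV_def sum.case
      by (rule metric_mean_metric[OF gVm_invertible[OF c] gVm_symmetric[OF c] s(2)])
  next
    case (Inr a)
    show ?thesis unfolding Inr conV_def sum.case
      by (rule levi_civita_metric[OF gVm_invertible[OF c] gVm_symmetric[OF c] s(2)]) simp
  qed
qed

lemma tr_sum:
  fixes f :: "'p + 'r \<Rightarrow> 'z::real_vector"
  shows "(\<Sum>B\<in>UNIV. tr c c' v $ B $ Inl \<gamma> *\<^sub>R f B) = (\<Sum>\<gamma>'\<in>UNIV. trH c c' v $ \<gamma>' $ \<gamma> *\<^sub>R f (Inl \<gamma>'))"
    and "(\<Sum>B\<in>UNIV. tr c c' v $ B $ Inr a *\<^sub>R f B) = (\<Sum>a'\<in>UNIV. trV c c' v $ a' $ a *\<^sub>R f (Inr a'))"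
  by (simp_all add: sum_UNIV_Plus tr_def)

text \<open>In the mixed cases the connections entering \<open>metric_mean\<close> are additive in the direction, so that they can be
  compared along one frame vector of \<open>c\<close>. For the horizontal subbundle the matrix \<open>0\<close> obeys the law of a
  connection along vertical vectors because the transition matrices are constant along the fibres.\<close>

lemma con_change:
  assumes c: "c \<in> charts" "v \<in> dom_E S c" and c': "c' \<in> charts" "v \<in> dom_E S c'"
  shows "trH c c' v ** conH c v A = dmat (frame S c v A) (trH c c') + (\<Sum>B\<in>UNIV. tr c c' v $ B $ A *\<^sub>R conH c' v B) ** trH c c' v"
    and "trV c c' v ** conV c v A = dmat (frame S c v A) (trV c c') + (\<Sum>B\<in>UNIV. tr c c' v $ B $ A *\<^sub>R conV c' v B) ** trV c c' v"
proof -
  note s = dmat_metric_symmetric[OF c frame_gte_vector[OF c]] and s' = dmat_metric_symmetric[OF c' frame_gte_vector[OF c']]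
  note ch = dmat_metric_change[OF c c' frame_gte_vector[OF c]]
  show "trH c c' v ** conH c v A = dmat (frame S c v A) (trH c c') + (\<Sum>B\<in>UNIV. tr c c' v $ B $ A *\<^sub>R conH c' v B) ** trH c c' v"
  proof (cases A)
    case (Inl \<gamma>)
    show ?thesis unfolding Inl tr_sum unfolding conH_def sum.case
    proof (rule levi_civita_change[OF gHm_invertible[OF c] gHm_symmetric[OF c] s(1) L_at_antisym[OF c]
          gHm_invertible[OF c'] gHm_symmetric[OF c'] s'(1) L_at_antisym[OF c'] gHm_change[OF c c'] _ L_at_change[OF c c']
          trH_inverse[OF c' c] trH_inverse[OF c c']])
      fix \<gamma>
      show "dmat (frame S c v (Inl \<gamma>)) (gHm c) = transpose (dmat (frame S c v (Inl \<gamma>)) (trH c c')) ** gHm c' v ** trH c c' v +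
          transpose (trH c c' v) ** (\<Sum>\<gamma>'\<in>UNIV. trH c c' v $ \<gamma>' $ \<gamma> *\<^sub>R dmat (frame S c' v (Inl \<gamma>')) (gHm c')) ** trH c c' v +
          transpose (trH c c' v) ** gHm c' v ** dmat (frame S c v (Inl \<gamma>)) (trH c c')"
        using ch(1)[of "Inl \<gamma>"] unfolding dmat_frame_change[OF c c', of _ "gHm c'"] tr_sum .
    qed
  next
    case (Inr a)
    have "(\<Sum>a'\<in>UNIV. trV c c' v $ a' $ a *\<^sub>R conH c' v (Inr a')) =
        metric_mean (gHm c' v) 0 (dmat (frame S c v (Inr a)) (gHm c'))"
      using metric_mean_sum[of "gHm c' v" "\<lambda>a'. trV c c' v $ a' $ a" "\<lambda>_. 0" UNIV "\<lambda>a'. dmat (frame S c' v (Inr a')) (gHm c')"]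
      unfolding dmat_frame_change[OF c c', of _ "gHm c'"] tr_sum by (simp add: conH_def)
    then show ?thesis unfolding Inr tr_sum
      using metric_mean_change[OF gHm_change[OF c c'] ch(1)[of "Inr a"] _ gHm_invertible[OF c] gHm_invertible[OF c'] trH_inverse[OF c' c], of 0 0]
        dmat_tr_vertical(1)[OF c c', of a] by (simp add: conH_def)
  qed
  show "trV c c' v ** conV c v A = dmat (frame S c v A) (trV c c') + (\<Sum>B\<in>UNIV. tr c c' v $ B $ A *\<^sub>R conV c' v B) ** trV c c' v"
  proof (cases A)
    case (Inl \<gamma>)
    have "(\<Sum>\<gamma>'\<in>UNIV. trH c c' v $ \<gamma>' $ \<gamma> *\<^sub>R conV c' v (Inl \<gamma>')) =
        metric_mean (gVm c' v) (\<Sum>\<gamma>'\<in>UNIV. trH c c' v $ \<gamma>' $ \<gamma> *\<^sub>R berwald c' v \<gamma>') (dmat (frame S c v (Inl \<gamma>)) (gVm c'))"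
      unfolding dmat_frame_change[OF c c', of _ "gVm c'"] tr_sum metric_mean_sum by (simp add: conV_def)
    then show ?thesis unfolding Inl tr_sum
      using metric_mean_change[OF gVm_change[OF c c'] ch(2)[of "Inl \<gamma>"] berwald_change[OF c c', of \<gamma>] gVm_invertible[OF c] gVm_invertible[OF c'] trV_inverse[OF c' c]]
      by (simp add: conV_def)
  next
    case (Inr a)
    show ?thesis unfolding Inr tr_sum unfolding conV_def sum.case
    proof (rule levi_civita_change[OF gVm_invertible[OF c] gVm_symmetric[OF c] s(2) _
          gVm_invertible[OF c'] gVm_symmetric[OF c'] s'(2) _ gVm_change[OF c c'] _ _ trV_inverse[OF c' c] trV_inverse[OF c c']])
      fix a
      show "dmat (frame S c v (Inr a)) (gVm c) = transpose (dmat (frame S c v (Inr a)) (trV c c')) ** gVm c' v ** trV c c' v +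
          transpose (trV c c' v) ** (\<Sum>a'\<in>UNIV. trV c c' v $ a' $ a *\<^sub>R dmat (frame S c' v (Inr a')) (gVm c')) ** trV c c' v +
          transpose (trV c c' v) ** gVm c' v ** dmat (frame S c v (Inr a)) (trV c c')"
        using ch(2)[of "Inr a"] unfolding dmat_frame_change[OF c c', of _ "gVm c'"] tr_sum .
    qed (simp_all add: dmat_tr_vertical(2)[OF c c'] del: dmat_nth)
  qed
qed

lemma con_smooth:
  assumes c: "c \<in> charts" "v \<in> dom_E S c"
  shows "smooth v (\<lambda>v. conH c v A $ \<alpha> $ \<beta>)" and "smooth v (\<lambda>v. conV c v A $ a $ b)"
proof -
  have iH: "smooth v (\<lambda>v. matrix_inv (gHm c v) $ \<alpha> $ \<beta>)" for \<alpha> \<beta>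
    by (rule E.smooth_near_matrix_inv[OF gHm_smooth[OF c]], use eventually_dom_E[OF c] in eventually_elim) (rule gHm_invertible[OF c(1)])
  have iV: "smooth v (\<lambda>v. matrix_inv (gVm c v) $ a $ b)" for a b
    by (rule E.smooth_near_matrix_inv[OF gVm_smooth[OF c]], use eventually_dom_E[OF c] in eventually_elim) (rule gVm_invertible[OF c(1)])
  have L: "smooth v (\<lambda>v. L_at S c \<theta> \<alpha> \<beta> v)" for \<theta> \<alpha> \<beta>
    by (rule smooth_h\<pi>[where f = "\<lambda>y. L_comp S c y \<theta> \<alpha> \<beta>"]) (rule L_comp_smooth[OF c(1) dom_E_parts(3)[OF c(2)]])
  have B: "smooth v (\<lambda>v. dy S c b (Gam S c a \<gamma>) v)" for a b \<gamma> by (rule dy_smooth[OF c Gam_smooth[OF c]])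
  note sm = E.smooth_near_add E.smooth_near_diff E.smooth_near_mult E.smooth_near_sum smooth_near_const
    frame_deriv_smooth[OF c] gHm_smooth[OF c] gVm_smooth[OF c] iH iV L B
  show "smooth v (\<lambda>v. conH c v A $ \<alpha> $ \<beta>)"
  proof (cases A)
    case (Inl \<gamma>)
    show ?thesis unfolding Inl conH_def sum.case levi_civita_def vec_lambda_beta dmat_nth by (intro sm)
  next
    case (Inr d)
    have "smooth v (\<lambda>v. 1/2 * (\<Sum>k\<in>UNIV. matrix_inv (gHm c v) $ \<alpha> $ k * snd (frame S c v (Inr d)) (\<lambda>v. gHm c v $ k $ \<beta>)))"
      by (intro sm)
    then show ?thesis by (simp add: Inr conH_def metric_mean_def matrix_matrix_mult_def transpose_def)
  qed
  show "smooth v (\<lambda>v. conV c v A $ a $ b)"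
  proof (cases A)
    case (Inl \<gamma>)
    have "smooth v (\<lambda>v. dy S c b (Gam S c a \<gamma>) v + 1/2 * (\<Sum>k\<in>UNIV. matrix_inv (gVm c v) $ a $ k *
        (snd (frame S c v (Inl \<gamma>)) (\<lambda>v. gVm c v $ k $ b) - (\<Sum>e\<in>UNIV. dy S c k (Gam S c e \<gamma>) v * gVm c v $ e $ b)
         - (\<Sum>e\<in>UNIV. gVm c v $ k $ e * dy S c b (Gam S c e \<gamma>) v))))"
      by (intro sm)
    then show ?thesis by (simp add: Inl conV_def metric_mean_def berwald_def matrix_matrix_mult_def transpose_def)
  next
    case (Inr d)
    show ?thesis unfolding Inr conV_def sum.case levi_civita_def vec_lambda_beta dmat_nth by (intro sm)
  qed
qed

definition OmH where "OmH c v X = (\<Sum>A\<in>UNIV. acoord c v X $ A *\<^sub>R conH c v A)"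
definition OmV where "OmV c v X = (\<Sum>A\<in>UNIV. acoord c v X $ A *\<^sub>R conV c v A)"
definition Om where "Om c v X = blockm (OmH c v X) (OmV c v X)"

lemma Om_parts_change:
  assumes c: "c \<in> charts" "v \<in> dom_E S c" and c': "c' \<in> charts" "v \<in> dom_E S c'" and X: "gte_vector v X"
  shows "trH c c' v ** OmH c v X = dmat X (trH c c') + OmH c' v X ** trH c c' v"
    and "trV c c' v ** OmV c v X = dmat X (trV c c') + OmV c' v X ** trV c c' v"
proof -
  have e: "(\<Sum>B\<in>UNIV. acoord c' v X $ B *\<^sub>R f B) = (\<Sum>A\<in>UNIV. acoord c v X $ A *\<^sub>R (\<Sum>B\<in>UNIV. tr c c' v $ B $ A *\<^sub>R f B))"
    for f :: "'p + 'r \<Rightarrow> 'z::real_vector"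
    unfolding acoord_change[OF c c' X] matrix_vector_mult_def
    by (simp add: scaleR_sum_left scaleR_sum_right mult.commute, rule sum.swap)
  show "trH c c' v ** OmH c v X = dmat X (trH c c') + OmH c' v X ** trH c c' v"
    unfolding OmH_def e dmat_expand[OF c X]
    by (simp only: matrix_mult_simps(6,8) con_change(1)[OF c c'] scaleR_add_right sum.distrib)
      (simp only: matrix_mult_simps(5,7))
  show "trV c c' v ** OmV c v X = dmat X (trV c c') + OmV c' v X ** trV c c' v"
    unfolding OmV_def e dmat_expand[OF c X]
    by (simp only: matrix_mult_simps(6,8) con_change(2)[OF c c'] scaleR_add_right sum.distrib)
      (simp only: matrix_mult_simps(5,7))
qed

sublocale gte_connection S Om
proof
  show "Om c v (gte_add S X X') = Om c v X + Om c v X'"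
    if "c \<in> charts" "v \<in> dom_E S c" "gte_vector v X" "gte_vector v X'" for c v X X'
  proof -
    have "Om c v (gte_add S X X') $ A $ B = (Om c v X + Om c v X') $ A $ B" for A B
      by (cases A; cases B) (simp_all add: Om_def OmH_def OmV_def acoord_add[OF that] sum_component distrib_right sum.distrib)
    then show ?thesis by (simp add: vec_eq_iff)
  qed
  show "Om c v (gte_scale S k X) = k *\<^sub>R Om c v X"
    if "c \<in> charts" "v \<in> dom_E S c" "gte_vector v X" for c v X k
  proof -
    have "Om c v (gte_scale S k X) $ A $ B = (k *\<^sub>R Om c v X) $ A $ B" for A B
      by (cases A; cases B) (simp_all add: Om_def OmH_def OmV_def acoord_scale[OF that] sum_component sum_distrib_left mult.assoc)
    then show ?thesis by (simp add: vec_eq_iff)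
  qed
  show "smooth v (\<lambda>v. Om c v (W v) $ A $ B)"
    if c: "c \<in> charts" "v \<in> dom_E S c" and W: "W \<in> gte_sections S" for c v W A B
    by (cases A; cases B)
      (simp_all add: Om_def OmH_def OmV_def sum_component smooth_near_const E.smooth_near_sum E.smooth_near_mult
        gte_sections_smooth[OF W c] con_smooth[OF c])
  show "tr c c' v ** Om c v X = (\<chi> A B. snd X (\<lambda>v. tr c c' v $ A $ B)) + Om c' v X ** tr c c' v"
    if c: "c \<in> charts" "v \<in> dom_E S c" and c': "c' \<in> charts" "v \<in> dom_E S c'" and X: "gte_vector v X" for c v c' X
  proof -
    have "(tr c c' v ** Om c v X) $ A $ B = ((\<chi> A B. snd X (\<lambda>v. tr c c' v $ A $ B)) + Om c' v X ** tr c c' v) $ A $ B" for A B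
      unfolding Om_def tr_def blockm_mult Om_parts_change[OF c c' X]
      using E.tangent_const[OF gte_vector_tangent[OF X], of 0] by (cases A; cases B) simp_all
    then show ?thesis by (simp add: vec_eq_iff)
  qed
qed (simp_all add: Om_def)

lemma Om_frame:
  assumes "c \<in> charts" "v \<in> dom_E S c"
  shows "Om c v (frame S c v C) $ Inl \<alpha> $ Inl \<beta> = conH c v C $ \<alpha> $ \<beta>"
    "Om c v (frame S c v C) $ Inr a $ Inr b = conV c v C $ a $ b"
  by (simp_all only: Om_def OmH_def OmV_def acoord_frame[OF assms] blockm_nth sum_axis_scaleR)

text \<open>Both sides of \<open>con_metric\<close> are linear in the direction. Extended to arbitrary \<open>X\<close>, it says that the derivative
  of the components of \<open>G\<close> equals the two corrections.\<close>

lemma D_metric: "metrizes S D G"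
  unfolding metrizes_def
proof
  fix X assume X: "X \<in> gte_sections S"
  have tz: "tens_zero \<in> TF 0 2" by (rule TFI) (simp_all add: tens_zero_def smooth_near_const)
  show "D X G = tens_zero"
  proof (rule D_valid_eqI[OF D_tensor[OF G_tensor X] tz])
    fix v c \<omega>s Xs
    assume len: "length \<omega>s = 0" "length Xs = 2" and val: "valid_args v \<omega>s Xs" and c: "c \<in> charts" "v \<in> dom_E S c"
    note Xv = gte_sections_vector[OF X, of v]
    note w = gte_vector_tangent[OF Xv]
    obtain Y Y' where Xs: "Xs = [Y, Y']" using len(2) by (auto simp: length_Suc_conv numeral_2_eq_2)
    let ?a = "acoord c v Y" and ?b = "acoord c v Y'" and ?\<Omega> = "Om c v (X v)"
    define M where "M u = blockm (gHm c u) (gVm c u)" for u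
    have T: "Tc c G 0 u [a, b] = a \<bullet> (M u *v b)" if "u \<in> dom_E S c" for u a b
      using G_formula[OF c(1) that avec_gte_vector[OF c(1) that] avec_gte_vector[OF c(1) that]]
      by (simp add: Tc_def acoord_avec[OF c(1) that] M_def)
    have Msm: "smooth v (\<lambda>u. M u $ A $ B)" for A B
      by (cases A; cases B) (simp_all add: M_def metric_smooth[OF c] smooth_near_const)
    have dM: "dmat (X v) M = transpose ?\<Omega> ** M v + M v ** ?\<Omega>"
    proof -
      have H: "dmat (X v) (gHm c) = transpose (OmH c v (X v)) ** gHm c v + gHm c v ** OmH c v (X v)"
        unfolding dmat_expand[OF c Xv] OmH_def
        by (simp only: con_metric(1)[OF c, symmetric] matrix_mult_simps scaleR_add_right sum.distrib)
      have V: "dmat (X v) (gVm c) = transpose (OmV c v (X v)) ** gVm c v + gVm c v ** OmV c v (X v)"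
        unfolding dmat_expand[OF c Xv] OmV_def
        by (simp only: con_metric(2)[OF c, symmetric] matrix_mult_simps scaleR_add_right sum.distrib)
      have Hn: "snd (X v) (\<lambda>v. gHm c v $ \<alpha> $ \<beta>) = (transpose (OmH c v (X v)) ** gHm c v + gHm c v ** OmH c v (X v)) $ \<alpha> $ \<beta>" for \<alpha> \<beta>
        unfolding H[symmetric] by simp
      have Vn: "snd (X v) (\<lambda>v. gVm c v $ a $ b) = (transpose (OmV c v (X v)) ** gVm c v + gVm c v ** OmV c v (X v)) $ a $ b" for a b
        unfolding V[symmetric] by simp
      have "dmat (X v) M $ A $ B = (transpose ?\<Omega> ** M v + M v ** ?\<Omega>) $ A $ B" for A B
      proof -
        show ?thesis
          unfolding Om_def M_def blockm_transpose blockm_mult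
          by (cases A; cases B) (simp_all add: Hn Vn E.tangent_const[OF w])
      qed
      then show ?thesis by (simp add: vec_eq_iff)
    qed
    have "near v (\<lambda>u. Tc c G 0 u [?a, ?b]) (\<lambda>u. \<Sum>A\<in>UNIV. ?a $ A * (M u *v ?b) $ A)"
      unfolding near_def using eventually_dom_E[OF c] by eventually_elim (simp add: T inner_vec_def)
    then have "snd (X v) (\<lambda>u. Tc c G 0 u [?a, ?b]) = snd (X v) (\<lambda>u. \<Sum>A\<in>UNIV. ?a $ A * (M u *v ?b) $ A)"
      by (rule E.tangent_cong[OF w])
    also have "\<dots> = (\<Sum>A\<in>UNIV. ?a $ A * snd (X v) (\<lambda>u. (M u *v ?b) $ A))"
    proof -
      have s: "smooth v (\<lambda>u. (M u *v ?b) $ A)" for A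
        unfolding matrix_vector_mult_def by (simp add: E.smooth_near_sum E.smooth_near_mult Msm smooth_near_const)
      show ?thesis
        by (simp add: E.tangent_sum[OF w E.smooth_near_mult[OF smooth_near_const s]] E.tangent_cmult[OF w s])
    qed
    also have "\<dots> = ?a \<bullet> (dmat (X v) M *v ?b)"
      using deriv_matrix_vector[OF w Msm, of ?b] by (simp add: inner_vec_def vec_eq_iff dmat_def)
    also have "\<dots> = ?a \<bullet> (transpose ?\<Omega> *v (M v *v ?b)) + ?a \<bullet> (M v *v (?\<Omega> *v ?b))"
      unfolding dM matrix_vector_mult_add_rdistrib matrix_vector_mul_assoc[symmetric] inner_add_right ..
    also have "?a \<bullet> (transpose ?\<Omega> *v (M v *v ?b)) = (?\<Omega> *v ?a) \<bullet> (M v *v ?b)"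
      by (simp only: dot_lmul_matrix[symmetric] vector_transpose_matrix)
    finally have "Dat c v (X v) G [] [Y, Y'] = 0"
      by (simp add: Dat_unfold cov_pairs_def vec_pairs_def T[OF c(2)])
    then show "D X G v \<omega>s Xs = tens_zero v \<omega>s Xs"
      using D_eq[where X = X, OF G_tensor c Xv val] len by (simp add: Xs tens_zero_def)
  qed
qed

subsection \<open>Components\<close>

lemma D_components:
  assumes c: "c \<in> charts"
    and "\<And>v \<alpha> \<beta> \<gamma>. v \<in> dom_E S c \<Longrightarrow> HH \<alpha> \<beta> \<gamma> v = conH c v (Inl \<gamma>) $ \<alpha> $ \<beta>"
    and "\<And>v a b \<gamma>. v \<in> dom_E S c \<Longrightarrow> HV a b \<gamma> v = conV c v (Inl \<gamma>) $ a $ b"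
    and "\<And>v \<alpha> \<beta> d. v \<in> dom_E S c \<Longrightarrow> VH \<alpha> \<beta> d v = conH c v (Inr d) $ \<alpha> $ \<beta>"
    and "\<And>v a b d. v \<in> dom_E S c \<Longrightarrow> VV a b d v = conV c v (Inr d) $ a $ b"
  shows "has_components S D c HH HV VH VV"
proof -
  have main: "D X (vec_tensor S Y) v = vec_tensor_at S v (adapted_vec S c v
      (\<chi> \<alpha>. Om c v (frame S c v C) $ Inl \<alpha> $ B) (\<chi> a. Om c v (frame S c v C) $ Inr a $ B))"
    if "v \<in> dom_E S c" "X \<in> gte_sections S" "Y \<in> gte_sections S"
      "near v X (\<lambda>v. frame S c v C)" "near v Y (\<lambda>v. frame S c v B)" for v X Y B C
    using D_frame[OF that(2,3) c that(1,4,5)] by (simp add: avec_def)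
  have z: "Om c v X $ Inl \<alpha> $ Inr b = 0" "Om c v X $ Inr a $ Inl \<beta> = 0" for v X \<alpha> \<beta> a b
    by (simp_all add: Om_def)
  have z0: "(\<chi> i. 0) = (0 :: real ^ 'k)" by (simp add: vec_eq_iff)
  show ?thesis
    unfolding has_components_def
  proof (intro ballI conjI allI impI; elim conjE)
    fix v X Y assume v: "v \<in> dom_E S c" and XY: "X \<in> gte_sections S" "Y \<in> gte_sections S"
    note m = main[OF v XY] and o = Om_frame[OF c v]
    show "D X (vec_tensor S Y) v = vec_tensor_at S v (adapted_vec S c v (\<chi> \<alpha>. HH \<alpha> \<beta> \<gamma> v) 0)"
      if "near v X (delta S c \<gamma>)" "near v Y (delta S c \<beta>)" for \<beta> \<gamma>
      using m[of "Inl \<gamma>" "Inl \<beta>"] that by (simp add: o z z0 assms(2)[OF v]) (simp add: frame_def o z z0)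
    show "D X (vec_tensor S Y) v = vec_tensor_at S v (adapted_vec S c v 0 (\<chi> a. HV a b \<gamma> v))"
      if "near v X (delta S c \<gamma>)" "near v Y (vdot S c b)" for b \<gamma>
      using m[of "Inl \<gamma>" "Inr b"] that by (simp add: o z z0 assms(3)[OF v]) (simp add: frame_def o z z0)
    show "D X (vec_tensor S Y) v = vec_tensor_at S v (adapted_vec S c v (\<chi> \<alpha>. VH \<alpha> \<beta> d v) 0)"
      if "near v X (vdot S c d)" "near v Y (delta S c \<beta>)" for \<beta> d
      using m[of "Inr d" "Inl \<beta>"] that by (simp add: o z z0 assms(4)[OF v]) (simp add: frame_def o z z0)
    show "D X (vec_tensor S Y) v = vec_tensor_at S v (adapted_vec S c v 0 (\<chi> a. VV a b d v))"
      if "near v X (vdot S c d)" "near v Y (vdot S c b)" for b d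
      using m[of "Inr d" "Inr b"] that by (simp add: o z z0 assms(5)[OF v]) (simp add: frame_def o z z0)
  qed
qed

lemma metric_symmetric_nth:
  assumes "c \<in> charts" "v \<in> dom_E S c"
  shows "gH S G c \<alpha> \<beta> v = gH S G c \<beta> \<alpha> v" "gV S G c a b v = gV S G c b a v"
    and "gte_vector v X \<Longrightarrow> snd X (gH S G c \<alpha> \<beta>) = snd X (gH S G c \<beta> \<alpha>)"
    and "gte_vector v X \<Longrightarrow> snd X (gV S G c a b) = snd X (gV S G c b a)"
  using symmetric_matrix_nth[OF gHm_symmetric[OF assms], of \<alpha> \<beta>] symmetric_matrix_nth[OF gVm_symmetric[OF assms], of a b]
    symmetric_matrix_nth[OF dmat_metric_symmetric(1)[OF assms], of X \<alpha> \<beta>] symmetric_matrix_nth[OF dmat_metric_symmetric(2)[OF assms], of X a b]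
  by (simp_all add: gHm_def gVm_def)

lemma frame_deriv_eq:
  "snd (frame S c v (Inl \<gamma>)) f = gte_deriv (delta S c \<gamma>) f v"
  by (simp add: frame_def gte_deriv_def)

lemma conH_horizontal:
  "conH c v (Inl \<gamma>) $ \<alpha> $ \<beta> = 1/2 * (\<Sum>\<epsilon>\<in>UNIV. gH_inv S G c \<alpha> \<epsilon> v *
     (gte_deriv (delta S c \<gamma>) (gH S G c \<epsilon> \<beta>) v + gte_deriv (delta S c \<beta>) (gH S G c \<epsilon> \<gamma>) v
      - gte_deriv (delta S c \<epsilon>) (gH S G c \<beta> \<gamma>) v
      + (\<Sum>\<theta>\<in>UNIV. gH S G c \<theta> \<epsilon> v * L_at S c \<theta> \<gamma> \<beta> v)
      - (\<Sum>\<theta>\<in>UNIV. gH S G c \<beta> \<theta> v * L_at S c \<theta> \<gamma> \<epsilon> v)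
      - (\<Sum>\<theta>\<in>UNIV. gH S G c \<theta> \<gamma> v * L_at S c \<theta> \<beta> \<epsilon> v)))"
  by (simp add: conH_def levi_civita_def gH_inv_def gHm_def frame_deriv_eq)

lemma conV_horizontal:
  assumes "c \<in> charts" "v \<in> dom_E S c"
  shows "conV c v (Inl \<gamma>) $ a $ b = dy S c b (Gam S c a \<gamma>) v
    + 1/2 * (\<Sum>k\<in>UNIV. gV_inv S G c a k v * h_cov_gV S G c (berwald_HV S c) b k \<gamma> v)"
proof -
  note fv = frame_gte_vector[OF assms, of "Inl \<gamma>"]
  have "h_cov_gV S G c (berwald_HV S c) b k \<gamma> v =
    (dmat (frame S c v (Inl \<gamma>)) (gVm c) - transpose (berwald c v \<gamma>) ** gVm c v - gVm c v ** berwald c v \<gamma>) $ k $ b" for k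
    unfolding h_cov_gV_def berwald_HV_def
    by (simp add: matrix_matrix_mult_def transpose_def berwald_def gVm_def frame_deriv_eq[symmetric]
        metric_symmetric_nth(2)[OF assms, of b] metric_symmetric_nth(2)[OF assms, of k] metric_symmetric_nth(4)[OF assms fv, of b] mult.commute)
  then show ?thesis
    by (simp add: conV_def metric_mean_def berwald_def gV_inv_def matrix_matrix_mult_def flip: gVm_def)
qed

lemma conH_vertical:
  assumes "c \<in> charts" "v \<in> dom_E S c"
  shows "conH c v (Inr d) $ \<alpha> $ \<beta> = 1/2 * (\<Sum>\<epsilon>\<in>UNIV. gH_inv S G c \<alpha> \<epsilon> v * dy S c d (gH S G c \<beta> \<epsilon>) v)"
proof -
  have "dmat (frame S c v (Inr d)) (gHm c) $ \<epsilon> $ \<beta> = dy S c d (gH S G c \<beta> \<epsilon>) v" for \<epsilon>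
    using metric_symmetric_nth(3)[OF assms frame_gte_vector[OF assms, of "Inr d"], of \<epsilon> \<beta>]
    by (simp add: gHm_def frame_Inr_deriv[OF assms])
  then show ?thesis
    by (simp add: conH_def metric_mean_def gH_inv_def matrix_matrix_mult_def transpose_def flip: gHm_def del: dmat_nth)
qed

lemma conV_vertical:
  assumes "c \<in> charts" "v \<in> dom_E S c"
  shows "conV c v (Inr d) $ a $ b = 1/2 * (\<Sum>e\<in>UNIV. gV_inv S G c a e v *
    (dy S c d (gV S G c e b) v + dy S c b (gV S G c e d) v - dy S c e (gV S G c b d) v))"
  by (simp add: conV_def levi_civita_def gV_inv_def gVm_def frame_Inr_deriv[OF assms])

end

text \<open>In the second part the connection is the same: in charts in which the metric does not depend on the
  fibre coordinates, its vertical derivatives drop out.\<close>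

lemma (in gte) dy_zero:
  assumes c: "c \<in> charts" "v \<in> dom_E S c" and f: "depends_on_x S c f" "smooth v f"
  shows "dy S c b f v = 0"
proof -
  let ?d = "chartE S c"
  note d = local_chart_parts(4)[OF c(1)] dom_E_parts(4)[OF c(2)]
  let ?F = "\<lambda>\<xi>. coord_vec (atlasE S) ?d v \<xi> f" and ?e = "(0, axis b 1) :: (real ^ 'm) \<times> (real ^ 'r)"
  have "((f \<circ> chart_inv ?d) has_derivative ?F) (at (snd ?d v + 0 *\<^sub>R ?e))"
    using E.coord_vec_has_derivative[OF d f(2)] by (simp only: scaleR_zero_left add_0_right)
  moreover have "((\<lambda>t::real. snd ?d v + t *\<^sub>R ?e) has_derivative (\<lambda>t. t *\<^sub>R ?e)) (at 0)"
    by (auto intro!: derivative_eq_intros)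
  ultimately have D: "((\<lambda>t. (f \<circ> chart_inv ?d) (snd ?d v + t *\<^sub>R ?e)) has_derivative (\<lambda>t. ?F (t *\<^sub>R ?e))) (at 0)"
    using has_derivative_compose[of "\<lambda>t::real. snd ?d v + t *\<^sub>R ?e" "\<lambda>t. t *\<^sub>R ?e" 0 UNIV "f \<circ> chart_inv ?d" ?F] by simp
  define U where "U = {t::real. snd ?d v + t *\<^sub>R ?e \<in> snd ?d ` (fst ?d \<inter> dom_E S c)}"
  have "open (snd ?d ` (fst ?d \<inter> dom_E S c))" by (rule E.open_chart_image_Int[OF d(1) open_dom_E[OF c(1)]])
  then have "open ((\<lambda>t::real. snd ?d v + t *\<^sub>R ?e) -` (snd ?d ` (fst ?d \<inter> dom_E S c)))"
    by (rule open_vimage) (intro continuous_intros)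
  moreover have "snd ?d v + 0 *\<^sub>R ?e \<in> snd ?d ` (fst ?d \<inter> dom_E S c)"
    unfolding scaleR_zero_left add_0_right using d(2) c(2) by blast
  ultimately have U: "open U" "0 \<in> U" unfolding U_def vimage_def by blast+
  \<comment> \<open>the coordinate line in the direction of \<open>y\<^sup>b\<close> stays in the fibre over \<open>\<pi> v\<close>\<close>
  have const: "(f \<circ> chart_inv ?d) (snd ?d v + t *\<^sub>R ?e) = f v" if t: "t \<in> U" for t
  proof -
    obtain u where u: "u \<in> fst ?d" "u \<in> dom_E S c" "snd ?d v + t *\<^sub>R ?e = snd ?d u" using t by (auto simp: U_def)
    then have "snd (xpart c) (\<pi> u) = snd (xpart c) (\<pi> v)" by (simp add: total_chart_simps prod_eq_iff)
    then have "\<pi> u = \<pi> v"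
      using M.chart_inv_left[OF local_chart_parts(1)[OF c(1)]] dom_E_parts(1)[OF u(2)] dom_E_parts(1)[OF c(2)] by metis
    then have "f u = f v" using f(1) u(2) c(2) unfolding depends_on_x_def by blast
    then show ?thesis using E.chart_inv_left[OF d(1) u(1)] u(3) by simp
  qed
  have "((\<lambda>t. f v) has_derivative (\<lambda>t. ?F (t *\<^sub>R ?e))) (at 0)"
    by (rule has_derivative_transform_within_open[OF D U]) (use const in simp)
  then have "(\<lambda>t. ?F (t *\<^sub>R ?e)) = (\<lambda>t::real. 0)" by (rule has_derivative_unique) simp
  from fun_cong[OF this, of 1] show ?thesis by (simp add: dy_def)
qed

context gte_metric
begin

lemma adapted_dy:
  assumes "c \<in> charts" "v \<in> dom_E S c"
  shows "H_adapted_chart S G c \<Longrightarrow> dy S c b (gH S G c \<alpha> \<beta>) v = 0" and "V_adapted_chart S G c \<Longrightarrow> dy S c b (gV S G c a d) v = 0"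
  using dy_zero[OF assms, of "gH S G c \<alpha> \<beta>"] dy_zero[OF assms, of "gV S G c a d"] gHm_smooth[OF assms, of \<alpha> \<beta>] gVm_smooth[OF assms, of a d]
  by (simp_all add: H_adapted_chart_def V_adapted_chart_def gHm_def gVm_def)

lemma adapted_delta:
  assumes "c \<in> charts" "v \<in> dom_E S c"
  shows "H_adapted_chart S G c \<Longrightarrow> gte_deriv (delta S c \<gamma>) (gH S G c \<alpha> \<beta>) v = (\<Sum>i\<in>UNIV. rho_at S c i \<gamma> v * dx S c i (gH S G c \<alpha> \<beta>) v)"
    and "V_adapted_chart S G c \<Longrightarrow> gte_deriv (delta S c \<gamma>) (gV S G c a b) v = (\<Sum>i\<in>UNIV. rho_at S c i \<gamma> v * dx S c i (gV S G c a b) v)"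
  by (simp_all add: frame_deriv_eq[symmetric] frame_Inl_deriv[OF assms] adapted_dy[OF assms])

end

theorem theorem5p2:
  fixes S :: "('a::{t2_space, second_countable_topology}, 'b::{t2_space, second_countable_topology},
    'm::finite, 'f::topological_space, 'p::finite, 'e::topological_space, 'r::finite) gte_data"
    and G :: "('f, 'e) tensor_field"
  assumes "gte_setting S"
    and "pseudo_metrical_structure S G"
  shows "(\<exists>D. distinguished_linear_connection S D \<and>
      (\<forall>ch\<in>local_charts S. has_components S D ch
        (\<lambda>\<alpha> \<beta> \<gamma> v. 1/2 * (\<Sum>\<epsilon>\<in>UNIV. gH_inv S G ch \<alpha> \<epsilon> v *
           (gte_deriv (delta S ch \<gamma>) (gH S G ch \<epsilon> \<beta>) v
            + gte_deriv (delta S ch \<beta>) (gH S G ch \<epsilon> \<gamma>) v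
            - gte_deriv (delta S ch \<epsilon>) (gH S G ch \<beta> \<gamma>) v
            + (\<Sum>\<theta>\<in>UNIV. gH S G ch \<theta> \<epsilon> v * L_at S ch \<theta> \<gamma> \<beta> v)
            - (\<Sum>\<theta>\<in>UNIV. gH S G ch \<beta> \<theta> v * L_at S ch \<theta> \<gamma> \<epsilon> v)
            - (\<Sum>\<theta>\<in>UNIV. gH S G ch \<theta> \<gamma> v * L_at S ch \<theta> \<beta> \<epsilon> v))))
        (\<lambda>a b \<gamma> v. dy S ch b (Gam S ch a \<gamma>) v
           + 1/2 * (\<Sum>c\<in>UNIV. gV_inv S G ch a c v * h_cov_gV S G ch (berwald_HV S ch) b c \<gamma> v))
        (\<lambda>\<alpha> \<beta> c v. 1/2 * (\<Sum>\<epsilon>\<in>UNIV. gH_inv S G ch \<alpha> \<epsilon> v * dy S ch c (gH S G ch \<beta> \<epsilon>) v))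
        (\<lambda>a b c v. 1/2 * (\<Sum>e\<in>UNIV. gV_inv S G ch a e v *
           (dy S ch c (gV S G ch e b) v + dy S ch b (gV S G ch e c) v - dy S ch e (gV S G ch b c) v)))) \<and>
      metrizes S D G) \<and>
    (H_Riemannian S G \<and> V_Riemannian S G \<longrightarrow>
     (\<exists>D. distinguished_linear_connection S D \<and>
      (\<forall>ch\<in>local_charts S. H_adapted_chart S G ch \<and> V_adapted_chart S G ch \<longrightarrow> has_components S D ch
        (\<lambda>\<alpha> \<beta> \<gamma> v. 1/2 * (\<Sum>\<epsilon>\<in>UNIV. gH_inv S G ch \<alpha> \<epsilon> v *
           ((\<Sum>k\<in>UNIV. rho_at S ch k \<gamma> v * dx S ch k (gH S G ch \<epsilon> \<beta>) v)
            + (\<Sum>j\<in>UNIV. rho_at S ch j \<beta> v * dx S ch j (gH S G ch \<epsilon> \<gamma>) v)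
            - (\<Sum>k\<in>UNIV. rho_at S ch k \<epsilon> v * dx S ch k (gH S G ch \<beta> \<gamma>) v)
            + (\<Sum>\<theta>\<in>UNIV. gH S G ch \<theta> \<epsilon> v * L_at S ch \<theta> \<gamma> \<beta> v)
            - (\<Sum>\<theta>\<in>UNIV. gH S G ch \<beta> \<theta> v * L_at S ch \<theta> \<gamma> \<epsilon> v)
            - (\<Sum>\<theta>\<in>UNIV. gH S G ch \<theta> \<gamma> v * L_at S ch \<theta> \<beta> \<epsilon> v))))
        (\<lambda>a b \<gamma> v. dy S ch b (Gam S ch a \<gamma>) v
           + 1/2 * (\<Sum>c\<in>UNIV. gV_inv S G ch a c v *
              ((\<Sum>i\<in>UNIV. rho_at S ch i \<gamma> v * dx S ch i (gV S G ch b c) v)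
               - (\<Sum>e\<in>UNIV. dy S ch b (Gam S ch e \<gamma>) v * gV S G ch e c v)
               - (\<Sum>e\<in>UNIV. dy S ch c (Gam S ch e \<gamma>) v * gV S G ch e b v))))
        (\<lambda>\<alpha> \<beta> c v. 0)
        (\<lambda>a b c v. 0)) \<and>
      metrizes S D G))"
proof -
  interpret gte_metric S G
    using assms by (simp add: gte_metric_def gte_def gte_metric_axioms_def)
  show ?thesis
  proof (intro conjI impI exI[of _ D] ballI D_distinguished D_metric; (elim conjE)?)
    fix ch assume ch: "ch \<in> local_charts S"
    show "has_components S D ch
        (\<lambda>\<alpha> \<beta> \<gamma> v. 1/2 * (\<Sum>\<epsilon>\<in>UNIV. gH_inv S G ch \<alpha> \<epsilon> v *
           (gte_deriv (delta S ch \<gamma>) (gH S G ch \<epsilon> \<beta>) v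
            + gte_deriv (delta S ch \<beta>) (gH S G ch \<epsilon> \<gamma>) v
            - gte_deriv (delta S ch \<epsilon>) (gH S G ch \<beta> \<gamma>) v
            + (\<Sum>\<theta>\<in>UNIV. gH S G ch \<theta> \<epsilon> v * L_at S ch \<theta> \<gamma> \<beta> v)
            - (\<Sum>\<theta>\<in>UNIV. gH S G ch \<beta> \<theta> v * L_at S ch \<theta> \<gamma> \<epsilon> v)
            - (\<Sum>\<theta>\<in>UNIV. gH S G ch \<theta> \<gamma> v * L_at S ch \<theta> \<beta> \<epsilon> v))))
        (\<lambda>a b \<gamma> v. dy S ch b (Gam S ch a \<gamma>) v
           + 1/2 * (\<Sum>c\<in>UNIV. gV_inv S G ch a c v * h_cov_gV S G ch (berwald_HV S ch) b c \<gamma> v))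
        (\<lambda>\<alpha> \<beta> c v. 1/2 * (\<Sum>\<epsilon>\<in>UNIV. gH_inv S G ch \<alpha> \<epsilon> v * dy S ch c (gH S G ch \<beta> \<epsilon>) v))
        (\<lambda>a b c v. 1/2 * (\<Sum>e\<in>UNIV. gV_inv S G ch a e v *
           (dy S ch c (gV S G ch e b) v + dy S ch b (gV S G ch e c) v - dy S ch e (gV S G ch b c) v)))"
      by (rule D_components[OF ch])
        (simp_all only: conH_horizontal conV_horizontal[OF ch] conH_vertical[OF ch] conV_vertical[OF ch])
  next
    fix ch assume ch: "ch \<in> local_charts S" and H: "H_adapted_chart S G ch" and V: "V_adapted_chart S G ch"
    note ad = adapted_delta(1)[OF ch _ H] adapted_delta(2)[OF ch _ V] adapted_dy(1)[OF ch _ H] adapted_dy(2)[OF ch _ V]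
    have HV: "conV ch v (Inl \<gamma>) $ a $ b = dy S ch b (Gam S ch a \<gamma>) v
           + 1/2 * (\<Sum>c\<in>UNIV. gV_inv S G ch a c v *
              ((\<Sum>i\<in>UNIV. rho_at S ch i \<gamma> v * dx S ch i (gV S G ch b c) v)
               - (\<Sum>e\<in>UNIV. dy S ch b (Gam S ch e \<gamma>) v * gV S G ch e c v)
               - (\<Sum>e\<in>UNIV. dy S ch c (Gam S ch e \<gamma>) v * gV S G ch e b v)))"
      if v: "v \<in> dom_E S ch" for v a b \<gamma>
      unfolding conV_horizontal[OF ch v] h_cov_gV_def berwald_HV_def ad(2)[OF v] metric_symmetric_nth(2)[OF ch v, of b] ..
    show "has_components S D ch
        (\<lambda>\<alpha> \<beta> \<gamma> v. 1/2 * (\<Sum>\<epsilon>\<in>UNIV. gH_inv S G ch \<alpha> \<epsilon> v *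
           ((\<Sum>k\<in>UNIV. rho_at S ch k \<gamma> v * dx S ch k (gH S G ch \<epsilon> \<beta>) v)
            + (\<Sum>j\<in>UNIV. rho_at S ch j \<beta> v * dx S ch j (gH S G ch \<epsilon> \<gamma>) v)
            - (\<Sum>k\<in>UNIV. rho_at S ch k \<epsilon> v * dx S ch k (gH S G ch \<beta> \<gamma>) v)
            + (\<Sum>\<theta>\<in>UNIV. gH S G ch \<theta> \<epsilon> v * L_at S ch \<theta> \<gamma> \<beta> v)
            - (\<Sum>\<theta>\<in>UNIV. gH S G ch \<beta> \<theta> v * L_at S ch \<theta> \<gamma> \<epsilon> v)
            - (\<Sum>\<theta>\<in>UNIV. gH S G ch \<theta> \<gamma> v * L_at S ch \<theta> \<beta> \<epsilon> v))))
        (\<lambda>a b \<gamma> v. dy S ch b (Gam S ch a \<gamma>) v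
           + 1/2 * (\<Sum>c\<in>UNIV. gV_inv S G ch a c v *
              ((\<Sum>i\<in>UNIV. rho_at S ch i \<gamma> v * dx S ch i (gV S G ch b c) v)
               - (\<Sum>e\<in>UNIV. dy S ch b (Gam S ch e \<gamma>) v * gV S G ch e c v)
               - (\<Sum>e\<in>UNIV. dy S ch c (Gam S ch e \<gamma>) v * gV S G ch e b v))))
        (\<lambda>\<alpha> \<beta> c v. 0)
        (\<lambda>a b c v. 0)"
    proof (rule D_components[OF ch])
      fix v assume v: "v \<in> dom_E S ch"
      show "0 = conH ch v (Inr d) $ \<alpha> $ \<beta>" for d \<alpha> \<beta> by (simp add: conH_vertical[OF ch v] ad(3)[OF v])
      show "0 = conV ch v (Inr d) $ a $ b" for d a b by (simp add: conV_vertical[OF ch v] ad(4)[OF v])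
    qed (simp_all only: HV conH_horizontal ad(1))
  qed
qed

end
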